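(* Let $\Omega\subset\mathbb{R}^2$ be a bounded piecewise smooth domain with $\Omega\subset\subset D$, let $R>1$, and let $k>0$ be such that $k^2$ is not a Dirichlet eigenvalue of $-\Delta$ on $\Omega$. Assume there is a sufficiently large domain $\Omega_\rho$, meaning that $\Omega_\rho\supset\supset O_\rho$ for some $\rho>R^2$, so that $$\Omega\subset\subset D\subset\subset O_R\subset\subset\Omega_\rho .$$ Assume that $u$ satisfies $\Delta u+k^2u=0$ in $\Omega_\rho$ and that $\|u\|_{H^1(\Omega_\rho)}\le C_\rho$ with a constant $C_\rho$, and set $f=u|_{\partial\Omega}$. Let $\{x_j\}_{j=1}^N$ be equally placed on $\partial\Omega$, let $\{\hat x_i\}_{i=1}^M$ be equally distributed on $\partial O_R$, and let the regularization parameter satisfy $$\alpha\sim MNR^{-2M}.$$ Then the numerical solution $u^{(c)}(x)=\boldsymbol{a}_{*,x}\boldsymbol{f}$ satisfies $$\|u-u^{(c)}\|_{L^2(\partial\Omega)}\le C\,\|u\|_{L^2(\Omega_\rho)}\Big(R^{-M}+\frac1N\Big),$$ where $C$ depends on the wave number $k$, on $d$ and on the domain $\Omega$ (and not on $M$, $N$ or $u$); here $R$, $\rho$, $\Omega_\rho$ and the comparability constants in $\alpha\sim MNR^{-2M}$ are regarded as fixed.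
   Context: $O_r=\{x\in\mathbb{R}^2:|x|<r\}$ is the disk of radius $r$ centred at the origin, and $D=\{x:|x|\le1\}$ is the unit disk. $A\subset\subset B$ means that $\overline A$ is a compact subset of the interior of $B$. Functions are complex valued. $d:=\min_j \frac{|k^2-E_j|}{E_j}$, where $E_j$ are the Dirichlet eigenvalues of $-\Delta$ on the domain $\Omega$. $\Phi(\hat x,x)=\frac{\mathrm{i}}{4}H_0^{(1)}(k|\hat x-x|)$ is the fundamental solution of the two-dimensional Helmholtz equation, with $H_0^{(1)}$ the Hankel function of the first kind of order $0$. Collocation points $x_1,\dots,x_N$ are equally placed on $\partial\Omega$; poles (source points) $\hat x_1,\dots,\hat x_M$ are equally distributed on the circle $\partial O_R$. The learning based numerical solution, using fundamental solutions as learning solutions, is defined as follows. For $x\in\overline\Omega$ put $\boldsymbol b_x=(\Phi(\hat x_1,x),\dots,\Phi(\hat x_M,x))$ (a row vector), let $V$ be the $N\times M$ matrix with entries $V_{ji}=\Phi(\hat x_i,x_j)$, and let $\boldsymbol f=(f(x_1),\dots,f(x_N))^T$. For $\alpha>0$ let $$\boldsymbol a_{*,x}=\arg\min_{\boldsymbol a\in\mathbb{C}^N}\{\|\boldsymbol aV-\boldsymbol b_x\|^2+\alpha\|\boldsymbol a\|^2\}=\boldsymbol b_xV^*(VV^*+\alpha I)^{-1}$$ (row vectors, Euclidean norms, $V^*$ the conjugate transpose), and $u^{(c)}(x)=\boldsymbol a_{*,x}\boldsymbol f$. $\alpha\sim MNR^{-2M}$ means $c_1MNR^{-2M}\le\alpha\le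 c_2MNR^{-2M}$ for fixed positive constants $c_1,c_2$. *)

theory Defs
  imports "HOL-Analysis.Analysis"
begin

section \<open>Compact inclusion and Sobolev spaces\<close>

definition compactly_inside :: "(real^2) set \<Rightarrow> (real^2) set \<Rightarrow> bool"
  (infix "\<subset>\<subset>" 50)
  where "A \<subset>\<subset> B \<longleftrightarrow> compact (closure A) \<and> closure A \<subseteq> interior B"

definition pdiff :: "2 \<Rightarrow> (real^2 \<Rightarrow> complex) \<Rightarrow> real^2 \<Rightarrow> complex"
  where "pdiff i f x = frechet_derivative f (at x) (axis i 1)"

text \<open>As in Brezis' textbook, weak derivatives, weak solutions and the space of functions with
  zero trace are all based on compactly supported test functions of class C1; density makes this
  equivalent to the use of smooth test functions.\<close>

definition test_functions :: "(real^2) set \<Rightarrow> (real^2 \<Rightarrow> complex) set"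
  where "test_functions U =
    {\<phi>. (\<forall>x. \<phi> differentiable (at x)) \<and> (\<forall>i. continuous_on UNIV (pdiff i \<phi>)) \<and>
         compact (closure {x. \<phi> x \<noteq> 0}) \<and> closure {x. \<phi> x \<noteq> 0} \<subseteq> U}"

definition square_integrable :: "(real^2) set \<Rightarrow> (real^2 \<Rightarrow> 'b::euclidean_space) \<Rightarrow> bool"
  where "square_integrable U f \<longleftrightarrow>
    set_borel_measurable lebesgue U f \<and> set_integrable lebesgue U (\<lambda>x. (norm (f x))\<^sup>2)"

definition L2norm :: "(real^2) set \<Rightarrow> (real^2 \<Rightarrow> 'b::euclidean_space) \<Rightarrow> real"
  where "L2norm U f = sqrt (LINT x:U|lebesgue. (norm (f x))\<^sup>2)"

definition is_H1_gradient ::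
    "(real^2) set \<Rightarrow> (real^2 \<Rightarrow> complex) \<Rightarrow> (real^2 \<Rightarrow> complex^2) \<Rightarrow> bool"
  where "is_H1_gradient U u g \<longleftrightarrow>
    square_integrable U u \<and> square_integrable U g \<and>
    (\<forall>\<phi>\<in>test_functions U. \<forall>i.
       (LINT x:U|lebesgue. u x * pdiff i \<phi> x) = - (LINT x:U|lebesgue. g x $ i * \<phi> x))"

definition in_H1 :: "(real^2) set \<Rightarrow> (real^2 \<Rightarrow> complex) \<Rightarrow> bool"
  where "in_H1 U u \<longleftrightarrow> (\<exists>g. is_H1_gradient U u g)"

text \<open>The weak gradient is unique up to null sets, so the choice below is immaterial.\<close>

definition H1_gradient :: "(real^2) set \<Rightarrow> (real^2 \<Rightarrow> complex) \<Rightarrow> real^2 \<Rightarrow> complex^2"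
  where "H1_gradient U u = (SOME g. is_H1_gradient U u g)"

definition H1_norm :: "(real^2) set \<Rightarrow> (real^2 \<Rightarrow> complex) \<Rightarrow> real"
  where "H1_norm U u = sqrt ((L2norm U u)\<^sup>2 + (L2norm U (H1_gradient U u))\<^sup>2)"

definition in_H1_0 :: "(real^2) set \<Rightarrow> (real^2 \<Rightarrow> complex) \<Rightarrow> bool"
  where "in_H1_0 U u \<longleftrightarrow>
    in_H1 U u \<and> (\<forall>\<epsilon>>0. \<exists>\<phi>\<in>test_functions U. H1_norm U (\<lambda>x. u x - \<phi> x) < \<epsilon>)"

text \<open>\<open>- \<Delta> u = E u\<close> in \<open>U\<close>, for \<open>u\<close> in the Sobolev space of order one, in the weak sense.\<close>

definition weak_eigen_equation :: "(real^2) set \<Rightarrow> real \<Rightarrow> (real^2 \<Rightarrow> complex) \<Rightarrow> bool"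
  where "weak_eigen_equation U E u \<longleftrightarrow>
    in_H1 U u \<and>
    (\<forall>\<phi>\<in>test_functions U.
       (LINT x:U|lebesgue. (\<Sum>i\<in>UNIV. H1_gradient U u x $ i * pdiff i \<phi> x))
         = of_real E * (LINT x:U|lebesgue. u x * \<phi> x))"

definition dirichlet_eigenvalue :: "(real^2) set \<Rightarrow> real \<Rightarrow> bool"
  where "dirichlet_eigenvalue U E \<longleftrightarrow>
    (\<exists>w. in_H1_0 U w \<and> L2norm U w \<noteq> 0 \<and> weak_eigen_equation U E w)"

text \<open>\<open>\<Delta> u + k\<^sup>2 u = 0\<close> in \<open>U\<close>.  Continuity selects the representative of the Sobolev function
  (by interior regularity there is exactly one) whose point values on a curve inside \<open>U\<close> are
  its trace.\<close>

definition helmholtz_solution :: "(real^2) set \<Rightarrow> real \<Rightarrow> (real^2 \<Rightarrow> complex) \<Rightarrow> bool"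
  where "helmholtz_solution U k u \<longleftrightarrow> continuous_on U u \<and> weak_eigen_equation U (k\<^sup>2) u"

section \<open>Piecewise smooth domains\<close>

text \<open>A simple closed piecewise C1 curve of length \<open>l\<close>, parametrized by arc length on \<open>{0..l}\<close>.\<close>

definition arclength_loop :: "real \<Rightarrow> (real \<Rightarrow> real^2) \<Rightarrow> bool"
  where "arclength_loop l g \<longleftrightarrow>
    0 < l \<and> g piecewise_C1_differentiable_on {0..l} \<and>
    g l = g 0 \<and> inj_on g {0..<l} \<and>
    finite {s\<in>{0..l}. norm (vector_derivative g (at s)) \<noteq> 1}"

text \<open>The boundary consists of finitely many disjoint loops, given as a list of pairs of a length
  and an arc length parametrization; the domain need not be simply connected.\<close>

definition boundary_parametrization ::
    "(real^2) set \<Rightarrow> (real \<times> (real \<Rightarrow> real^2)) list \<Rightarrow> bool"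
  where "boundary_parametrization \<Omega> bs \<longleftrightarrow>
    (\<forall>(l, g)\<in>set bs. arclength_loop l g) \<and>
    (\<forall>i<length bs. \<forall>j<length bs. i \<noteq> j \<longrightarrow>
       snd (bs ! i) ` {0..fst (bs ! i)} \<inter> snd (bs ! j) ` {0..fst (bs ! j)} = {}) \<and>
    (\<Union>(l, g)\<in>set bs. g ` {0..l}) = frontier \<Omega>"

definition bounded_piecewise_smooth_domain :: "(real^2) set \<Rightarrow> bool"
  where "bounded_piecewise_smooth_domain \<Omega> \<longleftrightarrow>
    open \<Omega> \<and> connected \<Omega> \<and> \<Omega> \<noteq> {} \<and> bounded \<Omega> \<and> (\<exists>bs. boundary_parametrization \<Omega> bs)"

definition boundary_length :: "(real \<times> (real \<Rightarrow> real^2)) list \<Rightarrow> real"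
  where "boundary_length bs = sum_list (map fst bs)"

text \<open>The point at arc length \<open>s\<close>, \<open>0 \<le> s < boundary_length bs\<close>, when the loops are traversed one
  after the other.\<close>

fun boundary_point :: "(real \<times> (real \<Rightarrow> real^2)) list \<Rightarrow> real \<Rightarrow> real^2"
  where
    "boundary_point [] s = 0"
  | "boundary_point ((l, g) # bs) s = (if s < l then g s else boundary_point bs (s - l))"

definition boundary_L2norm ::
    "(real \<times> (real \<Rightarrow> real^2)) list \<Rightarrow> (real^2 \<Rightarrow> complex) \<Rightarrow> real"
  where "boundary_L2norm bs h =
    sqrt (LINT s:{0..<boundary_length bs}|lebesgue. (norm (h (boundary_point bs s)))\<^sup>2)"

text \<open>Equal spacing with respect to arc length.  The first point is arbitrary: up to a cyclic
  renumbering every offset can be brought below the spacing.  Points are numbered from \<open>0\<close>.\<close>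

definition equally_placed ::
    "(real \<times> (real \<Rightarrow> real^2)) list \<Rightarrow> nat \<Rightarrow> (nat \<Rightarrow> real^2) \<Rightarrow> bool"
  where "equally_placed bs N x \<longleftrightarrow>
    (\<exists>s0. 0 \<le> s0 \<and> s0 < boundary_length bs / real N \<and>
       (\<forall>j<N. x j = boundary_point bs (s0 + real j * boundary_length bs / real N)))"

definition equally_distributed_on_circle :: "real \<Rightarrow> nat \<Rightarrow> (nat \<Rightarrow> real^2) \<Rightarrow> bool"
  where "equally_distributed_on_circle R M y \<longleftrightarrow>
    (\<exists>\<theta>0. \<forall>i<M. y i = vector [R * cos (\<theta>0 + 2 * pi * real i / real M),
                              R * sin (\<theta>0 + 2 * pi * real i / real M)])"

section \<open>The fundamental solution\<close>

text \<open>Power series of the Bessel functions of order zero (Abramowitz and Stegun, 9.1.10 and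
  9.1.13), on the positive half line.\<close>

definition bessel_J0 :: "real \<Rightarrow> real"
  where "bessel_J0 z = (\<Sum>m. (-1) ^ m * (z\<^sup>2 / 4) ^ m / (fact m)\<^sup>2)"

definition bessel_Y0 :: "real \<Rightarrow> real"
  where "bessel_Y0 z = 2 / pi * ((ln (z / 2) + euler_mascheroni) * bessel_J0 z
           - (\<Sum>m. (-1) ^ m * harm m * (z\<^sup>2 / 4) ^ m / (fact m)\<^sup>2))"

definition hankel_H0 :: "real \<Rightarrow> complex"
  where "hankel_H0 z = of_real (bessel_J0 z) + \<i> * of_real (bessel_Y0 z)"

definition fundamental_solution :: "real \<Rightarrow> real^2 \<Rightarrow> real^2 \<Rightarrow> complex"
  where "fundamental_solution k y x = \<i> / 4 * hankel_H0 (k * norm (y - x))"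

section \<open>The learning based numerical solution\<close>

text \<open>Vectors indexed by \<open>j < N\<close> are functions on the naturals that vanish from \<open>N\<close> on.
  In both definitions \<open>y\<close> is the family of \<open>M\<close> poles, \<open>x\<close> the family of \<open>N\<close> collocation points
  and \<open>p\<close> the point of evaluation.\<close>

definition tikhonov_functional ::
    "real \<Rightarrow> nat \<Rightarrow> nat \<Rightarrow> (nat \<Rightarrow> real^2) \<Rightarrow> (nat \<Rightarrow> real^2) \<Rightarrow> real \<Rightarrow> real^2 \<Rightarrow>
     (nat \<Rightarrow> complex) \<Rightarrow> real"
  where "tikhonov_functional k M N y x \<alpha> p a =
    (\<Sum>i<M. (norm ((\<Sum>j<N. a j * fundamental_solution k (y i) (x j))
                   - fundamental_solution k (y i) p))\<^sup>2)
    + \<alpha> * (\<Sum>j<N. (norm (a j))\<^sup>2)"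

definition learning_weights ::
    "real \<Rightarrow> nat \<Rightarrow> nat \<Rightarrow> (nat \<Rightarrow> real^2) \<Rightarrow> (nat \<Rightarrow> real^2) \<Rightarrow> real \<Rightarrow> real^2 \<Rightarrow> nat \<Rightarrow> complex"
  where "learning_weights k M N y x \<alpha> p =
    arg_min (tikhonov_functional k M N y x \<alpha> p) (\<lambda>a. \<forall>j\<ge>N. a j = 0)"

definition numerical_solution ::
    "real \<Rightarrow> nat \<Rightarrow> nat \<Rightarrow> (nat \<Rightarrow> real^2) \<Rightarrow> (nat \<Rightarrow> real^2) \<Rightarrow> real \<Rightarrow> (real^2 \<Rightarrow> complex) \<Rightarrow>
     real^2 \<Rightarrow> complex"
  where "numerical_solution k M N y x \<alpha> f p =
    (\<Sum>j<N. learning_weights k M N y x \<alpha> p j * f (x j))"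

end

theory Submission
  imports Defs "HOL-Complex_Analysis.Complex_Analysis" "HOL-Real_Asymp.Real_Asymp"
begin

text \<open>The weights that the regularized least squares problem assigns to the data can be traded for
  coefficients of the sources: the numerical solution is also \<open>p \<mapsto> \<Sum>i<M. e i * \<Phi> (y i) p\<close>, where \<open>e\<close>
  minimizes the residual at the collocation points plus \<open>\<alpha>\<close> times the squared norm of \<open>e\<close>
  (\<open>numerical_solution_dual\<close>, a comparison of the two normal equations). Hence any other
  combination of sources that fits \<open>u\<close> bounds both the discrete residual of the numerical solution
  and the size of \<open>e\<close>.

  Such a combination comes from separation of variables (\<open>helmholtz_source_approximation\<close>). In a
  disk of radius \<open>q > R\<^sup>2\<close> a solution is a sum of modes \<open>C m * E m\<close> with \<open>C m\<close> of order
  \<open>q powr - \<bar>m\<bar>\<close> (\<open>helmholtz_expansion\<close>), and a source at angle \<open>\<phi>\<close> of the circle of radius \<open>R\<close> is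
  the sum of \<open>a \<bar>m\<bar> * cis (- m * \<phi>) * E m\<close> (\<open>fundamental_solution_expansion\<close>). Averaging the
  \<open>M\<close> sources against \<open>cis (m * \<phi>)\<close> singles out mode \<open>m\<close> up to aliases \<open>m + M * j\<close>, an error of order
  \<open>R ^ \<bar>m\<bar> / R ^ M\<close> in the unit disk (\<open>source_average_mode_error\<close>). Dividing mode \<open>m\<close> by \<open>a \<bar>m\<bar>\<close>, which is
  essentially of order \<open>R powr - \<bar>m\<bar>\<close>, and summing over \<open>m\<close> costs the series of \<open>(R\<^sup>2 / q) ^ \<bar>m\<bar>\<close>:
  this is where \<open>\<rho> > R\<^sup>2\<close> enters. The total error is of order \<open>R powr - M\<close> with coefficients of
  order \<open>1 / M\<close>, and the choice of \<open>\<alpha>\<close> balances the two terms of the functional.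

  Neither expansion goes through the classical theory of Bessel functions. The radial functions
  solve the equation of the entire function \<open>bessel_clifford\<close>; angular averages of a weak
  solution are identified by testing with \<open>(t - \<bar>x\<bar>\<^sup>2)\<^sup>3 * (x 1 \<plusminus> \<i> * x 2) ^ m\<close> inside its support. For the
  source one passes to the characteristic variables \<open>z\<close> and \<open>w = cnj z\<close>, in which the Helmholtz
  equation is \<open>\<partial>z \<partial>w f = - c * f\<close> with \<open>c = k\<^sup>2 / 4\<close>, and solutions depend stably on their values on
  \<open>w = 0\<close> and \<open>z = 0\<close> (\<open>characteristic_solution_bound\<close>). That no \<open>a m\<close> vanishes, with the lower bound
  on it, follows from a three-term recurrence and its Wronskian (\<open>recurrence_solution_lower_bound\<close>).

  The error \<open>w\<close> is bounded and Lipschitz on the boundary, with constants proportional to the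
  \<open>L\<^sup>2\<close> norm of \<open>u\<close>. So the integral of \<open>\<bar>w\<bar>\<^sup>2\<close> over the boundary is controlled by its mean over the
  equally spaced collocation points and by the square of the spacing
  (\<open>boundary_L2norm_quadrature\<close>). Finally the constants must not depend on the parametrization of the
  boundary. Two parametrizations have comparable total lengths (\<open>boundary_length_comparison\<close>), and a loop
  cannot be shorter than the smallest diameter of a component of the boundary
  (\<open>loop_length_lower_bound\<close>).\<close>

section \<open>Entire solutions of the radial Helmholtz equation\<close>

text \<open>The Bessel-Clifford function: with \<open>c = k\<^sup>2 / 4\<close> one has
  \<open>J\<^sub>p (k * r) = (k * r / 2) ^ p * bessel_clifford c p (r\<^sup>2)\<close>. As a function of \<open>s = r\<^sup>2\<close> it is entire, which
  the Bessel function itself is only after removing a power.\<close>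

definition bessel_clifford :: "real \<Rightarrow> nat \<Rightarrow> 'a::{real_normed_field,banach} \<Rightarrow> 'a"
  where "bessel_clifford c p s = (\<Sum>j. of_real ((-c) ^ j / (fact j * fact (j + p))) * s ^ j)"

lemma bessel_clifford_term_bound:
  fixes s :: "'a::{real_normed_field,banach}"
  shows "norm (of_real ((-c) ^ j / (fact j * fact (j + p))) * s ^ j)
          \<le> (\<bar>c\<bar> * norm s) ^ j / fact j / fact p"
proof -
  have "norm (of_real ((-c) ^ j / (fact j * fact (j + p))) * s ^ j)
      = (\<bar>c\<bar> * norm s) ^ j / (fact j * fact (j + p))"
    unfolding norm_mult norm_of_real norm_power
    by (simp add: abs_mult power_abs power_mult_distrib)
  also have "\<dots> \<le> (\<bar>c\<bar> * norm s) ^ j / (fact j * fact p)"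
    by (intro divide_left_mono mult_left_mono mult_pos_pos fact_mono) auto
  finally show ?thesis by simp
qed

lemma bessel_clifford_summable_norm:
  fixes s :: "'a::{real_normed_field,banach}"
  shows "summable (\<lambda>j. norm (of_real ((-c) ^ j / (fact j * fact (j + p))) * s ^ j))"
proof (rule summable_comparison_test')
  show "summable (\<lambda>j. (\<bar>c\<bar> * norm s) ^ j / fact j / fact p)"
    using summable_exp_generic[of "\<bar>c\<bar> * norm s"]
    by (intro summable_divide) (simp add: scaleR_conv_of_real divide_inverse mult.commute)
qed (use bessel_clifford_term_bound[of c _ p s] in simp)

lemma bessel_clifford_summable:
  fixes s :: "'a::{real_normed_field,banach}"
  shows "summable (\<lambda>j. of_real ((-c) ^ j / (fact j * fact (j + p))) * s ^ j)"
  by (rule summable_norm_cancel[OF bessel_clifford_summable_norm])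

lemma bessel_clifford_sums:
  fixes s :: "'a::{real_normed_field,banach}"
  shows "(\<lambda>j. of_real ((-c) ^ j / (fact j * fact (j + p))) * s ^ j) sums bessel_clifford c p s"
  unfolding bessel_clifford_def by (rule summable_sums[OF bessel_clifford_summable])

lemma bessel_clifford_norm_le:
  fixes s :: "'a::{real_normed_field,banach}"
  shows "norm (bessel_clifford c p s) \<le> exp (\<bar>c\<bar> * norm s) / fact p"
proof -
  have e: "(\<lambda>j. (\<bar>c\<bar> * norm s) ^ j / fact j / fact p) sums (exp (\<bar>c\<bar> * norm s) / fact p)"
    using exp_converges[of "\<bar>c\<bar> * norm s"]
    by (intro sums_divide) (simp add: scaleR_conv_of_real divide_inverse mult.commute)
  have "norm (bessel_clifford c p s) \<le> (\<Sum>j. norm (of_real ((-c) ^ j / (fact j * fact (j + p))) * s ^ j))"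
    unfolding bessel_clifford_def by (rule summable_norm[OF bessel_clifford_summable_norm])
  also have "\<dots> \<le> (\<Sum>j. (\<bar>c\<bar> * norm s) ^ j / fact j / fact p)"
    by (intro suminf_le bessel_clifford_term_bound bessel_clifford_summable_norm sums_summable[OF e])
  finally show ?thesis using sums_unique[OF e] by simp
qed

lemma bessel_clifford_of_real:
  "bessel_clifford c p (of_real s :: 'a::{real_normed_field,banach}) = of_real (bessel_clifford c p s)"
proof -
  have "(\<lambda>j. of_real ((-c) ^ j / (fact j * fact (j + p)) * s ^ j) :: 'a) sums of_real (bessel_clifford c p s)"
    using bessel_clifford_sums[of c p s] by (subst sums_of_real_iff) simp
  moreover have "(\<lambda>j. of_real ((-c) ^ j / (fact j * fact (j + p)) * s ^ j) :: 'a)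
      sums bessel_clifford c p (of_real s :: 'a)"
    using bessel_clifford_sums[of c p "of_real s :: 'a"] by simp
  ultimately show ?thesis using sums_unique2 by blast
qed

lemma bessel_clifford_0: "bessel_clifford c p (0::'a::{real_normed_field,banach}) = 1 / fact p"
  unfolding bessel_clifford_def by (subst suminf_finite[of "{0}"]) auto

lemma bessel_clifford_deriv:
  fixes s :: "'a::{real_normed_field,banach}"
  shows "(bessel_clifford c p has_field_derivative (- of_real c * bessel_clifford c (Suc p) s)) (at s)"
proof -
  have "((\<lambda>s. \<Sum>j. of_real ((-c) ^ j / (fact j * fact (j + p))) * s ^ j) has_field_derivative
      (\<Sum>j. diffs (\<lambda>j. of_real ((-c) ^ j / (fact j * fact (j + p)))) j * s ^ j)) (at s)"
    by (rule termdiffs_strong_converges_everywhere) (rule bessel_clifford_summable)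
  also have "diffs (\<lambda>j. of_real ((-c) ^ j / (fact j * fact (j + p))) :: 'a)
      = (\<lambda>j. - of_real c * of_real ((-c) ^ j / (fact j * fact (j + Suc p))))"
  proof (rule ext)
    fix j
    have "real (Suc j) * ((-c) ^ Suc j / (fact (Suc j) * fact (Suc j + p)))
        = - c * ((-c) ^ j / (fact j * fact (j + Suc p)))"
      by (simp add: divide_simps del: of_nat_Suc)
    then have "of_real (real (Suc j) * ((-c) ^ Suc j / (fact (Suc j) * fact (Suc j + p)))) =
        (of_real (- c * ((-c) ^ j / (fact j * fact (j + Suc p)))) :: 'a)" by (rule arg_cong)
    then show "diffs (\<lambda>j. of_real ((-c) ^ j / (fact j * fact (j + p))) :: 'a) j
        = - of_real c * of_real ((-c) ^ j / (fact j * fact (j + Suc p)))"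
      unfolding diffs_def of_real_mult of_real_of_nat_eq of_real_minus by simp
  qed
  also have "(\<Sum>j. - of_real c * of_real ((-c) ^ j / (fact j * fact (j + Suc p))) * s ^ j)
      = - of_real c * bessel_clifford c (Suc p) s"
    unfolding bessel_clifford_def mult.assoc
    by (rule suminf_mult[OF bessel_clifford_summable])
  finally show ?thesis unfolding bessel_clifford_def[abs_def] .
qed

lemma bessel_clifford_has_derivative [derivative_intros]:
  fixes f :: "'a::{real_normed_field,banach} \<Rightarrow> 'a"
  assumes "(f has_field_derivative f') (at x within S)"
  shows "((\<lambda>x. bessel_clifford c p (f x)) has_field_derivative
           (- of_real c * bessel_clifford c (Suc p) (f x) * f')) (at x within S)"
  using DERIV_chain2[OF bessel_clifford_deriv assms] by (simp add: mult_ac)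

lemma bessel_clifford_continuous [continuous_intros]:
  fixes f :: "'b::topological_space \<Rightarrow> 'a::{real_normed_field,banach}"
  assumes "continuous_on S f"
  shows "continuous_on S (\<lambda>x. bessel_clifford c p (f x))"
proof -
  have "continuous_on UNIV (bessel_clifford c p :: 'a \<Rightarrow> 'a)"
    by (intro continuous_at_imp_continuous_on ballI DERIV_isCont[OF bessel_clifford_deriv])
  from continuous_on_compose2[OF this assms] show ?thesis by simp
qed

text \<open>Comparison of the coefficients of \<open>s ^ j\<close>; this is the three-term recurrence of Bessel
  functions, and together with the derivative it encodes the Bessel equation.\<close>

lemma bessel_clifford_recurrence:
  fixes s :: "'a::{real_normed_field,banach}"
  shows "bessel_clifford c p s - of_nat (Suc p) * bessel_clifford c (Suc p) s
          = - of_real c * s * bessel_clifford c (Suc (Suc p)) s"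
proof -
  let ?t = "\<lambda>p j. of_real ((-c) ^ j / (fact j * fact (j + p))) * s ^ j :: 'a"
  have 1: "(\<lambda>j. ?t p j - of_nat (Suc p) * ?t (Suc p) j) sums
      (bessel_clifford c p s - of_nat (Suc p) * bessel_clifford c (Suc p) s)"
    by (intro sums_diff sums_mult bessel_clifford_sums)
  have shift: "?t p (Suc j) - of_nat (Suc p) * ?t (Suc p) (Suc j)
      = - of_real c * s * ?t (Suc (Suc p)) j" for j
  proof -
    have F: "fact (Suc j + Suc p) = (of_nat (j + p + 2) * fact (Suc j + p) :: real)"
      by (simp add: algebra_simps)
    have G: "fact (j + Suc (Suc p)) = (fact (Suc j + Suc p) :: real)"
      by simp
    have H: "fact (Suc j) = (of_nat (Suc j) * fact j :: real)" by simp
    have "(-c) ^ Suc j / (fact (Suc j) * fact (Suc j + p))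
        - real (Suc p) * ((-c) ^ Suc j / (fact (Suc j) * fact (Suc j + Suc p)))
        = - c * ((-c) ^ j / (fact j * fact (j + Suc (Suc p))))"
      unfolding G F H by (simp add: divide_simps del: fact_Suc) (simp add: algebra_simps)
    then have "of_real ((-c) ^ Suc j / (fact (Suc j) * fact (Suc j + p))
        - real (Suc p) * ((-c) ^ Suc j / (fact (Suc j) * fact (Suc j + Suc p)))) * s ^ Suc j
        = of_real (- c * ((-c) ^ j / (fact j * fact (j + Suc (Suc p))))) * s ^ Suc j"
      by simp
    then show ?thesis
      unfolding of_real_diff of_real_mult of_real_minus of_real_of_nat_eq left_diff_distrib
      by (simp add: mult_ac del: fact_Suc)
  qed
  have z: "?t p 0 - of_nat (Suc p) * ?t (Suc p) 0 = 0"
    using of_nat_neq_0[of p, where 'a = 'a] by (simp add: divide_simps del: of_nat_Suc)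
  have "(\<lambda>j. ?t p (Suc j) - of_nat (Suc p) * ?t (Suc p) (Suc j)) sums
      (- of_real c * s * bessel_clifford c (Suc (Suc p)) s)"
    unfolding shift by (intro sums_mult bessel_clifford_sums)
  then have "(\<lambda>j. ?t p j - of_nat (Suc p) * ?t (Suc p) j) sums
      (- of_real c * s * bessel_clifford c (Suc (Suc p)) s)"
    by (subst (asm) sums_Suc_iff) (use z in simp)
  with 1 show ?thesis using sums_unique2 by blast
qed

text \<open>The functions \<open>s ^ p * bessel_clifford c p s\<close> are successive antiderivatives of each other. This
  permits to identify a function through its iterated integrals.\<close>

lemma power_bessel_clifford_deriv:
  fixes s :: "'a::{real_normed_field,banach}"
  shows "((\<lambda>s. s ^ Suc p * bessel_clifford c (Suc p) s) has_field_derivative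
           (s ^ p * bessel_clifford c p s)) (at s)"
proof -
  have r: "bessel_clifford c p s = of_nat (Suc p) * bessel_clifford c (Suc p) s
          - of_real c * s * bessel_clifford c (Suc (Suc p)) s"
    using bessel_clifford_recurrence[of c p s] by (simp add: algebra_simps)
  show ?thesis
    by (rule derivative_eq_intros refl | simp)+ (simp add: r algebra_simps)
qed

section \<open>Regular solutions of the radial equation\<close>

text \<open>For \<open>t * D'' = b * D' - c * D\<close> the energy \<open>(D'\<^sup>2 + c * D\<^sup>2 / t) / t ^ (2 * b)\<close> decreases; it is zero
  initially, hence it stays zero.\<close>

lemma bessel_ode_energy:
  fixes D D' :: "real \<Rightarrow> real" and c a T :: real and b :: nat
  assumes c: "c > 0" and a: "0 < a"
    and D: "\<And>t. a \<le> t \<Longrightarrow> t < T \<Longrightarrow> (D has_real_derivative D' t) (at t)"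
    and D': "\<And>t. a \<le> t \<Longrightarrow> t < T \<Longrightarrow> (D' has_real_derivative ((real b * D' t - c * D t) / t)) (at t)"
    and init: "D a = 0" "D' a = 0" and t: "a \<le> t" "t < T"
  shows "D t = 0"
proof -
  define E where "E = (\<lambda>t. ((D' t)\<^sup>2 + c * (D t)\<^sup>2 / t) / t ^ (2 * b))"
  have "E t \<le> E a"
  proof (rule DERIV_nonpos_imp_nonincreasing[OF t(1)])
    fix s assume s: "a \<le> s" "s \<le> t"
    then have s0: "s > 0" "s < T" using a t by auto
    have "(E has_real_derivative
        ((2 * D' s * ((real b * D' s - c * D s) / s) + (c * (2 * D s * D' s) * s - c * (D s)\<^sup>2) / (s * s)) * s ^ (2 * b)
         - ((D' s)\<^sup>2 + c * (D s)\<^sup>2 / s) * (real (2*b) * s ^ (2*b - 1))) / (s ^ (2*b) * s ^ (2*b))) (at s)"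
      unfolding E_def using s0 s
      by (auto intro!: derivative_eq_intros D D' simp: mult_ac)
    also have "((2 * D' s * ((real b * D' s - c * D s) / s) + (c * (2 * D s * D' s) * s - c * (D s)\<^sup>2) / (s * s)) * s ^ (2 * b)
         - ((D' s)\<^sup>2 + c * (D s)\<^sup>2 / s) * (real (2*b) * s ^ (2*b - 1))) / (s ^ (2*b) * s ^ (2*b))
        = - ((2 * real b + 1) * c * (D s)\<^sup>2 / s\<^sup>2 / s ^ (2*b))"
    proof -
      have e: "real (2*b) * s ^ (2*b - 1) = real (2*b) * s ^ (2*b) / s"
        using s0 by (cases b) auto
      define q where "q = s ^ (2*b)"
      have q: "q \<noteq> 0" using s0 by (simp add: q_def)
      show ?thesis
        unfolding e q_def[symmetric] using q s0
        by (simp add: field_simps power2_eq_square)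
    qed
    finally have "(E has_real_derivative - ((2 * real b + 1) * c * (D s)\<^sup>2 / s\<^sup>2 / s ^ (2*b))) (at s)" .
    moreover have "- ((2 * real b + 1) * c * (D s)\<^sup>2 / s\<^sup>2 / s ^ (2*b)) \<le> 0"
    proof -
      have "0 \<le> (2 * real b + 1) * c * (D s)\<^sup>2 / s\<^sup>2 / s ^ (2*b)" using c s0 by simp
      then show ?thesis by simp
    qed
    ultimately show "\<exists>y. (E has_real_derivative y) (at s) \<and> y \<le> 0" by blast
  qed
  also have "E a = 0" using init by (simp add: E_def)
  finally have "E t \<le> 0" .
  moreover have tp: "t > 0" using t a by simp
  ultimately have "(D' t)\<^sup>2 + c * (D t)\<^sup>2 / t \<le> 0"
    using zero_less_power[OF tp, of "2 * b"] by (auto simp: E_def divide_le_0_iff simp del: zero_less_power)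
  moreover have "(D' t)\<^sup>2 \<ge> 0" "c * (D t)\<^sup>2 / t \<ge> 0" using c tp by auto
  ultimately have "c * (D t)\<^sup>2 / t = 0" by linarith
  then show ?thesis using c tp by simp
qed

text \<open>The equation has a second solution, singular at the origin. The Wronskian of \<open>W\<close> with the regular
  solution, divided by \<open>t ^ Suc p\<close>, is constant and tends to \<open>0\<close> at the origin because \<open>W\<close> and \<open>W'\<close> do.
  Where the regular solution is nonzero the two are thus proportional to first order, and the
  energy argument extends the proportionality to the right.\<close>

lemma bessel_ode_regular_solution:
  fixes W W' :: "real \<Rightarrow> real" and p :: nat and c T :: real
  defines "P \<equiv> (\<lambda>q t::real. t ^ q * bessel_clifford c q t)"
  assumes c: "c > 0" and T: "T > 0"
    and W: "\<And>t. 0 < t \<Longrightarrow> t < T \<Longrightarrow> (W has_real_derivative W' t) (at t)"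
    and W': "\<And>t. 0 < t \<Longrightarrow> t < T \<Longrightarrow> (W' has_real_derivative ((real (Suc p) * W' t - c * W t) / t)) (at t)"
    and lim: "(W \<longlongrightarrow> 0) (at_right 0)" "(W' \<longlongrightarrow> 0) (at_right 0)"
  shows "\<exists>l. \<forall>t. 0 < t \<and> t < T \<longrightarrow> W t = l * P (Suc (Suc p)) t"
proof -
  have P1: "(P (Suc q) has_real_derivative P q t) (at t)" for q t
    unfolding P_def by (rule power_bessel_clifford_deriv)
  have P2: "t * P p t = real (Suc p) * P (Suc p) t - c * P (Suc (Suc p)) t" for t
  proof -
    have r: "bessel_clifford c p t = real (Suc p) * bessel_clifford c (Suc p) t
        - c * t * bessel_clifford c (Suc (Suc p)) t"
      using bessel_clifford_recurrence[of c p t] by simp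
    show ?thesis unfolding P_def r by (simp add: algebra_simps)
  qed
  \<comment> \<open>the normalized Wronskian of W and the regular solution\<close>
  define X where "X = (\<lambda>t. (W t * P (Suc p) t - W' t * P (Suc (Suc p)) t) / t ^ Suc p)"
  have dX: "(X has_real_derivative 0) (at t)" if t: "0 < t" "t < T" for t
  proof -
    let ?n = "(W' t * P (Suc p) t + W t * P p t - ((real (Suc p) * W' t - c * W t) / t * P (Suc (Suc p)) t + W' t * P (Suc p) t))"
    have "(X has_real_derivative
       (?n * t ^ Suc p - (W t * P (Suc p) t - W' t * P (Suc (Suc p)) t) * (real (Suc p) * t ^ p)) / (t ^ Suc p * t ^ Suc p)) (at t)"
      unfolding X_def
      by (rule DERIV_cong[OF DERIV_divide[OF DERIV_diff[OF DERIV_mult[OF W[OF t] P1] DERIV_mult[OF W'[OF t] P1]] DERIV_pow]])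
        (use t in \<open>simp_all add: ac_simps\<close>)
    moreover have "?n * t = (W t * P (Suc p) t - W' t * P (Suc (Suc p)) t) * real (Suc p)"
    proof -
      have "?n * t = W t * (t * P p t) - (real (Suc p) * W' t - c * W t) * P (Suc (Suc p)) t"
        using t by (simp add: field_simps)
      also have "\<dots> = (W t * P (Suc p) t - W' t * P (Suc (Suc p)) t) * real (Suc p)"
        unfolding P2 by (simp add: algebra_simps)
      finally show ?thesis .
    qed
    moreover have "?n * t ^ Suc p - (W t * P (Suc p) t - W' t * P (Suc (Suc p)) t) * (real (Suc p) * t ^ p)
        = t ^ p * (?n * t - (W t * P (Suc p) t - W' t * P (Suc (Suc p)) t) * real (Suc p))"
      by (simp add: right_diff_distrib)
    ultimately show ?thesis by (simp only: diff_self mult_zero_right div_0)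
  qed
  have Xc: "X s = X t" if "0 < s" "s < T" "0 < t" "t < T" for s t
    by (rule DERIV_isconst3[of 0 T]) (use that dX T in auto)
  have Xlim: "(X \<longlongrightarrow> 0) (at_right 0)"
  proof -
    have cc: "((\<lambda>t. bessel_clifford c q t) \<longlongrightarrow> bessel_clifford c q 0) (at_right (0::real))" for q
      using DERIV_isCont[OF bessel_clifford_deriv, of "0::real" c q]
      by (simp add: isCont_def filterlim_at_split)
    have "((\<lambda>t. W t * bessel_clifford c (Suc p) t - W' t * (t * bessel_clifford c (Suc (Suc p)) t))
        \<longlongrightarrow> 0 * bessel_clifford c (Suc p) 0 - 0 * (0 * bessel_clifford c (Suc (Suc p)) 0)) (at_right 0)"
      by (intro tendsto_intros lim cc)
    then have lim0: "((\<lambda>t. W t * bessel_clifford c (Suc p) t - W' t * (t * bessel_clifford c (Suc (Suc p)) t))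
        \<longlongrightarrow> 0) (at_right 0)" by simp
    show ?thesis
    proof (rule Lim_transform_eventually[OF lim0])
      show "\<forall>\<^sub>F t in at_right 0. W t * bessel_clifford c (Suc p) t - W' t * (t * bessel_clifford c (Suc (Suc p)) t) = X t"
        by (rule eventually_mono[OF eventually_at_right_less[of 0]])
          (simp add: X_def P_def field_simps)
    qed
  qed
  have X0: "X t = 0" if t: "0 < t" "t < T" for t
  proof -
    have "((\<lambda>_. X t) \<longlongrightarrow> 0) (at_right (0::real))"
    proof (rule Lim_transform_eventually[OF Xlim])
      have "\<forall>s>0. s < T \<longrightarrow> X s = X t" using Xc t by blast
      then show "\<forall>\<^sub>F s in at_right 0. X s = X t"
        unfolding eventually_at_right_field using T by blast
    qed
    then show ?thesis by (simp add: tendsto_const_iff)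
  qed
  have ev: "\<exists>l. \<forall>t. t0 \<le> t \<and> t < T \<longrightarrow> W t = l * P (Suc (Suc p)) t"
    if t0: "0 < t0" "t0 < T" and nz: "P (Suc (Suc p)) t0 \<noteq> 0" for t0
  proof -
    define l where "l = W t0 / P (Suc (Suc p)) t0"
    have "W t = l * P (Suc (Suc p)) t" if t: "t0 \<le> t" "t < T" for t
    proof -

    have "(\<lambda>t. W t - l * P (Suc (Suc p)) t) t = 0"
    proof (rule bessel_ode_energy[where a = t0 and T = T and b = "Suc p" and c = c
          and D = "\<lambda>t. W t - l * P (Suc (Suc p)) t" and D' = "\<lambda>t. W' t - l * P (Suc p) t"])
      fix s assume s: "t0 \<le> s" "s < T"
      then have s0: "s > 0" using t0 by simp
      show "((\<lambda>t. W t - l * P (Suc (Suc p)) t) has_real_derivative (W' s - l * P (Suc p) s)) (at s)"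
        using s s0 by (intro DERIV_diff DERIV_cmult W P1)
      have Ps: "P p s = (real (Suc p) * P (Suc p) s - c * P (Suc (Suc p)) s) / s"
        using P2[of s] s0 by (simp add: field_simps)
      have eq: "(real (Suc p) * W' s - c * W s) / s - l * P p s =
          (real (Suc p) * (W' s - l * P (Suc p) s) - c * (W s - l * P (Suc (Suc p)) s)) / s"
        unfolding Ps using s0 by (simp add: field_simps)
      show "((\<lambda>t. W' t - l * P (Suc p) t) has_real_derivative
          (real (Suc p) * (W' s - l * P (Suc p) s) - c * (W s - l * P (Suc (Suc p)) s)) / s) (at s)"
        unfolding eq[symmetric] using s s0 by (intro DERIV_diff DERIV_cmult W' P1)
    next
      show "W t0 - l * P (Suc (Suc p)) t0 = 0" using nz by (simp add: l_def)
      have "W t0 * P (Suc p) t0 = W' t0 * P (Suc (Suc p)) t0"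
        using X0[of t0] t0 by (simp add: X_def)
      then show "W' t0 - l * P (Suc p) t0 = 0" using nz by (simp add: l_def field_simps)
    qed (use t t0 c in auto)
    then show ?thesis by simp
    qed
    then show ?thesis by blast
  qed
  have "\<forall>\<^sub>F t in at_right (0::real). bessel_clifford c (Suc (Suc p)) t > 0"
  proof -
    have "((\<lambda>t. bessel_clifford c (Suc (Suc p)) t) \<longlongrightarrow> bessel_clifford c (Suc (Suc p)) 0) (at_right (0::real))"
      using DERIV_isCont[OF bessel_clifford_deriv, of "0::real" c "Suc (Suc p)"]
      by (simp add: isCont_def filterlim_at_split)
    then show ?thesis by (rule order_tendstoD) (simp add: bessel_clifford_0)
  qed
  then have "\<exists>e>0. \<forall>t>0. t < e \<longrightarrow> bessel_clifford c (Suc (Suc p)) (t::real) > 0"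
    by (simp only: eventually_at_right_field)
  then obtain e :: real where e: "e > 0" "\<And>t. 0 < t \<Longrightarrow> t < e \<Longrightarrow> bessel_clifford c (Suc (Suc p)) t > 0"
    by blast
  \<comment> \<open>left of d the regular solution has no zero; its multiples found from there agree\<close>
  define d where "d = min e T / 2"
  have d: "0 < d" "d < T" "d < e" using e(1) T by (auto simp: d_def)
  have nz: "P (Suc (Suc p)) t \<noteq> 0" if "0 < t" "t \<le> d" for t
    using e(2)[of t] that d unfolding P_def by simp
  obtain l where l: "\<forall>t. d \<le> t \<and> t < T \<longrightarrow> W t = l * P (Suc (Suc p)) t"
    using ev[OF d(1,2) nz[of d]] d by auto
  show ?thesis
  proof (intro exI allI impI)
    fix t assume t: "0 < t \<and> t < T"
    show "W t = l * P (Suc (Suc p)) t"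
    proof (cases "d \<le> t")
      case True then show ?thesis using l t by simp
    next
      case False
      then obtain l' where l': "\<forall>s. t \<le> s \<and> s < T \<longrightarrow> W s = l' * P (Suc (Suc p)) s"
        using ev[of t] nz[of t] t by auto
      have "l' * P (Suc (Suc p)) d = l * P (Suc (Suc p)) d"
        using l[rule_format, of d] l'[rule_format, of d] d False by simp
      then have "l = l'" using nz[of d] d by simp
      then show ?thesis using l' t by simp
    qed
  qed
qed

section \<open>Stability of the Goursat problem and the logarithmic solution\<close>

text \<open>One Picard iteration for \<open>\<partial>p \<partial>q D = \<mu> * D\<close>: integrate a polynomial bound in both variables. The
  term \<open>3 * \<epsilon>\<close> comes from \<open>D p 0 + D 0 q - D 0 0\<close>.\<close>

lemma goursat_step:
  fixes D Dq :: "real \<Rightarrow> real \<Rightarrow> complex" and \<mu> :: complex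
  assumes Dq: "\<And>p q. p \<in> {0..1} \<Longrightarrow> q \<in> {0..1} \<Longrightarrow> ((\<lambda>q. D p q) has_vector_derivative Dq p q) (at q)"
    and Dp: "\<And>p q. p \<in> {0..1} \<Longrightarrow> q \<in> {0..1} \<Longrightarrow> ((\<lambda>p. Dq p q) has_vector_derivative (\<mu> * D p q)) (at p)"
    and bd: "\<And>p. p \<in> {0..1} \<Longrightarrow> norm (D p 0) \<le> \<epsilon>" "\<And>q. q \<in> {0..1} \<Longrightarrow> norm (D 0 q) \<le> \<epsilon>"
    and B: "\<And>p q. p \<in> {0..1} \<Longrightarrow> q \<in> {0..1} \<Longrightarrow> norm (D p q) \<le> (\<Sum>i<n. C i * (p * q) ^ i)"
    and pq: "p \<in> {0..1}" "q \<in> {0..1}"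
  shows "norm (D p q) \<le> 3 * \<epsilon> + (\<Sum>i<n. C i * norm \<mu> / (real (Suc i))\<^sup>2 * (p * q) ^ Suc i)"
proof -
  define h where "h = (\<lambda>p q. \<Sum>i<n. C i * norm \<mu> / real (Suc i) * (p ^ Suc i * q ^ i))"
  define H where "H = (\<lambda>p q. \<Sum>i<n. C i * norm \<mu> / (real (Suc i))\<^sup>2 * (p ^ Suc i * q ^ Suc i))"
  have hp: "((\<lambda>p. h p q) has_real_derivative (norm \<mu> * (\<Sum>i<n. C i * (p * q) ^ i))) (at p)" for p q
  proof -
    have "((\<lambda>p. h p q) has_real_derivative (\<Sum>i<n. C i * norm \<mu> / real (Suc i) * (real (Suc i) * p ^ i * q ^ i))) (at p)"
      unfolding h_def by (auto intro!: derivative_eq_intros sum.cong simp del: of_nat_Suc power_Suc)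
    also have "(\<Sum>i<n. C i * norm \<mu> / real (Suc i) * (real (Suc i) * p ^ i * q ^ i)) = norm \<mu> * (\<Sum>i<n. C i * (p * q) ^ i)"
      unfolding sum_distrib_left by (intro sum.cong) (simp_all add: power_mult_distrib del: of_nat_Suc)
    finally show ?thesis .
  qed
  have Hq: "((\<lambda>q. H p q) has_real_derivative h p q) (at q)" for p q
  proof -
    have "((\<lambda>q. H p q) has_real_derivative (\<Sum>i<n. C i * norm \<mu> / (real (Suc i))\<^sup>2 * (p ^ Suc i * (real (Suc i) * q ^ i)))) (at q)"
      unfolding H_def
      by (intro DERIV_sum DERIV_cmult DERIV_cong[OF DERIV_pow]) simp
    also have "(\<Sum>i<n. C i * norm \<mu> / (real (Suc i))\<^sup>2 * (p ^ Suc i * (real (Suc i) * q ^ i))) = h p q"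
      unfolding h_def by (intro sum.cong) (simp_all add: power2_eq_square del: of_nat_Suc power_Suc)
    finally show ?thesis .
  qed
  have h0: "h 0 q = 0" and H0: "H p 0 = 0" for p q
    by (simp_all add: h_def H_def)
  have d1: "norm (Dq p q - Dq 0 q) \<le> h p q" if "p \<in> {0..1}" "q \<in> {0..1}" for p q
  proof (cases "p = 0")
    case False
    then have "0 < p" using that by simp
    have "norm (Dq p q - Dq 0 q) \<le> h p q - h 0 q"
    proof (rule differentiable_bound_general[OF \<open>0 < p\<close>, where f' = "\<lambda>p. \<mu> * D p q"
          and \<phi>' = "\<lambda>p. norm \<mu> * (\<Sum>i<n. C i * (p * q) ^ i)"])
      show "continuous_on {0..p} (\<lambda>p. Dq p q)"
        using that by (intro continuous_at_imp_continuous_on ballI has_vector_derivative_continuous[OF Dp]) auto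
      show "continuous_on {0..p} (\<lambda>p. h p q)"
        by (intro continuous_at_imp_continuous_on ballI DERIV_isCont[OF hp])
      fix x assume x: "0 < x" "x < p"
      show "((\<lambda>p. Dq p q) has_vector_derivative \<mu> * D x q) (at x)"
        using x that by (intro Dp) auto
      show "((\<lambda>p. h p q) has_vector_derivative norm \<mu> * (\<Sum>i<n. C i * (x * q) ^ i)) (at x)"
        using hp by (simp add: has_real_derivative_iff_has_vector_derivative)
      show "norm (\<mu> * D x q) \<le> norm \<mu> * (\<Sum>i<n. C i * (x * q) ^ i)"
        unfolding norm_mult using x that by (intro mult_left_mono B) auto
    qed
    then show ?thesis by (simp add: h0)
  qed (simp add: h0)
  have d2: "norm ((D p q - D 0 q) - (D p 0 - D 0 0)) \<le> H p q"
  proof (cases "q = 0")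
    case False
    then have "0 < q" using pq by simp
    have "norm ((D p q - D 0 q) - (D p 0 - D 0 0)) \<le> H p q - H p 0"
    proof (rule differentiable_bound_general[OF \<open>0 < q\<close>, where f = "\<lambda>q. D p q - D 0 q"
        and f' = "\<lambda>q. Dq p q - Dq 0 q" and \<phi>' = "\<lambda>q. h p q"])
      show "continuous_on {0..q} (\<lambda>q. D p q - D 0 q)"
        using pq by (intro continuous_at_imp_continuous_on ballI continuous_diff has_vector_derivative_continuous[OF Dq]) auto
      show "continuous_on {0..q} (\<lambda>q. H p q)"
        by (intro continuous_at_imp_continuous_on ballI DERIV_isCont[OF Hq])
      fix x assume x: "0 < x" "x < q"
      show "((\<lambda>q. D p q - D 0 q) has_vector_derivative Dq p x - Dq 0 x) (at x)"
        using x pq by (intro has_vector_derivative_diff Dq) auto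
      show "((\<lambda>q. H p q) has_vector_derivative h p x) (at x)"
        using Hq by (simp add: has_real_derivative_iff_has_vector_derivative)
      show "norm (Dq p x - Dq 0 x) \<le> h p x" using x pq by (intro d1) auto
    qed
    then show ?thesis by (simp add: H0)
  qed (simp add: H0)
  have "norm (((D p q - D 0 q) - (D p 0 - D 0 0)) + D 0 q + (D p 0 - D 0 0))
      \<le> norm ((D p q - D 0 q) - (D p 0 - D 0 0)) + norm (D 0 q) + (norm (D p 0) + norm (D 0 0))"
    by (intro norm_triangle_mono norm_triangle_ineq4 order_refl)
  moreover have "((D p q - D 0 q) - (D p 0 - D 0 0)) + D 0 q + (D p 0 - D 0 0) = D p q" by simp
  ultimately have "norm (D p q) \<le> norm ((D p q - D 0 q) - (D p 0 - D 0 0)) + norm (D 0 q) + (norm (D p 0) + norm (D 0 0))"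
    by (simp only: )
  also have "\<dots> \<le> H p q + \<epsilon> + (\<epsilon> + \<epsilon>)"
    using pq by (intro add_mono d2 bd) auto
  finally show ?thesis by (simp add: H_def power_mult_distrib del: of_nat_Suc power_Suc)
qed

text \<open>After \<open>n\<close> iterations of the Picard step the a priori bound \<open>K\<close> has turned into
  \<open>K * (norm \<mu>) ^ n / (fact n)\<^sup>2\<close>, which vanishes in the limit; the boundary terms sum up to at most an exponential.\<close>

lemma goursat_stability:
  fixes D Dq :: "real \<Rightarrow> real \<Rightarrow> complex" and \<mu> :: complex
  assumes Dq: "\<And>p q. p \<in> {0..1} \<Longrightarrow> q \<in> {0..1} \<Longrightarrow> ((\<lambda>q. D p q) has_vector_derivative Dq p q) (at q)"
    and Dp: "\<And>p q. p \<in> {0..1} \<Longrightarrow> q \<in> {0..1} \<Longrightarrow> ((\<lambda>p. Dq p q) has_vector_derivative (\<mu> * D p q)) (at p)"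
    and bd: "\<And>p. p \<in> {0..1} \<Longrightarrow> norm (D p 0) \<le> \<epsilon>" "\<And>q. q \<in> {0..1} \<Longrightarrow> norm (D 0 q) \<le> \<epsilon>"
    and K: "\<And>p q. p \<in> {0..1} \<Longrightarrow> q \<in> {0..1} \<Longrightarrow> norm (D p q) \<le> K"
  shows "norm (D 1 1) \<le> 3 * \<epsilon> * exp (norm \<mu>)"
proof -
  have e0: "\<epsilon> \<ge> 0" using order_trans[OF norm_ge_zero bd(1)[of 0]] by simp
  have K0: "K \<ge> 0" using order_trans[OF norm_ge_zero K[of 0 0]] by simp
  define C where "C = (\<lambda>n i. (if i < n then 3 * \<epsilon> else K) * norm \<mu> ^ i / (fact i)\<^sup>2)"
  have step: "\<forall>p\<in>{0..1}. \<forall>q\<in>{0..1}. norm (D p q) \<le> (\<Sum>i<Suc n. C n i * (p * q) ^ i)" for n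
  proof (induction n)
    case 0 then show ?case using K by (simp add: C_def)
  next
    case (Suc n)
    show ?case
    proof (intro ballI)
      fix p q :: real assume pq: "p \<in> {0..1}" "q \<in> {0..1}"
      have "norm (D p q) \<le> 3 * \<epsilon> + (\<Sum>i<Suc n. C n i * norm \<mu> / (real (Suc i))\<^sup>2 * (p * q) ^ Suc i)"
        by (rule goursat_step[OF Dq Dp bd _ pq]) (use Suc in auto)
      also have "(\<Sum>i<Suc n. C n i * norm \<mu> / (real (Suc i))\<^sup>2 * (p * q) ^ Suc i)
          = (\<Sum>i<Suc n. C (Suc n) (Suc i) * (p * q) ^ Suc i)"
        by (intro sum.cong refl) (simp add: C_def power_mult_distrib mult_ac del: of_nat_Suc)
      also have "3 * \<epsilon> + (\<Sum>i<Suc n. C (Suc n) (Suc i) * (p * q) ^ Suc i) = (\<Sum>i<Suc (Suc n). C (Suc n) i * (p * q) ^ i)"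
        by (subst (2) sum.lessThan_Suc_shift) (simp add: C_def)
      finally show "norm (D p q) \<le> (\<Sum>i<Suc (Suc n). C (Suc n) i * (p * q) ^ i)" .
    qed
  qed
  have bound: "norm (D 1 1) \<le> 3 * \<epsilon> * exp (norm \<mu>) + K * (inverse (fact n) * norm \<mu> ^ n)" for n
  proof -
    have "norm (D 1 1) \<le> (\<Sum>i<Suc n. C n i)" using step[of n, rule_format, of 1 1] by simp
    also have "\<dots> = (\<Sum>i<n. C n i) + C n n" by simp
    also have "\<dots> \<le> 3 * \<epsilon> * exp (norm \<mu>) + K * (inverse (fact n) * norm \<mu> ^ n)"
    proof (intro add_mono)
      have q: "1 / (fact i)\<^sup>2 \<le> inverse (fact i :: real)" for i
        by (simp add: divide_simps power2_eq_square fact_ge_1)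
      have "(\<Sum>i<n. C n i) = 3 * \<epsilon> * (\<Sum>i<n. norm \<mu> ^ i * (1 / (fact i)\<^sup>2))"
        by (simp add: C_def sum_distrib_left mult.assoc)
      also have "\<dots> \<le> 3 * \<epsilon> * (\<Sum>i<n. norm \<mu> ^ i * inverse (fact i))"
        using e0 by (intro mult_left_mono sum_mono q) auto
      also have "(\<Sum>i<n. norm \<mu> ^ i * inverse (fact i)) \<le> exp (norm \<mu>)"
        using sum_le_suminf[OF sums_summable[OF exp_converges[of "norm \<mu>"]], of "{..<n}"] sums_unique[OF exp_converges[of "norm \<mu>"]]
        by (simp add: mult.commute)
      finally show "(\<Sum>i<n. C n i) \<le> 3 * \<epsilon> * exp (norm \<mu>)" using e0 by (simp add: mult_left_mono)
      have "C n n = K * (norm \<mu> ^ n * (1 / (fact n)\<^sup>2))" by (simp add: C_def)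
      also have "\<dots> \<le> K * (norm \<mu> ^ n * inverse (fact n))"
        using K0 by (intro mult_left_mono q) auto
      finally show "C n n \<le> K * (inverse (fact n) * norm \<mu> ^ n)" by (simp add: mult.commute)
    qed
    finally show ?thesis .
  qed
  have "(\<lambda>n. 3 * \<epsilon> * exp (norm \<mu>) + K * (inverse (fact n) * norm \<mu> ^ n)) \<longlonglongrightarrow> 3 * \<epsilon> * exp (norm \<mu>) + K * 0"
    by (intro tendsto_intros summable_LIMSEQ_zero summable_exp)
  then have "norm (D 1 1) \<le> 3 * \<epsilon> * exp (norm \<mu>) + K * 0"
    by (rule LIMSEQ_le_const) (use bound in auto)
  then show ?thesis by simp
qed

text \<open>The series that accompanies the logarithm in the Bessel function of the second kind of order
  zero; it is real analytic in the square of the radius.\<close>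

definition neumann_coeff :: "real \<Rightarrow> nat \<Rightarrow> complex"
  where "neumann_coeff c j = of_real ((-c) ^ j * harm j / (fact j)\<^sup>2)"

definition neumann_series :: "real \<Rightarrow> complex \<Rightarrow> complex"
  where "neumann_series c s = (\<Sum>j. neumann_coeff c j * s ^ j)"

lemma harm_le_of_nat: "harm n \<le> (of_nat n :: real)"
proof (induction n)
  case (Suc n)
  have "inverse (real (Suc n)) \<le> 1" by (simp add: field_simps)
  with Suc show ?case unfolding harm_Suc by simp
qed (simp add: harm_def)

lemma neumann_series_summable: "summable (\<lambda>j. neumann_coeff c j * s ^ j)"
proof (rule summable_comparison_test')
  show "summable (\<lambda>j. (\<bar>c\<bar> * norm s) ^ j / fact j)"
    using summable_exp_generic[of "\<bar>c\<bar> * norm s"]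
    by (simp add: scaleR_conv_of_real divide_inverse mult.commute)
  fix j :: nat
  have "harm j \<le> (fact j :: real)"
    using harm_le_of_nat[of j] fact_ge_self[of j] by (metis of_nat_fact of_nat_le_iff order_trans)
  then have h: "harm j / (fact j)\<^sup>2 \<le> (1 / fact j :: real)"
    by (simp add: field_simps power2_eq_square)
  have "norm (neumann_coeff c j * s ^ j) = (\<bar>c\<bar> * norm s) ^ j * (harm j / (fact j)\<^sup>2)"
    unfolding neumann_coeff_def norm_mult norm_of_real norm_power
    by (simp add: abs_mult power_abs power_mult_distrib harm_nonneg)
  also have "\<dots> \<le> (\<bar>c\<bar> * norm s) ^ j * (1 / fact j)"
    by (intro mult_left_mono h) auto
  finally show "norm (neumann_coeff c j * s ^ j) \<le> (\<bar>c\<bar> * norm s) ^ j / fact j" by simp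
qed

lemma suminf_in_Reals:
  fixes f :: "nat \<Rightarrow> complex"
  assumes "summable f" "\<And>n. f n \<in> \<real>"
  shows "suminf f \<in> \<real>"
proof -
  have "Im (suminf f) = (\<Sum>n. Im (f n))" by (rule Im_suminf[OF assms(1)])
  also have "\<dots> = 0" using assms(2) by (simp add: complex_is_Real_iff)
  finally show ?thesis by (simp add: complex_is_Real_iff)
qed

lemma neumann_coeff_real: "neumann_coeff c j \<in> \<real>"
  unfolding neumann_coeff_def by (rule Reals_of_real)

lemma neumann_series_real: "neumann_series c (of_real x) \<in> \<real>"
  unfolding neumann_series_def
  by (intro suminf_in_Reals[OF neumann_series_summable] Reals_mult Reals_power Reals_of_real neumann_coeff_real)

text \<open>The harmonic numbers are chosen such that the logarithmic terms compensate: the right hand side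
  is what \<open>ln s * bessel_clifford c 0 s\<close> leaves over in the radial equation, up to a factor.\<close>

lemma neumann_series_ode:
  obtains N' N'' where
    "\<And>s. (neumann_series c has_field_derivative N' s) (at s)"
    "\<And>s. (N' has_field_derivative N'' s) (at s)"
    "\<And>s. s * N'' s + N' s + of_real c * neumann_series c s = - of_real c * bessel_clifford c (Suc 0) s"
    "\<And>x. N' (of_real x) \<in> \<real>"
proof
  let ?e = "neumann_coeff c"
  define N' where "N' = (\<lambda>s. \<Sum>j. diffs ?e j * s ^ j)"
  define N'' where "N'' = (\<lambda>s. \<Sum>j. diffs (diffs ?e) j * s ^ j)"
  show 1: "(neumann_series c has_field_derivative N' s) (at s)" for s
    unfolding neumann_series_def[abs_def] N'_def
    by (rule termdiffs_strong_converges_everywhere) (rule neumann_series_summable)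
  have s1: "summable (\<lambda>j. diffs ?e j * s ^ j)" for s
    by (rule termdiff_converges_all) (rule neumann_series_summable)
  have s2: "summable (\<lambda>j. diffs (diffs ?e) j * s ^ j)" for s
    by (rule termdiff_converges_all) (rule s1)
  show 2: "(N' has_field_derivative N'' s) (at s)" for s
    unfolding N'_def N''_def by (rule termdiffs_strong_converges_everywhere) (rule s1)
  show "N' (of_real x) \<in> \<real>" for x
    unfolding N'_def
    by (intro suminf_in_Reals[OF s1] Reals_mult Reals_power Reals_of_real)
      (simp only: diffs_def Reals_mult Reals_of_nat neumann_coeff_real)
  show "s * N'' s + N' s + of_real c * neumann_series c s = - of_real c * bessel_clifford c (Suc 0) s" for s
  proof -
    have a: "(\<lambda>j. diffs (diffs ?e) j * s ^ j * s) sums (N'' s * s)"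
      unfolding N''_def by (intro sums_mult2 summable_sums s2)
    define t where "t = (\<lambda>j. of_nat j * diffs ?e j * s ^ j)"
    have "(\<lambda>j. t (Suc j)) sums (N'' s * s)"
      using a by (simp add: t_def diffs_def mult_ac del: of_nat_Suc)
    then have b: "t sums (N'' s * s)"
      by (subst (asm) sums_Suc_iff) (simp add: t_def)
    have "(\<lambda>j. t j + diffs ?e j * s ^ j + of_real c * (?e j * s ^ j)) sums
        (N'' s * s + N' s + of_real c * neumann_series c s)"
      unfolding N'_def neumann_series_def
      by (intro sums_add b sums_mult summable_sums s1 neumann_series_summable)
    also have "(\<lambda>j. t j + diffs ?e j * s ^ j + of_real c * (?e j * s ^ j)) =
        (\<lambda>j. - of_real c * (of_real ((-c) ^ j / (fact j * fact (j + Suc 0))) * s ^ j))"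
    proof
      fix j
      have "real (Suc j) * real (Suc j) * ((-c) ^ Suc j * harm (Suc j) / (fact (Suc j))\<^sup>2) + c * ((-c) ^ j * harm j / (fact j)\<^sup>2)
          = - c * ((-c) ^ j / (fact j * fact (j + Suc 0)))"
        by (simp add: harm_Suc divide_simps power2_eq_square del: of_nat_Suc) (simp add: algebra_simps)
      then have "of_real (real (Suc j) * real (Suc j) * ((-c) ^ Suc j * harm (Suc j) / (fact (Suc j))\<^sup>2) + c * ((-c) ^ j * harm j / (fact j)\<^sup>2))
          = (of_real (- c * ((-c) ^ j / (fact j * fact (j + Suc 0)))) :: complex)"
        by (rule arg_cong)
      then have "of_nat (Suc j) * of_nat (Suc j) * ?e (Suc j) + of_real c * ?e j
          = - of_real c * of_real ((-c) ^ j / (fact j * fact (j + Suc 0)))"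
        unfolding neumann_coeff_def of_real_add of_real_minus of_real_mult[of "real (Suc j) * real (Suc j)"]
          of_real_mult[of "real (Suc j)"] of_real_mult[of c] of_real_mult[of "-c"] of_real_of_nat_eq .
      then have "(of_nat (Suc j) * of_nat (Suc j) * ?e (Suc j) + of_real c * ?e j) * s ^ j
          = - of_real c * of_real ((-c) ^ j / (fact j * fact (j + Suc 0))) * s ^ j" by simp
      then show "t j + diffs ?e j * s ^ j + of_real c * (?e j * s ^ j) =
        - of_real c * (of_real ((-c) ^ j / (fact j * fact (j + Suc 0))) * s ^ j)"
        by (simp add: t_def diffs_def algebra_simps)
    qed
    finally have "\<dots> sums (N'' s * s + N' s + of_real c * neumann_series c s)" .
    moreover have "(\<lambda>j. - of_real c * (of_real ((-c) ^ j / (fact j * fact (j + Suc 0))) * s ^ j)) sums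
        (- of_real c * bessel_clifford c (Suc 0) s)"
      by (intro sums_mult bessel_clifford_sums)
    ultimately have "N'' s * s + N' s + of_real c * neumann_series c s = - of_real c * bessel_clifford c (Suc 0) s"
      by (rule sums_unique2)
    then show ?thesis by (simp add: mult.commute)
  qed
qed

section \<open>The Helmholtz equation in characteristic variables\<close>

text \<open>Writing \<open>z = x 1 + \<i> * x 2\<close> and \<open>w = cnj z\<close> and treating the two as independent turns
  \<open>\<Delta> + k\<^sup>2\<close> into \<open>4 * \<partial>z \<partial>w + k\<^sup>2\<close>. In this form solutions are determined by their values
  on the two complex lines \<open>w = 0\<close> and \<open>z = 0\<close>.\<close>

definition characteristic_solution :: "real \<Rightarrow> complex set \<Rightarrow> (complex \<Rightarrow> complex \<Rightarrow> complex) \<Rightarrow> bool"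
  where "characteristic_solution c U f \<longleftrightarrow>
    continuous_on (U \<times> U) (\<lambda>(z, w). f z w) \<and>
    (\<exists>fw. \<forall>z\<in>U. \<forall>w\<in>U. ((\<lambda>w. f z w) has_field_derivative fw z w) (at w) \<and>
        ((\<lambda>z. fw z w) has_field_derivative (- of_real c * f z w)) (at z))"

lemma characteristic_solution_linear:
  assumes "characteristic_solution c U f" "characteristic_solution c U g"
  shows "characteristic_solution c U (\<lambda>z w. a * f z w + b * g z w)"
proof -
  obtain fw where f: "continuous_on (U \<times> U) (\<lambda>(z, w). f z w)"
      "\<And>z w. z \<in> U \<Longrightarrow> w \<in> U \<Longrightarrow> ((\<lambda>w. f z w) has_field_derivative fw z w) (at w)"
      "\<And>z w. z \<in> U \<Longrightarrow> w \<in> U \<Longrightarrow> ((\<lambda>z. fw z w) has_field_derivative (- of_real c * f z w)) (at z)"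
    using assms(1) unfolding characteristic_solution_def by blast
  obtain gw where g: "continuous_on (U \<times> U) (\<lambda>(z, w). g z w)"
      "\<And>z w. z \<in> U \<Longrightarrow> w \<in> U \<Longrightarrow> ((\<lambda>w. g z w) has_field_derivative gw z w) (at w)"
      "\<And>z w. z \<in> U \<Longrightarrow> w \<in> U \<Longrightarrow> ((\<lambda>z. gw z w) has_field_derivative (- of_real c * g z w)) (at z)"
    using assms(2) unfolding characteristic_solution_def by blast
  have 1: "continuous_on (U \<times> U) (\<lambda>(z, w). a * f z w + b * g z w)"
    using f(1) g(1) unfolding split_def by (intro continuous_intros)
  have 2: "((\<lambda>w. a * f z w + b * g z w) has_field_derivative a * fw z w + b * gw z w) (at w)"
    if "z \<in> U" "w \<in> U" for z w
    using that by (intro DERIV_add DERIV_cmult f g)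
  have 3: "((\<lambda>z. a * fw z w + b * gw z w) has_field_derivative - of_real c * (a * f z w + b * g z w)) (at z)"
    if "z \<in> U" "w \<in> U" for z w
  proof -
    have "((\<lambda>z. a * fw z w + b * gw z w) has_field_derivative a * (- of_real c * f z w) + b * (- of_real c * g z w)) (at z)"
      using that by (intro DERIV_add DERIV_cmult f g)
    then show ?thesis by (simp add: algebra_simps)
  qed
  show ?thesis unfolding characteristic_solution_def
    by (intro conjI 1 exI[of _ "\<lambda>z w. a * fw z w + b * gw z w"] ballI 2 3)
qed

lemma characteristic_solution_zero: "characteristic_solution c U (\<lambda>z w. 0)"
  unfolding characteristic_solution_def
  by (intro conjI exI[of _ "\<lambda>z w. 0"]) auto

lemma characteristic_solution_sum:
  assumes "\<And>i. i \<in> I \<Longrightarrow> characteristic_solution c U (f i)"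
  shows "characteristic_solution c U (\<lambda>z w. \<Sum>i\<in>I. b i * f i z w)"
  using assms
proof (induction I rule: infinite_finite_induct)
  case (insert x F)
  then show ?case
    using characteristic_solution_linear[of c U "f x" "\<lambda>z w. \<Sum>i\<in>F. b i * f i z w" "b x" 1] by simp
qed (simp_all add: characteristic_solution_zero)

text \<open>Along the real parameters \<open>p\<close> and \<open>q\<close> the function \<open>f (p * z) (q * w)\<close> solves the Goursat problem with
  \<open>\<mu> = - c * z * w\<close>.\<close>

lemma characteristic_solution_bound:
  assumes f: "characteristic_solution c (ball 0 R) f" and z: "norm z < R" and w: "norm w < R"
    and b1: "\<And>p. p \<in> {0..1} \<Longrightarrow> norm (f (of_real p * z) 0) \<le> \<epsilon>"
    and b2: "\<And>q. q \<in> {0..1} \<Longrightarrow> norm (f 0 (of_real q * w)) \<le> \<epsilon>"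
  shows "norm (f z w) \<le> 3 * \<epsilon> * exp (norm (of_real c * z * w))"
proof -
  obtain fw where fc: "continuous_on (ball 0 R \<times> ball 0 R) (\<lambda>(z, w). f z w)"
    and f1: "\<And>z w. z \<in> ball 0 R \<Longrightarrow> w \<in> ball 0 R \<Longrightarrow> ((\<lambda>w. f z w) has_field_derivative fw z w) (at w)"
    and f2: "\<And>z w. z \<in> ball 0 R \<Longrightarrow> w \<in> ball 0 R \<Longrightarrow> ((\<lambda>z. fw z w) has_field_derivative (- of_real c * f z w)) (at z)"
    using f unfolding characteristic_solution_def by blast
  have inb: "of_real p * z \<in> ball 0 R" "of_real p * w \<in> ball 0 R" if "p \<in> {0..1}" for p
    using that z w mult_left_le_one_le[of "norm z" "\<bar>p\<bar>"] mult_left_le_one_le[of "norm w" "\<bar>p\<bar>"]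
    by (auto simp: norm_mult)
  define D where "D = (\<lambda>p q. f (of_real p * z) (of_real q * w))"
  define Dq where "Dq = (\<lambda>p q. w * fw (of_real p * z) (of_real q * w))"
  have lin: "((\<lambda>q. of_real q * a) has_vector_derivative a) (at x)" for a :: complex and x
    unfolding has_vector_derivative_def scaleR_conv_of_real
    by (auto intro!: derivative_eq_intros)
  have "continuous_on ({0..1} \<times> {0..1}) (\<lambda>x. D (fst x) (snd x))"
  proof -
    have "continuous_on ({0..1} \<times> {0..1}) ((\<lambda>(z, w). f z w) \<circ> (\<lambda>x. (of_real (fst x) * z, of_real (snd x) * w)))"
      by (intro continuous_on_compose continuous_on_subset[OF fc] continuous_intros) (use inb in fastforce)
    then show ?thesis by (simp add: D_def o_def)
  qed
  then have "compact ((\<lambda>x. D (fst x) (snd x)) ` ({0..1} \<times> {0..1}))"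
    by (intro compact_continuous_image compact_Times) auto
  then obtain K where "\<forall>y\<in>(\<lambda>x. D (fst x) (snd x)) ` ({0..1} \<times> {0..1}). norm y \<le> K"
    using compact_imp_bounded bounded_iff by metis
  then have K: "norm (D p q) \<le> K" if "p \<in> {0..1}" "q \<in> {0..1}" for p q using that by force
  have "norm (D 1 1) \<le> 3 * \<epsilon> * exp (norm (- of_real c * z * w))"
  proof (rule goursat_stability[where D = D and Dq = Dq and K = K])
    fix p q :: real assume pq: "p \<in> {0..1}" "q \<in> {0..1}"
    show "((\<lambda>q. D p q) has_vector_derivative Dq p q) (at q)"
      using field_vector_diff_chain_at[OF lin[of w q] f1[OF inb(1)[OF pq(1)] inb(2)[OF pq(2)]]]
      by (simp add: D_def Dq_def o_def)
    show "((\<lambda>p. Dq p q) has_vector_derivative - of_real c * z * w * D p q) (at p)"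
      using has_vector_derivative_mult_right[OF field_vector_diff_chain_at[OF lin[of z p] f2[OF inb(1)[OF pq(1)] inb(2)[OF pq(2)]]], of w]
      by (simp add: D_def Dq_def o_def mult_ac)
  qed (use b1 b2 K in \<open>auto simp: D_def\<close>)
  then show ?thesis by (simp add: D_def norm_mult)
qed

text \<open>On \<open>w = cnj z\<close> these are the modes of nonnegative order; on \<open>w = 0\<close> they reduce to the
  multiples \<open>z ^ m / fact m\<close>, so that they match a Taylor series there.\<close>

lemma characteristic_solution_power_left:
  "characteristic_solution c U (\<lambda>z w. z ^ m * bessel_clifford c m (z * w))"
  unfolding characteristic_solution_def
proof (intro conjI exI[of _ "\<lambda>z w. - of_real c * (z ^ Suc m * bessel_clifford c (Suc m) (z * w))"] ballI)
  show "continuous_on (U \<times> U) (\<lambda>(z, w). z ^ m * bessel_clifford c m (z * w))"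
    unfolding split_def by (intro continuous_intros)
  fix z w :: complex
  show "((\<lambda>w. z ^ m * bessel_clifford c m (z * w)) has_field_derivative
      - of_real c * (z ^ Suc m * bessel_clifford c (Suc m) (z * w))) (at w)"
    by (auto intro!: derivative_eq_intros)
  have r: "bessel_clifford c m (z * w) = of_nat (Suc m) * bessel_clifford c (Suc m) (z * w)
          - of_real c * (z * w) * bessel_clifford c (Suc (Suc m)) (z * w)"
    using bessel_clifford_recurrence[of c m "z * w"] by (simp add: algebra_simps)
  show "((\<lambda>z. - of_real c * (z ^ Suc m * bessel_clifford c (Suc m) (z * w))) has_field_derivative
      - of_real c * (z ^ m * bessel_clifford c m (z * w))) (at z)"
    unfolding r by (rule derivative_eq_intros refl | simp)+ (simp add: algebra_simps)
qed

lemma characteristic_solution_power_right: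
  "characteristic_solution c U (\<lambda>z w. w ^ Suc m * bessel_clifford c (Suc m) (z * w))"
  unfolding characteristic_solution_def
proof (intro conjI exI[of _ "\<lambda>z w. w ^ m * bessel_clifford c m (z * w)"] ballI)
  show "continuous_on (U \<times> U) (\<lambda>(z, w). w ^ Suc m * bessel_clifford c (Suc m) (z * w))"
    unfolding split_def by (intro continuous_intros)
  fix z w :: complex
  show "((\<lambda>z. w ^ m * bessel_clifford c m (z * w)) has_field_derivative
      - of_real c * (w ^ Suc m * bessel_clifford c (Suc m) (z * w))) (at z)"
    by (auto intro!: derivative_eq_intros)
  have r: "bessel_clifford c m (z * w) = of_nat (Suc m) * bessel_clifford c (Suc m) (z * w)
          - of_real c * (z * w) * bessel_clifford c (Suc (Suc m)) (z * w)"
    using bessel_clifford_recurrence[of c m "z * w"] by (simp add: algebra_simps)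
  show "((\<lambda>w. w ^ Suc m * bessel_clifford c (Suc m) (z * w)) has_field_derivative
      w ^ m * bessel_clifford c m (z * w)) (at w)"
    unfolding r by (rule derivative_eq_intros refl | simp)+ (simp add: algebra_simps)
qed

text \<open>The fundamental solution with its source at \<open>R\<close> on the real axis, continued to independent \<open>z\<close> and
  \<open>w\<close>. The squared distance becomes \<open>(R - z) * (R - w)\<close>; its logarithm is split into two
  logarithms, because each of them is holomorphic in the disk of radius \<open>R\<close> whereas the product
  may meet the branch cut.\<close>

definition hankel_kernel :: "real \<Rightarrow> complex \<Rightarrow> complex \<Rightarrow> real \<Rightarrow> complex \<Rightarrow> complex \<Rightarrow> complex"
  where "hankel_kernel c \<alpha> \<beta> R z w =
    bessel_clifford c 0 ((of_real R - z) * (of_real R - w)) * (\<alpha> + \<beta> * (Ln (of_real R - z) + Ln (of_real R - w)))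
      - 2 * \<beta> * neumann_series c ((of_real R - z) * (of_real R - w))"

lemma notin_nonpos_Reals_ball:
  fixes z :: complex
  assumes "norm z < R" shows "of_real R - z \<notin> \<real>\<^sub>\<le>\<^sub>0" "of_real R - z \<noteq> 0"
proof -
  have "Re (of_real R - z) > 0" using assms complex_Re_le_cmod[of z] by simp
  then show "of_real R - z \<notin> \<real>\<^sub>\<le>\<^sub>0" "of_real R - z \<noteq> 0"
    by (auto simp: complex_nonpos_Reals_iff)
qed

lemma characteristic_solution_hankel_kernel:
  "characteristic_solution c (ball 0 R) (hankel_kernel c \<alpha> \<beta> R)"
proof -
  obtain N' N'' where N1: "\<And>s. (neumann_series c has_field_derivative N' s) (at s)"
    and N2: "\<And>s. (N' has_field_derivative N'' s) (at s)"
    and N3: "\<And>s. s * N'' s + N' s + of_real c * neumann_series c s = - of_real c * bessel_clifford c (Suc 0) s"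
    by (rule neumann_series_ode[of c]) (rule that; assumption)
  have Nc: "continuous_on S (\<lambda>x. neumann_series c (f x))" if "continuous_on S f" for S and f :: "complex \<times> complex \<Rightarrow> complex"
  proof -
    have "continuous_on UNIV (neumann_series c)"
      by (intro continuous_at_imp_continuous_on ballI DERIV_isCont[OF N1])
    from continuous_on_compose2[OF this that] show ?thesis by simp
  qed
  have D1: "((\<lambda>x. neumann_series c (f x)) has_field_derivative N' (f x) * f') (at x)"
    and D2: "((\<lambda>x. N' (f x)) has_field_derivative N'' (f x) * f') (at x)"
    if "(f has_field_derivative f') (at x)" for f f' x
    using DERIV_chain2[OF N1 that] DERIV_chain2[OF N2 that] by auto
  let ?R = "of_real R :: complex"
  let ?s = "\<lambda>z w. (?R - z) * (?R - w)"
  let ?L = "\<lambda>z w. \<alpha> + \<beta> * (Ln (?R - z) + Ln (?R - w))"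
  define kw where "kw = (\<lambda>z w. of_real c * (?R - z) * bessel_clifford c (Suc 0) (?s z w) * ?L z w
      - \<beta> * bessel_clifford c 0 (?s z w) / (?R - w) + 2 * \<beta> * (?R - z) * N' (?s z w))"
  show ?thesis unfolding characteristic_solution_def
  proof (intro conjI exI[of _ kw] ballI)
    show "continuous_on (ball 0 R \<times> ball 0 R) (\<lambda>(z, w). hankel_kernel c \<alpha> \<beta> R z w)"
      unfolding split_def hankel_kernel_def
      by (intro continuous_intros Nc continuous_on_Ln') (auto dest: notin_nonpos_Reals_ball)
    fix z w :: complex assume zw: "z \<in> ball 0 R" "w \<in> ball 0 R"
    then have nz: "?R - z \<notin> \<real>\<^sub>\<le>\<^sub>0" "?R - z \<noteq> 0" "?R - w \<notin> \<real>\<^sub>\<le>\<^sub>0" "?R - w \<noteq> 0"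
      using notin_nonpos_Reals_ball by auto
    have w: "((\<lambda>w. hankel_kernel c \<alpha> \<beta> R z w) has_field_derivative
        (- of_real c * bessel_clifford c (Suc 0) (?s z w) * (- (?R - z))) * ?L z w
        + bessel_clifford c 0 (?s z w) * (\<beta> * (- 1 / (?R - w))) - 2 * \<beta> * (N' (?s z w) * (- (?R - z)))) (at w)"
      unfolding hankel_kernel_def using nz
      by (auto intro!: derivative_eq_intros D1 simp: divide_inverse)
    show "((\<lambda>w. hankel_kernel c \<alpha> \<beta> R z w) has_field_derivative kw z w) (at w)"
      by (rule DERIV_cong[OF w]) (simp add: kw_def algebra_simps)
    have z: "((\<lambda>z. kw z w) has_field_derivative
        (of_real c * (-1) * bessel_clifford c (Suc 0) (?s z w)
          + of_real c * (?R - z) * (- of_real c * bessel_clifford c (Suc (Suc 0)) (?s z w) * (- (?R - w)))) * ?L z w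
        + of_real c * (?R - z) * bessel_clifford c (Suc 0) (?s z w) * (\<beta> * (- 1 / (?R - z)))
        - \<beta> * (- of_real c * bessel_clifford c (Suc 0) (?s z w) * (- (?R - w))) / (?R - w)
        + 2 * \<beta> * ((-1) * N' (?s z w) + (?R - z) * (N'' (?s z w) * (- (?R - w))))) (at z)"
      unfolding kw_def using nz
      by (auto intro!: derivative_eq_intros D2 simp: divide_inverse) (simp add: algebra_simps)
    show "((\<lambda>z. kw z w) has_field_derivative - of_real c * hankel_kernel c \<alpha> \<beta> R z w) (at z)"
    proof (rule DERIV_cong[OF z])
      define s where "s = ?s z w"
      have N: "s * N'' s = - of_real c * bessel_clifford c (Suc 0) s - N' s - of_real c * neumann_series c s"
        using N3[of s] by (simp add: algebra_simps)
      have B: "bessel_clifford c (Suc 0) s = bessel_clifford c 0 s + of_real c * s * bessel_clifford c (Suc (Suc 0)) s"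
        using bessel_clifford_recurrence[of c 0 s] by (simp add: algebra_simps)
      have k: "hankel_kernel c \<alpha> \<beta> R z w = bessel_clifford c 0 s * ?L z w - 2 * \<beta> * neumann_series c s"
        by (simp add: hankel_kernel_def s_def)
      have alg: "(C*(-1)*b1 + C*A*(-C*b2*(-W)))*L + C*A*b1*(\<beta>*(-1/A)) - \<beta>*(-C*b1*(-W))/W + 2*\<beta>*((-1)*n1 + A*(n2*(-W)))
          = (-C*b1 + C*C*(A*W)*b2)*L - 2*\<beta>*C*b1 - 2*\<beta>*n1 - 2*\<beta>*(A*W*n2)"
        if "A \<noteq> 0" "W \<noteq> 0" for A W C b1 b2 n1 n2 L :: complex
        using that by (simp add: field_simps)
      have "?R - z \<noteq> 0" "?R - w \<noteq> 0" using nz by auto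
      then have "(of_real c * (-1) * bessel_clifford c (Suc 0) s
          + of_real c * (?R - z) * (- of_real c * bessel_clifford c (Suc (Suc 0)) s * (- (?R - w)))) * ?L z w
        + of_real c * (?R - z) * bessel_clifford c (Suc 0) s * (\<beta> * (- 1 / (?R - z)))
        - \<beta> * (- of_real c * bessel_clifford c (Suc 0) s * (- (?R - w))) / (?R - w)
        + 2 * \<beta> * ((-1) * N' s + (?R - z) * (N'' s * (- (?R - w))))
        = (- of_real c * bessel_clifford c (Suc 0) s + of_real c * of_real c * s * bessel_clifford c (Suc (Suc 0)) s) * ?L z w
        - 2 * \<beta> * of_real c * bessel_clifford c (Suc 0) s - 2 * \<beta> * N' s - 2 * \<beta> * (s * N'' s)"
        unfolding s_def by (rule alg)
      also have "\<dots> = - of_real c * hankel_kernel c \<alpha> \<beta> R z w"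
        unfolding N k by (subst (1) B) (simp add: algebra_simps)
      finally show "(of_real c * (-1) * bessel_clifford c (Suc 0) (?s z w)
          + of_real c * (?R - z) * (- of_real c * bessel_clifford c (Suc (Suc 0)) (?s z w) * (- (?R - w)))) * ?L z w
        + of_real c * (?R - z) * bessel_clifford c (Suc 0) (?s z w) * (\<beta> * (- 1 / (?R - z)))
        - \<beta> * (- of_real c * bessel_clifford c (Suc 0) (?s z w) * (- (?R - w))) / (?R - w)
        + 2 * \<beta> * ((-1) * N' (?s z w) + (?R - z) * (N'' (?s z w) * (- (?R - w))))
        = - of_real c * hankel_kernel c \<alpha> \<beta> R z w" unfolding s_def .
    qed
  qed
qed

section \<open>Growth of solutions of the three-term recurrence\<close>

text \<open>The discrete Wronskian of the real and imaginary parts of \<open>a\<close> obeys a first order recurrence, since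
  the coefficients of the recurrence of \<open>a\<close> are real.\<close>

lemma recurrence_solution_nonzero:
  fixes a :: "nat \<Rightarrow> complex"
  assumes R: "R > 0" and c: "c > 0"
    and rec: "\<And>n. of_real R * of_nat (n + 2) * of_nat (n + 1) * a (n + 2)
        = (of_nat (n + 1))\<^sup>2 * a (n + 1) - of_real (c * R) * a n"
  shows "Im (cnj (a (Suc n)) * a (Suc (Suc n))) = c / (real (n + 1) * real (n + 2)) * Im (cnj (a n) * a (Suc n))"
    and "a (n + 2) = of_real (real (n + 1) / (R * real (n + 2))) * a (n + 1) - of_real (c / (real (n + 1) * real (n + 2))) * a n"
proof -
  have nz: "of_real R \<noteq> (0::complex)" "of_nat (n + 2) \<noteq> (0::complex)" "of_nat (n + 1) \<noteq> (0::complex)"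
    using R by (simp, metis Zero_neq_Suc add_2_eq_Suc' of_nat_eq_0_iff, metis Suc_eq_plus1 Zero_neq_Suc of_nat_eq_0_iff)
  have "a (n + 2) = ((of_nat (n + 1))\<^sup>2 * a (n + 1) - of_real (c * R) * a n) / (of_real R * of_nat (n + 2) * of_nat (n + 1))"
    unfolding rec[symmetric] using nz by simp
  also have "\<dots> = of_nat (n + 1) / (of_real R * of_nat (n + 2)) * a (n + 1) - of_real c / (of_nat (n + 1) * of_nat (n + 2)) * a n"
    using nz by (simp add: diff_divide_distrib power2_eq_square del: of_nat_add of_nat_Suc)
  finally show A: "a (n + 2) = of_real (real (n + 1) / (R * real (n + 2))) * a (n + 1) - of_real (c / (real (n + 1) * real (n + 2))) * a n"
    by simp
  define p where "p = real (n + 1) / (R * real (n + 2))"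
  define q where "q = c / (real (n + 1) * real (n + 2))"
  have A': "a (Suc (Suc n)) = of_real p * a (Suc n) - of_real q * a n"
    using A by (simp add: p_def q_def)
  show "Im (cnj (a (Suc n)) * a (Suc (Suc n))) = c / (real (n + 1) * real (n + 2)) * Im (cnj (a n) * a (Suc n))"
    unfolding q_def[symmetric] A' by (simp add: algebra_simps)
qed

text \<open>The recurrence has solutions that decay like \<open>R powr - n\<close> and solutions that decay
  factorially. A sequence whose ratios stay below \<open>q\<close> would be of the second kind, at a rate
  \<open>K / n\<^sup>2\<close>; but then the product of two consecutive terms would eventually be smaller than
  their Wronskian. So at some index the ratio is at least \<open>q\<close>, and the recurrence
  propagates this.\<close>

lemma recurrence_solution_lower_bound:
  fixes a :: "nat \<Rightarrow> complex"
  assumes R: "R > 0" and c: "c > 0"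
    and rec: "\<And>n. of_real R * of_nat (n + 2) * of_nat (n + 1) * a (n + 2)
        = (of_nat (n + 1))\<^sup>2 * a (n + 1) - of_real (c * R) * a n"
    and w: "Im (cnj (a 0) * a 1) \<noteq> 0" and q: "0 < q" "q < 1 / R"
  shows "\<exists>\<delta>>0. \<forall>n. \<delta> * q ^ n \<le> norm (a n)"
proof -
  note rec1 = recurrence_solution_nonzero(1)[OF R c rec]
  note rec2 = recurrence_solution_nonzero(2)[OF R c rec]
  have wn: "Im (cnj (a n) * a (Suc n)) \<noteq> 0" for n
  proof (induction n)
    case 0 then show ?case using w by simp
  next
    case (Suc n) then show ?case unfolding rec1 using c by simp
  qed
  have nz: "a n \<noteq> 0" for n using wn[of n] by auto
  \<comment> \<open>the room between q and the true decay rate 1 / R\<close>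
  define \<eta> where "\<eta> = (1 - R * q) / 2"
  have eta: "\<eta> > 0" "R * q = 1 - 2 * \<eta>" using q R by (auto simp: \<eta>_def field_simps)
  define K where "K = c * R / \<eta>"
  have K: "K > 0" using eta c R by (simp add: K_def)
  have e1: "\<forall>\<^sub>F n in sequentially. real (n + 1) / (R * real (n + 2)) - c / (real (n + 1) * real (n + 2)) / q \<ge> q"
  proof -
    have "(\<lambda>n. real (n + 1) / (R * real (n + 2)) - c / (real (n + 1) * real (n + 2)) / q) \<longlonglongrightarrow> inverse R"
      using R c q by real_asymp
    then have "\<forall>\<^sub>F n in sequentially. real (n + 1) / (R * real (n + 2)) - c / (real (n + 1) * real (n + 2)) / q > q"
      by (rule order_tendstoD) (use q in \<open>simp add: divide_inverse\<close>)
    then show ?thesis by (rule eventually_mono) simp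
  qed
  have e2: "\<forall>\<^sub>F n in sequentially. real (n + 1) - (1 - 2 * \<eta>) * real (n + 2) \<ge> \<eta> * real (n + 1)"
    using eta(1) by real_asymp
  have e3: "\<forall>\<^sub>F n in sequentially. K * K / (c * (real (n + 1) * real (n + 2))) \<le> 1 / 2"
    using K c by real_asymp
  obtain n0 where n1: "\<And>n. n \<ge> n0 \<Longrightarrow> real (n + 1) / (R * real (n + 2)) - c / (real (n + 1) * real (n + 2)) / q \<ge> q"
    and n2: "\<And>n. n \<ge> n0 \<Longrightarrow> real (n + 1) - (1 - 2 * \<eta>) * real (n + 2) \<ge> \<eta> * real (n + 1)"
    and n3: "\<And>n. n \<ge> n0 \<Longrightarrow> K * K / (c * (real (n + 1) * real (n + 2))) \<le> 1 / 2"
    using eventually_conj[OF e1 eventually_conj[OF e2 e3]] unfolding eventually_sequentially by blast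
  have "\<exists>n\<ge>n0. q * norm (a n) \<le> norm (a (Suc n))"
  proof (rule ccontr)
    assume "\<not> ?thesis"
    then have dec: "norm (a (Suc n)) \<le> q * norm (a n)" if "n \<ge> n0" for n
      using that by (meson linorder_not_le less_imp_le)
    have fast: "norm (a (Suc n)) \<le> K / (real (n + 1))\<^sup>2 * norm (a n)" if n: "n \<ge> n0" for n
    proof -
      have "(real (n + 1))\<^sup>2 * norm (a (Suc n)) = norm ((of_nat (n + 1))\<^sup>2 * a (n + 1))"
        by (simp only: norm_mult norm_power norm_of_nat Suc_eq_plus1)
      also have "(of_nat (n + 1))\<^sup>2 * a (n + 1) = of_real R * of_nat (n + 2) * of_nat (n + 1) * a (n + 2) + of_real (c * R) * a n"
        unfolding rec by simp
      also have "norm \<dots> \<le> R * real (n + 2) * real (n + 1) * norm (a (n + 2)) + c * R * norm (a n)"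
        using R c by (intro norm_triangle_le add_mono) (simp_all only: norm_mult norm_of_nat norm_of_real abs_mult abs_of_pos order_refl)
      also have "\<dots> \<le> R * real (n + 2) * real (n + 1) * (q * norm (a (Suc n))) + c * R * norm (a n)"
        using dec[of "Suc n"] n R by (intro add_right_mono mult_left_mono) auto
      also have "\<dots> = real (n + 1) * ((1 - 2 * \<eta>) * real (n + 2)) * norm (a (Suc n)) + c * R * norm (a n)"
        unfolding eta(2)[symmetric] by (simp only: mult_ac)
      also have "\<dots> \<le> real (n + 1) * (real (n + 1) - \<eta> * real (n + 1)) * norm (a (Suc n)) + c * R * norm (a n)"
        using n2[OF n] by (intro add_right_mono mult_right_mono mult_left_mono) auto
      finally have "\<eta> * ((real (n + 1))\<^sup>2 * norm (a (Suc n))) \<le> c * R * norm (a n)"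
        by (simp add: power2_eq_square algebra_simps)
      then show ?thesis
        using eta(1) by (simp add: K_def field_simps)
    qed
    \<comment> \<open>at least 1, yet halved in each step under the assumption of fast decay\<close>
    define y where "y = (\<lambda>n. norm (a n) * norm (a (Suc n)) / \<bar>Im (cnj (a n) * a (Suc n))\<bar>)"
    have y1: "y n \<ge> 1" for n
    proof -
      have "\<bar>Im (cnj (a n) * a (Suc n))\<bar> \<le> norm (a n) * norm (a (Suc n))"
        using abs_Im_le_cmod[of "cnj (a n) * a (Suc n)"] by (simp only: norm_mult complex_mod_cnj)
      then show ?thesis using wn[of n] by (simp add: y_def)
    qed
    have ystep: "y (Suc n) \<le> 1 / 2 * y n" if n: "n \<ge> n0" for n
    proof -
      have "norm (a (Suc n)) * norm (a (Suc (Suc n)))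
          \<le> (K / (real (n + 1))\<^sup>2 * norm (a n)) * (K / (real (Suc n + 1))\<^sup>2 * norm (a (Suc n)))"
        using fast[OF n] fast[of "Suc n"] n K by (intro mult_mono) auto
      also have "\<dots> = (K * K / (c * (real (n + 1) * real (n + 2)))) * (c / (real (n + 1) * real (n + 2)) * (norm (a n) * norm (a (Suc n))))"
      proof -
        have "(K / N\<^sup>2 * x) * (K / N'\<^sup>2 * y) = (K * K / (c * (N * N'))) * (c / (N * N') * (x * y))"
          if "N > 0" "N' > 0" for N N' x y :: real
          using that c by (simp add: field_simps power2_eq_square)
        from this[of "real (n + 1)" "real (Suc n + 1)"] show ?thesis by simp
      qed
      also have "\<dots> \<le> 1 / 2 * (c / (real (n + 1) * real (n + 2)) * (norm (a n) * norm (a (Suc n))))"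
        using n3[OF n] c by (intro mult_right_mono) auto
      finally have *: "norm (a (Suc n)) * norm (a (Suc (Suc n))) \<le> 1 / 2 * (c / (real (n + 1) * real (n + 2)) * (norm (a n) * norm (a (Suc n))))" .
      define d where "d = c / (real (n + 1) * real (n + 2))"
      have d: "d > 0" using c by (simp add: d_def)
      have W: "\<bar>Im (cnj (a (Suc n)) * a (Suc (Suc n)))\<bar> = d * \<bar>Im (cnj (a n) * a (Suc n))\<bar>"
        unfolding rec1 d_def[symmetric] using d by (simp only: abs_mult abs_of_pos)
      have "y (Suc n) \<le> 1 / 2 * (d * (norm (a n) * norm (a (Suc n)))) / \<bar>Im (cnj (a (Suc n)) * a (Suc (Suc n)))\<bar>"
        unfolding y_def using * by (intro divide_right_mono) (auto simp: d_def)
      also have "\<dots> = 1 / 2 * y n"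
        unfolding y_def W using d by (simp only: times_divide_eq_right mult_divide_mult_cancel_left mult.left_commute[of "1/2" d] less_imp_neq[symmetric]) simp
      finally show ?thesis .
    qed
    have "y (n0 + j) \<le> (1 / 2) ^ j * y n0" for j
    proof (induction j)
      case (Suc j) then show ?case using ystep[of "n0 + j"] by simp
    qed simp
    moreover have "(\<lambda>j. (1 / 2) ^ j * y n0) \<longlonglongrightarrow> 0"
      by real_asymp
    then have "\<forall>\<^sub>F j in sequentially. (1 / 2) ^ j * y n0 < 1" by (rule order_tendstoD) simp
    then obtain j where "(1 / 2) ^ j * y n0 < 1" by (meson eventually_sequentially order_refl)
    ultimately show False using y1[of "n0 + j"] by (meson linorder_not_le order_trans)
  qed
  then obtain n1 where n1': "n1 \<ge> n0" "q * norm (a n1) \<le> norm (a (Suc n1))" by blast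
  have grow: "q * norm (a (n1 + j)) \<le> norm (a (Suc (n1 + j)))" for j
  proof (induction j)
    case 0 then show ?case using n1' by simp
  next
    case (Suc j)
    define n where "n = n1 + j"
    define p where "p = real (n + 1) / (R * real (n + 2))"
    define d where "d = c / (real (n + 1) * real (n + 2))"
    have pd: "p > 0" "d > 0" using R c by (auto simp: p_def d_def)
    have IH: "norm (a n) \<le> norm (a (Suc n)) / q" using Suc q by (simp add: n_def field_simps)
    have "q * norm (a (Suc n)) \<le> (p - d / q) * norm (a (Suc n))"
      using n1[of n] n1'(1) by (intro mult_right_mono) (auto simp: n_def p_def d_def)
    also have "\<dots> \<le> p * norm (a (Suc n)) - d * norm (a n)"
      using mult_left_mono[OF IH, of d] pd by (simp add: algebra_simps)
    also have "\<dots> = norm (of_real p * a (Suc n)) - norm (of_real d * a n)"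
      using pd by (simp add: norm_mult)
    also have "\<dots> \<le> norm (of_real p * a (Suc n) - of_real d * a n)" by (rule norm_triangle_ineq2)
    also have "of_real p * a (Suc n) - of_real d * a n = a (Suc (Suc n))"
      using rec2[of n] by (simp add: p_def d_def)
    finally show ?case by (simp add: n_def)
  qed
  have grow2: "norm (a n1) * q ^ j \<le> norm (a (n1 + j))" for j
  proof (induction j)
    case (Suc j)
    have "norm (a n1) * q ^ Suc j = q * (norm (a n1) * q ^ j)" by simp
    also have "\<dots> \<le> q * norm (a (n1 + j))" using Suc q by simp
    also have "\<dots> \<le> norm (a (n1 + Suc j))" using grow[of j] by simp
    finally show ?case .
  qed simp
  define \<delta> where "\<delta> = Min ((\<lambda>n. norm (a n) / q ^ n) ` {..n1})"
  have d: "\<delta> > 0" unfolding \<delta>_def using nz q by (subst Min_gr_iff) auto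
  have d1: "\<delta> * q ^ n \<le> norm (a n)" if "n \<le> n1" for n
  proof -
    have "\<delta> \<le> norm (a n) / q ^ n" unfolding \<delta>_def using that by (intro Min_le) auto
    then show ?thesis using q by (simp add: field_simps)
  qed
  show ?thesis
  proof (intro exI[of _ \<delta>] conjI allI d)
    fix n show "\<delta> * q ^ n \<le> norm (a n)"
    proof (cases "n \<le> n1")
      case False
      then have n: "n = n1 + (n - n1)" by simp
      have "\<delta> * q ^ n = (\<delta> * q ^ n1) * q ^ (n - n1)" by (subst n) (simp add: power_add)
      also have "\<dots> \<le> norm (a n1) * q ^ (n - n1)" using d1[of n1] q by (intro mult_right_mono) auto
      also have "\<dots> \<le> norm (a n)" using grow2[of "n - n1"] n by simp
      finally show ?thesis .
    qed (rule d1)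
  qed
qed

section \<open>Coefficients of the source expansion\<close>

definition hankel_coeff :: "real \<Rightarrow> complex \<Rightarrow> complex \<Rightarrow> real \<Rightarrow> nat \<Rightarrow> complex"
  where "hankel_coeff c \<alpha> \<beta> R m = (deriv ^^ m) (\<lambda>z. hankel_kernel c \<alpha> \<beta> R z 0) 0 / fact m"

text \<open>On \<open>w = 0\<close> the radial equation becomes an equation in \<open>z\<close> alone, whose singularity is at
  \<open>z = R\<close>. The last clause is the classical Wronskian of \<open>J\<^sub>0\<close> and \<open>Y\<^sub>0\<close>, evaluated at the centre.\<close>

lemma hankel_kernel_deriv_z:
  assumes R: "R > 0"
  obtains g1 g2 where
    "\<And>z. norm z < R \<Longrightarrow> ((\<lambda>z. hankel_kernel c \<alpha> \<beta> R z 0) has_field_derivative g1 z) (at z)"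
    "\<And>z. norm z < R \<Longrightarrow> (g1 has_field_derivative g2 z) (at z)"
    "\<And>z. norm z < R \<Longrightarrow> (of_real R - z) * g2 z - g1 z + of_real (c * R) * hankel_kernel c \<alpha> \<beta> R z 0 = 0"
    "Im \<beta> = 0 \<Longrightarrow> Im (cnj (hankel_kernel c \<alpha> \<beta> R 0 0) * g1 0) = Im \<alpha> * Re \<beta> / R"
proof -
  obtain N' N'' where N1: "\<And>s. (neumann_series c has_field_derivative N' s) (at s)"
    and N2: "\<And>s. (N' has_field_derivative N'' s) (at s)"
    and N3: "\<And>s. s * N'' s + N' s + of_real c * neumann_series c s = - of_real c * bessel_clifford c (Suc 0) s"
    and N4: "\<And>x. N' (of_real x) \<in> \<real>"
    by (rule neumann_series_ode[of c]) (rule that; assumption)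
  have D1: "((\<lambda>x. neumann_series c (f x)) has_field_derivative N' (f x) * f') (at x)"
    and D2: "((\<lambda>x. N' (f x)) has_field_derivative N'' (f x) * f') (at x)"
    if "(f has_field_derivative f') (at x)" for f f' x
    using DERIV_chain2[OF N1 that] DERIV_chain2[OF N2 that] by auto
  let ?R = "of_real R :: complex"
  let ?s = "\<lambda>z. ?R * (?R - z)"
  let ?L = "\<lambda>z. \<alpha> + \<beta> * (Ln (?R - z) + Ln ?R)"
  have k: "hankel_kernel c \<alpha> \<beta> R z 0 = bessel_clifford c 0 (?s z) * ?L z - 2 * \<beta> * neumann_series c (?s z)" for z
    by (simp add: hankel_kernel_def mult.commute)
  define g1 where "g1 = (\<lambda>z. of_real c * ?R * bessel_clifford c (Suc 0) (?s z) * ?L z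
      - \<beta> * bessel_clifford c 0 (?s z) / (?R - z) + 2 * \<beta> * ?R * N' (?s z))"
  define g2 where "g2 = (\<lambda>z. of_real c * ?R * (of_real c * ?R * bessel_clifford c (Suc (Suc 0)) (?s z)) * ?L z
      + of_real c * ?R * bessel_clifford c (Suc 0) (?s z) * (\<beta> * (- 1 / (?R - z)))
      - (\<beta> * (of_real c * ?R * bessel_clifford c (Suc 0) (?s z)) * (?R - z) + \<beta> * bessel_clifford c 0 (?s z)) / ((?R - z) * (?R - z))
      - 2 * \<beta> * ?R * (N'' (?s z) * ?R))"
  have d1: "((\<lambda>z. hankel_kernel c \<alpha> \<beta> R z 0) has_field_derivative g1 z) (at z)" if z: "norm z < R" for z
  proof -
    have nz: "?R - z \<notin> \<real>\<^sub>\<le>\<^sub>0" "?R - z \<noteq> 0" using notin_nonpos_Reals_ball z by auto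
    have "((\<lambda>z. hankel_kernel c \<alpha> \<beta> R z 0) has_field_derivative
        (- of_real c * bessel_clifford c (Suc 0) (?s z) * (- ?R)) * ?L z + bessel_clifford c 0 (?s z) * (\<beta> * (- 1 / (?R - z)))
        - 2 * \<beta> * (N' (?s z) * (- ?R))) (at z)"
      unfolding k using nz by (auto intro!: derivative_eq_intros D1 simp: divide_inverse)
    then show ?thesis by (rule DERIV_cong) (simp add: g1_def mult_ac)
  qed
  have d2: "(g1 has_field_derivative g2 z) (at z)" if z: "norm z < R" for z
  proof -
    have nz: "?R - z \<notin> \<real>\<^sub>\<le>\<^sub>0" "?R - z \<noteq> 0" using notin_nonpos_Reals_ball z by auto
    show ?thesis
      unfolding g1_def
      by (rule derivative_eq_intros D2 refl nz | simp only: diff_0 mult_zero_left mult_zero_right)+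
        (use nz in \<open>simp add: g2_def divide_inverse\<close>, (simp add: algebra_simps)?)
  qed
  have d3: "(?R - z) * g2 z - g1 z + of_real (c * R) * hankel_kernel c \<alpha> \<beta> R z 0 = 0" if z: "norm z < R" for z
  proof -
    have nz: "?R - z \<noteq> 0" using notin_nonpos_Reals_ball z by auto
    define s where "s = ?s z"
    have N: "s * N'' s = - of_real c * bessel_clifford c (Suc 0) s - N' s - of_real c * neumann_series c s"
      using N3[of s] by (simp add: algebra_simps)
    have B: "bessel_clifford c 0 s = bessel_clifford c (Suc 0) s - of_real c * s * bessel_clifford c (Suc (Suc 0)) s"
      using bessel_clifford_recurrence[of c 0 s] by (simp add: algebra_simps)
    have alg: "A * (C * r * (C * r * b2) * L + C * r * b1 * (\<beta> * (- 1 / A)) - (\<beta> * (C * r * b1) * A + \<beta> * b0) / (A * A)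
        - 2 * \<beta> * r * (n2 * r)) - (C * r * b1 * L - \<beta> * b0 / A + 2 * \<beta> * r * n1) + C * r * (b0 * L - 2 * \<beta> * n)
        = C * r * L * (b0 - b1 + C * (r * A) * b2) - 2 * \<beta> * r * (r * A * n2 + n1 + C * n + C * b1)"
      if "A \<noteq> 0" for A r C b0 b1 b2 n n1 n2 L :: complex
      using that by (simp add: field_simps)
    have "(?R - z) * g2 z - g1 z + of_real c * ?R * (bessel_clifford c 0 s * ?L z - 2 * \<beta> * neumann_series c s)
      = of_real c * ?R * ?L z * (bessel_clifford c 0 s - bessel_clifford c (Suc 0) s + of_real c * s * bessel_clifford c (Suc (Suc 0)) s)
        - 2 * \<beta> * ?R * (s * N'' s + N' s + of_real c * neumann_series c s + of_real c * bessel_clifford c (Suc 0) s)"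
      unfolding g2_def g1_def s_def by (rule alg[OF nz])
    also have "\<dots> = 0" unfolding N3 B by simp
    finally show ?thesis unfolding k s_def by simp
  qed
  have d4: "Im (cnj (hankel_kernel c \<alpha> \<beta> R 0 0) * g1 0) = Im \<alpha> * Re \<beta> / R" if b: "Im \<beta> = 0"
  proof -
    let ?T = "\<lambda>s. (bessel_clifford c 0 s)\<^sup>2 - 2 * s * (bessel_clifford c 0 s * N' s + of_real c * bessel_clifford c (Suc 0) s * neumann_series c s)"
    have dT: "(?T has_field_derivative 0) (at s)" for s
    proof -
      define b0 b1 b2 n n1 n2 where d: "b0 = bessel_clifford c 0 s" "b1 = bessel_clifford c (Suc 0) s"
        "b2 = bessel_clifford c (Suc (Suc 0)) s" "n = neumann_series c s" "n1 = N' s" "n2 = N'' s"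
      have N: "s * n2 = - of_real c * b1 - n1 - of_real c * n"
        using N3[of s] by (simp add: algebra_simps d)
      have B: "of_real c * s * b2 = b1 - b0"
        using bessel_clifford_recurrence[of c 0 s] by (simp add: algebra_simps d)
      have "(?T has_field_derivative (2 * b0 * (- of_real c * b1) - (2 * (b0 * n1 + of_real c * b1 * n)
          + 2 * s * ((- of_real c * b1) * n1 + b0 * n2 + of_real c * (- of_real c * b2) * n + of_real c * b1 * n1)))) (at s)"
        unfolding d by (auto intro!: derivative_eq_intros N1 N2)
      moreover have "2 * b0 * (- of_real c * b1) - (2 * (b0 * n1 + of_real c * b1 * n)
          + 2 * s * ((- of_real c * b1) * n1 + b0 * n2 + of_real c * (- of_real c * b2) * n + of_real c * b1 * n1))
          = - 2 * b0 * of_real c * b1 - 2 * b0 * n1 - 2 * of_real c * b1 * n - 2 * b0 * (s * n2) + 2 * of_real c * n * (of_real c * s * b2)"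
        by (simp add: algebra_simps)
      moreover have "- 2 * b0 * of_real c * b1 - 2 * b0 * n1 - 2 * of_real c * b1 * n - 2 * b0 * (s * n2) + 2 * of_real c * n * (of_real c * s * b2) = 0"
        unfolding N B by (simp add: algebra_simps)
      ultimately show ?thesis by (simp only: )
    qed
    have T: "?T s = 1" for s
    proof -
      have "?T s = ?T 0"
      proof -
        obtain C where "\<forall>x\<in>UNIV. ?T x = C"
          using has_field_derivative_zero_constant[OF convex_UNIV, of ?T] dT by blast
        then have "?T s = C" "?T 0 = C" by blast+
        then show ?thesis by (simp only: )
      qed
      then show ?thesis by (simp add: bessel_clifford_0)
    qed
    define r0 r1 n n1 l where d: "r0 = bessel_clifford c 0 (R * R)" "r1 = bessel_clifford c (Suc 0) (R * R)"
      "n = Re (neumann_series c (of_real (R * R)))" "n1 = Re (N' (of_real (R * R)))" "l = 2 * ln R"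
    have n: "neumann_series c (of_real (R * R)) = of_real n" "N' (of_real (R * R)) = of_real n1"
      using neumann_series_real[of c "R * R"] N4[of "R * R"] by (auto simp: d simp del: of_real_mult)
    have br: "bessel_clifford c p (of_real (R * R) :: complex) = of_real (bessel_clifford c p (R * R))" for p
      by (rule bessel_clifford_of_real)
    have L: "?L 0 = \<alpha> + of_real (Re \<beta> * l)"
      using R b by (simp add: d Ln_of_real complex_eq_iff)
    have beta: "\<beta> = of_real (Re \<beta>)" using b by (simp add: complex_eq_iff)
    have "r0\<^sup>2 - 2 * (R * R) * (r0 * n1 + c * r1 * n) = 1"
    proof -
      have "of_real (r0\<^sup>2 - 2 * (R * R) * (r0 * n1 + c * r1 * n)) = (1::complex)"
        using T[of "of_real (R * R)"] unfolding n br d(1,2)[symmetric] by simp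
      then show ?thesis by (metis of_real_eq_1_iff)
    qed
    then have t: "r0 * r0 - 2 * (R * R) * (r0 * n1) - 2 * (R * R) * (c * (r1 * n)) = 1"
      by (simp add: power2_eq_square algebra_simps)
    have h0: "hankel_kernel c \<alpha> \<beta> R 0 0 = of_real r0 * (\<alpha> + of_real (Re \<beta> * l)) - of_real (2 * Re \<beta> * n)"
      using L n(1) br[of 0] beta unfolding k by (simp add: d)
    have h1: "g1 0 = of_real (c * R * r1) * (\<alpha> + of_real (Re \<beta> * l)) - of_real (Re \<beta> * r0 / R) + of_real (2 * Re \<beta> * R * n1)"
      using L n(2) br[of 0] br[of "Suc 0"] beta unfolding g1_def by (simp add: d)
    have "Im (cnj (hankel_kernel c \<alpha> \<beta> R 0 0) * g1 0)
        = Im \<alpha> * Re \<beta> / R * (r0 * r0 - 2 * (R * R) * (r0 * n1) - 2 * (R * R) * (c * (r1 * n)))"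
      unfolding h0 h1 using R by (simp add: field_simps)
    then show ?thesis unfolding t by simp
  qed
  show ?thesis by (rule that[OF d1 d2 d3 d4])
qed

section \<open>Size of the coefficients and the Helmholtz modes\<close>

lemma hankel_coeff_sums:
  assumes R: "R > 0" and z: "norm z < R"
  shows "(\<lambda>m. hankel_coeff c \<alpha> \<beta> R m * z ^ m) sums hankel_kernel c \<alpha> \<beta> R z 0"
proof -
  obtain g1 where "\<And>z. norm z < R \<Longrightarrow> ((\<lambda>z. hankel_kernel c \<alpha> \<beta> R z 0) has_field_derivative g1 z) (at z)"
    by (rule hankel_kernel_deriv_z[OF R, of c \<alpha> \<beta>]) (rule that; assumption)
  then have "(\<lambda>z. hankel_kernel c \<alpha> \<beta> R z 0) holomorphic_on ball 0 R"
    by (intro holomorphic_onI) (auto simp: field_differentiable_def intro: has_field_derivative_at_within)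
  from holomorphic_power_series[OF this, of z] show ?thesis
    using z by (simp add: hankel_coeff_def)
qed

lemma hankel_coeff_summable_norm:
  assumes R: "R > 0" and r: "0 \<le> r" "r < R"
  shows "summable (\<lambda>m. norm (hankel_coeff c \<alpha> \<beta> R m) * r ^ m)"
proof -
  define x :: complex where "x = of_real ((r + R) / 2)"
  have "norm x = (r + R) / 2" unfolding x_def norm_of_real using r by simp
  then have x: "norm x < R" "norm (of_real r :: complex) < norm x" using r by auto
  have "summable (\<lambda>m. hankel_coeff c \<alpha> \<beta> R m * x ^ m)"
    by (rule sums_summable[OF hankel_coeff_sums[OF R x(1)]])
  from powser_insidea[OF this x(2)] show ?thesis
    using r by (simp add: norm_mult norm_power)
qed

text \<open>The kernel is holomorphic in the disk of radius \<open>R\<close>, so its Taylor coefficients are bounded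
  geometrically in any smaller disk.\<close>

lemma hankel_coeff_upper_bound:
  assumes R: "R > 0" and r: "0 < r" "r < R"
  shows "\<exists>K>0. \<forall>m. norm (hankel_coeff c \<alpha> \<beta> R m) \<le> K / r ^ m"
proof -
  let ?f = "\<lambda>m. norm (hankel_coeff c \<alpha> \<beta> R m) * r ^ m"
  have s: "summable ?f" using hankel_coeff_summable_norm[OF R] r by simp
  show ?thesis
  proof (intro exI[of _ "suminf ?f + 1"] conjI allI)
    have "suminf ?f \<ge> 0" using s r by (intro suminf_nonneg) auto
    then show "suminf ?f + 1 > 0" by simp
    fix m
    have "?f m \<le> suminf ?f" using sum_le_suminf[OF s, of "{m}"] r by simp
    then have "?f m \<le> suminf ?f + 1" by simp
    then show "norm (hankel_coeff c \<alpha> \<beta> R m) \<le> (suminf ?f + 1) / r ^ m"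
      using r by (simp add: field_simps)
  qed
qed

text \<open>The differential equation for the kernel on \<open>w = 0\<close> translates into the three-term recurrence
  for its Taylor coefficients, and the Wronskian of the first two of them is nonzero.\<close>

lemma hankel_coeff_lower_bound:
  assumes R: "R > 0" and c: "c > 0" and \<alpha>: "Im \<alpha> \<noteq> 0" and \<beta>: "Im \<beta> = 0" "\<beta> \<noteq> 0" and r: "R < r"
  shows "\<exists>\<delta>>0. \<forall>m. \<delta> / r ^ m \<le> norm (hankel_coeff c \<alpha> \<beta> R m)"
proof -
  obtain g1 g2 where d1': "\<And>z. norm z < R \<Longrightarrow> ((\<lambda>z. hankel_kernel c \<alpha> \<beta> R z 0) has_field_derivative g1 z) (at z)"
    and d2: "\<And>z. norm z < R \<Longrightarrow> (g1 has_field_derivative g2 z) (at z)"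
    and ode': "\<And>z. norm z < R \<Longrightarrow> (of_real R - z) * g2 z - g1 z + of_real (c * R) * hankel_kernel c \<alpha> \<beta> R z 0 = 0"
    and w': "Im \<beta> = 0 \<Longrightarrow> Im (cnj (hankel_kernel c \<alpha> \<beta> R 0 0) * g1 0) = Im \<alpha> * Re \<beta> / R"
    by (rule hankel_kernel_deriv_z[OF R, of c \<alpha> \<beta>]) (rule that; assumption)
  define g where "g = (\<lambda>z. hankel_kernel c \<alpha> \<beta> R z 0)"
  have d1: "(g has_field_derivative g1 z) (at z)" if "norm z < R" for z
    unfolding g_def by (rule d1'[OF that])
  have ode: "(of_real R - z) * g2 z - g1 z + of_real (c * R) * g z = 0" if "norm z < R" for z
    unfolding g_def by (rule ode'[OF that])
  have w: "Im (cnj (g 0) * g1 0) = Im \<alpha> * Re \<beta> / R"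
    unfolding g_def by (rule w'[OF \<beta>(1)])
  have hol: "g holomorphic_on ball 0 R"
    using d1 by (intro holomorphic_onI) (auto simp: field_differentiable_def intro: has_field_derivative_at_within)
  then have "g analytic_on {0}" using R by (auto simp: analytic_on_open intro: analytic_on_subset[of _ "ball 0 R"])
  then have F0: "g has_fps_expansion fps_expansion g 0"
    by (rule analytic_at_imp_has_fps_expansion_0)
  define F where "F = fps_expansion g 0"
  have Fn: "fps_nth F m = hankel_coeff c \<alpha> \<beta> R m" for m
    by (simp add: F_def fps_expansion_def hankel_coeff_def g_def)
  have e1: "\<forall>\<^sub>F z in nhds 0. deriv g z = g1 z"
  proof (rule eventually_mono[of "\<lambda>z. z \<in> ball 0 R"])
    show "\<forall>\<^sub>F z in nhds 0. z \<in> ball 0 R" using R by (intro eventually_nhds_in_open) auto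
  qed (use d1 in \<open>auto intro: DERIV_imp_deriv\<close>)
  have F1: "g1 has_fps_expansion fps_deriv F"
    using has_fps_expansion_cong[OF e1 refl] has_fps_expansion_deriv[OF F0] by (simp add: F_def)
  have e2: "\<forall>\<^sub>F z in nhds 0. deriv g1 z = g2 z"
  proof (rule eventually_mono[of "\<lambda>z. z \<in> ball 0 R"])
    show "\<forall>\<^sub>F z in nhds 0. z \<in> ball 0 R" using R by (intro eventually_nhds_in_open) auto
  qed (use d2 in \<open>auto intro: DERIV_imp_deriv\<close>)
  have F2: "g2 has_fps_expansion fps_deriv (fps_deriv F)"
    using has_fps_expansion_cong[OF e2 refl] has_fps_expansion_deriv[OF F1] by simp
  have "(\<lambda>z. (of_real R - z) * g2 z - g1 z + of_real (c * R) * g z) has_fps_expansion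
      ((fps_const (of_real R) - fps_X) * fps_deriv (fps_deriv F) - fps_deriv F + fps_const (of_real (c * R)) * F)"
    using F0 F1 F2 unfolding F_def[symmetric] by (intro fps_expansion_intros) 
  moreover have e0: "\<forall>\<^sub>F z in nhds 0. (of_real R - z) * g2 z - g1 z + of_real (c * R) * g z = 0"
  proof (rule eventually_mono[of "\<lambda>z. z \<in> ball 0 R"])
    show "\<forall>\<^sub>F z in nhds 0. z \<in> ball 0 R" using R by (intro eventually_nhds_in_open) auto
  qed (use ode in auto)
  ultimately have "(\<lambda>z. 0::complex) has_fps_expansion
      ((fps_const (of_real R) - fps_X) * fps_deriv (fps_deriv F) - fps_deriv F + fps_const (of_real (c * R)) * F)"
    using has_fps_expansion_cong[OF e0 refl] by simp
  then have Z: "(fps_const (of_real R) - fps_X) * fps_deriv (fps_deriv F) - fps_deriv F + fps_const (of_real (c * R)) * F = 0"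
    using fps_expansion_unique_complex has_fps_expansion_0 by blast
  define a where "a = hankel_coeff c \<alpha> \<beta> R"
  have rec: "of_real R * of_nat (n + 2) * of_nat (n + 1) * a (n + 2) = (of_nat (n + 1))\<^sup>2 * a (n + 1) - of_real (c * R) * a n" for n
  proof -
    have "fps_nth ((fps_const (of_real R) - fps_X) * fps_deriv (fps_deriv F) - fps_deriv F + fps_const (of_real (c * R)) * F) n = 0"
      unfolding Z by simp
    then show ?thesis
      by (cases n) (auto simp: left_diff_distrib fps_X_mult_nth Fn a_def[symmetric] power2_eq_square algebra_simps)
  qed
  have a0: "a 0 = g 0" by (simp add: a_def hankel_coeff_def g_def)
  have a1: "a 1 = g1 0"
    using DERIV_imp_deriv[OF d1[of 0]] R by (simp add: a_def hankel_coeff_def g_def[symmetric])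
  have "\<exists>\<delta>>0. \<forall>n. \<delta> * (1 / r) ^ n \<le> norm (a n)"
  proof (rule recurrence_solution_lower_bound[OF R c rec])
    have "Re \<beta> \<noteq> 0" using \<beta> by (auto simp: complex_eq_iff)
    then show "Im (cnj (a 0) * a 1) \<noteq> 0" unfolding a0 a1 w using \<alpha> R by simp
    show "0 < 1 / r" "1 / r < 1 / R" using R r by (auto simp: frac_less2)
  qed
  then show ?thesis by (simp add: a_def power_divide)
qed

text \<open>A multiple of \<open>J m (k * r) * cis (m * \<theta>)\<close>, normalized to agree with \<open>z ^ m\<close> (or its conjugate)
  to leading order at the origin.\<close>

definition helmholtz_mode :: "real \<Rightarrow> int \<Rightarrow> complex \<Rightarrow> complex"
  where "helmholtz_mode c m z = (if m \<ge> 0 then z else cnj z) ^ nat \<bar>m\<bar> *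
      (fact (nat \<bar>m\<bar>) * bessel_clifford c (nat \<bar>m\<bar>) (of_real ((norm z)\<^sup>2)))"

lemma helmholtz_mode_norm_le:
  "norm (helmholtz_mode c m z) \<le> norm z ^ nat \<bar>m\<bar> * exp (\<bar>c\<bar> * (norm z)\<^sup>2)"
proof -
  have "norm (fact (nat \<bar>m\<bar>) * bessel_clifford c (nat \<bar>m\<bar>) (of_real ((norm z)\<^sup>2)) :: complex)
      \<le> fact (nat \<bar>m\<bar>) * (exp (\<bar>c\<bar> * norm (of_real ((norm z)\<^sup>2) :: complex)) / fact (nat \<bar>m\<bar>))"
    unfolding norm_mult using bessel_clifford_norm_le by (intro mult_mono) auto
  also have "\<dots> = exp (\<bar>c\<bar> * (norm z)\<^sup>2)" by (simp add: norm_power)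
  finally show ?thesis
    unfolding helmholtz_mode_def norm_mult norm_power by (intro mult_mono) auto
qed

text \<open>Absolute summability makes the value independent of the order of summation.\<close>

lemma has_sum_int_eq_limit:
  fixes f :: "int \<Rightarrow> complex"
  assumes f: "f summable_on UNIV" and lim: "(\<lambda>n. (\<Sum>m<n. f (int m)) + (\<Sum>m<n. f (- int (Suc m)))) \<longlonglongrightarrow> S"
  shows "(f has_sum S) UNIV"
proof -
  have h: "(f has_sum infsum f UNIV) UNIV" using f by (rule has_sum_infsum)
  have "filterlim (\<lambda>n. {- int n..<int n}) (finite_subsets_at_top UNIV) sequentially"
    unfolding filterlim_finite_subsets_at_top
  proof (intro allI impI)
    fix X :: "int set" assume "finite X \<and> X \<subseteq> UNIV"
    then obtain K where K: "\<And>x. x \<in> X \<Longrightarrow> \<bar>x\<bar> \<le> K"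
      by (metis finite_imageI finite_has_maximal2 Max_ge imageI)
    show "\<forall>\<^sub>F n in sequentially. finite {- int n..<int n} \<and> X \<subseteq> {- int n..<int n} \<and> {- int n..<int n} \<subseteq> UNIV"
      unfolding eventually_sequentially
    proof (intro exI[of _ "nat K + 1"] allI impI conjI subsetI)
      fix n x assume "nat K + 1 \<le> n" "x \<in> X"
      then show "x \<in> {- int n..<int n}" using K[of x] by auto
    qed auto
  qed
  from filterlim_compose[OF h[unfolded has_sum_def] this]
  have "(\<lambda>n. sum f {- int n..<int n}) \<longlonglongrightarrow> infsum f UNIV" .
  moreover have "sum f {- int n..<int n} = (\<Sum>m<n. f (int m)) + (\<Sum>m<n. f (- int (Suc m)))" for n
  proof -
    have "{- int n..<int n} = int ` {..<n} \<union> (\<lambda>m. - int (Suc m)) ` {..<n}"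
    proof (intro equalityI subsetI)
      fix x assume x: "x \<in> {- int n..<int n}"
      show "x \<in> int ` {..<n} \<union> (\<lambda>m. - int (Suc m)) ` {..<n}"
      proof (cases "x \<ge> 0")
        case True then have "x = int (nat x)" "nat x < n" using x by auto
        then show ?thesis by blast
      next
        case False then have "x = - int (Suc (nat (- x - 1)))" "nat (- x - 1) < n" using x by auto
        then show ?thesis by blast
      qed
    qed auto
    then have "sum f {- int n..<int n} = sum f (int ` {..<n}) + sum f ((\<lambda>m. - int (Suc m)) ` {..<n})"
      by (simp only:) (intro sum.union_disjoint, auto)
    also have "\<dots> = (\<Sum>m<n. f (int m)) + (\<Sum>m<n. f (- int (Suc m)))"
      by (subst (1 2) sum.reindex) (auto simp: inj_on_def)
    finally show ?thesis .
  qed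
  ultimately have "infsum f UNIV = S" using lim LIMSEQ_unique by fastforce
  then show ?thesis using h by simp
qed

lemma summable_on_int_nat_abs:
  fixes f :: "nat \<Rightarrow> real"
  assumes f: "summable f" and nn: "\<And>n. f n \<ge> 0"
  shows "(\<lambda>m::int. f (nat \<bar>m\<bar>)) summable_on UNIV"
proof -
  have s: "f summable_on UNIV" using summable_nonneg_imp_summable_on[OF f nn] .
  have 1: "(\<lambda>m. f (nat \<bar>m\<bar>)) summable_on range int"
    by (subst summable_on_reindex) (use s in \<open>auto simp: o_def\<close>)
  have "(\<lambda>m. f (nat \<bar>m\<bar>)) summable_on range (\<lambda>n. - int n)"
    by (subst summable_on_reindex) (use s in \<open>auto simp: o_def inj_on_def\<close>)
  then have 2: "(\<lambda>m. f (nat \<bar>m\<bar>)) summable_on (range (\<lambda>n. - int n) - range int)"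
    by (rule summable_on_subset_banach) auto
  have "(\<lambda>m. f (nat \<bar>m\<bar>)) summable_on (range int \<union> (range (\<lambda>n. - int n) - range int))"
    by (rule summable_on_Un_disjoint[OF 1 2]) auto
  moreover have "range int \<union> (range (\<lambda>n. - int n) - range int) = UNIV"
  proof -
    have "x \<in> range int \<or> x \<in> range (\<lambda>n. - int n)" for x :: int
      by (cases x rule: int_cases2) auto
    then show ?thesis by auto
  qed
  ultimately show ?thesis by simp
qed

section \<open>Expansion of the fundamental solution\<close>

lemma power_series_tail_bound:
  fixes a :: "nat \<Rightarrow> complex"
  assumes s: "summable (\<lambda>m. norm (a m) * r ^ m)" and y: "norm y \<le> r" and g: "(\<lambda>m. a m * y ^ m) sums g" and N: "n \<le> N"
  shows "norm (g - (\<Sum>m<N. a m * y ^ m)) \<le> (\<Sum>m. norm (a m) * r ^ m) - (\<Sum>m<n. norm (a m) * r ^ m)"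
proof -
  have r: "r \<ge> 0" using order_trans[OF norm_ge_zero y] .
  have le: "norm (a m * y ^ m) \<le> norm (a m) * r ^ m" for m
    unfolding norm_mult norm_power using y by (intro mult_left_mono power_mono) auto
  have s2: "summable (\<lambda>m. norm (a (m + N) * y ^ (m + N)))"
    by (rule summable_comparison_test'[OF summable_ignore_initial_segment[OF s, of N]]) (use le in simp)
  have "g - (\<Sum>m<N. a m * y ^ m) = (\<Sum>m. a (m + N) * y ^ (m + N))"
    using suminf_minus_initial_segment[OF sums_summable[OF g], of N] sums_unique[OF g] by simp
  also have "norm \<dots> \<le> (\<Sum>m. norm (a (m + N) * y ^ (m + N)))" by (rule summable_norm[OF s2])
  also have "\<dots> \<le> (\<Sum>m. norm (a (m + N)) * r ^ (m + N))"
    by (intro suminf_le le s2 summable_ignore_initial_segment[OF s])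
  also have "\<dots> = (\<Sum>m. norm (a m) * r ^ m) - (\<Sum>m<N. norm (a m) * r ^ m)"
    by (rule suminf_minus_initial_segment[OF s])
  also have "\<dots> \<le> (\<Sum>m. norm (a m) * r ^ m) - (\<Sum>m<n. norm (a m) * r ^ m)"
    using N r by (intro diff_left_mono sum_mono2) auto
  finally show ?thesis .
qed

text \<open>Subtract from the kernel its partial sum in modes. The difference solves the characteristic
  equation, and on \<open>w = 0\<close> and \<open>z = 0\<close> it is the remainder of the Taylor series, uniformly small on a
  closed disk. Stability of the Goursat problem carries the smallness to \<open>w = cnj z\<close>.\<close>

lemma hankel_kernel_expansion:
  assumes R: "R > 0" and z: "norm z < R"
  shows "((\<lambda>m. hankel_coeff c \<alpha> \<beta> R (nat \<bar>m\<bar>) * helmholtz_mode c m z) has_sum hankel_kernel c \<alpha> \<beta> R z (cnj z)) UNIV"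
proof (rule has_sum_int_eq_limit)
  define a where "a = hankel_coeff c \<alpha> \<beta> R"
  define r where "r = norm z"
  have r: "0 \<le> r" "r < R" using z by (auto simp: r_def)
  have s: "summable (\<lambda>m. norm (a m) * r ^ m)"
    unfolding a_def by (rule hankel_coeff_summable_norm[OF R r])
  have "(\<lambda>m::int. norm (a (nat \<bar>m\<bar>)) * r ^ nat \<bar>m\<bar> * exp (\<bar>c\<bar> * r\<^sup>2)) summable_on UNIV"
    by (intro summable_on_cmult_left summable_on_int_nat_abs[OF s]) (use r in auto)
  then have "(\<lambda>m. norm (a (nat \<bar>m\<bar>) * helmholtz_mode c m z)) summable_on UNIV"
  proof (rule Infinite_Sum.abs_summable_on_comparison_test')
    fix m
    have "norm (a (nat \<bar>m\<bar>)) * norm (helmholtz_mode c m z) \<le> norm (a (nat \<bar>m\<bar>)) * (r ^ nat \<bar>m\<bar> * exp (\<bar>c\<bar> * r\<^sup>2))"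
      unfolding r_def by (intro mult_left_mono helmholtz_mode_norm_le) auto
    then show "norm (a (nat \<bar>m\<bar>) * helmholtz_mode c m z) \<le> norm (a (nat \<bar>m\<bar>)) * r ^ nat \<bar>m\<bar> * exp (\<bar>c\<bar> * r\<^sup>2)"
      by (simp add: norm_mult mult.assoc)
  qed
  then show "(\<lambda>m. hankel_coeff c \<alpha> \<beta> R (nat \<bar>m\<bar>) * helmholtz_mode c m z) summable_on UNIV"
    unfolding a_def by (rule abs_summable_summable)
  define S where "S = (\<lambda>n z w. (\<Sum>m<n. (a m * fact m) * (z ^ m * bessel_clifford c m (z * w)))
      + (\<Sum>m<n. (a (Suc m) * fact (Suc m)) * (w ^ Suc m * bessel_clifford c (Suc m) (z * w))))"
  define tail where "tail = (\<lambda>n. (\<Sum>m. norm (a m) * r ^ m) - (\<Sum>m<n. norm (a m) * r ^ m))"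
  have pz: "norm (of_real p * y) \<le> norm y" if "p \<in> {0..1}" for p and y :: complex
    using that by (simp add: norm_mult mult_left_le_one_le)
  have bound: "norm (hankel_kernel c \<alpha> \<beta> R z (cnj z) - S (Suc n) z (cnj z)) \<le> 3 * tail (Suc n) * exp (norm (of_real c * z * cnj z))" for n
  proof (rule characteristic_solution_bound[where R = R and f = "\<lambda>z w. hankel_kernel c \<alpha> \<beta> R z w - S (Suc n) z w"])
    have "characteristic_solution c (ball 0 R) (\<lambda>z w. 1 * hankel_kernel c \<alpha> \<beta> R z w + (-1) * (1 * (\<Sum>m<Suc n. (a m * fact m) * (z ^ m * bessel_clifford c m (z * w)))
      + 1 * (\<Sum>m<Suc n. (a (Suc m) * fact (Suc m)) * (w ^ Suc m * bessel_clifford c (Suc m) (z * w)))))"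
      by (intro characteristic_solution_linear characteristic_solution_sum characteristic_solution_hankel_kernel
          characteristic_solution_power_left characteristic_solution_power_right)
    then show "characteristic_solution c (ball 0 R) (\<lambda>z w. hankel_kernel c \<alpha> \<beta> R z w - S (Suc n) z w)"
      by (simp only: S_def mult_1_left mult_minus1 add_uminus_conv_diff)
  next
    fix p :: real assume p: "p \<in> {0..1}"
    let ?y = "of_real p * z"
    have y: "norm ?y \<le> r" using pz[OF p, of z] by (simp add: r_def)
    then have y': "norm ?y < R" using r by simp
    have S0: "S (Suc n) ?y 0 = (\<Sum>m<Suc n. a m * ?y ^ m)"
      unfolding S_def by (simp only: mult_zero_right bessel_clifford_0 power_Suc mult_zero_left sum.neutral_const add_0_right)
        (intro sum.cong refl, simp)
    show "norm (hankel_kernel c \<alpha> \<beta> R ?y 0 - S (Suc n) ?y 0) \<le> tail (Suc n)"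
      unfolding S0 tail_def
      by (rule power_series_tail_bound[OF s y _ order_refl]) (use hankel_coeff_sums[OF R y'] in \<open>simp add: a_def\<close>)
  next
    fix q :: real assume q: "q \<in> {0..1}"
    let ?y = "of_real q * cnj z"
    have y: "norm ?y \<le> r" using pz[OF q, of "cnj z"] by (simp add: r_def)
    then have y': "norm ?y < R" using r by simp
    have S0: "S (Suc n) 0 ?y = (\<Sum>m<Suc (Suc n). a m * ?y ^ m)"
    proof -
      have "S (Suc n) 0 ?y = a 0 + (\<Sum>m<Suc n. a (Suc m) * ?y ^ Suc m)"
      proof -
        have "(\<Sum>m<Suc n. a m * fact m * (0 ^ m * (1 / fact m))) = a 0"
          by (subst sum.lessThan_Suc_shift) simp
        moreover have "(\<Sum>m<Suc n. a (Suc m) * fact (Suc m) * (?y ^ Suc m * (1 / fact (Suc m)))) = (\<Sum>m<Suc n. a (Suc m) * ?y ^ Suc m)"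
          by (intro sum.cong refl) (simp del: fact_Suc power_Suc)
        ultimately show ?thesis unfolding S_def mult_zero_left bessel_clifford_0 by (simp only: )
      qed
      also have "\<dots> = (\<Sum>m<Suc (Suc n). a m * ?y ^ m)" by (subst (2) sum.lessThan_Suc_shift) simp
      finally show ?thesis .
    qed
    have sym: "hankel_kernel c \<alpha> \<beta> R 0 ?y = hankel_kernel c \<alpha> \<beta> R ?y 0"
      by (simp add: hankel_kernel_def mult.commute add.commute)
    show "norm (hankel_kernel c \<alpha> \<beta> R 0 ?y - S (Suc n) 0 ?y) \<le> tail (Suc n)"
      unfolding S0 tail_def sym
      by (rule power_series_tail_bound[OF s y]) (use hankel_coeff_sums[OF R y'] in \<open>simp_all add: a_def\<close>)
  qed (use z in auto)
  have "tail \<longlonglongrightarrow> (\<Sum>m. norm (a m) * r ^ m) - (\<Sum>m. norm (a m) * r ^ m)"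
    unfolding tail_def by (intro tendsto_intros summable_LIMSEQ s)
  then have "(\<lambda>n. 3 * tail (Suc n) * exp (norm (of_real c * z * cnj z))) \<longlonglongrightarrow> 3 * 0 * exp (norm (of_real c * z * cnj z))"
    by (intro tendsto_intros LIMSEQ_Suc) simp
  then have t0: "(\<lambda>n. 3 * tail (Suc n) * exp (norm (of_real c * z * cnj z))) \<longlonglongrightarrow> 0"
    by simp
  have "(\<lambda>n. hankel_kernel c \<alpha> \<beta> R z (cnj z) - S (Suc n) z (cnj z)) \<longlonglongrightarrow> 0"
    by (rule Lim_null_comparison[OF _ t0]) (intro always_eventually allI bound)
  then have "(\<lambda>n. hankel_kernel c \<alpha> \<beta> R z (cnj z) - (hankel_kernel c \<alpha> \<beta> R z (cnj z) - S (Suc n) z (cnj z))) \<longlonglongrightarrow> hankel_kernel c \<alpha> \<beta> R z (cnj z) - 0"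
    by (intro tendsto_intros)
  then have "(\<lambda>n. S (Suc n) z (cnj z)) \<longlonglongrightarrow> hankel_kernel c \<alpha> \<beta> R z (cnj z)" by simp
  then have L: "(\<lambda>n. S n z (cnj z)) \<longlonglongrightarrow> hankel_kernel c \<alpha> \<beta> R z (cnj z)" by (rule LIMSEQ_imp_Suc)
  have "S n z (cnj z) = (\<Sum>m<n. hankel_coeff c \<alpha> \<beta> R (nat \<bar>int m\<bar>) * helmholtz_mode c (int m) z)
      + (\<Sum>m<n. hankel_coeff c \<alpha> \<beta> R (nat \<bar>- int (Suc m)\<bar>) * helmholtz_mode c (- int (Suc m)) z)" for n
  proof -
    have zz: "z * cnj z = of_real ((norm z)\<^sup>2)" by (rule complex_norm_square[symmetric])
    have e: "nat \<bar>- int (Suc m)\<bar> = Suc m" "(0 \<le> - int (Suc m)) = False" "nat \<bar>int m\<bar> = m" "(0 \<le> int m) = True" for m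
      by auto
    show ?thesis unfolding S_def a_def helmholtz_mode_def zz e if_True if_False
      by (simp only: mult_ac)
  qed
  then show "(\<lambda>n. (\<Sum>m<n. hankel_coeff c \<alpha> \<beta> R (nat \<bar>int m\<bar>) * helmholtz_mode c (int m) z)
      + (\<Sum>m<n. hankel_coeff c \<alpha> \<beta> R (nat \<bar>- int (Suc m)\<bar>) * helmholtz_mode c (- int (Suc m)) z))
      \<longlonglongrightarrow> hankel_kernel c \<alpha> \<beta> R z (cnj z)"
    using L by simp
qed

text \<open>The modes are functions of a complex variable, whereas the domain lies in \<open>real^2\<close>.\<close>

definition plane_complex :: "real^2 \<Rightarrow> complex"
  where "plane_complex x = Complex (x $ 1) (x $ 2)"

lemma plane_complex_norm: "norm (plane_complex x) = norm x"
  by (simp add: plane_complex_def norm_vec_def L2_set_def UNIV_2 complex_norm)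

lemma plane_complex_diff: "plane_complex (x - y) = plane_complex x - plane_complex y"
  by (simp add: plane_complex_def complex_eq_iff)

lemma helmholtz_mode_rotate:
  "helmholtz_mode c m (z * cis (- \<phi>)) = cis (- (of_int m * \<phi>)) * helmholtz_mode c m z"
proof (cases "m \<ge> 0")
  case True
  then have "real (nat \<bar>m\<bar>) * (- \<phi>) = - (of_int m * \<phi>)" by simp
  then have "cis (- \<phi>) ^ nat \<bar>m\<bar> = cis (- (of_int m * \<phi>))"
    unfolding Complex.DeMoivre by (rule arg_cong)
  then show ?thesis using True
    by (simp add: helmholtz_mode_def norm_mult power_mult_distrib)
next
  case False
  then have "real (nat \<bar>m\<bar>) * \<phi> = - (of_int m * \<phi>)" by simp
  then have "cis \<phi> ^ nat \<bar>m\<bar> = cis (- (of_int m * \<phi>))"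
    unfolding Complex.DeMoivre by (rule arg_cong)
  then show ?thesis using False
    by (simp add: helmholtz_mode_def norm_mult power_mult_distrib cis_cnj)
qed

definition hankel_alpha :: "real \<Rightarrow> complex"
  where "hankel_alpha k = \<i> / 4 - of_real ((ln (k / 2) + euler_mascheroni) / (2 * pi))"

definition hankel_beta :: complex
  where "hankel_beta = - of_real (1 / (4 * pi))"

text \<open>After a rotation the source lies on the real axis. Both sides are the same combination of the
  entire and the logarithmic solution, with \<open>ln\<close> of the squared distance written as twice \<open>ln\<close>
  of the distance.\<close>

lemma fundamental_solution_eq_hankel_kernel:
  assumes k: "k > 0" and y: "plane_complex y = of_real R * cis \<phi>" and R: "R > 0" and x: "norm x < R"
  defines "z \<equiv> plane_complex x * cis (- \<phi>)"
  shows "fundamental_solution k y x = hankel_kernel (k\<^sup>2 / 4) (hankel_alpha k) hankel_beta R z (cnj z)"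
proof -
  define v where "v = of_real R - z"
  define c where "c = k\<^sup>2 / 4"
  have nz: "norm z < R" using x by (simp add: z_def norm_mult plane_complex_norm)
  have v: "v \<notin> \<real>\<^sub>\<le>\<^sub>0" "v \<noteq> 0" unfolding v_def using notin_nonpos_Reals_ball[OF nz] by auto
  have "norm (y - x) = norm (plane_complex y - plane_complex x)"
    by (simp add: plane_complex_norm flip: plane_complex_diff)
  also have "\<dots> = norm ((plane_complex y - plane_complex x) * cis (- \<phi>))" by (simp add: norm_mult)
  also have "(plane_complex y - plane_complex x) * cis (- \<phi>) = v"
    unfolding y v_def z_def by (simp add: left_diff_distrib mult.assoc cis_mult)
  finally have n: "norm (y - x) = norm v" .
  define s where "s = (norm v)\<^sup>2"
  have vv: "(of_real R - z) * (of_real R - cnj z) = of_real s"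
    unfolding s_def complex_norm_square v_def by simp
  have vn: "norm v > 0" using v by simp
  have ln: "Ln (of_real R - z) + Ln (of_real R - cnj z) = of_real (2 * ln (norm v))"
  proof -
    have "Ln (of_real R - cnj z) = cnj (Ln v)"
      using cnj_Ln[OF v(1)] by (simp add: v_def)
    then have "Ln (of_real R - z) + Ln (of_real R - cnj z) = Ln v + cnj (Ln v)" by (simp add: v_def)
    also have "\<dots> = of_real (2 * Re (Ln v))" by (simp add: complex_add_cnj)
    finally show ?thesis using v by (simp add: Re_Ln)
  qed
  have arg: "(k * norm v)\<^sup>2 / 4 = c * s" by (simp add: c_def s_def power_mult_distrib)
  have J: "bessel_J0 (k * norm v) = bessel_clifford c 0 s"
    unfolding bessel_J0_def bessel_clifford_def arg
    by (intro suminf_cong) (simp add: power_mult_distrib power2_eq_square power_minus[of c])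
  have N: "neumann_series c (of_real s) = of_real (\<Sum>m. (-1) ^ m * harm m * (c * s) ^ m / (fact m)\<^sup>2)"
  proof -
    have e: "neumann_coeff c m * of_real s ^ m = of_real ((-1) ^ m * harm m * (c * s) ^ m / (fact m)\<^sup>2)" for m
    proof -
      have "neumann_coeff c m * of_real s ^ m = of_real ((-c) ^ m * harm m / (fact m)\<^sup>2 * s ^ m)"
        by (simp only: neumann_coeff_def of_real_mult of_real_power)
      also have "(-c) ^ m * harm m / (fact m)\<^sup>2 * s ^ m = (-1) ^ m * harm m * (c * s) ^ m / (fact m)\<^sup>2"
        by (simp add: power_mult_distrib power_minus[of c] mult_ac)
      finally show ?thesis .
    qed
    have "summable (\<lambda>m. neumann_coeff c m * of_real s ^ m)" by (rule neumann_series_summable)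
    then have "summable (\<lambda>m. (-1) ^ m * harm m * (c * s) ^ m / (fact m)\<^sup>2 :: real)"
      unfolding e by (simp only: summable_of_real_iff)
    then show ?thesis unfolding neumann_series_def e by (rule suminf_of_real[symmetric])
  qed
  define J0 N0 where "J0 = bessel_clifford c 0 s" and "N0 = (\<Sum>m. (-1) ^ m * harm m * (c * s) ^ m / (fact m)\<^sup>2)"
  have l: "ln (k * norm v / 2) = ln (k / 2) + ln (norm v)"
    using k vn by (simp add: ln_mult ln_div)
  have Y: "bessel_Y0 (k * norm v) = 2 / pi * ((ln (k / 2) + ln (norm v) + euler_mascheroni) * J0 - N0)"
    unfolding bessel_Y0_def arg J l J0_def N0_def ..
  have "hankel_kernel c (hankel_alpha k) hankel_beta R z (cnj z)
      = of_real J0 * (hankel_alpha k + hankel_beta * of_real (2 * ln (norm v))) - 2 * hankel_beta * of_real N0"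
    unfolding hankel_kernel_def vv ln N bessel_clifford_of_real J0_def N0_def ..
  also have "\<dots> = \<i> / 4 * (of_real J0 + \<i> * of_real (2 / pi * ((ln (k / 2) + ln (norm v) + euler_mascheroni) * J0 - N0)))"
    unfolding hankel_alpha_def hankel_beta_def
    by (simp add: complex_eq_iff field_simps)
  also have "\<dots> = fundamental_solution k y x"
    unfolding fundamental_solution_def n hankel_H0_def Y unfolding J J0_def by simp
  finally show ?thesis by (simp add: c_def)
qed

text \<open>The addition theorem for the Hankel function of order zero. The coefficients, classically Hankel
  functions of \<open>k * R\<close>, are here the Taylor coefficients of the kernel on \<open>w = 0\<close>.\<close>

theorem fundamental_solution_expansion:
  assumes k: "k > 0" and y: "plane_complex y = of_real R * cis \<phi>" and R: "R > 0" and x: "norm x < R"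
  shows "((\<lambda>m. hankel_coeff (k\<^sup>2 / 4) (hankel_alpha k) hankel_beta R (nat \<bar>m\<bar>) * cis (- (of_int m * \<phi>))
      * helmholtz_mode (k\<^sup>2 / 4) m (plane_complex x)) has_sum fundamental_solution k y x) UNIV"
proof -
  have "norm (plane_complex x * cis (- \<phi>)) < R" using x by (simp add: norm_mult plane_complex_norm)
  from hankel_kernel_expansion[OF R this, of "k\<^sup>2 / 4" "hankel_alpha k" hankel_beta]
  show ?thesis
    unfolding helmholtz_mode_rotate fundamental_solution_eq_hankel_kernel[OF k y R x] by (simp only: mult.assoc)
qed

section \<open>Duality for the regularized least squares problem\<close>

definition tikhonov :: "(nat \<Rightarrow> nat \<Rightarrow> complex) \<Rightarrow> nat \<Rightarrow> nat \<Rightarrow> (nat \<Rightarrow> complex) \<Rightarrow> real \<Rightarrow> (nat \<Rightarrow> complex) \<Rightarrow> real"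
  where "tikhonov A N M b \<alpha> a =
    (\<Sum>i<M. (norm ((\<Sum>j<N. a j * A j i) - b i))\<^sup>2) + \<alpha> * (\<Sum>j<N. (norm (a j))\<^sup>2)"

text \<open>The functional is continuous and coercive on a finite dimensional space.\<close>

lemma tikhonov_minimizer_exists:
  assumes \<alpha>: "\<alpha> > 0"
  shows "\<exists>a. is_arg_min (tikhonov A N M b \<alpha>) (\<lambda>a. \<forall>j\<ge>N. a j = 0) a"
proof -
  let ?T = "tikhonov A N M b \<alpha>"
  define r where "r = sqrt (?T (\<lambda>_. 0) / \<alpha>)"
  have T0: "?T (\<lambda>_. 0) \<ge> 0" using \<alpha> unfolding tikhonov_def by (intro add_nonneg_nonneg sum_nonneg mult_nonneg_nonneg) auto
  have r: "r \<ge> 0" "r\<^sup>2 = ?T (\<lambda>_. 0) / \<alpha>" using T0 \<alpha> by (auto simp: r_def)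
  define B where "B = PiE UNIV (\<lambda>j. if j < N then cball (0::complex) r else {0})"
  have "compactin (product_topology (\<lambda>i. euclidean) UNIV) B"
    unfolding B_def by (subst compactin_PiE) auto
  then have cB: "compact B" by (simp add: euclidean_product_topology)
  have B0: "(\<lambda>_. 0) \<in> B" using r by (auto simp: B_def)
  have cont: "continuous_on B ?T"
    unfolding tikhonov_def
    by (intro continuous_intros continuous_on_subset[OF continuous_on_product_coordinates]) auto
  obtain a where a: "a \<in> B" "\<And>y. y \<in> B \<Longrightarrow> ?T a \<le> ?T y"
    using continuous_attains_inf[OF cB _ cont] B0 by blast
  have "is_arg_min ?T (\<lambda>a. \<forall>j\<ge>N. a j = 0) a"
    unfolding is_arg_min_def
  proof (intro conjI allI impI notI)
    show "a j = 0" if "N \<le> j" for j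
      using a(1) that by (auto simp: B_def PiE_iff dest: spec[of _ j])
    assume "\<exists>y. (\<forall>j\<ge>N. y j = 0) \<and> ?T y < ?T a"
    then obtain y where y: "\<And>j. j \<ge> N \<Longrightarrow> y j = 0" "?T y < ?T a" by blast
    have "y \<in> B"
      unfolding B_def
    proof (rule PiE_I)
      fix j
      show "y j \<in> (if j < N then cball 0 r else {0})"
      proof (cases "j < N")
        case True
        have "\<alpha> * (norm (y j))\<^sup>2 \<le> \<alpha> * (\<Sum>j<N. (norm (y j))\<^sup>2)"
          using True \<alpha> by (intro mult_left_mono member_le_sum) auto
        also have "\<dots> \<le> ?T y" unfolding tikhonov_def by (simp add: sum_nonneg)
        also have "\<dots> \<le> ?T (\<lambda>_. 0)" using y(2) a(2)[OF B0] by simp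
        finally have "(norm (y j))\<^sup>2 \<le> r\<^sup>2" using \<alpha> unfolding r(2) by (simp add: field_simps)
        then have "norm (y j) \<le> r" using r(1) by (rule power2_le_imp_le)
        then show ?thesis using True by simp
      qed (use y(1) in auto)
    qed simp
    then show False using a(2)[of y] y(2) by simp
  qed
  then show ?thesis by blast
qed

text \<open>Perturbing coordinate \<open>k\<close> of the minimizer by a suitable multiple of the left hand side would decrease the
  functional, unless the left hand side vanishes.\<close>

lemma tikhonov_normal_equation:
  assumes \<alpha>: "\<alpha> > 0" and a: "is_arg_min (tikhonov A N M b \<alpha>) (\<lambda>a. \<forall>j\<ge>N. a j = 0) a" and k: "k < N"
  shows "(\<Sum>i<M. ((\<Sum>j<N. a j * A j i) - b i) * cnj (A k i)) + of_real \<alpha> * a k = 0"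
proof -
  let ?T = "tikhonov A N M b \<alpha>"
  define \<rho> where "\<rho> = (\<lambda>i. (\<Sum>j<N. a j * A j i) - b i)"
  define S where "S = (\<Sum>i<M. \<rho> i * cnj (A k i)) + of_real \<alpha> * a k"
  define Q where "Q = (\<Sum>i<M. (norm (A k i))\<^sup>2) + \<alpha>"
  have Q: "Q > 0" using \<alpha> unfolding Q_def by (intro add_nonneg_pos sum_nonneg) auto
  have nsq: "(norm (x + t * y))\<^sup>2 = (norm x)\<^sup>2 + 2 * Re (cnj t * (x * cnj y)) + (norm t)\<^sup>2 * (norm y)\<^sup>2" for x y t :: complex
    unfolding cmod_power2 by (simp add: power2_eq_square algebra_simps)
  have key: "?T (a(k := a k + t)) = ?T a + 2 * Re (cnj t * S) + (norm t)\<^sup>2 * Q" for t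
  proof -
    have 1: "(\<Sum>j<N. (a(k := a k + t)) j * A j i) - b i = \<rho> i + t * A k i" for i
    proof -
      have "(\<Sum>j<N. (a(k := a k + t)) j * A j i) = (\<Sum>j<N. a j * A j i + (if j = k then t * A k i else 0))"
        by (intro sum.cong) (auto simp: algebra_simps)
      then show ?thesis using k by (simp add: sum.distrib \<rho>_def)
    qed
    have 2: "(\<Sum>j<N. (norm ((a(k := a k + t)) j))\<^sup>2) = (\<Sum>j<N. (norm (a j))\<^sup>2) + (2 * Re (cnj t * a k) + (norm t)\<^sup>2)"
    proof -
      have "(\<Sum>j<N. (norm ((a(k := a k + t)) j))\<^sup>2) = (\<Sum>j<N. (norm (a j))\<^sup>2 + (if j = k then 2 * Re (cnj t * a k) + (norm t)\<^sup>2 else 0))"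
        by (intro sum.cong) (use nsq[of "a k" t 1] in auto)
      then show ?thesis using k by (simp add: sum.distrib)
    qed
    have "?T (a(k := a k + t)) = (\<Sum>i<M. (norm (\<rho> i))\<^sup>2 + 2 * Re (cnj t * (\<rho> i * cnj (A k i))) + (norm t)\<^sup>2 * (norm (A k i))\<^sup>2)
        + \<alpha> * ((\<Sum>j<N. (norm (a j))\<^sup>2) + (2 * Re (cnj t * a k) + (norm t)\<^sup>2))"
      unfolding tikhonov_def 1 2 nsq ..
    also have "(\<Sum>i<M. (norm (\<rho> i))\<^sup>2 + 2 * Re (cnj t * (\<rho> i * cnj (A k i))) + (norm t)\<^sup>2 * (norm (A k i))\<^sup>2)
        = (\<Sum>i<M. (norm (\<rho> i))\<^sup>2) + 2 * Re (cnj t * (\<Sum>i<M. \<rho> i * cnj (A k i))) + (norm t)\<^sup>2 * (\<Sum>i<M. (norm (A k i))\<^sup>2)"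
      by (simp only: sum.distrib sum_distrib_left[symmetric] Re_sum[symmetric])
    also have "(\<Sum>i<M. (norm (\<rho> i))\<^sup>2) + 2 * Re (cnj t * (\<Sum>i<M. \<rho> i * cnj (A k i))) + (norm t)\<^sup>2 * (\<Sum>i<M. (norm (A k i))\<^sup>2)
        + \<alpha> * ((\<Sum>j<N. (norm (a j))\<^sup>2) + (2 * Re (cnj t * a k) + (norm t)\<^sup>2))
        = ?T a + 2 * Re (cnj t * S) + (norm t)\<^sup>2 * Q"
    proof -
      have Ta: "?T a = (\<Sum>i<M. (norm (\<rho> i))\<^sup>2) + \<alpha> * (\<Sum>j<N. (norm (a j))\<^sup>2)"
        by (simp add: tikhonov_def \<rho>_def)
      show ?thesis
        unfolding Ta S_def Q_def distrib_left[of "cnj t"] by (simp add: algebra_simps)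
    qed
    finally show ?thesis .
  qed
  have ge: "?T a \<le> ?T (a(k := a k + t))" for t
    using a k unfolding is_arg_min_def by (metis fun_upd_apply leD linorder_le_less_linear)
  define t where "t = - of_real (1 / Q) * S"
  have "0 \<le> 2 * Re (cnj t * S) + (norm t)\<^sup>2 * Q" using ge[of t] key[of t] by simp
  also have "cnj t * S = - of_real ((norm S)\<^sup>2 / Q)"
  proof -
    have "cnj t * S = - of_real (1 / Q) * (S * cnj S)" by (simp add: t_def)
    also have "S * cnj S = of_real ((norm S)\<^sup>2)" by (rule complex_norm_square[symmetric])
    finally show ?thesis by simp
  qed
  also have "(norm t)\<^sup>2 = (norm S)\<^sup>2 / Q\<^sup>2"
    using Q by (simp add: t_def norm_mult power_mult_distrib power_divide norm_divide)
  also have "2 * Re (- of_real ((norm S)\<^sup>2 / Q)) + (norm S)\<^sup>2 / Q\<^sup>2 * Q = - ((norm S)\<^sup>2 / Q)"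
    using Q by (simp add: power2_eq_square field_simps)
  finally have "(norm S)\<^sup>2 / Q \<le> 0" by simp
  then have "S = 0" using Q by (simp add: divide_le_0_iff)
  then show ?thesis by (simp add: S_def \<rho>_def)
qed

text \<open>In matrix form this is the identity of \<open>V' * inverse (V * V' + \<alpha> * I)\<close> with
  \<open>inverse (V' * V + \<alpha> * I) * V'\<close>, where \<open>V'\<close> is the adjoint of \<open>V\<close>. The proof avoids inverses by pairing the
  normal equation of either problem with the solution of the other.\<close>

lemma tikhonov_duality:
  assumes \<alpha>: "\<alpha> > 0"
    and a: "is_arg_min (tikhonov A N M b \<alpha>) (\<lambda>a. \<forall>j\<ge>N. a j = 0) a"
    and c: "is_arg_min (tikhonov (\<lambda>i j. A j i) M N f \<alpha>) (\<lambda>c. \<forall>i\<ge>M. c i = 0) c"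
  shows "(\<Sum>j<N. a j * f j) = (\<Sum>i<M. c i * b i)"
proof -
  define \<rho> where "\<rho> = (\<lambda>i. (\<Sum>j<N. a j * A j i) - b i)"
  define e where "e = (\<lambda>j. (\<Sum>i<M. c i * A j i) - f j)"
  have ea: "of_real \<alpha> * a j = - (\<Sum>i<M. \<rho> i * cnj (A j i))" if "j < N" for j
    using tikhonov_normal_equation[OF \<alpha> a that] unfolding \<rho>_def by (simp add: add_eq_0_iff)
  have ec: "of_real \<alpha> * c i = - (\<Sum>j<N. e j * cnj (A j i))" if "i < M" for i
    using tikhonov_normal_equation[OF \<alpha> c that] unfolding e_def by (simp add: add_eq_0_iff)
  have "of_real \<alpha> * (\<Sum>j<N. a j * e j) = (\<Sum>j<N. (of_real \<alpha> * a j) * e j)"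
    by (simp add: sum_distrib_left mult.assoc)
  also have "\<dots> = (\<Sum>j<N. (- (\<Sum>i<M. \<rho> i * cnj (A j i))) * e j)" by (intro sum.cong) (simp_all add: ea)
  also have "\<dots> = (\<Sum>j<N. \<Sum>i<M. - (\<rho> i * cnj (A j i) * e j))"
    by (simp add: sum_distrib_right sum_negf)
  also have "\<dots> = (\<Sum>i<M. \<Sum>j<N. - (\<rho> i * cnj (A j i) * e j))" by (rule sum.swap)
  also have "\<dots> = (\<Sum>i<M. \<rho> i * (- (\<Sum>j<N. e j * cnj (A j i))))"
    by (intro sum.cong refl) (simp add: sum_distrib_left sum_negf mult_ac)
  also have "\<dots> = (\<Sum>i<M. \<rho> i * (of_real \<alpha> * c i))" by (intro sum.cong) (simp_all add: ec)
  also have "\<dots> = of_real \<alpha> * (\<Sum>i<M. \<rho> i * c i)" by (simp add: sum_distrib_left mult_ac)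
  finally have eq: "(\<Sum>j<N. a j * e j) = (\<Sum>i<M. \<rho> i * c i)" using \<alpha> by simp
  have 1: "(\<Sum>j<N. a j * e j) = (\<Sum>j<N. \<Sum>i<M. a j * c i * A j i) - (\<Sum>j<N. a j * f j)"
    by (simp add: e_def right_diff_distrib sum_subtractf sum_distrib_left mult.assoc)
  have 2: "(\<Sum>i<M. \<rho> i * c i) = (\<Sum>i<M. \<Sum>j<N. a j * c i * A j i) - (\<Sum>i<M. c i * b i)"
  proof -
    have "\<rho> i * c i = (\<Sum>j<N. a j * c i * A j i) - c i * b i" for i
      unfolding \<rho>_def left_diff_distrib sum_distrib_right by (simp add: mult_ac)
    then show ?thesis by (simp add: sum_subtractf)
  qed
  have "(\<Sum>j<N. \<Sum>i<M. a j * c i * A j i) = (\<Sum>i<M. \<Sum>j<N. a j * c i * A j i)" by (rule sum.swap)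
  with eq 1 2 show ?thesis by simp
qed

text \<open>The weights depend on the point \<open>p\<close>, the dual coefficients \<open>c\<close> do not: one regularized fit of the data by
  sources serves all points at once.\<close>

lemma numerical_solution_dual:
  assumes \<alpha>: "\<alpha> > 0"
  shows "\<exists>c. (\<forall>p. numerical_solution k M N y x \<alpha> f p = (\<Sum>i<M. c i * fundamental_solution k (y i) p)) \<and>
    (\<forall>c'. (\<Sum>j<N. (norm ((\<Sum>i<M. c i * fundamental_solution k (y i) (x j)) - f (x j)))\<^sup>2) + \<alpha> * (\<Sum>i<M. (norm (c i))\<^sup>2)
       \<le> (\<Sum>j<N. (norm ((\<Sum>i<M. c' i * fundamental_solution k (y i) (x j)) - f (x j)))\<^sup>2) + \<alpha> * (\<Sum>i<M. (norm (c' i))\<^sup>2))"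
proof -
  define A where "A = (\<lambda>j i. fundamental_solution k (y i) (x j))"
  obtain c where c: "is_arg_min (tikhonov (\<lambda>i j. A j i) M N (\<lambda>j. f (x j)) \<alpha>) (\<lambda>c. \<forall>i\<ge>M. c i = 0) c"
    using tikhonov_minimizer_exists[OF \<alpha>] by blast
  have n: "numerical_solution k M N y x \<alpha> f p = (\<Sum>i<M. c i * fundamental_solution k (y i) p)" for p
  proof -
    have t: "tikhonov_functional k M N y x \<alpha> p = tikhonov A N M (\<lambda>i. fundamental_solution k (y i) p) \<alpha>"
      by (auto simp: fun_eq_iff tikhonov_functional_def tikhonov_def A_def)
    have "is_arg_min (tikhonov A N M (\<lambda>i. fundamental_solution k (y i) p) \<alpha>) (\<lambda>a. \<forall>j\<ge>N. a j = 0)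
        (learning_weights k M N y x \<alpha> p)"
      unfolding learning_weights_def t arg_min_def by (rule someI_ex[OF tikhonov_minimizer_exists[OF \<alpha>]])
    from tikhonov_duality[OF \<alpha> this c] show ?thesis by (simp add: numerical_solution_def)
  qed
  have m: "tikhonov (\<lambda>i j. A j i) M N (\<lambda>j. f (x j)) \<alpha> c \<le> tikhonov (\<lambda>i j. A j i) M N (\<lambda>j. f (x j)) \<alpha> c'" for c'
  proof -
    define c'' where "c'' = (\<lambda>i. if i < M then c' i else 0)"
    have "tikhonov (\<lambda>i j. A j i) M N (\<lambda>j. f (x j)) \<alpha> c'' = tikhonov (\<lambda>i j. A j i) M N (\<lambda>j. f (x j)) \<alpha> c'"
      by (simp add: tikhonov_def c''_def)
    moreover have "\<forall>i\<ge>M. c'' i = 0" by (simp add: c''_def)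
    ultimately show ?thesis using c unfolding is_arg_min_def by (metis linorder_not_less)
  qed
  show ?thesis using n m unfolding tikhonov_def A_def by blast
qed

section \<open>Polar coordinates\<close>

definition plane_of_complex :: "complex \<Rightarrow> real^2"
  where "plane_of_complex z = vector [Re z, Im z]"

lemma plane_of_complex_inverse [simp]: "plane_complex (plane_of_complex z) = z"
  by (simp add: plane_complex_def plane_of_complex_def)

lemma plane_complex_inverse [simp]: "plane_of_complex (plane_complex x) = x"
  by (simp add: plane_complex_def plane_of_complex_def vec_eq_iff forall_2)

lemma plane_of_complex_norm [simp]: "norm (plane_of_complex z) = norm z"
  using plane_complex_norm[of "plane_of_complex z"] by simp

lemma continuous_on_plane_complex [continuous_intros]:
  "continuous_on S f \<Longrightarrow> continuous_on S (\<lambda>x. plane_complex (f x))"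
  unfolding plane_complex_def Complex_eq by (intro continuous_intros)

lemma plane_of_complex_eq: "plane_of_complex z = Re z *\<^sub>R axis 1 1 + Im z *\<^sub>R axis 2 1"
  by (simp add: plane_of_complex_def vec_eq_iff forall_2 axis_def)

lemma continuous_on_plane_of_complex [continuous_intros]:
  "continuous_on S f \<Longrightarrow> continuous_on S (\<lambda>x. plane_of_complex (f x))"
  unfolding plane_of_complex_eq by (intro continuous_intros)

definition plane_rotation :: "real \<Rightarrow> real^2 \<Rightarrow> real^2"
  where "plane_rotation \<theta> x = plane_of_complex (cis \<theta> * plane_complex x)"

lemma plane_rotation_norm [simp]: "norm (plane_rotation \<theta> x) = norm x"
  by (simp add: plane_rotation_def norm_mult plane_complex_norm)

lemma plane_rotation_inverse: "plane_rotation (- \<theta>) (plane_rotation \<theta> x) = x" "plane_rotation \<theta> (plane_rotation (- \<theta>) x) = x"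
  by (simp_all add: plane_rotation_def mult.assoc[symmetric] cis_mult)

lemma orthogonal_plane_rotation: "orthogonal_transformation (plane_rotation \<theta>)"
proof -
  have "linear (plane_rotation \<theta>)"
    by (rule linearI) (simp_all add: plane_rotation_def plane_of_complex_def plane_complex_def vec_eq_iff forall_2 algebra_simps)
  then show ?thesis by (simp add: orthogonal_transformation)
qed

text \<open>Orthogonal maps preserve Lebesgue measure.\<close>

lemma distr_plane_rotation: "distr lborel borel (plane_rotation \<theta>) = lborel"
proof (rule lborel_eqI[symmetric])
  have m: "plane_rotation \<theta> \<in> borel_measurable borel"
    unfolding plane_rotation_def by (intro borel_measurable_continuous_onI continuous_intros)
  fix l u :: "real^2" assume lu: "\<And>b. b \<in> Basis \<Longrightarrow> l \<bullet> b \<le> u \<bullet> b"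
  have v: "plane_rotation \<theta> -` box l u = plane_rotation (- \<theta>) ` box l u"
    using plane_rotation_inverse by (auto simp: image_iff) metis+
  have B: "plane_rotation \<theta> -` box l u \<in> sets borel"
    using measurable_sets[OF m, of "box l u"] by simp
  have "emeasure (distr lborel borel (plane_rotation \<theta>)) (box l u) = emeasure lborel (plane_rotation \<theta> -` box l u)"
    using m by (subst emeasure_distr) auto
  also have "\<dots> = emeasure lebesgue (plane_rotation (- \<theta>) ` box l u)"
    using B unfolding v by simp
  also have "\<dots> = measure lebesgue (plane_rotation (- \<theta>) ` box l u)"
    by (rule emeasure_eq_measure2, rule measurable_orthogonal_image[OF orthogonal_plane_rotation]) simp
  also have "measure lebesgue (plane_rotation (- \<theta>) ` box l u) = measure lebesgue (box l u)"
    by (rule measure_orthogonal_image[OF orthogonal_plane_rotation]) simp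
  also have "ennreal \<dots> = emeasure lborel (box l u)"
    by (subst emeasure_eq_measure2[symmetric]) auto
  also have "\<dots> = (\<Prod>b\<in>Basis. (u - l) \<bullet> b)"
    using lu by (subst emeasure_lborel_box) auto
  finally show "emeasure (distr lborel borel (plane_rotation \<theta>)) (box l u) = (\<Prod>b\<in>Basis. (u - l) \<bullet> b)" .
qed simp

lemma integral_plane_rotation:
  fixes g :: "real^2 \<Rightarrow> 'b::{banach, second_countable_topology}"
  assumes "g \<in> borel_measurable borel"
  shows "(\<integral>x. g (plane_rotation \<theta> x) \<partial>lborel) = (\<integral>x. g x \<partial>lborel)"
proof -
  have m: "plane_rotation \<theta> \<in> borel_measurable borel"
    unfolding plane_rotation_def by (intro borel_measurable_continuous_onI continuous_intros)
  have "(\<integral>x. g x \<partial>lborel) = (\<integral>x. g x \<partial>distr lborel borel (plane_rotation \<theta>))"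
    by (simp only: distr_plane_rotation)
  also have "\<dots> = (\<integral>x. g (plane_rotation \<theta> x) \<partial>lborel)"
    using m assms by (subst integral_distr) auto
  finally show ?thesis ..
qed

lemma emeasure_cball_plane:
  assumes "r \<ge> 0"
  shows "emeasure lborel (cball (0::real^2) r) = ennreal (pi * r\<^sup>2)"
proof -
  have "emeasure lborel (cball (0::real^2) r) = ennreal (unit_ball_vol (real DIM(real^2)) * r ^ DIM(real^2))"
    using assms by (rule emeasure_cball)
  then show ?thesis by (simp add: unit_ball_vol_2)
qed

text \<open>The image of Lebesgue measure under \<open>x \<mapsto> \<bar>x\<bar>\<^sup>2\<close> is \<open>pi\<close> times Lebesgue measure on the half line, by
  the area of a disk.\<close>

lemma integral_radial:
  fixes F :: "real \<Rightarrow> 'b::{banach, second_countable_topology}"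
  assumes r: "r \<ge> 0" and F: "F \<in> borel_measurable borel"
  shows "(\<integral>x. indicator (cball (0::real^2) r) x *\<^sub>R F ((norm x)\<^sup>2) \<partial>lborel)
       = pi *\<^sub>R (\<integral>s. indicator {0..r\<^sup>2} s *\<^sub>R F s \<partial>lborel)"
proof -
  let ?M = "distr (restrict_space lborel (cball (0::real^2) r)) borel (\<lambda>x. (norm x)\<^sup>2)"
  let ?N = "density lborel (\<lambda>s. ennreal pi * indicator {0..r\<^sup>2} s)"
  have m: "(\<lambda>x::real^2. (norm x)\<^sup>2) \<in> borel_measurable (restrict_space lborel (cball 0 r))"
    by (intro measurable_restrict_space1) simp
  have "?M = ?N"
  proof (rule measure_eqI_lessThan)
    have M: "emeasure ?M {t<..} = ennreal (if t < 0 then pi * r\<^sup>2 else if t \<le> r\<^sup>2 then pi * (r\<^sup>2 - t) else 0)" for t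
    proof -
      have "emeasure ?M {t<..} = emeasure lborel {x \<in> cball (0::real^2) r. t < (norm x)\<^sup>2}"
        by (subst emeasure_distr[OF m]) (auto simp: space_restrict_space emeasure_restrict_space intro!: arg_cong[where f = "emeasure lborel"])
      also have "\<dots> = ennreal (if t < 0 then pi * r\<^sup>2 else if t \<le> r\<^sup>2 then pi * (r\<^sup>2 - t) else 0)"
      proof (cases "t < 0")
        case True
        then have "{x \<in> cball (0::real^2) r. t < (norm x)\<^sup>2} = cball 0 r"
          by (auto intro: less_le_trans)
        then show ?thesis using True r by (simp add: emeasure_cball_plane)
      next
        case False
        have e: "{x \<in> cball (0::real^2) r. t < (norm x)\<^sup>2} = cball 0 r - cball 0 (sqrt t)"
          using False by (auto simp: real_less_rsqrt not_le dest: real_sqrt_less_mono) (metis abs_norm_cancel linorder_not_less real_le_rsqrt real_sqrt_abs real_sqrt_le_iff)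
        show ?thesis
        proof (cases "t \<le> r\<^sup>2")
          case True
          then have "sqrt t \<le> r" using r by (metis real_sqrt_le_iff real_sqrt_abs abs_of_nonneg)
          then have "emeasure lborel (cball (0::real^2) r - cball 0 (sqrt t)) = emeasure lborel (cball (0::real^2) r) - emeasure lborel (cball (0::real^2) (sqrt t))"
          proof (intro emeasure_Diff)
            have "emeasure lborel (cball (0::real^2) (sqrt t)) = ennreal (pi * (sqrt t)\<^sup>2)"
              using False by (intro emeasure_cball_plane) auto
            then show "emeasure lborel (cball (0::real^2) (sqrt t)) \<noteq> \<infinity>" by simp
          qed auto
          also have "\<dots> = ennreal (pi * r\<^sup>2) - ennreal (pi * t)"
            using False r by (simp add: emeasure_cball_plane)
          also have "\<dots> = ennreal (pi * (r\<^sup>2 - t))"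
            using False by (subst ennreal_minus) (auto simp: algebra_simps)
          finally show ?thesis using True False e by simp
        next
          case t: False
          then have "r \<le> sqrt t" using r by (metis abs_of_nonneg less_imp_le not_le real_sqrt_abs real_sqrt_less_mono)
          then have d: "cball (0::real^2) r - cball 0 (sqrt t) = {}" by auto
          show ?thesis using t False unfolding e d by simp
        qed
      qed
      finally show ?thesis .
    qed
    show "emeasure ?M {t<..} < \<infinity>" for t unfolding M by simp
    show "emeasure ?M {t<..} = emeasure ?N {t<..}" for t
    proof -
      have "emeasure ?N {t<..} = (\<integral>\<^sup>+s. ennreal pi * indicator ({0..r\<^sup>2} \<inter> {t<..}) s \<partial>lborel)"
        by (subst emeasure_density) (auto intro!: nn_integral_cong simp: indicator_def)
      also have "\<dots> = ennreal pi * emeasure lborel ({0..r\<^sup>2} \<inter> {t<..})"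
        by (subst nn_integral_cmult_indicator) auto
      also have "emeasure lborel ({0..r\<^sup>2} \<inter> {t<..}) = ennreal (if t < 0 then r\<^sup>2 else if t \<le> r\<^sup>2 then r\<^sup>2 - t else 0)"
      proof -
        consider "t < 0" | "0 \<le> t" "t \<le> r\<^sup>2" | "0 \<le> t" "r\<^sup>2 < t" by linarith
        then show ?thesis
        proof cases
          case 1
          then have "{0..r\<^sup>2} \<inter> {t<..} = {0..r\<^sup>2}" by auto
          then show ?thesis using 1 by simp
        next
          case 2
          then have "{0..r\<^sup>2} \<inter> {t<..} = {t<..r\<^sup>2}" by auto
          then show ?thesis using 2 by simp
        next
          case 3
          then have "{0..r\<^sup>2} \<inter> {t<..} = {}" by auto
          then show ?thesis using 3 by simp
        qed
      qed
      finally show ?thesis unfolding M by (auto simp: ennreal_mult[symmetric] split: if_splits)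
    qed
  qed auto
  have "(\<integral>x. indicator (cball (0::real^2) r) x *\<^sub>R F ((norm x)\<^sup>2) \<partial>lborel) = (\<integral>x. F ((norm x)\<^sup>2) \<partial>restrict_space lborel (cball (0::real^2) r))"
    by (subst integral_restrict_space) auto
  also have "\<dots> = (\<integral>s. F s \<partial>?M)" using F by (subst integral_distr[OF m]) auto
  also have "\<dots> = (\<integral>s. F s \<partial>density lborel (\<lambda>s. ennreal (pi * indicator {0..r\<^sup>2} s)))"
    unfolding \<open>?M = ?N\<close> by (intro arg_cong2[where f = "integral\<^sup>L"] density_cong refl) (auto simp: indicator_def)
  also have "\<dots> = (\<integral>s. (pi * indicator {0..r\<^sup>2} s) *\<^sub>R F s \<partial>lborel)"
    using F by (subst integral_density) auto
  also have "\<dots> = pi *\<^sub>R (\<integral>s. indicator {0..r\<^sup>2} s *\<^sub>R F s \<partial>lborel)"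
    by (simp flip: scaleR_scaleR)
  finally show ?thesis .
qed

lemma integral_periodic_shift:
  fixes h :: "real \<Rightarrow> 'b::euclidean_space"
  assumes h: "continuous_on UNIV h" and per: "\<And>\<theta>. h (\<theta> + 2 * pi) = h \<theta>" and a: "0 \<le> a" "a \<le> 2 * pi"
  shows "integral {0..2*pi} (\<lambda>\<theta>. h (a + \<theta>)) = integral {0..2*pi} h"
proof -
  have i: "h integrable_on {x..y}" for x y
    using h by (intro integrable_continuous_real continuous_on_subset[OF h]) auto
  have "integral {0..2*pi} (\<lambda>\<theta>. h (a + \<theta>)) = integral {a..2*pi + a} h"
    using integral_shift_Icc_real[of 0 "2*pi" h a] by (simp add: o_def)
  also have "\<dots> = integral {a..2*pi} h + integral {2*pi..2*pi + a} h"
    using a by (intro Henstock_Kurzweil_Integration.integral_combine[symmetric] i) auto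
  also have "integral {2*pi..2*pi + a} h = integral {0..a} (h \<circ> (+) (2*pi))"
    using integral_shift_Icc_real[of 0 a h "2*pi"] by (simp add: add.commute)
  also have "h \<circ> (+) (2*pi) = h" using per by (auto simp: fun_eq_iff add.commute)
  also have "integral {a..2*pi} h + integral {0..a} h = integral {0..2*pi} h"
    using a by (subst add.commute) (intro Henstock_Kurzweil_Integration.integral_combine i, auto)
  finally show ?thesis .
qed

text \<open>The parameter is the square of the radius, in which the radial measure is constant.\<close>

definition circle_point :: "real \<Rightarrow> real \<Rightarrow> real^2"
  where "circle_point s \<theta> = plane_of_complex (of_real (sqrt s) * cis \<theta>)"

lemma circle_point_norm: "s \<ge> 0 \<Longrightarrow> norm (circle_point s \<theta>) = sqrt s"
  by (simp add: circle_point_def norm_mult)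

lemma continuous_on_circle_point [continuous_intros]:
  "continuous_on S f \<Longrightarrow> continuous_on S g \<Longrightarrow> continuous_on S (\<lambda>x. circle_point (f x) (g x))"
  unfolding circle_point_def by (intro continuous_intros)

lemma continuous_on_circle_average:
  fixes f :: "real^2 \<Rightarrow> complex"
  assumes f: "continuous_on (cball 0 r) f" and r: "r \<ge> 0"
  shows "continuous_on {0..r\<^sup>2} (\<lambda>s. integral {0..2*pi} (\<lambda>\<theta>. f (circle_point s \<theta>)))"
proof -
  have "continuous_on {0..r\<^sup>2} (\<lambda>s. integral (cbox 0 (2*pi)) (\<lambda>\<theta>. f (circle_point s \<theta>)))"
  proof (rule integral_continuous_on_param)
    have "continuous_on ({0..r\<^sup>2} \<times> cbox 0 (2*pi)) (\<lambda>p. f (circle_point (fst p) (snd p)))"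
    proof (rule continuous_on_compose2[OF f])
      show "continuous_on ({0..r\<^sup>2} \<times> cbox 0 (2*pi)) (\<lambda>p. circle_point (fst p) (snd p))"
        by (intro continuous_intros)
      show "(\<lambda>p. circle_point (fst p) (snd p)) ` ({0..r\<^sup>2} \<times> cbox 0 (2*pi)) \<subseteq> cball 0 r"
        using r by (auto simp: circle_point_norm real_le_lsqrt)
    qed
    then show "continuous_on ({0..r\<^sup>2} \<times> cbox 0 (2*pi)) (\<lambda>(s, \<theta>). f (circle_point s \<theta>))"
      by (simp add: split_def)
  qed
  then show ?thesis by simp
qed

text \<open>Averaging the integral over all rotations replaces the integrand by its circular averages, a
  radial function.\<close>

theorem integral_polar:
  fixes f :: "real^2 \<Rightarrow> complex"
  assumes f: "continuous_on (cball 0 r) f" and r: "r \<ge> 0"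
  shows "(\<integral>x. indicator (cball 0 r) x *\<^sub>R f x \<partial>lborel)
     = integral {0..r\<^sup>2} (\<lambda>s. integral {0..2*pi} (\<lambda>\<theta>. f (circle_point s \<theta>))) / 2"
proof -
  let ?g = "\<lambda>x. indicator (cball 0 r) x *\<^sub>R f x"
  have gm [measurable]: "?g \<in> borel_measurable borel"
    using f by (intro borel_measurable_continuous_on_indicator) auto
  obtain B where "\<forall>y\<in>f ` cball 0 r. norm y \<le> B"
    using compact_imp_bounded[OF compact_continuous_image[OF f compact_cball]] unfolding bounded_iff by blast
  then have B: "norm (f x) \<le> B" if "x \<in> cball 0 r" for x using that by blast
  have B0: "B \<ge> 0" using B[of 0] norm_ge_zero[of "f 0"] r by (simp del: norm_ge_zero)
  define Fc where "Fc = (\<lambda>s. integral {0..2*pi} (\<lambda>\<theta>. f (circle_point s \<theta>)))"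
  have Fcont: "continuous_on {0..r\<^sup>2} Fc"
    unfolding Fc_def by (rule continuous_on_circle_average[OF f r])
  have rotm: "(\<lambda>p. plane_rotation (fst p) (snd p)) \<in> borel_measurable (borel \<Otimes>\<^sub>M borel)"
    unfolding borel_prod plane_rotation_def by (intro borel_measurable_continuous_onI continuous_intros)
  have int: "integrable (lborel \<Otimes>\<^sub>M lborel) (\<lambda>(\<theta>, x). indicator {0..2*pi} \<theta> *\<^sub>R ?g (plane_rotation \<theta> x))"
  proof (rule integrableI_bounded_set[where A = "{0..2*pi} \<times> cball 0 r" and B = B])
    show "{0..2*pi} \<times> cball 0 r \<in> sets (lborel \<Otimes>\<^sub>M lborel)" by simp
    show "(\<lambda>(\<theta>, x). indicator {0..2*pi} \<theta> *\<^sub>R ?g (plane_rotation \<theta> x)) \<in> borel_measurable (lborel \<Otimes>\<^sub>M lborel)"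
    proof -
      have g: "(\<lambda>p. ?g (plane_rotation (fst p) (snd p))) \<in> borel_measurable (lborel \<Otimes>\<^sub>M lborel)"
        using measurable_compose[OF rotm gm] by (simp cong: measurable_cong_sets)
      have i: "(\<lambda>p. indicator {0..2*pi} (fst p) :: real) \<in> borel_measurable (lborel \<Otimes>\<^sub>M (lborel :: (real^2) measure))"
        by measurable
      show ?thesis unfolding split_def by (rule borel_measurable_scaleR[OF i g])
    qed
    show "emeasure (lborel \<Otimes>\<^sub>M lborel) ({0..2*pi} \<times> cball (0::real^2) r) < \<infinity>"
      by (subst lborel.emeasure_pair_measure_Times) (auto simp: ennreal_mult_less_top emeasure_cball_plane r)
    show "AE p in lborel \<Otimes>\<^sub>M lborel. p \<in> {0..2*pi} \<times> cball 0 r \<longrightarrow>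
        norm ((\<lambda>(\<theta>, x). indicator {0..2*pi} \<theta> *\<^sub>R ?g (plane_rotation \<theta> x)) p) \<le> B"
      using B B0 by (intro AE_I2) (auto simp: indicator_def)
    show "AE p in lborel \<Otimes>\<^sub>M lborel. p \<notin> {0..2*pi} \<times> cball 0 r \<longrightarrow>
        (\<lambda>(\<theta>, x). indicator {0..2*pi} \<theta> *\<^sub>R ?g (plane_rotation \<theta> x)) p = 0"
      by (intro AE_I2) (auto simp: indicator_def)
  qed
  have inner: "(\<integral>\<theta>. indicator {0..2*pi} \<theta> *\<^sub>R ?g (plane_rotation \<theta> x) \<partial>lborel) = indicator (cball 0 r) x *\<^sub>R Fc ((norm x)\<^sup>2)" for x
  proof (cases "x \<in> cball 0 r")
    case True
    have rc: "continuous_on UNIV (\<lambda>\<theta>. f (plane_rotation \<theta> x))"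
      by (rule continuous_on_compose2[OF f]) (use True in \<open>auto simp: plane_rotation_def norm_mult plane_complex_norm intro!: continuous_intros\<close>)
    have "(\<integral>\<theta>. indicator {0..2*pi} \<theta> *\<^sub>R ?g (plane_rotation \<theta> x) \<partial>lborel) = (LINT \<theta>:{0..2*pi}|lborel. f (plane_rotation \<theta> x))"
      unfolding set_lebesgue_integral_def using True by (intro Bochner_Integration.integral_cong) (auto simp: indicator_def)
    also have "\<dots> = integral {0..2*pi} (\<lambda>\<theta>. f (plane_rotation \<theta> x))"
      by (intro set_borel_integral_eq_integral borel_integrable_atLeastAtMost' continuous_on_subset[OF rc]) auto
    also have "\<dots> = Fc ((norm x)\<^sup>2)"
    proof -
      define a where "a = Arg2pi (plane_complex x)"
      have a: "0 \<le> a" "a \<le> 2 * pi" using Arg2pi[of "plane_complex x"] by (auto simp: a_def)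
      have "plane_complex x = of_real (norm x) * cis a"
        using Arg2pi[of "plane_complex x"] unfolding is_Arg_def plane_complex_norm a_def cis_conv_exp by blast
      then have rot: "plane_rotation \<theta> x = circle_point ((norm x)\<^sup>2) (a + \<theta>)" for \<theta>
        unfolding plane_rotation_def circle_point_def by (simp add: cis_mult[symmetric] mult_ac)
      have hc: "continuous_on UNIV (\<lambda>\<theta>. f (circle_point ((norm x)\<^sup>2) \<theta>))"
        by (rule continuous_on_compose2[OF f]) (use True in \<open>auto simp: circle_point_norm intro!: continuous_intros\<close>)
      have per: "f (circle_point ((norm x)\<^sup>2) (\<theta> + 2 * pi)) = f (circle_point ((norm x)\<^sup>2) \<theta>)" for \<theta>
        by (simp add: circle_point_def cis.code)
      show ?thesis
        unfolding rot Fc_def by (rule integral_periodic_shift[OF hc per a])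
    qed
    finally show ?thesis using True by simp
  qed (auto simp: indicator_def)
  have "(2 * pi) *\<^sub>R (\<integral>x. ?g x \<partial>lborel) = (\<integral>\<theta>. indicator {0..2*pi} \<theta> *\<^sub>R (\<integral>x. ?g x \<partial>lborel) \<partial>lborel)"
    by simp
  also have "\<dots> = (\<integral>\<theta>. (\<integral>x. indicator {0..2*pi} \<theta> *\<^sub>R ?g (plane_rotation \<theta> x) \<partial>lborel) \<partial>lborel)"
  proof -
    have "(\<integral>x. indicator {0..2*pi} \<theta> *\<^sub>R ?g (plane_rotation \<theta> x) \<partial>lborel) = indicator {0..2*pi} \<theta> *\<^sub>R (\<integral>x. ?g x \<partial>lborel)" for \<theta>
      using integral_plane_rotation[OF gm, of \<theta>] by (simp only: integral_scaleR_right)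
    then show ?thesis by (simp only: )
  qed
  also have "\<dots> = (\<integral>x. (\<integral>\<theta>. indicator {0..2*pi} \<theta> *\<^sub>R ?g (plane_rotation \<theta> x) \<partial>lborel) \<partial>lborel)"
    by (rule lborel_pair.Fubini_integral[OF int, symmetric])
  also have "\<dots> = (\<integral>x. indicator (cball (0::real^2) r) x *\<^sub>R Fc ((norm x)\<^sup>2) \<partial>lborel)"
    unfolding inner ..
  also have "\<dots> = (\<integral>x. indicator (cball (0::real^2) r) x *\<^sub>R (indicator {0..r\<^sup>2} ((norm x)\<^sup>2) *\<^sub>R Fc ((norm x)\<^sup>2)) \<partial>lborel)"
    by (intro Bochner_Integration.integral_cong) (auto simp: indicator_def power_mono)
  also have "\<dots> = pi *\<^sub>R (\<integral>s. indicator {0..r\<^sup>2} s *\<^sub>R (indicator {0..r\<^sup>2} s *\<^sub>R Fc s) \<partial>lborel)"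
    by (rule integral_radial[OF r borel_measurable_continuous_on_indicator[OF _ Fcont]]) simp
  also have "(\<integral>s. indicator {0..r\<^sup>2} s *\<^sub>R (indicator {0..r\<^sup>2} s *\<^sub>R Fc s) \<partial>lborel) = (LINT s:{0..r\<^sup>2}|lborel. Fc s)"
    unfolding set_lebesgue_integral_def by (intro Bochner_Integration.integral_cong) (auto simp: indicator_def)
  also have "\<dots> = integral {0..r\<^sup>2} Fc"
    by (intro set_borel_integral_eq_integral borel_integrable_atLeastAtMost' Fcont)
  finally have "(2 * pi) *\<^sub>R (\<integral>x. ?g x \<partial>lborel) = pi *\<^sub>R integral {0..r\<^sup>2} Fc" .
  then have "pi *\<^sub>R (2 *\<^sub>R (\<integral>x. ?g x \<partial>lborel)) = pi *\<^sub>R integral {0..r\<^sup>2} Fc" by (simp add: mult.commute)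
  then have "2 *\<^sub>R (\<integral>x. ?g x \<partial>lborel) = integral {0..r\<^sup>2} Fc"
    unfolding scaleR_cancel_left by simp
  then have "2 * (\<integral>x. ?g x \<partial>lborel) = integral {0..r\<^sup>2} Fc" by (simp only: scaleR_conv_of_real of_real_numeral)
  then show ?thesis unfolding Fc_def by (simp only: eq_divide_eq_numeral1 mult.commute) simp
qed

section \<open>Test functions adapted to an angular mode\<close>

lemma frechet_pdiff:
  "(f has_derivative f') (at x) \<Longrightarrow> pdiff i f x = f' (axis i 1)"
  unfolding pdiff_def by (simp add: frechet_derivative_at[symmetric])

lemma positive_part_power_deriv:
  fixes y :: real
  assumes n: "n \<ge> 2"
  shows "((\<lambda>y. max 0 y ^ n) has_real_derivative (real n * max 0 y ^ (n - 1))) (at y)"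
proof -
  consider "y > 0" | "y < 0" | "y = 0" by linarith
  then show ?thesis
  proof cases
    case 1
    have "((\<lambda>y. y ^ n) has_real_derivative (real n * y ^ (n - 1))) (at y)"
      using DERIV_pow[of n y] by simp
    then have "((\<lambda>y. max 0 y ^ n) has_real_derivative (real n * y ^ (n - 1))) (at y)"
      by (rule has_field_derivative_transform_within_open[of _ _ _ "{0<..}"]) (use 1 in auto)
    then show ?thesis using 1 by simp
  next
    case 2
    have "((\<lambda>y. 0) has_real_derivative 0) (at y)" by simp
    then have "((\<lambda>y. max 0 y ^ n) has_real_derivative 0) (at y)"
      by (rule has_field_derivative_transform_within_open[of _ _ _ "{..<0}"]) (use 2 n in \<open>auto simp: max_def\<close>)
    moreover have "max 0 y ^ (n - 1) = 0" using 2 n by (simp add: max_def power_0_left)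
    ultimately show ?thesis by (simp only: mult_zero_right)
  next
    case 3
    have "((\<lambda>h::real. max 0 h ^ n / h) \<longlongrightarrow> 0) (at 0)"
    proof (rule Lim_null_comparison)
      show "\<forall>\<^sub>F h in at 0. norm (max 0 h ^ n / h) \<le> \<bar>h\<bar> ^ (n - 1)"
      proof (intro always_eventually allI)
        fix h :: real
        have "max 0 h ^ n \<le> \<bar>h\<bar> ^ n" by (intro power_mono) auto
        also have "\<dots> = \<bar>h\<bar> ^ (n - 1) * \<bar>h\<bar>" using n by (metis One_nat_def Suc_pred' less_le_trans mult.commute pos2 power_Suc)
        finally show "norm (max 0 h ^ n / h) \<le> \<bar>h\<bar> ^ (n - 1)"
          by (cases "h = 0") (auto simp: abs_divide field_simps)
      qed
      have "((\<lambda>h::real. \<bar>h\<bar> ^ (n - 1)) \<longlongrightarrow> \<bar>0\<bar> ^ (n - 1)) (at 0)" by (intro tendsto_intros)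
      then show "((\<lambda>h::real. \<bar>h\<bar> ^ (n - 1)) \<longlongrightarrow> 0) (at 0)" using n by (simp add: power_0_left)
    qed
    then show ?thesis using 3 n by (simp add: DERIV_def power_0_left)
  qed
qed

context
  fixes t :: real and \<sigma> :: complex
begin

text \<open>The test function for angular mode \<open>m\<close> is \<open>(t - \<bar>x\<bar>\<^sup>2) ^ n * (x 1 + \<sigma> * \<i> * x 2) ^ m\<close> on the disk of
  squared radius \<open>t\<close> and zero outside, with \<open>\<sigma> = 1\<close> or \<open>\<sigma> = - 1\<close> for the two orientations. With exponent
  three its second derivatives are still continuous.\<close>

definition cutoff :: "nat \<Rightarrow> real^2 \<Rightarrow> real"
  where "cutoff n x = max 0 (t - x \<bullet> x) ^ n"

definition twisted :: "real^2 \<Rightarrow> complex"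
  where "twisted x = of_real (x $ 1) + \<sigma> * \<i> * of_real (x $ 2)"

definition unit_slope :: "2 \<Rightarrow> complex"
  where "unit_slope i = twisted (axis i 1)"

lemma cutoff_has_derivative:
  assumes "n \<ge> 2"
  shows "((\<lambda>x. complex_of_real (cutoff n x)) has_derivative (\<lambda>v. of_real (- 2 * real n * cutoff (n - 1) x * (x \<bullet> v)))) (at x)"
proof -
  have 1: "((\<lambda>x. t - x \<bullet> x) has_derivative (\<lambda>v. - 2 * (x \<bullet> v))) (at x)"
    by (auto intro!: derivative_eq_intros simp: inner_commute)
  have "((\<lambda>y. max 0 y ^ n) has_derivative (\<lambda>v. real n * max 0 (t - x \<bullet> x) ^ (n - 1) * v)) (at (t - x \<bullet> x))"
    using positive_part_power_deriv[OF assms] by (simp add: has_field_derivative_def)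
  from has_derivative_compose[OF 1 this]
  have "((\<lambda>x. cutoff n x) has_derivative (\<lambda>v. - 2 * real n * cutoff (n - 1) x * (x \<bullet> v))) (at x)"
    unfolding cutoff_def by (simp add: mult_ac)
  then show ?thesis by (rule has_derivative_of_real)
qed

lemma twisted_has_derivative: "(twisted has_derivative twisted) (at x)"
proof -
  have "linear twisted"
    by (rule linearI; simp add: twisted_def; simp add: algebra_simps scaleR_conv_of_real)
  then show ?thesis by (simp add: linear_imp_has_derivative linear_linear bounded_linear_imp_has_derivative)
qed

lemma cutoff_continuous [continuous_intros]: "continuous_on S f \<Longrightarrow> continuous_on S (\<lambda>x. cutoff n (f x))"
  unfolding cutoff_def by (intro continuous_intros)

lemma twisted_continuous [continuous_intros]: "continuous_on S f \<Longrightarrow> continuous_on S (\<lambda>x. twisted (f x))"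
  unfolding twisted_def by (intro continuous_intros)

definition bump :: "nat \<Rightarrow> nat \<Rightarrow> real^2 \<Rightarrow> complex"
  where "bump n m x = of_real (cutoff n x) * twisted x ^ m"

lemma bump_continuous [continuous_intros]: "continuous_on S f \<Longrightarrow> continuous_on S (\<lambda>x. bump n m (f x))"
  unfolding bump_def by (intro continuous_intros)

lemma bump_has_derivative:
  assumes "n \<ge> 2"
  shows "(bump n m has_derivative (\<lambda>v. of_real (- 2 * real n * (x \<bullet> v)) * bump (n - 1) m x
      + of_nat m * twisted v * bump n (m - 1) x)) (at x)"
proof -
  have "((\<lambda>x. twisted x ^ m) has_derivative (\<lambda>v. of_nat m * twisted x ^ (m - 1) * twisted v)) (at x)"
    by (rule has_derivative_eq_rhs[OF has_derivative_power[OF twisted_has_derivative]]) (auto simp: fun_eq_iff)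
  from has_derivative_mult[OF cutoff_has_derivative[OF assms] this]
  show ?thesis unfolding bump_def[abs_def]
    by (rule has_derivative_eq_rhs) (auto simp: fun_eq_iff algebra_simps)
qed

lemma pdiff_bump:
  assumes "n \<ge> 2"
  shows "pdiff i (bump n m) x = of_real (- 2 * real n * x $ i) * bump (n - 1) m x + of_nat m * unit_slope i * bump n (m - 1) x"
  using frechet_pdiff[OF bump_has_derivative[OF assms]] by (simp add: inner_axis unit_slope_def)

lemma bump_support: "bump n m x \<noteq> 0 \<Longrightarrow> n > 0 \<Longrightarrow> x \<in> cball 0 (sqrt t)"
proof -
  assume "bump n m x \<noteq> 0" "n > 0"
  then have "cutoff n x \<noteq> 0" by (auto simp: bump_def)
  then have "x \<bullet> x < t" using \<open>n > 0\<close> by (auto simp: cutoff_def max_def split: if_splits)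
  then have "(norm x)\<^sup>2 \<le> t" by (simp add: power2_norm_eq_inner)
  then show ?thesis by (simp add: real_le_rsqrt)
qed

lemma closure_support:
  assumes "\<And>x. f x \<noteq> (0::complex) \<Longrightarrow> x \<in> cball (0::real^2) r" and "cball 0 r \<subseteq> U"
  shows "compact (closure {x. f x \<noteq> 0}) \<and> closure {x. f x \<noteq> 0} \<subseteq> U"
proof -
  have s: "closure {x. f x \<noteq> 0} \<subseteq> cball 0 r"
    by (rule closure_minimal) (use assms(1) in auto)
  then show ?thesis
    using assms(2) by (meson closed_closure compact_cball compact_Int_closed compact_eq_bounded_closed bounded_subset bounded_cball order_trans)
qed

lemma bump_test_function:
  assumes U: "cball 0 (sqrt t) \<subseteq> U"
  shows "bump 3 m \<in> test_functions U"
proof -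
  have "continuous_on UNIV (pdiff i (bump 3 m))" for i
    unfolding pdiff_bump[of 3, simplified, abs_def] by (intro continuous_intros)
  moreover have "bump 3 m differentiable (at x)" for x
    using bump_has_derivative[of 3 m x] by (auto simp: differentiable_def)
  ultimately show ?thesis
    unfolding test_functions_def using closure_support[OF _ U, of "bump 3 m"] bump_support[of 3 m] by auto
qed

definition bump_slope :: "2 \<Rightarrow> nat \<Rightarrow> real^2 \<Rightarrow> complex"
  where "bump_slope i m x = of_real (- 6 * x $ i) * bump 2 m x + of_nat m * unit_slope i * bump 3 (m - 1) x"

lemma pdiff_bump3: "pdiff i (bump 3 m) = bump_slope i m"
  by (simp add: fun_eq_iff bump_slope_def pdiff_bump)

lemma bump_slope_has_derivative:
  "(bump_slope i m has_derivative (\<lambda>v. of_real (- 6 * v $ i) * bump 2 m x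
     + of_real (- 6 * x $ i) * (of_real (- 4 * (x \<bullet> v)) * bump 1 m x + of_nat m * twisted v * bump 2 (m - 1) x)
     + of_nat m * unit_slope i * (of_real (- 6 * (x \<bullet> v)) * bump 2 (m - 1) x + of_nat (m - 1) * twisted v * bump 3 (m - 1 - 1) x))) (at x)"
proof -
  have c: "((\<lambda>x::real^2. complex_of_real (- 6 * x $ i)) has_derivative (\<lambda>v. of_real (- 6 * v $ i))) (at x)"
    by (intro has_derivative_of_real has_derivative_mult_right bounded_linear_imp_has_derivative bounded_linear_vec_nth)
  have d2: "(bump 2 m has_derivative (\<lambda>v. of_real (- 4 * (x \<bullet> v)) * bump 1 m x + of_nat m * twisted v * bump 2 (m - 1) x)) (at x)"
    using bump_has_derivative[of 2 m x] by simp
  have d3: "(bump 3 (m - 1) has_derivative (\<lambda>v. of_real (- 6 * (x \<bullet> v)) * bump 2 (m - 1) x + of_nat (m - 1) * twisted v * bump 3 (m - 1 - 1) x)) (at x)"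
    using bump_has_derivative[of 3 "m - 1" x] by simp
  show ?thesis
    unfolding bump_slope_def[abs_def]
    by (rule has_derivative_eq_rhs[OF has_derivative_add[OF has_derivative_mult[OF c d2] has_derivative_mult_right[OF d3]]])
      (simp add: fun_eq_iff algebra_simps)
qed

lemma pdiff_bump_slope:
  "pdiff l (bump_slope i m) x = of_real (- 6 * axis l 1 $ i) * bump 2 m x
     + of_real (- 6 * x $ i) * (of_real (- 4 * x $ l) * bump 1 m x + of_nat m * unit_slope l * bump 2 (m - 1) x)
     + of_nat m * unit_slope i * (of_real (- 6 * x $ l) * bump 2 (m - 1) x + of_nat (m - 1) * unit_slope l * bump 3 (m - 1 - 1) x)"
  using frechet_pdiff[OF bump_slope_has_derivative] by (simp add: inner_axis unit_slope_def)

lemma bump_slope_test_function: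
  assumes U: "cball 0 (sqrt t) \<subseteq> U"
  shows "bump_slope i m \<in> test_functions U"
proof -
  have c: "continuous_on UNIV (pdiff l (bump_slope i m))" for l
    unfolding pdiff_bump_slope[abs_def] by (intro continuous_intros)
  have d: "bump_slope i m differentiable (at x)" for x
    using bump_slope_has_derivative[of i m x] by (auto simp: differentiable_def)
  have s: "x \<in> cball 0 (sqrt t)" if "bump_slope i m x \<noteq> 0" for x
    using that bump_support[of 2 m x] bump_support[of 3 "m - 1" x] unfolding bump_slope_def by force
  show ?thesis
    unfolding test_functions_def using closure_support[OF s U] c d by auto
qed

text \<open>The factor \<open>twisted x ^ m\<close> is harmonic, and Euler's identity for homogeneous functions evaluates the
  mixed term.\<close>

lemma bump_laplacian:
  assumes \<sigma>: "\<sigma>\<^sup>2 = 1"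
  shows "(\<Sum>i\<in>UNIV. pdiff i (bump_slope i m) x)
     = of_real (24 * (x \<bullet> x)) * bump 1 m x - of_nat (12 * (m + 1)) * bump 2 m x"
proof -
  have sl: "unit_slope 1 = 1" "unit_slope 2 = \<sigma> * \<i>"
    by (simp_all add: unit_slope_def twisted_def axis_def)
  have z: "unit_slope 1 * unit_slope 1 + unit_slope 2 * unit_slope 2 = 0"
    using \<sigma> by (simp add: sl power2_eq_square algebra_simps)
  have w: "of_real (x $ 1) * unit_slope 1 + of_real (x $ 2) * unit_slope 2 = twisted x"
    by (simp add: sl twisted_def mult_ac)
  have tb: "of_nat m * (twisted x * bump 2 (m - 1) x) = of_nat m * bump 2 m x"
    by (cases m) (auto simp: bump_def)
  have xx: "x \<bullet> x = x $ 1 * x $ 1 + x $ 2 * x $ 2"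
    by (simp add: inner_vec_def UNIV_2)
  have "(\<Sum>i\<in>UNIV. pdiff i (bump_slope i m) x) =
     - 12 * bump 2 m x + of_real (24 * (x $ 1 * x $ 1 + x $ 2 * x $ 2)) * bump 1 m x
     - 12 * (of_nat m * ((of_real (x $ 1) * unit_slope 1 + of_real (x $ 2) * unit_slope 2) * bump 2 (m - 1) x))
     + of_nat m * of_nat (m - 1) * (unit_slope 1 * unit_slope 1 + unit_slope 2 * unit_slope 2) * bump 3 (m - 1 - 1) x"
    unfolding UNIV_2 pdiff_bump_slope by (simp add: axis_def algebra_simps del: of_nat_diff)
  also have "\<dots> = of_real (24 * (x \<bullet> x)) * bump 1 m x - of_nat (12 * (m + 1)) * bump 2 m x"
    unfolding z w tb xx by (simp add: algebra_simps)
  finally show ?thesis .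
qed

end

text \<open>A square integrable function is integrable on the compact support of the test function.\<close>

lemma square_integrable_mult_test:
  fixes f :: "real^2 \<Rightarrow> 'b::euclidean_space" and L :: "'b \<Rightarrow> complex"
  assumes f: "square_integrable U f" and L: "bounded_linear L" "\<And>y. norm (L y) \<le> norm y"
    and h: "continuous_on UNIV h" and K: "compact K" "\<And>x. h x \<noteq> (0::complex) \<Longrightarrow> x \<in> K"
  shows "set_integrable lebesgue U (\<lambda>x. L (f x) * h x)"
proof -
  have fm: "(\<lambda>x. indicator U x *\<^sub>R f x) \<in> borel_measurable lebesgue"
    and fi: "integrable lebesgue (\<lambda>x. indicator U x *\<^sub>R (norm (f x))\<^sup>2)"
    using f by (auto simp: square_integrable_def set_borel_measurable_def set_integrable_def)
  obtain B where "\<forall>y\<in>h ` K. norm y \<le> B"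
    using compact_imp_bounded[OF compact_continuous_image[OF continuous_on_subset[OF h] K(1)]] unfolding bounded_iff by blast
  then have B: "norm (h x) \<le> B" if "x \<in> K" for x using that by blast
  have K': "K \<in> lmeasurable" using K(1) by (rule lmeasurable_compact)
  have hm: "h \<in> borel_measurable lebesgue" using h by (intro measurable_completion) (simp add: borel_measurable_continuous_onI)
  show ?thesis unfolding set_integrable_def
  proof (rule Bochner_Integration.integrable_bound)
    show "integrable lebesgue (\<lambda>x. indicator U x *\<^sub>R (norm (f x))\<^sup>2 + B\<^sup>2 * indicator K x)"
      using fi K' by (intro Bochner_Integration.integrable_add integrable_mult_right) (auto simp: fmeasurable_def)
    have "(\<lambda>x. L (indicator U x *\<^sub>R f x) * h x) \<in> borel_measurable lebesgue"
      by (intro borel_measurable_times hm measurable_compose[OF fm] borel_measurable_continuous_onI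
          linear_continuous_on L)
    then show "(\<lambda>x. indicator U x *\<^sub>R (L (f x) * h x)) \<in> borel_measurable lebesgue"
      by (simp add: linear_scale[OF bounded_linear.linear[OF L(1)]])
    show "AE x in lebesgue. norm (indicator U x *\<^sub>R (L (f x) * h x)) \<le> norm (indicator U x *\<^sub>R (norm (f x))\<^sup>2 + B\<^sup>2 * indicator K x)"
    proof (intro AE_I2)
      fix x
      show "norm (indicator U x *\<^sub>R (L (f x) * h x)) \<le> norm (indicator U x *\<^sub>R (norm (f x))\<^sup>2 + B\<^sup>2 * indicator K x)"
      proof (cases "x \<in> U \<and> h x \<noteq> 0")
        case True
        then have "x \<in> K" using K(2) by blast
        have "norm (L (f x)) * norm (h x) \<le> norm (f x) * B"
          using L(2) B[OF \<open>x \<in> K\<close>] by (intro mult_mono) auto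
        also have "\<dots> \<le> (norm (f x))\<^sup>2 + B\<^sup>2"
        proof -
          have "B \<ge> 0" using order_trans[OF norm_ge_zero B[OF \<open>x \<in> K\<close>]] .
          then have "0 \<le> norm (f x) * B" by simp
          then show ?thesis using sum_squares_bound[of "norm (f x)" B] by linarith
        qed
        finally show ?thesis using True \<open>x \<in> K\<close> by (simp add: norm_mult)
      qed (auto simp: indicator_def)
    qed
  qed
qed

text \<open>Since the slopes of the test function are test functions themselves, the weak derivative of
  \<open>u\<close> can be moved onto them.\<close>

lemma helmholtz_distributional:
  assumes u: "helmholtz_solution U k u" and t: "cball 0 (sqrt t) \<subseteq> U" and \<sigma>: "\<sigma>\<^sup>2 = 1"
  shows "(LINT x:U|lebesgue. u x * ((\<Sum>i\<in>UNIV. pdiff i (bump_slope t \<sigma> i m) x) + of_real (k\<^sup>2) * bump t \<sigma> 3 m x)) = 0"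
proof -
  define g where "g = H1_gradient U u"
  have eq: "weak_eigen_equation U (k\<^sup>2) u" using u by (simp add: helmholtz_solution_def)
  then have g: "is_H1_gradient U u g"
    unfolding g_def H1_gradient_def weak_eigen_equation_def in_H1_def by (metis someI_ex)
  have squ: "square_integrable U u" and sqg: "square_integrable U g"
    and gi: "\<And>\<phi> i. \<phi> \<in> test_functions U \<Longrightarrow> (LINT x:U|lebesgue. u x * pdiff i \<phi> x) = - (LINT x:U|lebesgue. g x $ i * \<phi> x)"
    using g by (auto simp: is_H1_gradient_def)
  let ?\<phi> = "bump t \<sigma> 3 m" and ?\<psi> = "\<lambda>i. bump_slope t \<sigma> i m"
  have w: "(LINT x:U|lebesgue. (\<Sum>i\<in>UNIV. g x $ i * ?\<psi> i x)) = of_real (k\<^sup>2) * (LINT x:U|lebesgue. u x * ?\<phi> x)"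
    using eq bump_test_function[OF t, of \<sigma> m] unfolding weak_eigen_equation_def g_def pdiff_bump3[symmetric] by blast
  have supp1: "x \<in> cball 0 (sqrt t)" if "bump t \<sigma> n j x \<noteq> 0" "n > 0" for n j x using bump_support that by blast
  have pcont: "continuous_on UNIV (pdiff i (?\<psi> i))" and scont: "continuous_on UNIV (?\<psi> i)" for i
  proof -
    show "continuous_on UNIV (pdiff i (?\<psi> i))"
      using bump_slope_test_function[OF t, of \<sigma> i m] by (simp add: test_functions_def)
    show "continuous_on UNIV (?\<psi> i)"
      using bump_test_function[OF t, of \<sigma> m] unfolding pdiff_bump3[symmetric] by (simp add: test_functions_def)
  qed
  have "set_integrable lebesgue U (\<lambda>x. g x $ i * ?\<psi> i x)" for i
  proof (rule square_integrable_mult_test[OF sqg, where L = "\<lambda>y. y $ i" and K = "cball 0 (sqrt t)"])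
    show "x \<in> cball 0 (sqrt t)" if "?\<psi> i x \<noteq> 0" for x
      using that supp1[of 2 m x] supp1[of 3 "m - 1" x] unfolding bump_slope_def by force
  qed (auto simp: scont bounded_linear_vec_nth component_le_norm_cart Finite_Cartesian_Product.norm_nth_le)
  then have "(LINT x:U|lebesgue. (\<Sum>i\<in>UNIV. g x $ i * ?\<psi> i x)) = (\<Sum>i\<in>UNIV. LINT x:U|lebesgue. g x $ i * ?\<psi> i x)"
    unfolding set_lebesgue_integral_def scaleR_sum_right set_integrable_def by (intro Bochner_Integration.integral_sum) auto
  also have "\<dots> = (\<Sum>i\<in>UNIV. - (LINT x:U|lebesgue. u x * pdiff i (?\<psi> i) x))"
    using gi[OF bump_slope_test_function[OF t, of \<sigma> _ m]] by (intro sum.cong refl) simp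
  finally have w2: "(\<Sum>i\<in>UNIV. LINT x:U|lebesgue. u x * pdiff i (?\<psi> i) x) + of_real (k\<^sup>2) * (LINT x:U|lebesgue. u x * ?\<phi> x) = 0"
    using w by (simp add: sum_negf)
  have i1: "set_integrable lebesgue U (\<lambda>x. u x * pdiff i (?\<psi> i) x)" for i
  proof (rule square_integrable_mult_test[OF squ, where L = "\<lambda>y. y" and K = "cball 0 (sqrt t)"])
    show "x \<in> cball 0 (sqrt t)" if "pdiff i (?\<psi> i) x \<noteq> 0" for x
      using that supp1[of 2 m x] supp1[of 3 "m - 1 - 1" x] supp1[of 2 "m - 1" x] supp1[of 1 "m" x] unfolding pdiff_bump_slope by force
  qed (auto simp: pcont)
  have i2: "set_integrable lebesgue U (\<lambda>x. u x * (of_real (k\<^sup>2) * ?\<phi> x))"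
    by (rule square_integrable_mult_test[OF squ, where L = "\<lambda>y. y" and K = "cball 0 (sqrt t)"])
      (auto intro!: continuous_intros bump_continuous dest: supp1)
  have "(LINT x:U|lebesgue. u x * ((\<Sum>i\<in>UNIV. pdiff i (?\<psi> i) x) + of_real (k\<^sup>2) * ?\<phi> x))
      = (LINT x:U|lebesgue. (\<Sum>i\<in>UNIV. u x * pdiff i (?\<psi> i) x) + u x * (of_real (k\<^sup>2) * ?\<phi> x))"
    by (simp only: distrib_left sum_distrib_left)
  also have "\<dots> = (LINT x:U|lebesgue. (\<Sum>i\<in>UNIV. u x * pdiff i (?\<psi> i) x)) + (LINT x:U|lebesgue. u x * (of_real (k\<^sup>2) * ?\<phi> x))"
  proof (rule set_integral_add(2)[OF _ i2])
    show "set_integrable lebesgue U (\<lambda>x. \<Sum>i\<in>UNIV. u x * pdiff i (?\<psi> i) x)"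
      using i1 unfolding set_integrable_def scaleR_sum_right by (intro Bochner_Integration.integrable_sum) auto
  qed
  also have "(LINT x:U|lebesgue. (\<Sum>i\<in>UNIV. u x * pdiff i (?\<psi> i) x)) = (\<Sum>i\<in>UNIV. LINT x:U|lebesgue. u x * pdiff i (?\<psi> i) x)"
    using i1 unfolding set_lebesgue_integral_def scaleR_sum_right set_integrable_def by (intro Bochner_Integration.integral_sum) auto
  also have "(LINT x:U|lebesgue. u x * (of_real (k\<^sup>2) * ?\<phi> x)) = of_real (k\<^sup>2) * (LINT x:U|lebesgue. u x * ?\<phi> x)"
  proof -
    have "(LINT x:U|lebesgue. u x * (of_real (k\<^sup>2) * ?\<phi> x)) = (LINT x:U|lebesgue. of_real (k\<^sup>2) * (u x * ?\<phi> x))"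
      by (simp only: mult.left_commute)
    also have "\<dots> = of_real (k\<^sup>2) * (LINT x:U|lebesgue. u x * ?\<phi> x)"
      by (rule set_integral_mult_right)
    finally show ?thesis .
  qed
  finally show ?thesis using w2 by simp
qed

section \<open>A weak form of the radial equation\<close>

lemma integral_from_0_deriv:
  fixes f :: "real \<Rightarrow> real"
  assumes f: "continuous_on {0..<T} f" and t: "0 < t" "t < T"
  shows "((\<lambda>t. integral {0..t} f) has_real_derivative f t) (at t)"
proof -
  define b where "b = (t + T) / 2"
  have b: "t < b" "b < T" using t by (auto simp: b_def)
  have "((\<lambda>x. integral {0..x} f) has_real_derivative f t) (at t within {0..b})"
    by (rule integral_has_real_derivative) (use t b in \<open>auto intro: continuous_on_subset[OF f]\<close>)
  then show ?thesis using at_within_Icc_at[OF t(1) b(1)] by simp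
qed

lemma integral_from_0_continuous:
  fixes f :: "real \<Rightarrow> real"
  assumes f: "continuous_on {0..<T} f"
  shows "continuous_on {0..<T} (\<lambda>t. integral {0..t} f)"
  unfolding continuous_on_eq_continuous_within
proof
  fix t assume t: "t \<in> {0..<T}"
  define b where "b = (t + T) / 2"
  have b: "t < b" "b < T" "0 \<le> t" using t by (auto simp: b_def)
  have "continuous_on {0..b} (\<lambda>t. integral {0..t} f)"
    by (rule indefinite_integral_continuous_1, rule integrable_continuous_real)
      (use b in \<open>auto intro: continuous_on_subset[OF f]\<close>)
  then have "continuous (at t within {0..b}) (\<lambda>t. integral {0..t} f)"
    using b by (auto simp: continuous_on_eq_continuous_within)
  moreover have "at t within {0..b} = at t within {0..<T}"
    by (rule at_within_nhd[of _ "{..<b}"]) (use b in auto)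
  ultimately show "continuous (at t within {0..<T}) (\<lambda>t. integral {0..t} f)" by simp
qed

text \<open>Integration by parts; iterated, this is Cauchy's formula for repeated integration.\<close>

lemma integral_kernel_power:
  fixes f :: "real \<Rightarrow> real"
  assumes f: "continuous_on {0..<T} f" and t: "0 < t" "t < T"
  shows "integral {0..t} (\<lambda>s. f s * (t - s) ^ Suc n) = real (Suc n) * integral {0..t} (\<lambda>s. integral {0..s} f * (t - s) ^ n)"
proof -
  let ?F = "\<lambda>s. integral {0..s} f"
  have sub: "{0..t} \<subseteq> {0..<T}" using t by auto
  have Fc: "continuous_on {0..t} ?F" by (rule continuous_on_subset[OF integral_from_0_continuous[OF f] sub])
  have fc: "continuous_on {0..t} f" by (rule continuous_on_subset[OF f sub])
  have "((\<lambda>s. f s * (t - s) ^ Suc n - real (Suc n) * (?F s * (t - s) ^ n)) has_integral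
      (?F t * (t - t) ^ Suc n - ?F 0 * (t - 0) ^ Suc n)) {0..t}"
  proof (rule fundamental_theorem_of_calculus_interior)
    fix s assume s: "s \<in> {0<..<t}"
    have "((\<lambda>s. ?F s * (t - s) ^ Suc n) has_real_derivative
        f s * (t - s) ^ Suc n + (real (Suc n) * (t - s) ^ n * (0 - 1)) * ?F s) (at s)"
    proof -
      have "(?F has_real_derivative f s) (at s)"
        by (rule integral_from_0_deriv[OF f]) (use s t in auto)
      moreover have "((\<lambda>s. (t - s) ^ Suc n) has_real_derivative real (Suc n) * (t - s) ^ n * (0 - 1)) (at s)"
        by (auto intro!: derivative_eq_intros simp del: power_Suc)
      ultimately show ?thesis by (rule DERIV_mult)
    qed
    then show "((\<lambda>s. ?F s * (t - s) ^ Suc n) has_vector_derivative f s * (t - s) ^ Suc n - real (Suc n) * (?F s * (t - s) ^ n)) (at s)"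
      by (simp add: has_real_derivative_iff_has_vector_derivative algebra_simps)
  qed (use t in \<open>auto intro!: continuous_intros Fc\<close>)
  then have "integral {0..t} (\<lambda>s. f s * (t - s) ^ Suc n - real (Suc n) * (?F s * (t - s) ^ n)) = 0"
    by (simp add: integral_unique)
  moreover have "integral {0..t} (\<lambda>s. f s * (t - s) ^ Suc n - real (Suc n) * (?F s * (t - s) ^ n))
      = integral {0..t} (\<lambda>s. f s * (t - s) ^ Suc n) - integral {0..t} (\<lambda>s. real (Suc n) * (?F s * (t - s) ^ n))"
    by (intro Henstock_Kurzweil_Integration.integral_diff integrable_continuous_real continuous_intros Fc fc)
  ultimately show ?thesis by simp
qed

lemma deriv_eq_on_interval:
  fixes f g :: "real \<Rightarrow> real"
  assumes "\<And>t. 0 < t \<Longrightarrow> t < T \<Longrightarrow> f t = g t" and "(f has_real_derivative f') (at t)" "(g has_real_derivative g') (at t)"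
    and t: "0 < t" "t < T"
  shows "f' = g'"
proof -
  have "(f has_real_derivative g') (at t)"
    by (rule has_field_derivative_transform_within_open[OF assms(3), of "{0<..<T}"]) (use assms in auto)
  then show ?thesis using assms(2) DERIV_unique by blast
qed

text \<open>The kernel is a polynomial in \<open>t - s\<close> of degree at most three, so the weak identity is a
  differential equation for the fourfold antiderivative \<open>V3\<close> of \<open>v\<close>. This is regular at the origin,
  hence a multiple of the regular solution, and four differentiations recover \<open>v\<close>.\<close>

lemma weak_bessel_solution:
  fixes v :: "real \<Rightarrow> real"
  assumes c: "c > 0" and T: "T > 0" and v: "continuous_on {0..<T} v"
    and weak: "\<And>t. 0 < t \<Longrightarrow> t < T \<Longrightarrow> integral {0..t} (\<lambda>s. (24 * s * (t - s) - 12 * real (m + 1) * (t - s)\<^sup>2 + 4 * c * (t - s) ^ 3) * v s) = 0"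
  shows "\<exists>l. \<forall>t. 0 < t \<and> t < T \<longrightarrow> v t = l * (t ^ m * bessel_clifford c m t)"
proof -
  define J where "J = (\<lambda>f t::real. integral {0..t} f :: real)"
  have Jc: "continuous_on {0..<T} (J f)" if "continuous_on {0..<T} f" for f
    using integral_from_0_continuous[OF that] by (simp add: J_def[abs_def])
  have Jd: "(J f has_real_derivative f t) (at t)" if "continuous_on {0..<T} f" "0 < t" "t < T" for f t
    using integral_from_0_deriv[OF that] by (simp add: J_def[abs_def])
  have J0: "J f 0 = 0" for f by (simp add: J_def)
  have Jk: "integral {0..t} (\<lambda>s. f s * (t - s) ^ Suc n) = real (Suc n) * integral {0..t} (\<lambda>s. J f s * (t - s) ^ n)"
    if "continuous_on {0..<T} f" "0 < t" "t < T" for f t n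
    using integral_kernel_power[OF that] by (simp add: J_def)
  \<comment> \<open>V3 is the fourfold antiderivative of v that vanishes at 0 to fourth order\<close>
  define V0 V1 V2 V3 where "V0 = J v" and "V1 = J V0" and "V2 = J V1" and "V3 = J V2"
  have c0: "continuous_on {0..<T} V0" unfolding V0_def by (rule Jc[OF v])
  have c1: "continuous_on {0..<T} V1" unfolding V1_def by (rule Jc[OF c0])
  have c2: "continuous_on {0..<T} V2" unfolding V2_def by (rule Jc[OF c1])
  have c3: "continuous_on {0..<T} V3" unfolding V3_def by (rule Jc[OF c2])
  have d0: "(V0 has_real_derivative v t) (at t)" if "0 < t" "t < T" for t unfolding V0_def by (rule Jd[OF v that])
  have d1: "(V1 has_real_derivative V0 t) (at t)" if "0 < t" "t < T" for t unfolding V1_def by (rule Jd[OF c0 that])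
  have d2: "(V2 has_real_derivative V1 t) (at t)" if "0 < t" "t < T" for t unfolding V2_def by (rule Jd[OF c1 that])
  have d3: "(V3 has_real_derivative V2 t) (at t)" if "0 < t" "t < T" for t unfolding V3_def by (rule Jd[OF c2 that])
  have ode: "t * V1 t = real (m + 3) * V2 t - c * V3 t" if t: "0 < t" "t < T" for t
  proof -
    have k1: "integral {0..t} (\<lambda>s. v s * (t - s)) = V1 t"
      using Jk[OF v t, of 0] by (simp add: V0_def V1_def J_def)
    have k2: "integral {0..t} (\<lambda>s. v s * (t - s) ^ 2) = 2 * V2 t"
      using Jk[OF v t, of 1] Jk[OF c0 t, of 0] by (simp add: V0_def V1_def V2_def J_def numeral_2_eq_2)
    have k3: "integral {0..t} (\<lambda>s. v s * (t - s) ^ 3) = 6 * V3 t"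
      using Jk[OF v t, of 2] Jk[OF c0 t, of 1] Jk[OF c1 t, of 0]
      by (simp add: V0_def V1_def V2_def V3_def J_def numeral_3_eq_3 numeral_2_eq_2)
    have vc: "continuous_on {0..t} v" by (rule continuous_on_subset[OF v]) (use t in auto)
    have "0 = integral {0..t} (\<lambda>s. (24 * s * (t - s) - 12 * real (m + 1) * (t - s)\<^sup>2 + 4 * c * (t - s) ^ 3) * v s)"
      using weak[OF t] by simp
    also have "\<dots> = integral {0..t} (\<lambda>s. 24 * t * (v s * (t - s)) - (24 + 12 * real (m + 1)) * (v s * (t - s) ^ 2) + 4 * c * (v s * (t - s) ^ 3))"
      by (intro Henstock_Kurzweil_Integration.integral_cong) (simp add: algebra_simps power2_eq_square)
    also have "\<dots> = 24 * t * V1 t - (24 + 12 * real (m + 1)) * (2 * V2 t) + 4 * c * (6 * V3 t)"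
      unfolding k1[symmetric] k2[symmetric] k3[symmetric]
      by (subst Henstock_Kurzweil_Integration.integral_add Henstock_Kurzweil_Integration.integral_diff;
          (intro integrable_continuous_real continuous_intros vc)?)+ simp
    finally show ?thesis by (simp add: algebra_simps)
  qed
  have lim: "(f \<longlongrightarrow> 0) (at_right 0)" if "continuous_on {0..<T} f" "f 0 = 0" for f :: "real \<Rightarrow> real"
  proof -
    have "(f \<longlongrightarrow> f 0) (at 0 within {0..<T})"
      using that(1) T by (auto simp: continuous_on_def)
    then have "(f \<longlongrightarrow> f 0) (at 0 within {0..T / 2})" by (rule tendsto_within_subset) (use T in auto)
    then show ?thesis using at_within_Icc_at_right[of 0 "T / 2"] T that(2) by simp
  qed
  obtain l where l: "\<forall>t. 0 < t \<and> t < T \<longrightarrow> V3 t = l * (t ^ Suc (Suc (m + 2)) * bessel_clifford c (Suc (Suc (m + 2))) t)"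
  proof -
    have "\<exists>l. \<forall>t. 0 < t \<and> t < T \<longrightarrow> V3 t = l * (t ^ Suc (Suc (m + 2)) * bessel_clifford c (Suc (Suc (m + 2))) t)"
    proof (rule bessel_ode_regular_solution[OF c T, of V3 V2])
      fix t assume t: "0 < t" "t < T"
      show "(V3 has_real_derivative V2 t) (at t)" by (rule d3[OF t])
      have "V1 t = (real (Suc (m + 2)) * V2 t - c * V3 t) / t" using ode[OF t] t by (simp add: field_simps)
      then show "(V2 has_real_derivative (real (Suc (m + 2)) * V2 t - c * V3 t) / t) (at t)" using d2[OF t] by simp
    next
      show "(V3 \<longlongrightarrow> 0) (at_right 0)" by (rule lim[OF c3]) (simp add: V3_def J0)
      show "(V2 \<longlongrightarrow> 0) (at_right 0)" by (rule lim[OF c2]) (simp add: V2_def J0)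
    qed
    then show thesis using that by blast
  qed
  define P where "P = (\<lambda>q t::real. l * (t ^ q * bessel_clifford c q t))"
  have P: "(P (Suc q) has_real_derivative P q t) (at t)" for q t
    unfolding P_def by (intro DERIV_cmult power_bessel_clifford_deriv)
  have e3: "V3 t = P (Suc (Suc (Suc (Suc m)))) t" if "0 < t" "t < T" for t using l that by (simp add: P_def)
  have e2: "V2 t = P (Suc (Suc (Suc m))) t" if t: "0 < t" "t < T" for t
    by (rule deriv_eq_on_interval[OF e3 d3[OF t] P t])
  have e1: "V1 t = P (Suc (Suc m)) t" if t: "0 < t" "t < T" for t
    by (rule deriv_eq_on_interval[OF e2 d2[OF t] P t])
  have e0: "V0 t = P (Suc m) t" if t: "0 < t" "t < T" for t
    by (rule deriv_eq_on_interval[OF e1 d1[OF t] P t])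
  have "v t = P m t" if t: "0 < t" "t < T" for t
    by (rule deriv_eq_on_interval[OF e0 d0[OF t] P t])
  then show ?thesis unfolding P_def by blast
qed

section \<open>Fourier coefficients of a solution on circles\<close>

definition fourier_coeff :: "(real^2 \<Rightarrow> complex) \<Rightarrow> int \<Rightarrow> real \<Rightarrow> complex"
  where "fourier_coeff u m s = integral {0..2*pi} (\<lambda>\<theta>. u (circle_point s \<theta>) * cis (- (of_int m * \<theta>)))"

lemma fourier_coeff_continuous:
  assumes u: "continuous_on (ball 0 r) u" and r: "r > 0"
  shows "continuous_on {0..<r\<^sup>2} (fourier_coeff u m)"
  unfolding fourier_coeff_def
proof -
  have "continuous_on {0..<r\<^sup>2} (\<lambda>s. integral (cbox 0 (2*pi)) (\<lambda>\<theta>. u (circle_point s \<theta>) * cis (- (of_int m * \<theta>))))"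
  proof (rule integral_continuous_on_param)
    have "continuous_on ({0..<r\<^sup>2} \<times> cbox 0 (2*pi)) (\<lambda>p. u (circle_point (fst p) (snd p)))"
    proof (rule continuous_on_compose2[OF u])
      show "continuous_on ({0..<r\<^sup>2} \<times> cbox 0 (2*pi)) (\<lambda>p. circle_point (fst p) (snd p))"
        by (intro continuous_intros)
      show "(\<lambda>p. circle_point (fst p) (snd p)) ` ({0..<r\<^sup>2} \<times> cbox 0 (2*pi)) \<subseteq> ball 0 r"
        using r by (auto simp: circle_point_norm real_less_lsqrt)
    qed
    then show "continuous_on ({0..<r\<^sup>2} \<times> cbox 0 (2*pi)) (\<lambda>(s, \<theta>). u (circle_point s \<theta>) * cis (- (of_int m * \<theta>)))"
      unfolding split_def by (intro continuous_intros)
  qed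
  then show "continuous_on {0..<r\<^sup>2} (\<lambda>s. integral {0..2*pi} (\<lambda>\<theta>. u (circle_point s \<theta>) * cis (- (of_int m * \<theta>))))" by simp
qed

text \<open>The distributional equation, tested with the bump for mode \<open>m\<close> and evaluated in polar coordinates.
  The first two terms of the kernel are those of \<open>bump_laplacian\<close> with \<open>s = \<bar>x\<bar>\<^sup>2\<close>.\<close>

lemma helmholtz_fourier_weak:
  assumes u: "helmholtz_solution U k u" and U: "ball 0 r \<subseteq> U" and t: "0 < t" "t < r\<^sup>2" and r: "r > 0"
  shows "integral {0..t} (\<lambda>s. of_real (24 * s * (t - s) - 12 * real (nat \<bar>m\<bar> + 1) * (t - s)\<^sup>2 + k\<^sup>2 * (t - s) ^ 3)
      * (of_real (sqrt s ^ nat \<bar>m\<bar>) * fourier_coeff u m s)) = 0"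
proof -
  define n where "n = nat \<bar>m\<bar>"
  define \<sigma> :: complex where "\<sigma> = (if m \<ge> 0 then -1 else 1)"
  have \<sigma>2: "\<sigma>\<^sup>2 = 1" by (simp add: \<sigma>_def)
  have st: "sqrt t < r" using t r by (simp add: real_less_lsqrt)
  have "cball (0::real^2) (sqrt t) \<subseteq> ball 0 r" using st by (auto simp: subset_eq)
  then have sub: "cball 0 (sqrt t) \<subseteq> U" using U by (rule order_trans)
  have "continuous_on U u" using u by (simp add: helmholtz_solution_def)
  then have uc: "continuous_on (cball 0 (sqrt t)) u" using sub continuous_on_subset by blast
  define H where "H = (\<lambda>s. 24 * s * (t - s) - 12 * real (n + 1) * (t - s)\<^sup>2 + k\<^sup>2 * (t - s) ^ 3)"
  define f where "f = (\<lambda>x. u x * (of_real (H (x \<bullet> x)) * twisted \<sigma> x ^ n))"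
  have fc: "continuous_on (cball 0 (sqrt t)) f"
    unfolding f_def H_def by (intro continuous_intros twisted_continuous uc)
  have "0 = (LINT x:U|lebesgue. u x * ((\<Sum>i\<in>UNIV. pdiff i (bump_slope t \<sigma> i n) x) + of_real (k\<^sup>2) * bump t \<sigma> 3 n x))"
    using helmholtz_distributional[OF u sub \<sigma>2] by simp
  also have "\<dots> = (\<integral>x. indicator (cball 0 (sqrt t)) x *\<^sub>R f x \<partial>lebesgue)"
    unfolding set_lebesgue_integral_def
  proof (intro Bochner_Integration.integral_cong refl)
    fix x
    show "indicator U x *\<^sub>R (u x * ((\<Sum>i\<in>UNIV. pdiff i (bump_slope t \<sigma> i n) x) + of_real (k\<^sup>2) * bump t \<sigma> 3 n x))
        = indicator (cball 0 (sqrt t)) x *\<^sub>R f x"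
    proof (cases "x \<in> cball 0 (sqrt t)")
      case True
      then have "norm x \<le> sqrt t" by simp
      then have "x \<bullet> x \<le> t" using t by (metis norm_ge_zero power2_norm_eq_inner power_mono real_sqrt_pow2 less_imp_le)
      then have "max 0 (t - x \<bullet> x) = t - x \<bullet> x" by simp
      then have "(\<Sum>i\<in>UNIV. pdiff i (bump_slope t \<sigma> i n) x) + of_real (k\<^sup>2) * bump t \<sigma> 3 n x
          = of_real (H (x \<bullet> x)) * twisted \<sigma> x ^ n"
        unfolding bump_laplacian[OF \<sigma>2] bump_def cutoff_def H_def by (simp add: algebra_simps)
      then show ?thesis using True sub by (auto simp: f_def)
    next
      case False
      then have "bump t \<sigma> j n x = 0" if "j > 0" for j using bump_support that by blast
      then show ?thesis using False unfolding bump_laplacian[OF \<sigma>2] by simp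
    qed
  qed
  also have "\<dots> = (\<integral>x. indicator (cball 0 (sqrt t)) x *\<^sub>R f x \<partial>lborel)"
    by (intro integral_completion) (simp add: borel_measurable_continuous_on_indicator[OF _ fc])
  also have "\<dots> = integral {0..(sqrt t)\<^sup>2} (\<lambda>s. integral {0..2*pi} (\<lambda>\<theta>. f (circle_point s \<theta>))) / 2"
    by (rule integral_polar[OF fc]) (use t in simp)
  also have "(sqrt t)\<^sup>2 = t" using t by simp
  finally have "integral {0..t} (\<lambda>s. integral {0..2*pi} (\<lambda>\<theta>. f (circle_point s \<theta>))) = 0" by simp
  also have "integral {0..t} (\<lambda>s. integral {0..2*pi} (\<lambda>\<theta>. f (circle_point s \<theta>)))
      = integral {0..t} (\<lambda>s. of_real (H s) * (of_real (sqrt s ^ n) * fourier_coeff u m s))"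
  proof (intro Henstock_Kurzweil_Integration.integral_cong)
    fix s assume s: "s \<in> {0..t}"
    have tw: "twisted \<sigma> (circle_point s \<theta>) ^ n = of_real (sqrt s ^ n) * cis (- (of_int m * \<theta>))" for \<theta>
    proof -
      have "twisted \<sigma> (circle_point s \<theta>) = of_real (sqrt s) * cis (if m \<ge> 0 then - \<theta> else \<theta>)"
        by (simp add: twisted_def \<sigma>_def circle_point_def plane_of_complex_def complex_eq_iff)
      then have "twisted \<sigma> (circle_point s \<theta>) ^ n = of_real (sqrt s ^ n) * cis (real n * (if m \<ge> 0 then - \<theta> else \<theta>))"
        by (simp only: power_mult_distrib of_real_power Complex.DeMoivre)
      also have "real n * (if m \<ge> 0 then - \<theta> else \<theta>) = - (of_int m * \<theta>)" by (simp add: n_def)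
      finally show ?thesis .
    qed
    have nn: "circle_point s \<theta> \<bullet> circle_point s \<theta> = s" for \<theta>
      using circle_point_norm[of s \<theta>] s by (simp add: power2_norm_eq_inner[symmetric])
    have "integral {0..2*pi} (\<lambda>\<theta>. f (circle_point s \<theta>)) = integral {0..2*pi} (\<lambda>\<theta>. (of_real (H s) * of_real (sqrt s ^ n)) * (u (circle_point s \<theta>) * cis (- (of_int m * \<theta>))))"
      unfolding f_def nn tw by (simp only: mult_ac)
    also have "\<dots> = (of_real (H s) * of_real (sqrt s ^ n)) * fourier_coeff u m s"
      unfolding fourier_coeff_def by (rule integral_mult_right)
    finally show "integral {0..2*pi} (\<lambda>\<theta>. f (circle_point s \<theta>)) = of_real (H s) * (of_real (sqrt s ^ n) * fourier_coeff u m s)"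
      by (simp only: mult.assoc)
  qed
  finally show ?thesis by (simp add: H_def n_def)
qed

lemma weak_bessel_solution_complex:
  fixes v :: "real \<Rightarrow> complex"
  assumes c: "c > 0" and T: "T > 0" and v: "continuous_on {0..<T} v"
    and weak: "\<And>t. 0 < t \<Longrightarrow> t < T \<Longrightarrow> integral {0..t} (\<lambda>s. of_real (24 * s * (t - s) - 12 * real (m + 1) * (t - s)\<^sup>2 + 4 * c * (t - s) ^ 3) * v s) = 0"
  shows "\<exists>l. \<forall>t. 0 < t \<and> t < T \<longrightarrow> v t = l * of_real (t ^ m * bessel_clifford c m t)"
proof -
  have int: "(\<lambda>s. of_real (24 * s * (t - s) - 12 * real (m + 1) * (t - s)\<^sup>2 + 4 * c * (t - s) ^ 3) * v s) integrable_on {0..t}" if "t < T" for t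
    by (intro integrable_continuous_real continuous_intros continuous_on_subset[OF v]) (use that in auto)
  have "\<exists>l. \<forall>t. 0 < t \<and> t < T \<longrightarrow> Re (v t) = l * (t ^ m * bessel_clifford c m t)"
  proof (rule weak_bessel_solution[OF c T])
    show "continuous_on {0..<T} (\<lambda>t. Re (v t))" using v by (intro continuous_intros)
    show "integral {0..t} (\<lambda>s. (24 * s * (t - s) - 12 * real (m + 1) * (t - s)\<^sup>2 + 4 * c * (t - s) ^ 3) * Re (v s)) = 0" if "0 < t" "t < T" for t
      using integral_linear[OF int[OF that(2)] bounded_linear_Re] weak[OF that] by (simp add: o_def)
  qed
  then obtain l1 where l1: "\<forall>t. 0 < t \<and> t < T \<longrightarrow> Re (v t) = l1 * (t ^ m * bessel_clifford c m t)" by blast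
  have "\<exists>l. \<forall>t. 0 < t \<and> t < T \<longrightarrow> Im (v t) = l * (t ^ m * bessel_clifford c m t)"
  proof (rule weak_bessel_solution[OF c T])
    show "continuous_on {0..<T} (\<lambda>t. Im (v t))" using v by (intro continuous_intros)
    show "integral {0..t} (\<lambda>s. (24 * s * (t - s) - 12 * real (m + 1) * (t - s)\<^sup>2 + 4 * c * (t - s) ^ 3) * Im (v s)) = 0" if "0 < t" "t < T" for t
      using integral_linear[OF int[OF that(2)] bounded_linear_Im] weak[OF that] by (simp add: o_def)
  qed
  then obtain l2 where l2: "\<forall>t. 0 < t \<and> t < T \<longrightarrow> Im (v t) = l2 * (t ^ m * bessel_clifford c m t)" by blast
  show ?thesis
    by (rule exI[of _ "Complex l1 l2"]) (use l1 l2 in \<open>auto simp: complex_eq_iff\<close>)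
qed

text \<open>The weak identity determines \<open>s powr (\<bar>m\<bar> / 2)\<close> times the Fourier coefficient; dividing by this power
  gives the claim for \<open>s > 0\<close>, and continuity extends it to the centre.\<close>

lemma helmholtz_fourier_coeff:
  assumes u: "helmholtz_solution U k u" and k: "k > 0" and U: "ball 0 r \<subseteq> U" and r: "r > 0"
  shows "\<exists>C. \<forall>s. 0 \<le> s \<and> s < r\<^sup>2 \<longrightarrow>
    fourier_coeff u m s = C * of_real (sqrt s ^ nat \<bar>m\<bar> * (fact (nat \<bar>m\<bar>) * bessel_clifford (k\<^sup>2 / 4) (nat \<bar>m\<bar>) s))"
proof -
  define n where "n = nat \<bar>m\<bar>"
  define c where "c = k\<^sup>2 / 4"
  have "continuous_on U u" using u by (simp add: helmholtz_solution_def)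
  then have fc: "continuous_on {0..<r\<^sup>2} (fourier_coeff u m)"
    using U r by (intro fourier_coeff_continuous continuous_on_subset[OF _ U]) auto
  have "\<exists>l. \<forall>t. 0 < t \<and> t < r\<^sup>2 \<longrightarrow> of_real (sqrt t ^ n) * fourier_coeff u m t = l * of_real (t ^ n * bessel_clifford c n t)"
  proof (rule weak_bessel_solution_complex)
    show "c > 0" "r\<^sup>2 > 0" using k r by (auto simp: c_def)
    show "continuous_on {0..<r\<^sup>2} (\<lambda>t. of_real (sqrt t ^ n) * fourier_coeff u m t)"
      by (intro continuous_intros fc)
    fix t assume t: "0 < t" "t < r\<^sup>2"
    show "integral {0..t} (\<lambda>s. of_real (24 * s * (t - s) - 12 * real (n + 1) * (t - s)\<^sup>2 + 4 * c * (t - s) ^ 3)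
      * (of_real (sqrt s ^ n) * fourier_coeff u m s)) = 0"
      using helmholtz_fourier_weak[OF u U t r, of m] by (simp add: n_def c_def)
  qed
  then obtain l where l: "\<And>t. 0 < t \<Longrightarrow> t < r\<^sup>2 \<Longrightarrow> of_real (sqrt t ^ n) * fourier_coeff u m t = l * of_real (t ^ n * bessel_clifford c n t)"
    by blast
  define G where "G = (\<lambda>s. (l / fact n) * complex_of_real (sqrt s ^ n * (fact n * bessel_clifford c n s)))"
  have eq: "fourier_coeff u m s = G s" if s: "0 < s" "s < r\<^sup>2" for s
  proof -
    have "s ^ n = sqrt s ^ n * sqrt s ^ n" using s by (simp flip: power_mult_distrib)
    then have "of_real (sqrt s ^ n) * fourier_coeff u m s = of_real (sqrt s ^ n) * (l * of_real (sqrt s ^ n * bessel_clifford c n s))"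
      using l[OF s] by (simp add: mult_ac)
    moreover have "complex_of_real (sqrt s ^ n) \<noteq> 0" using s by simp
    ultimately have "fourier_coeff u m s = l * of_real (sqrt s ^ n * bessel_clifford c n s)"
      using mult_left_cancel by blast
    then show ?thesis by (simp add: G_def)
  qed
  have G: "continuous_on {0..<r\<^sup>2} G" unfolding G_def by (intro continuous_intros)
  have r2: "r\<^sup>2 > 0" using r by simp
  have lim: "(f \<longlongrightarrow> f 0) (at_right 0)" if "continuous_on {0..<r\<^sup>2} f" for f :: "real \<Rightarrow> complex"
  proof -
    have "(f \<longlongrightarrow> f 0) (at 0 within {0..<r\<^sup>2})"
      using that r2 unfolding continuous_on_def by simp
    then have "(f \<longlongrightarrow> f 0) (at 0 within {0..r\<^sup>2 / 2})" proof (rule tendsto_within_subset)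
      have "r\<^sup>2 / 2 < r\<^sup>2" using r2 by linarith
      then show "{0..r\<^sup>2 / 2} \<subseteq> {0..<r\<^sup>2}" by (meson atLeastatMost_subset_iff order_refl atLeastAtMost_subseteq_atLeastLessThan_iff)
    qed
    then show ?thesis using at_within_Icc_at_right[of 0 "r\<^sup>2 / 2"] r2 by simp
  qed
  have ev: "\<forall>\<^sub>F s in at_right 0. fourier_coeff u m s = G s"
    unfolding eventually_at_right_field using eq r2 by blast
  have "fourier_coeff u m 0 = G 0"
    by (rule tendsto_unique[OF trivial_limit_at_right_real Lim_transform_eventually[OF lim[OF fc] ev] lim[OF G]])
  with eq have "\<forall>s. 0 \<le> s \<and> s < r\<^sup>2 \<longrightarrow> fourier_coeff u m s = G s"
    by (metis order_le_less)
  then show ?thesis unfolding G_def n_def c_def by blast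
qed

section \<open>Uniqueness of Fourier coefficients\<close>

lemma integral_cis: "integral {0..2*pi} (\<lambda>\<theta>. cis (of_int m * \<theta>)) = (if m = 0 then 2 * pi else 0)"
proof (cases "m = 0")
  case False
  have "((\<lambda>\<theta>. cis (of_int m * \<theta>)) has_integral cis (of_int m * (2 * pi)) / (\<i> * of_int m) - cis (of_int m * 0) / (\<i> * of_int m)) {0..2*pi}"
  proof (rule fundamental_theorem_of_calculus)
    fix x :: real
    have "((\<lambda>z. exp (\<i> * of_int m * z) / (\<i> * of_int m)) has_field_derivative exp (\<i> * of_int m * of_real x)) (at (of_real x))"
      using False by (auto intro!: derivative_eq_intros)
    from has_vector_derivative_real_field[OF this]
    show "((\<lambda>\<theta>. cis (of_int m * \<theta>) / (\<i> * of_int m)) has_vector_derivative cis (of_int m * x)) (at x within {0..2*pi})"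
      unfolding cis_conv_exp by (simp add: mult.assoc has_vector_derivative_at_within)
  qed simp
  moreover have "cis (of_int m * (2 * pi)) = 1"
    using cis_multiple_2pi[of "of_int m"] by (simp add: mult_ac)
  ultimately show ?thesis using False by (simp add: integral_unique)
qed (simp add: scaleR_conv_of_real)

text \<open>Continuous functions on the circle with vanishing Fourier coefficients. They form a module over the
  trigonometric polynomials, which is what makes the proof that they vanish short.\<close>

definition fourier_null :: "(complex \<Rightarrow> complex) \<Rightarrow> bool"
  where "fourier_null h \<longleftrightarrow> continuous_on (sphere 0 1) h \<and>
    (\<forall>m::int. integral {0..2*pi} (\<lambda>\<theta>. h (cis \<theta>) * cis (of_int m * \<theta>)) = 0)"

lemma circle_continuous:
  assumes "continuous_on (sphere 0 1) h"
  shows "continuous_on S (\<lambda>\<theta>. h (cis \<theta>))"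
  by (rule continuous_on_compose2[OF assms]) (auto intro!: continuous_intros)

lemma fourier_null_add:
  assumes "fourier_null g" "fourier_null h"
  shows "fourier_null (\<lambda>z. g z + h z)"
proof -
  have "integral {0..2*pi} (\<lambda>\<theta>. (g (cis \<theta>) + h (cis \<theta>)) * cis (of_int m * \<theta>)) = 0" for m
  proof -
    have "integral {0..2*pi} (\<lambda>\<theta>. (g (cis \<theta>) + h (cis \<theta>)) * cis (of_int m * \<theta>))
        = integral {0..2*pi} (\<lambda>\<theta>. g (cis \<theta>) * cis (of_int m * \<theta>)) + integral {0..2*pi} (\<lambda>\<theta>. h (cis \<theta>) * cis (of_int m * \<theta>))"
      unfolding distrib_right using assms
      by (intro Henstock_Kurzweil_Integration.integral_add integrable_continuous_real continuous_intros circle_continuous)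
        (auto simp: fourier_null_def)
    then show ?thesis using assms by (simp add: fourier_null_def)
  qed
  then show ?thesis using assms by (auto simp: fourier_null_def intro!: continuous_intros)
qed

lemma fourier_null_cmult:
  assumes "fourier_null h"
  shows "fourier_null (\<lambda>z. a * h z)"
  using assms by (auto simp: fourier_null_def mult.assoc intro!: continuous_intros)

lemma fourier_null_shift:
  assumes "fourier_null h"
  shows "fourier_null (\<lambda>z. z * h z)" "fourier_null (\<lambda>z. cnj z * h z)"
proof -
  have 1: "cis \<theta> * h (cis \<theta>) * cis (of_int m * \<theta>) = h (cis \<theta>) * cis (of_int (m + 1) * \<theta>)" for m \<theta>
    by (simp add: cis_mult algebra_simps)
  have 2: "cnj (cis \<theta>) * h (cis \<theta>) * cis (of_int m * \<theta>) = h (cis \<theta>) * cis (of_int (m - 1) * \<theta>)" for m \<theta>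
    by (simp add: cis_cnj cis_mult algebra_simps)
  have z: "integral {0..2*pi} (\<lambda>\<theta>. h (cis \<theta>) * cis (of_int m * \<theta>)) = 0" for m
    using assms by (simp add: fourier_null_def)
  show "fourier_null (\<lambda>z. z * h z)" "fourier_null (\<lambda>z. cnj z * h z)"
    unfolding fourier_null_def 1 2 z using assms by (auto simp: fourier_null_def intro!: continuous_intros)
qed

text \<open>The coordinate functions of the plane are combinations of \<open>z\<close> and \<open>cnj z\<close> on the circle.\<close>

lemma fourier_null_real_polynomial:
  assumes "real_polynomial_function p" "fourier_null h"
  shows "fourier_null (\<lambda>z. of_real (p z) * h z)"
  using assms
proof (induction arbitrary: h rule: real_polynomial_function.induct)
  case (linear f)
  interpret f: bounded_linear f by fact
  have "of_real (f z) * h z = of_real (f 1) / 2 * (z * h z + cnj z * h z) + of_real (f \<i>) / (2 * \<i>) * (z * h z + (-1) * (cnj z * h z))" for z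
  proof -
    have "z = Re z *\<^sub>R 1 + Im z *\<^sub>R \<i>" by (simp add: complex_eq_iff)
    then have "f z = Re z * f 1 + Im z * f \<i>"
      by (metis f.add f.scaleR real_scaleR_def)
    then have fz: "of_real (f z) = of_real (Re z) * of_real (f 1) + complex_of_real (Im z) * of_real (f \<i>)" by simp
    have R: "of_real (Re z) = (z + cnj z) / 2" by (simp add: complex_eq_iff)
    have I: "of_real (Im z) = (z - cnj z) / (2 * \<i>)" by (simp add: complex_eq_iff)
    show ?thesis unfolding fz R I by (simp add: field_simps)
  qed
  moreover have "fourier_null (\<lambda>z. of_real (f 1) / 2 * (z * h z + cnj z * h z) + of_real (f \<i>) / (2 * \<i>) * (z * h z + (-1) * (cnj z * h z)))"
    using linear.prems by (intro fourier_null_add fourier_null_cmult fourier_null_shift)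
  ultimately show ?case by simp
next
  case (const c)
  then show ?case by (rule fourier_null_cmult)
next
  case (add f g)
  have "fourier_null (\<lambda>z. of_real (f z) * h z + of_real (g z) * h z)"
    by (intro fourier_null_add add)
  then show ?case by (simp add: distrib_right)
next
  case (mult f g)
  have "fourier_null (\<lambda>z. of_real (f z) * (of_real (g z) * h z))" by (intro mult)
  then show ?case by (simp add: mult.assoc)
qed

text \<open>By Stone-Weierstrass there are polynomials close to \<open>cnj h\<close>; as \<open>h\<close> is orthogonal to polynomials, the
  integral of \<open>\<bar>h\<bar>\<^sup>2\<close> vanishes.\<close>

lemma fourier_null_imp_zero:
  assumes h: "fourier_null h"
  shows "h (cis \<theta>) = 0"
proof -
  have hc: "continuous_on (sphere 0 1) h" using h by (simp add: fourier_null_def)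
  obtain B where "\<forall>y\<in>h ` sphere 0 1. norm y \<le> B"
    using compact_imp_bounded[OF compact_continuous_image[OF hc compact_sphere]] unfolding bounded_iff by blast
  then have B: "norm (h (cis t)) \<le> B" for t by auto
  have B0: "B \<ge> 0" using order_trans[OF norm_ge_zero B[of 0]] .
  let ?I = "integral {0..2*pi} (\<lambda>t. (norm (h (cis t)))\<^sup>2)"
  have cn: "continuous_on {0..2*pi} (\<lambda>t. (norm (h (cis t)))\<^sup>2)"
    by (intro continuous_intros circle_continuous[OF hc])
  have I0: "?I \<ge> 0" by (intro Henstock_Kurzweil_Integration.integral_nonneg integrable_continuous_real cn) auto
  have bound: "?I \<le> B * e * (2 * pi)" if e: "e > 0" for e
  proof -
    obtain g where g: "polynomial_function g" "\<And>z. z \<in> sphere 0 1 \<Longrightarrow> norm (cnj (h z) - g z) < e"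
      using Stone_Weierstrass_polynomial_function[of "sphere 0 1" "\<lambda>z. cnj (h z)" e] hc e
      by (auto intro: continuous_intros)
    have "fourier_null (\<lambda>z. of_real (Re (g z)) * h z + \<i> * (of_real (Im (g z)) * h z))"
    proof (intro fourier_null_add fourier_null_cmult fourier_null_real_polynomial h)
      show "real_polynomial_function (\<lambda>z. Re (g z))" "real_polynomial_function (\<lambda>z. Im (g z))"
        using g(1) bounded_linear_Re bounded_linear_Im unfolding polynomial_function_def o_def by blast+
    qed
    moreover have "of_real (Re (g z)) * h z + \<i> * (of_real (Im (g z)) * h z) = g z * h z" for z
      by (subst (3) complex_eq[of "g z"]) (simp add: algebra_simps)
    ultimately have gh: "fourier_null (\<lambda>z. g z * h z)" by simp
    then have g0: "integral {0..2*pi} (\<lambda>t. g (cis t) * h (cis t)) = 0"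
      unfolding fourier_null_def by (auto dest: spec[of _ 0])
    have gc: "continuous_on (sphere 0 1) (\<lambda>z. g z * h z)" using gh by (simp add: fourier_null_def)
    have "integral {0..2*pi} (complex_of_real \<circ> (\<lambda>t. (norm (h (cis t)))\<^sup>2)) = of_real ?I"
      by (rule integral_linear[OF _ bounded_linear_of_real]) (intro integrable_continuous_real cn)
    then have "of_real ?I = integral {0..2*pi} (\<lambda>t. complex_of_real ((norm (h (cis t)))\<^sup>2))"
      by (simp add: o_def)
    also have "\<dots> = integral {0..2*pi} (\<lambda>t. h (cis t) * cnj (h (cis t)))"
      by (simp only: complex_norm_square)
    also have "\<dots> = integral {0..2*pi} (\<lambda>t. h (cis t) * cnj (h (cis t))) - integral {0..2*pi} (\<lambda>t. g (cis t) * h (cis t))"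
      by (simp add: g0)
    also have "\<dots> = integral {0..2*pi} (\<lambda>t. h (cis t) * cnj (h (cis t)) - g (cis t) * h (cis t))"
      by (intro Henstock_Kurzweil_Integration.integral_diff[symmetric] integrable_continuous_real continuous_intros circle_continuous[OF hc]
          circle_continuous[OF gc])
    finally have "norm (complex_of_real ?I) = norm (integral {0..2*pi} (\<lambda>t. h (cis t) * cnj (h (cis t)) - g (cis t) * h (cis t)))"
      by (rule arg_cong)
    then have "?I = norm (integral {0..2*pi} (\<lambda>t. h (cis t) * cnj (h (cis t)) - g (cis t) * h (cis t)))"
      unfolding norm_of_real abs_of_nonneg[OF I0] .
    also have "\<dots> \<le> B * e * (2 * pi - 0)"
    proof (rule integral_bound)
      show "continuous_on {0..2*pi} (\<lambda>t. h (cis t) * cnj (h (cis t)) - g (cis t) * h (cis t))"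
        by (intro continuous_intros circle_continuous[OF hc] circle_continuous[OF gc])
      fix t
      have "h (cis t) * cnj (h (cis t)) - g (cis t) * h (cis t) = h (cis t) * (cnj (h (cis t)) - g (cis t))" by (simp add: algebra_simps)
      also have "norm \<dots> \<le> B * e" unfolding norm_mult using B g(2)[of "cis t"] B0 by (intro mult_mono) auto
      finally show "norm (h (cis t) * cnj (h (cis t)) - g (cis t) * h (cis t)) \<le> B * e" .
    qed simp
    finally show ?thesis by simp
  qed
  have "?I \<le> 0"
  proof (rule field_le_epsilon)
    fix e :: real assume e: "e > 0"
    have "?I \<le> B * (e / ((B + 1) * (2 * pi))) * (2 * pi)" using B0 e by (intro bound) auto
    also have "\<dots> = e * (B / (B + 1))" by simp
    also have "\<dots> \<le> 0 + e" using B0 e by (simp add: field_simps)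
    finally show "?I \<le> 0 + e" .
  qed
  then have "?I = 0" using I0 by simp
  then have z: "\<forall>t\<in>{0..2*pi}. (norm (h (cis t)))\<^sup>2 = 0"
    using integral_eq_0_iff[OF cn] by auto
  define a where "a = Arg2pi (cis \<theta>)"
  have "a \<in> {0..2*pi}" using Arg2pi[of "cis \<theta>"] by (simp add: a_def)
  moreover have "cis \<theta> = cis a"
    using Arg2pi[of "cis \<theta>"] unfolding is_Arg_def a_def cis_conv_exp[symmetric] by simp
  ultimately show ?thesis using z by simp
qed

section \<open>Energy of a mode\<close>

text \<open>The modulus of \<open>helmholtz_mode\<close>, up to sign, at squared radius \<open>s\<close>.\<close>

definition mode_radius :: "real \<Rightarrow> nat \<Rightarrow> real \<Rightarrow> real"
  where "mode_radius c n s = sqrt s ^ n * (fact n * bessel_clifford c n s)"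

lemma mode_radius_continuous: "continuous_on S (mode_radius c n)"
  unfolding mode_radius_def by (intro continuous_intros)

lemma helmholtz_mode_polar:
  assumes s: "s \<ge> 0"
  shows "helmholtz_mode c m (of_real (sqrt s) * cis \<theta>) = of_real (mode_radius c (nat \<bar>m\<bar>) s) * cis (of_int m * \<theta>)"
proof -
  have n: "(norm (of_real (sqrt s) * cis \<theta>))\<^sup>2 = s" using s by (simp add: norm_mult)
  show ?thesis
  proof (cases "m \<ge> 0")
    case True
    then have "real (nat \<bar>m\<bar>) * \<theta> = of_int m * \<theta>" by simp
    then have "cis \<theta> ^ nat \<bar>m\<bar> = cis (of_int m * \<theta>)" unfolding Complex.DeMoivre by (rule arg_cong)
    then show ?thesis using True
      unfolding helmholtz_mode_def n mode_radius_def bessel_clifford_of_real by (simp add: power_mult_distrib)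
  next
    case False
    then have "real (nat \<bar>m\<bar>) * (- \<theta>) = of_int m * \<theta>" by simp
    then have "cis (- \<theta>) ^ nat \<bar>m\<bar> = cis (of_int m * \<theta>)" unfolding Complex.DeMoivre by (rule arg_cong)
    then show ?thesis using False
      unfolding helmholtz_mode_def n mode_radius_def bessel_clifford_of_real by (simp add: power_mult_distrib cis_cnj)
  qed
qed

text \<open>For large order the mode is close to the harmonic function \<open>z ^ n\<close>.\<close>

lemma scaled_bessel_clifford_near_1:
  assumes c: "c > 0" and s: "0 \<le> s" "s \<le> T"
  shows "\<bar>fact n * bessel_clifford c n s - 1\<bar> \<le> c * exp (c * T) / real (Suc n) * T"
proof -
  have "norm (fact n * bessel_clifford c n s - fact n * bessel_clifford c n 0) \<le> c * exp (c * T) / real (Suc n) * norm (s - 0)"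
  proof (rule field_differentiable_bound[of "{0..T}"])
    fix x assume x: "x \<in> {0..T}"
    show "((\<lambda>s. fact n * bessel_clifford c n s) has_field_derivative fact n * (- c * bessel_clifford c (Suc n) x)) (at x within {0..T})"
      using DERIV_cmult[OF bessel_clifford_deriv[of c n x], of "fact n"] by (simp add: has_field_derivative_at_within)
    have "norm (fact n * (- c * bessel_clifford c (Suc n) x)) = fact n * c * norm (bessel_clifford c (Suc n) x)"
      using c by (simp add: abs_mult)
    also have "\<dots> \<le> fact n * c * (exp (c * x) / fact (Suc n))"
      using bessel_clifford_norm_le[of c "Suc n" x] c x by (intro mult_left_mono) auto
    also have "\<dots> = c * exp (c * x) / real (Suc n)" by (simp del: of_nat_Suc)
    also have "\<dots> \<le> c * exp (c * T) / real (Suc n)"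
      using c x by (intro divide_right_mono mult_left_mono) auto
    finally show "norm (fact n * (- c * bessel_clifford c (Suc n) x)) \<le> c * exp (c * T) / real (Suc n)" .
  qed (use s in auto)
  also have "\<dots> \<le> c * exp (c * T) / real (Suc n) * T"
    using s c by (intro mult_left_mono) auto
  finally show ?thesis by (simp add: bessel_clifford_0)
qed

text \<open>For large \<open>n\<close> the integrand is at least a quarter of \<open>s ^ n\<close>, whose integral beats \<open>q ^ (2 * n)\<close>; each of the
  finitely many other integrals is positive because the integrand is positive near the origin.\<close>

lemma mode_energy_lower_bound:
  assumes c: "c > 0" and q: "0 < q" "q\<^sup>2 < T"
  shows "\<exists>\<delta>>0. \<forall>n. \<delta> * q ^ (2 * n) \<le> integral {0..T} (\<lambda>s. (mode_radius c n s)\<^sup>2)"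
proof -
  have T: "T > 0" using q by (meson less_trans zero_less_power)
  let ?I = "\<lambda>n. integral {0..T} (\<lambda>s. (mode_radius c n s)\<^sup>2)"
  have cont: "continuous_on S (\<lambda>s. (mode_radius c n s)\<^sup>2)" for n S
    by (intro continuous_intros mode_radius_continuous)
  have pos: "?I n > 0" for n
  proof -
    have "?I n \<ge> 0" by (intro Henstock_Kurzweil_Integration.integral_nonneg integrable_continuous_real cont) auto
    moreover have "?I n \<noteq> 0"
    proof
      assume "?I n = 0"
      then have z: "\<forall>s\<in>{0..T}. (mode_radius c n s)\<^sup>2 = 0"
        using integral_eq_0_iff[OF cont T] by auto
      have z': "bessel_clifford c n s = 0" if "0 < s" "s < T" for s
        using z[rule_format, of s] that by (simp add: mode_radius_def)
      have "(bessel_clifford c n \<longlongrightarrow> bessel_clifford c n 0) (at_right (0::real))"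
        using DERIV_isCont[OF bessel_clifford_deriv, of "0::real" c n] by (simp add: isCont_def filterlim_at_split)
      moreover have "\<forall>\<^sub>F s in at_right (0::real). bessel_clifford c n s = 0"
        unfolding eventually_at_right_field using z' T by blast
      ultimately have "((\<lambda>s::real. 0::real) \<longlongrightarrow> bessel_clifford c n 0) (at_right 0)"
        by (rule Lim_transform_eventually)
      then have "bessel_clifford c n (0::real) = 0"
        by (simp add: tendsto_const_iff)
      then show False by (simp add: bessel_clifford_0)
    qed
    ultimately show ?thesis by simp
  qed
  define n0 where "n0 = nat \<lceil>2 * (c * exp (c * T) * T)\<rceil>"
  have big: "(T - q\<^sup>2) / 4 * q ^ (2 * n) \<le> ?I n" if n: "n \<ge> n0" for n
  proof -
    have "2 * (c * exp (c * T) * T) \<le> real n0" unfolding n0_def by linarith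
    then have n': "2 * (c * exp (c * T) * T) \<le> real (Suc n)" using n by linarith
    have half: "fact n * bessel_clifford c n s \<ge> 1 / 2" if "0 \<le> s" "s \<le> T" for s
    proof -
      have "c * exp (c * T) / real (Suc n) * T \<le> 1 / 2" using n' by (simp add: field_simps)
      then show ?thesis using scaled_bessel_clifford_near_1[OF c that, of n] by linarith
    qed
    have "(T - q\<^sup>2) / 4 * q ^ (2 * n) = integral {q\<^sup>2..T} (\<lambda>s. q ^ (2 * n) / 4)"
      using q by simp
    also have "\<dots> \<le> integral {q\<^sup>2..T} (\<lambda>s. (mode_radius c n s)\<^sup>2)"
    proof (intro Henstock_Kurzweil_Integration.integral_le integrable_continuous_real cont)
      fix s assume s: "s \<in> {q\<^sup>2..T}"
      then have s0: "0 \<le> s" using order_trans[OF zero_le_power2, of q s] by simp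
      have "q ^ (2 * n) / 4 = (q\<^sup>2) ^ n * (1 / 2)\<^sup>2" by (simp add: power_mult power2_eq_square)
      also have "\<dots> \<le> s ^ n * (fact n * bessel_clifford c n s)\<^sup>2"
        using s s0 half[of s] by (intro mult_mono power_mono) auto
      also have "\<dots> = (mode_radius c n s)\<^sup>2"
        using s0 by (simp add: mode_radius_def power_mult_distrib real_sqrt_power[symmetric])
      finally show "q ^ (2 * n) / 4 \<le> (mode_radius c n s)\<^sup>2" .
    qed auto
    also have "\<dots> \<le> ?I n"
      using q by (intro integral_subset_le integrable_continuous_real cont) auto
    finally show ?thesis .
  qed
  define \<delta> where "\<delta> = Min (insert ((T - q\<^sup>2) / 4) ((\<lambda>n. ?I n / q ^ (2 * n)) ` {..n0}))"
  show ?thesis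
  proof (intro exI[of _ \<delta>] conjI allI)
    show "\<delta> > 0" unfolding \<delta>_def using pos q by (subst Min_gr_iff) auto
    fix n
    show "\<delta> * q ^ (2 * n) \<le> ?I n"
    proof (cases "n \<ge> n0")
      case True
      have "\<delta> \<le> (T - q\<^sup>2) / 4" unfolding \<delta>_def by (intro Min_le) auto
      then have "\<delta> * q ^ (2 * n) \<le> (T - q\<^sup>2) / 4 * q ^ (2 * n)" using q by (intro mult_right_mono) auto
      then show ?thesis using big[OF True] by linarith
    next
      case False
      then have "\<delta> \<le> ?I n / q ^ (2 * n)" unfolding \<delta>_def by (intro Min_le) auto
      then show ?thesis using q by (simp add: field_simps)
    qed
  qed
qed

lemma integral_norm_square_bound:
  fixes f :: "real \<Rightarrow> complex"
  assumes f: "continuous_on {0..2*pi} f"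
  shows "(norm (integral {0..2*pi} f))\<^sup>2 \<le> 2 * pi * integral {0..2*pi} (\<lambda>t. (norm (f t))\<^sup>2)"
proof -
  define A where "A = integral {0..2*pi} (\<lambda>t. norm (f t))"
  define B where "B = integral {0..2*pi} (\<lambda>t. (norm (f t))\<^sup>2)"
  have "norm (integral {0..2*pi} f) \<le> A"
    unfolding A_def by (intro integral_norm_bound_integral integrable_continuous_real continuous_intros f) auto
  then have 1: "(norm (integral {0..2*pi} f))\<^sup>2 \<le> A\<^sup>2" by (intro power_mono) auto
  define a where "a = A / (2 * pi)"
  have "0 \<le> integral {0..2*pi} (\<lambda>t. (norm (f t) - a)\<^sup>2)"
    by (intro Henstock_Kurzweil_Integration.integral_nonneg integrable_continuous_real continuous_intros f) auto
  also have "\<dots> = integral {0..2*pi} (\<lambda>t. (norm (f t))\<^sup>2 - 2 * a * norm (f t) + a\<^sup>2)"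
    by (simp add: power2_diff algebra_simps)
  also have "\<dots> = B - 2 * a * A + a\<^sup>2 * (2 * pi)"
  proof -
    have i: "(\<lambda>t. (norm (f t))\<^sup>2) integrable_on {0..2*pi}" "(\<lambda>t. 2 * a * norm (f t)) integrable_on {0..2*pi}"
      by (intro integrable_continuous_real continuous_intros f)+
    have "integral {0..2*pi} (\<lambda>t. (norm (f t))\<^sup>2 - 2 * a * norm (f t) + a\<^sup>2)
        = integral {0..2*pi} (\<lambda>t. (norm (f t))\<^sup>2 - 2 * a * norm (f t)) + integral {0..2*pi} (\<lambda>t. a\<^sup>2)"
      by (intro Henstock_Kurzweil_Integration.integral_add Henstock_Kurzweil_Integration.integrable_diff i) auto
    also have "integral {0..2*pi} (\<lambda>t. (norm (f t))\<^sup>2 - 2 * a * norm (f t)) = B - 2 * a * A"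
      unfolding Henstock_Kurzweil_Integration.integral_diff[OF i] by (simp add: A_def B_def)
    finally show ?thesis by simp
  qed
  finally have "A\<^sup>2 / (2 * pi) \<le> B" by (simp add: a_def power2_eq_square field_simps)
  then have "A\<^sup>2 \<le> 2 * pi * B" by (simp add: field_simps)
  then show ?thesis using 1 by (simp add: B_def)
qed

text \<open>The left hand side is twice the squared norm over the disk, in polar coordinates.\<close>

lemma circle_L2_le:
  assumes u: "helmholtz_solution U k u" and r: "r \<ge> 0" and U: "cball 0 r \<subseteq> U"
  shows "integral {0..r\<^sup>2} (\<lambda>s. integral {0..2*pi} (\<lambda>\<theta>. (norm (u (circle_point s \<theta>)))\<^sup>2)) \<le> 2 * (L2norm U u)\<^sup>2"
proof -
  have "in_H1 U u" using u by (simp add: helmholtz_solution_def weak_eigen_equation_def)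
  then have sq: "set_integrable lebesgue U (\<lambda>x. (norm (u x))\<^sup>2)"
    by (auto simp: in_H1_def is_H1_gradient_def square_integrable_def)
  have "continuous_on U u" using u by (simp add: helmholtz_solution_def)
  then have uc: "continuous_on (cball 0 r) u" using U continuous_on_subset by blast
  have nc: "continuous_on (cball 0 r) (\<lambda>x. (norm (u x))\<^sup>2)" by (intro continuous_intros uc)
  let ?J = "(\<integral>x. indicator (cball 0 r) x *\<^sub>R (norm (u x))\<^sup>2 \<partial>lborel)"
  let ?g = "\<lambda>s. integral {0..2*pi} (\<lambda>\<theta>. (norm (u (circle_point s \<theta>)))\<^sup>2)"
  have sub: "circle_point s \<theta> \<in> cball 0 r" if "s \<in> {0..r\<^sup>2}" for s \<theta>
    using that r by (simp add: circle_point_norm real_le_lsqrt)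
  have "?J = (\<integral>x. indicator (cball 0 r) x *\<^sub>R (norm (u x))\<^sup>2 \<partial>lebesgue)"
    by (intro integral_completion[symmetric]) (simp add: borel_measurable_continuous_on_indicator[OF _ nc] del: real_scaleR_def)
  also have "\<dots> \<le> (\<integral>x. indicator U x *\<^sub>R (norm (u x))\<^sup>2 \<partial>lebesgue)"
    using sq U unfolding set_integrable_def by (intro integral_mono') (auto simp: indicator_def)
  also have "\<dots> = (L2norm U u)\<^sup>2"
    unfolding L2norm_def set_lebesgue_integral_def
    by (intro real_sqrt_pow2[symmetric] Bochner_Integration.integral_nonneg_AE AE_I2) (auto simp: indicator_def)
  finally have J: "?J \<le> (L2norm U u)\<^sup>2" .
  have gcont: "continuous_on {0..r\<^sup>2} (\<lambda>s. integral {0..2*pi} (\<lambda>\<theta>. complex_of_real ((norm (u (circle_point s \<theta>)))\<^sup>2)))"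
    by (rule continuous_on_circle_average[OF _ r]) (intro continuous_intros uc)
  have cr: "continuous_on {0..2*pi} (\<lambda>\<theta>. (norm (u (circle_point s \<theta>)))\<^sup>2)" if "s \<in> {0..r\<^sup>2}" for s
    by (rule continuous_on_compose2[OF nc]) (use sub[OF that] in \<open>auto intro!: continuous_intros\<close>)
  have ofr: "integral {0..2*pi} (\<lambda>\<theta>. complex_of_real ((norm (u (circle_point s \<theta>)))\<^sup>2)) = of_real (?g s)" if "s \<in> {0..r\<^sup>2}" for s
  proof -
    have "integral {0..2*pi} (complex_of_real \<circ> (\<lambda>\<theta>. (norm (u (circle_point s \<theta>)))\<^sup>2)) = of_real (?g s)"
      by (rule integral_linear[OF integrable_continuous_real[OF cr[OF that]] bounded_linear_of_real])
    then show ?thesis by (simp add: o_def)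
  qed
  have gc: "continuous_on {0..r\<^sup>2} ?g"
  proof -
    have "continuous_on {0..r\<^sup>2} (\<lambda>s. Re (integral {0..2*pi} (\<lambda>\<theta>. complex_of_real ((norm (u (circle_point s \<theta>)))\<^sup>2))))"
      by (intro continuous_intros gcont)
    then show ?thesis by (rule continuous_on_eq) (simp only: ofr Re_complex_of_real)
  qed
  have "complex_of_real ?J = (\<integral>x. indicator (cball 0 r) x *\<^sub>R complex_of_real ((norm (u x))\<^sup>2) \<partial>lborel)"
    unfolding integral_complex_of_real[symmetric] by (intro Bochner_Integration.integral_cong) (auto simp: indicator_def)
  also have "\<dots> = integral {0..r\<^sup>2} (\<lambda>s. integral {0..2*pi} (\<lambda>\<theta>. complex_of_real ((norm (u (circle_point s \<theta>)))\<^sup>2))) / 2"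
    by (rule integral_polar[OF _ r]) (intro continuous_intros uc)
  also have "integral {0..r\<^sup>2} (\<lambda>s. integral {0..2*pi} (\<lambda>\<theta>. complex_of_real ((norm (u (circle_point s \<theta>)))\<^sup>2)))
      = integral {0..r\<^sup>2} (complex_of_real \<circ> ?g)"
    by (intro Henstock_Kurzweil_Integration.integral_cong) (simp only: ofr o_def)
  also have "\<dots> = of_real (integral {0..r\<^sup>2} ?g)"
    by (rule integral_linear[OF integrable_continuous_real[OF gc] bounded_linear_of_real])
  finally have "complex_of_real (2 * ?J) = of_real (integral {0..r\<^sup>2} ?g)" by (simp add: mult.commute del: real_scaleR_def)
  then have "2 * ?J = integral {0..r\<^sup>2} ?g" by (simp only: of_real_eq_iff)
  then show ?thesis using J by linarith
qed

section \<open>Expansion of a Helmholtz solution into modes\<close>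

text \<open>The energy of mode \<open>m\<close> in the disk is at most that of \<open>u\<close> (Cauchy-Schwarz on each circle), and it is
  \<open>(norm (C m))\<^sup>2\<close> times the energy of the normalized mode. The latter is of order
  \<open>r ^ (2 * \<bar>m\<bar>) / \<bar>m\<bar>\<close> in a disk of radius \<open>r\<close>, hence the passage from \<open>\<rho>\<close> to a smaller \<open>q\<close>.\<close>

lemma helmholtz_coeff_bound:
  assumes k: "k > 0" and q: "0 < q" "q < \<rho>"
  shows "\<exists>K>0. \<forall>U u. helmholtz_solution U k u \<longrightarrow> ball 0 \<rho> \<subseteq> U \<longrightarrow>
    (\<exists>C :: int \<Rightarrow> complex. (\<forall>m s. 0 \<le> s \<and> s < \<rho>\<^sup>2 \<longrightarrow> fourier_coeff u m s = of_real (2 * pi) * C m * of_real (mode_radius (k\<^sup>2 / 4) (nat \<bar>m\<bar>) s)) \<and>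
         (\<forall>m. norm (C m) \<le> K * L2norm U u / q ^ nat \<bar>m\<bar>))"
proof -
  define c where "c = k\<^sup>2 / 4"
  have c: "c > 0" using k by (simp add: c_def)
  define r where "r = (q + \<rho>) / 2"
  have r: "q < r" "r < \<rho>" "0 < r" using q by (auto simp: r_def)
  have "q\<^sup>2 < r\<^sup>2" using q r by (intro power_strict_mono) auto
  from mode_energy_lower_bound[OF c q(1) this] obtain \<delta> where \<delta>: "\<delta> > 0"
    "\<And>n. \<delta> * q ^ (2 * n) \<le> integral {0..r\<^sup>2} (\<lambda>s. (mode_radius c n s)\<^sup>2)" by blast
  define K where "K = sqrt (1 / \<delta>)"
  have K: "K > 0" using \<delta> by (simp add: K_def)
  show ?thesis
  proof (intro exI[of _ K] conjI K allI impI)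
    fix U u assume u: "helmholtz_solution U k u" and U: "ball 0 \<rho> \<subseteq> U"
    have rho: "\<rho> > 0" using q by simp
    have "\<exists>D. \<forall>s. 0 \<le> s \<and> s < \<rho>\<^sup>2 \<longrightarrow> fourier_coeff u m s = D * of_real (mode_radius c (nat \<bar>m\<bar>) s)" for m
      using helmholtz_fourier_coeff[OF u k U rho, of m] by (simp only: mode_radius_def c_def)
    then obtain D where D: "\<And>m s. 0 \<le> s \<Longrightarrow> s < \<rho>\<^sup>2 \<Longrightarrow> fourier_coeff u m s = D m * of_real (mode_radius c (nat \<bar>m\<bar>) s)"
      by metis
    have "cball 0 r \<subseteq> ball (0::real^2) \<rho>" using r by (auto simp: subset_eq)
    then have sub: "cball 0 r \<subseteq> U" using U by (rule order_trans)
    have "continuous_on U u" using u by (simp add: helmholtz_solution_def)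
    then have uc: "continuous_on (cball 0 r) u" using sub continuous_on_subset by blast
    have rr: "r\<^sup>2 < \<rho>\<^sup>2" using r by (intro power_strict_mono) auto
    let ?g = "\<lambda>s. integral {0..2*pi} (\<lambda>\<theta>. (norm (u (circle_point s \<theta>)))\<^sup>2)"
    have bound: "norm (D m) \<le> 2 * pi * (K * L2norm U u / q ^ nat \<bar>m\<bar>)" for m
    proof -
      define n where "n = nat \<bar>m\<bar>"
      have nc: "continuous_on (cball 0 r) (\<lambda>x. complex_of_real ((norm (u x))\<^sup>2))" by (intro continuous_intros uc)
      have cr: "continuous_on {0..2*pi} (\<lambda>\<theta>. u (circle_point s \<theta>))" if "s \<in> {0..r\<^sup>2}" for s
        by (rule continuous_on_compose2[OF uc]) (use that r in \<open>auto intro!: continuous_intros simp: circle_point_norm real_le_lsqrt\<close>)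
      have gc: "continuous_on {0..r\<^sup>2} ?g"
      proof -
        have "continuous_on {0..r\<^sup>2} (\<lambda>s. Re (integral {0..2*pi} (\<lambda>\<theta>. complex_of_real ((norm (u (circle_point s \<theta>)))\<^sup>2))))"
          using r by (intro continuous_intros continuous_on_circle_average[OF nc]) auto
        then show ?thesis
        proof (rule continuous_on_eq)
          fix s assume s: "s \<in> {0..r\<^sup>2}"
          have "integral {0..2*pi} (complex_of_real \<circ> (\<lambda>\<theta>. (norm (u (circle_point s \<theta>)))\<^sup>2)) = of_real (?g s)"
            by (rule integral_linear[OF integrable_continuous_real bounded_linear_of_real]) (intro continuous_intros cr[OF s])
          then have "integral {0..2*pi} (\<lambda>\<theta>. complex_of_real ((norm (u (circle_point s \<theta>)))\<^sup>2)) = of_real (?g s)"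
            by (simp only: o_def)
          then show "Re (integral {0..2*pi} (\<lambda>\<theta>. complex_of_real ((norm (u (circle_point s \<theta>)))\<^sup>2))) = ?g s"
            by (simp only: Re_complex_of_real)
        qed
      qed
      have "(norm (D m))\<^sup>2 * (\<delta> * q ^ (2 * n)) \<le> (norm (D m))\<^sup>2 * integral {0..r\<^sup>2} (\<lambda>s. (mode_radius c n s)\<^sup>2)"
        by (intro mult_left_mono \<delta>) auto
      also have "\<dots> = integral {0..r\<^sup>2} (\<lambda>s. (norm (D m))\<^sup>2 * (mode_radius c n s)\<^sup>2)" by simp
      also have "\<dots> \<le> integral {0..r\<^sup>2} (\<lambda>s. 2 * pi * ?g s)"
      proof (intro Henstock_Kurzweil_Integration.integral_le integrable_continuous_real continuous_intros gc mode_radius_continuous)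
        fix s assume s: "s \<in> {0..r\<^sup>2}"
        have "(norm (D m))\<^sup>2 * (mode_radius c n s)\<^sup>2 = (norm (fourier_coeff u m s))\<^sup>2"
          using D[of s m] s rr by (simp add: norm_mult power_mult_distrib n_def)
        also have "\<dots> \<le> 2 * pi * integral {0..2*pi} (\<lambda>\<theta>. (norm (u (circle_point s \<theta>) * cis (- (of_int m * \<theta>))))\<^sup>2)"
          unfolding fourier_coeff_def
          by (intro integral_norm_square_bound continuous_intros cr[OF s])
        also have "\<dots> = 2 * pi * ?g s" by (simp add: norm_mult)
        finally show "(norm (D m))\<^sup>2 * (mode_radius c n s)\<^sup>2 \<le> 2 * pi * ?g s" .
      qed
      also have "\<dots> = 2 * pi * integral {0..r\<^sup>2} ?g" by simp
      also have "\<dots> \<le> 2 * pi * (2 * (L2norm U u)\<^sup>2)"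
        using circle_L2_le[OF u _ sub] r by (intro mult_left_mono) auto
      also have "\<dots> \<le> (2 * pi)\<^sup>2 * (L2norm U u)\<^sup>2"
      proof -
        have "4 * pi \<le> (2 * pi)\<^sup>2" using pi_ge_two by (simp add: power2_eq_square)
        then show ?thesis using mult_right_mono[of "4 * pi" "(2*pi)\<^sup>2" "(L2norm U u)\<^sup>2"] by simp
      qed
      finally have "(norm (D m))\<^sup>2 \<le> (2 * pi * (K * L2norm U u / q ^ n))\<^sup>2"
        using \<delta>(1) q by (simp add: K_def power_mult_distrib power_divide field_simps flip: power_mult)
      moreover have "0 \<le> 2 * pi * (K * L2norm U u / q ^ n)"
        using K q by (simp add: L2norm_def set_lebesgue_integral_def Bochner_Integration.integral_nonneg_AE)
      ultimately show ?thesis unfolding n_def by (rule power2_le_imp_le)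
    qed
    show "\<exists>C :: int \<Rightarrow> complex. (\<forall>m s. 0 \<le> s \<and> s < \<rho>\<^sup>2 \<longrightarrow> fourier_coeff u m s = of_real (2 * pi) * C m * of_real (mode_radius (k\<^sup>2 / 4) (nat \<bar>m\<bar>) s)) \<and>
         (\<forall>m. norm (C m) \<le> K * L2norm U u / q ^ nat \<bar>m\<bar>)"
    proof (rule exI[of _ "\<lambda>m. D m / of_real (2 * pi)"], intro conjI allI impI)
      fix m s show "0 \<le> s \<and> s < \<rho>\<^sup>2 \<Longrightarrow> fourier_coeff u m s = of_real (2 * pi) * (D m / of_real (2 * pi)) * of_real (mode_radius (k\<^sup>2 / 4) (nat \<bar>m\<bar>) s)"
        using D[of s m] by (simp add: c_def)
      show "norm (D m / of_real (2 * pi)) \<le> K * L2norm U u / q ^ nat \<bar>m\<bar>"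
        using bound[of m] by (simp add: norm_divide norm_mult field_simps)
    qed
  qed
qed

text \<open>The series converges uniformly to a continuous function with the same Fourier coefficients as \<open>g\<close>.\<close>

lemma fourier_series_on_circle:
  fixes g :: "complex \<Rightarrow> complex" and a :: "int \<Rightarrow> complex"
  assumes g: "continuous_on (sphere 0 1) g"
    and a: "\<And>m. integral {0..2*pi} (\<lambda>\<theta>. g (cis \<theta>) * cis (- (of_int m * \<theta>))) = of_real (2 * pi) * a m"
    and M: "\<And>m. norm (a m) \<le> M (nat \<bar>m\<bar>)" "summable M"
  shows "((\<lambda>m. a m * cis (of_int m * \<theta>)) has_sum g (cis \<theta>)) UNIV"
proof -
  define e where "e = (\<lambda>m z. if m \<ge> (0::int) then z ^ nat m else cnj z ^ nat (- m))"
  have ec: "continuous_on S (e m)" for S m unfolding e_def by (cases "m \<ge> 0") (auto intro!: continuous_intros)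
  have ecis: "e m (cis t) = cis (of_int m * t)" for m t
  proof (cases "m \<ge> 0")
    case True
    then have "real (nat m) * t = of_int m * t" by simp
    then show ?thesis using True unfolding e_def by (simp add: Complex.DeMoivre)
  next
    case False
    then have "real (nat (- m)) * (- t) = of_int m * t" by simp
    then show ?thesis using False unfolding e_def by (simp add: Complex.DeMoivre cis_cnj)
  qed
  have en: "norm (e m z) = 1" if "z \<in> sphere 0 1" for m z using that by (simp add: e_def norm_power)
  have Mn: "M n \<ge> 0" for n using order_trans[OF norm_ge_zero M(1)[of "int n"]] by simp
  define f where "f = (\<lambda>i z. a (int i) * e (int i) z + a (- int (Suc i)) * e (- int (Suc i)) z)"
  have fb: "norm (f i z) \<le> M i + M (Suc i)" if "z \<in> sphere 0 1" for i z
    unfolding f_def using M(1)[of "int i"] M(1)[of "- int (Suc i)"] en[OF that]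
    by (intro norm_triangle_le add_mono) (simp_all add: norm_mult nat_add_distrib)
  have sM: "summable (\<lambda>i. M i + M (Suc i))" using M(2) by (intro summable_add) (simp_all add: summable_Suc_iff)
  define S where "S = (\<lambda>z. \<Sum>i. f i z)"
  have ul: "uniform_limit (sphere 0 1) (\<lambda>n z. \<Sum>i<n. f i z) S sequentially"
    unfolding S_def by (rule Weierstrass_m_test[OF fb sM])
  have fc: "continuous_on T (\<lambda>z. \<Sum>i<n. f i z)" for n T
    unfolding f_def by (intro continuous_intros ec)
  have Sc: "continuous_on (sphere 0 1) S"
    by (rule uniform_limit_theorem[OF always_eventually ul]) (auto intro: fc)
  have Scoef: "integral {0..2*pi} (\<lambda>t. S (cis t) * cis (- (of_int m * t))) = of_real (2 * pi) * a m" for m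
  proof -
    let ?I = "integral {0..2*pi} (\<lambda>t. S (cis t) * cis (- (of_int m * t)))"
    have part: "integral {0..2*pi} (\<lambda>t. (\<Sum>i<n. f i (cis t)) * cis (- (of_int m * t))) = of_real (2 * pi) * a m" if n: "n > nat \<bar>m\<bar>" for n
    proof -
      have one: "integral {0..2*pi} (\<lambda>t. (a j * e j (cis t)) * cis (- (of_int m * t))) = (if j = m then of_real (2 * pi) * a m else 0)" for j
      proof -
        have "(a j * e j (cis t)) * cis (- (of_int m * t)) = a j * cis (of_int (j - m) * t)" for t
          unfolding ecis by (simp add: cis_mult algebra_simps)
        then have "integral {0..2*pi} (\<lambda>t. (a j * e j (cis t)) * cis (- (of_int m * t))) = a j * integral {0..2*pi} (\<lambda>t. cis (of_int (j - m) * t))"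
          by (simp only: integral_mult_right)
        then show ?thesis unfolding integral_cis by simp
      qed
      have int: "(\<lambda>t. (a j * e j (cis t)) * cis (- (of_int m * t))) integrable_on {0..2*pi}" for j
        by (intro integrable_continuous_real continuous_intros circle_continuous[OF ec])
      have "integral {0..2*pi} (\<lambda>t. (\<Sum>i<n. f i (cis t)) * cis (- (of_int m * t)))
          = integral {0..2*pi} (\<lambda>t. \<Sum>i<n. ((a (int i) * e (int i) (cis t)) * cis (- (of_int m * t)) + (a (- int (Suc i)) * e (- int (Suc i)) (cis t)) * cis (- (of_int m * t))))"
        by (simp only: f_def sum_distrib_right distrib_right)
      also have "\<dots> = (\<Sum>i<n. (integral {0..2*pi} (\<lambda>t. (a (int i) * e (int i) (cis t)) * cis (- (of_int m * t))) + integral {0..2*pi} (\<lambda>t. (a (- int (Suc i)) * e (- int (Suc i)) (cis t)) * cis (- (of_int m * t)))))"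
        by (subst Henstock_Kurzweil_Integration.integral_sum)
          (auto intro!: Henstock_Kurzweil_Integration.integrable_add int sum.cong Henstock_Kurzweil_Integration.integral_add simp del: of_nat_Suc)
      also have "\<dots> = (\<Sum>i<n. (if i = nat m \<and> m \<ge> 0 then of_real (2 * pi) * a m else 0) + (if i = nat (- m - 1) \<and> m < 0 then of_real (2 * pi) * a m else 0))"
        unfolding one by (intro sum.cong refl arg_cong2[where f = "(+)"]) auto
      also have "\<dots> = of_real (2 * pi) * a m"
        using n unfolding sum.distrib by (cases "m \<ge> 0") (auto simp: sum.delta)
      finally show ?thesis .
    qed
    have "norm (?I - of_real (2 * pi) * a m) \<le> \<epsilon> * (2 * pi)" if \<epsilon>: "\<epsilon> > 0" for \<epsilon>
    proof -
      obtain n0 where n0: "\<forall>n\<ge>n0. \<forall>z\<in>sphere 0 1. dist (\<Sum>i<n. f i z) (S z) < \<epsilon>"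
        using uniform_limitD[OF ul \<epsilon>] unfolding eventually_sequentially by blast
      define n where "n = max n0 (Suc (nat \<bar>m\<bar>))"
      have n: "n \<ge> n0" "n > nat \<bar>m\<bar>" by (auto simp: n_def)
      have "?I - of_real (2 * pi) * a m = integral {0..2*pi} (\<lambda>t. S (cis t) * cis (- (of_int m * t)) - (\<Sum>i<n. f i (cis t)) * cis (- (of_int m * t)))"
        unfolding part[OF n(2), symmetric]
        by (intro Henstock_Kurzweil_Integration.integral_diff[symmetric] integrable_continuous_real continuous_intros
            circle_continuous[OF Sc] circle_continuous[OF fc])
      also have "norm \<dots> \<le> \<epsilon> * (2 * pi - 0)"
      proof (rule integral_bound)
        show "continuous_on {0..2*pi} (\<lambda>t. S (cis t) * cis (- (of_int m * t)) - (\<Sum>i<n. f i (cis t)) * cis (- (of_int m * t)))"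
          by (intro continuous_intros circle_continuous[OF Sc] circle_continuous[OF fc])
        fix t
        have "norm ((S (cis t) - (\<Sum>i<n. f i (cis t))) * cis (- (of_int m * t))) \<le> \<epsilon>"
          using n0 n(1) by (simp add: norm_mult dist_norm norm_minus_commute less_imp_le)
        then show "norm (S (cis t) * cis (- (of_int m * t)) - (\<Sum>i<n. f i (cis t)) * cis (- (of_int m * t))) \<le> \<epsilon>"
          by (simp only: left_diff_distrib)
      qed simp
      finally show ?thesis by simp
    qed
    note small = this
    have "norm (?I - of_real (2 * pi) * a m) \<le> 0 + \<epsilon>" if "\<epsilon> > 0" for \<epsilon>
    proof -
      have "\<epsilon> / (2 * pi) > 0" using that by simp
      from small[OF this] show ?thesis by simp
    qed
    then have "norm (?I - of_real (2 * pi) * a m) \<le> 0" by (rule field_le_epsilon)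
    then show ?thesis by simp
  qed
  have "fourier_null (\<lambda>z. g z - S z)"
    unfolding fourier_null_def
  proof (intro conjI allI)
    show "continuous_on (sphere 0 1) (\<lambda>z. g z - S z)" by (intro continuous_intros g Sc)
    fix m :: int
    have "integral {0..2*pi} (\<lambda>t. (g (cis t) - S (cis t)) * cis (of_int m * t))
        = integral {0..2*pi} (\<lambda>t. g (cis t) * cis (- (of_int (- m) * t))) - integral {0..2*pi} (\<lambda>t. S (cis t) * cis (- (of_int (- m) * t)))"
      by (subst Henstock_Kurzweil_Integration.integral_diff[symmetric])
        (auto intro!: integrable_continuous_real continuous_intros circle_continuous[OF g] circle_continuous[OF Sc] simp: left_diff_distrib)
    then show "integral {0..2*pi} (\<lambda>t. (g (cis t) - S (cis t)) * cis (of_int m * t)) = 0"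
      unfolding a Scoef by simp
  qed
  from fourier_null_imp_zero[OF this, of \<theta>] have gS: "g (cis \<theta>) = S (cis \<theta>)" by simp
  show ?thesis unfolding gS
  proof (rule has_sum_int_eq_limit)
    have "(\<lambda>m. norm (a m * cis (of_int m * \<theta>))) summable_on UNIV"
      by (rule Infinite_Sum.abs_summable_on_comparison_test'[OF summable_on_int_nat_abs[OF M(2) Mn]]) (use M(1) in \<open>simp add: norm_mult\<close>)
    then show "(\<lambda>m. a m * cis (of_int m * \<theta>)) summable_on UNIV" by (rule abs_summable_summable)
    have "(\<lambda>n. \<Sum>i<n. f i (cis \<theta>)) \<longlonglongrightarrow> S (cis \<theta>)"
      using tendsto_uniform_limitI[OF ul] by simp
    then show "(\<lambda>n. (\<Sum>m<n. a (int m) * cis (of_int (int m) * \<theta>)) + (\<Sum>m<n. a (- int (Suc m)) * cis (of_int (- int (Suc m)) * \<theta>))) \<longlonglongrightarrow> S (cis \<theta>)"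
      unfolding f_def ecis sum.distrib .
  qed
qed

text \<open>On each circle the Fourier series converges absolutely, by the bound on the coefficients for a
  radius between \<open>q\<close> and \<open>\<rho>\<close>.\<close>

theorem helmholtz_expansion:
  assumes k: "k > 0" and q: "0 < q" "q < \<rho>"
  shows "\<exists>K>0. \<forall>U u. helmholtz_solution U k u \<longrightarrow> ball 0 \<rho> \<subseteq> U \<longrightarrow>
    (\<exists>C. (\<forall>m. norm (C m) \<le> K * L2norm U u / q ^ nat \<bar>m\<bar>) \<and>
      (\<forall>x. norm x < q \<longrightarrow> ((\<lambda>m. C m * helmholtz_mode (k\<^sup>2 / 4) m (plane_complex x)) has_sum u x) UNIV))"
proof -
  define c where "c = k\<^sup>2 / 4"
  have c: "c > 0" using k by (simp add: c_def)
  obtain K where K: "K > 0" and ex: "\<And>U u. helmholtz_solution U k u \<Longrightarrow> ball 0 \<rho> \<subseteq> U \<Longrightarrow>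
    (\<exists>C :: int \<Rightarrow> complex. (\<forall>m s. 0 \<le> s \<and> s < \<rho>\<^sup>2 \<longrightarrow> fourier_coeff u m s = of_real (2 * pi) * C m * of_real (mode_radius c (nat \<bar>m\<bar>) s)) \<and>
         (\<forall>m. norm (C m) \<le> K * L2norm U u / q ^ nat \<bar>m\<bar>))"
    using helmholtz_coeff_bound[OF k q] unfolding c_def by blast
  show ?thesis
  proof (intro exI[of _ K] conjI K allI impI)
    fix U u assume u: "helmholtz_solution U k u" and U: "ball 0 \<rho> \<subseteq> U"
    obtain C :: "int \<Rightarrow> complex" where C1: "\<And>m s. 0 \<le> s \<Longrightarrow> s < \<rho>\<^sup>2 \<Longrightarrow> fourier_coeff u m s = of_real (2 * pi) * C m * of_real (mode_radius c (nat \<bar>m\<bar>) s)"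
      and C2: "\<And>m. norm (C m) \<le> K * L2norm U u / q ^ nat \<bar>m\<bar>"
      using ex[OF u U] by blast
    have "((\<lambda>m. C m * helmholtz_mode c m (plane_complex x)) has_sum u x) UNIV" if x: "norm x < q" for x
    proof -
      define s where "s = (norm x)\<^sup>2"
      have s: "0 \<le> s" "sqrt s = norm x" by (auto simp: s_def)
      have "(norm x)\<^sup>2 < \<rho>\<^sup>2" using x q by (intro power_strict_mono) auto
      then have s2: "s < \<rho>\<^sup>2" by (simp add: s_def)
      define \<theta> where "\<theta> = Arg2pi (plane_complex x)"
      have px: "plane_complex x = of_real (sqrt s) * cis \<theta>"
        using Arg2pi[of "plane_complex x"] unfolding is_Arg_def plane_complex_norm s(2) \<theta>_def cis_conv_exp by blast
      have xc: "x = circle_point s \<theta>" unfolding circle_point_def px[symmetric] by simp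
      define g where "g = (\<lambda>z. u (plane_of_complex (of_real (sqrt s) * z)))"
      have gcis: "g (cis t) = u (circle_point s t)" for t by (simp add: g_def circle_point_def)
      have "continuous_on U u" using u by (simp add: helmholtz_solution_def)
      then have ub: "continuous_on (ball 0 \<rho>) u" using U continuous_on_subset by blast
      have gc: "continuous_on (sphere 0 1) g"
        unfolding g_def using s x q by (intro continuous_on_compose2[OF ub] continuous_intros) (auto simp: norm_mult)
      define y where "y = norm x / q"
      have y: "0 \<le> y" "y < 1" using x q by (auto simp: y_def)
      define a where "a = (\<lambda>m. C m * of_real (mode_radius c (nat \<bar>m\<bar>) s))"
      have "((\<lambda>m. a m * cis (of_int m * \<theta>)) has_sum g (cis \<theta>)) UNIV"
      proof (rule fourier_series_on_circle[OF gc, where M = "\<lambda>n. K * L2norm U u * exp (c * s) * y ^ n" and a = a])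
        show "integral {0..2*pi} (\<lambda>\<theta>. g (cis \<theta>) * cis (- (of_int m * \<theta>))) = of_real (2 * pi) * a m" for m
          using C1[OF s(1) s2, of m] unfolding fourier_coeff_def gcis a_def by simp
        show "norm (a m) \<le> K * L2norm U u * exp (c * s) * y ^ nat \<bar>m\<bar>" for m
        proof -
          have "norm (of_real (mode_radius c (nat \<bar>m\<bar>) s) :: complex) \<le> sqrt s ^ nat \<bar>m\<bar> * exp (c * s)"
            using helmholtz_mode_norm_le[of c m "of_real (sqrt s) * cis 0"] c s unfolding helmholtz_mode_polar[OF s(1)]
            by (simp add: norm_mult s_def)
          then have "norm (a m) \<le> (K * L2norm U u / q ^ nat \<bar>m\<bar>) * (norm x ^ nat \<bar>m\<bar> * exp (c * s))"
            unfolding a_def norm_mult s(2) by (intro mult_mono C2) (use order_trans[OF norm_ge_zero C2[of m]] in auto)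
          then show ?thesis by (simp add: y_def power_divide mult_ac)
        qed
        show "summable (\<lambda>n. K * L2norm U u * exp (c * s) * y ^ n)"
          using y by (intro summable_mult summable_geometric) simp
      qed
      moreover have "C m * helmholtz_mode c m (plane_complex x) = a m * cis (of_int m * \<theta>)" for m
        unfolding px helmholtz_mode_polar[OF s(1)] by (simp add: a_def)
      ultimately show ?thesis by (simp add: gcis xc[symmetric])
    qed
    then show "\<exists>C. (\<forall>m. norm (C m) \<le> K * L2norm U u / q ^ nat \<bar>m\<bar>) \<and>
      (\<forall>x. norm x < q \<longrightarrow> ((\<lambda>m. C m * helmholtz_mode (k\<^sup>2 / 4) m (plane_complex x)) has_sum u x) UNIV)"
      using C2 unfolding c_def by blast
  qed
qed

section \<open>Averages of sources\<close>

lemma has_sum_norm_le: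
  fixes f :: "'a \<Rightarrow> complex"
  assumes f: "(f has_sum S) A" and g: "g summable_on A" and le: "\<And>x. x \<in> A \<Longrightarrow> norm (f x) \<le> g x"
  shows "norm S \<le> infsum g A"
proof -
  have n: "(\<lambda>x. norm (f x)) summable_on A"
    by (rule Infinite_Sum.abs_summable_on_comparison_test'[OF g le])
  have "norm (infsum f A) \<le> infsum (\<lambda>x. norm (f x)) A" by (rule norm_infsum_bound[OF n])
  also have "\<dots> \<le> infsum g A" by (rule infsum_mono[OF n g le])
  finally show ?thesis using infsumI[OF f] by simp
qed

lemma has_sum_finite_sum:
  fixes f :: "'i \<Rightarrow> 'a \<Rightarrow> complex"
  assumes "finite I" "\<And>i. i \<in> I \<Longrightarrow> (f i has_sum S i) A"
  shows "((\<lambda>x. \<Sum>i\<in>I. f i x) has_sum (\<Sum>i\<in>I. S i)) A"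
  using assms by (induction I rule: finite_induct) (auto intro!: has_sum_add has_sum_0)

lemma geometric_int_summable:
  assumes "0 \<le> q" "q < (1::real)"
  shows "(\<lambda>m::int. q ^ nat \<bar>m\<bar>) summable_on UNIV"
  by (rule summable_on_int_nat_abs) (use assms in \<open>auto intro: summable_geometric\<close>)

text \<open>A geometric sum over a nontrivial root of unity.\<close>

lemma sum_cis_equally_spaced:
  fixes j :: int
  assumes M: "M \<ge> 1" and j: "\<not> int M dvd j"
  shows "(\<Sum>i<M. cis (of_int j * (\<theta>\<^sub>0 + 2 * pi * real i / real M))) = 0"
proof -
  define \<zeta> where "\<zeta> = cis (2 * pi * of_int j / real M)"
  have t: "cis (of_int j * (\<theta>\<^sub>0 + 2 * pi * real i / real M)) = cis (of_int j * \<theta>\<^sub>0) * \<zeta> ^ i" for i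
    unfolding \<zeta>_def Complex.DeMoivre cis_mult by (rule arg_cong[where f = cis]) (simp add: field_simps)
  have "real M * (2 * pi * of_int j / real M) = 2 * pi * of_int j" using M by simp
  then have zM: "\<zeta> ^ M = 1"
    unfolding \<zeta>_def Complex.DeMoivre using cis_multiple_2pi[of "of_int j"] by simp
  have z1: "\<zeta> \<noteq> 1"
  proof
    assume "\<zeta> = 1"
    then have "exp (\<i> * of_real (2 * pi * of_int j / real M)) = 1" by (simp add: \<zeta>_def cis_conv_exp)
    then obtain n :: int where "2 * pi * of_int j / real M = of_int (2 * n) * pi"
      unfolding exp_eq_1 by auto
    then have "of_int j = of_int n * real M" using M by (simp add: field_simps)
    then have "of_int j = (of_int (n * int M) :: real)" by simp
    then have "j = n * int M" by (simp only: of_int_eq_iff)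
    then show False using j by simp
  qed
  have "(\<Sum>i<M. cis (of_int j * (\<theta>\<^sub>0 + 2 * pi * real i / real M))) = cis (of_int j * \<theta>\<^sub>0) * (\<Sum>i<M. \<zeta> ^ i)"
    unfolding t by (simp add: sum_distrib_left)
  also have "(\<Sum>i<M. \<zeta> ^ i) = 0" using geometric_sum[OF z1, of M] zM by simp
  finally show ?thesis by simp
qed

text \<open>By orthogonality of the equally spaced angles, the average differs from the wanted mode only in
  modes \<open>n\<close> with \<open>M \<le> \<bar>n\<bar> + \<bar>m\<bar>\<close>. These carry a factor \<open>(r / R) ^ \<bar>n\<bar>\<close> up to a small loss, and
  \<open>1 / R ^ \<bar>n\<bar> \<le> R ^ \<bar>m\<bar> / R ^ M\<close>; the remaining \<open>r ^ \<bar>n\<bar>\<close> makes the sum converge.\<close>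

lemma source_average_mode_error:
  assumes k: "k > 0" and R: "R > 1" and r: "0 < r" "r < 1"
  shows "\<exists>K>0. \<forall>M (y :: nat \<Rightarrow> real^2) \<theta>\<^sub>0 (m::int) x. M \<ge> 1 \<longrightarrow>
    (\<forall>i<M. plane_complex (y i) = of_real R * cis (\<theta>\<^sub>0 + 2 * pi * real i / real M)) \<longrightarrow> norm x \<le> r \<longrightarrow>
    norm ((\<Sum>i<M. cis (of_int m * (\<theta>\<^sub>0 + 2 * pi * real i / real M)) * fundamental_solution k (y i) x) / of_nat M
       - hankel_coeff (k\<^sup>2 / 4) (hankel_alpha k) hankel_beta R (nat \<bar>m\<bar>) * helmholtz_mode (k\<^sup>2 / 4) m (plane_complex x))
    \<le> K * R ^ nat \<bar>m\<bar> / R ^ M"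
proof -
  define c where "c = k\<^sup>2 / 4"
  define a where "a = hankel_coeff c (hankel_alpha k) hankel_beta R"
  \<comment> \<open>R1 < R serves to bound the coefficients, and r * R < R1 leaves a summable factor q\<close>
  define R1 where "R1 = (r * R + R) / 2"
  have "0 < r * R" "r * R < R" using r R by auto
  moreover have mid: "a < (a + b) / 2 \<and> (a + b) / 2 < b" if "a < b" for a b :: real using that by simp
  ultimately have R1: "0 < R1" "R1 < R" "r * R < R1" using mid[of "r * R" R] less_trans[of 0 "r * R" R1] by (simp_all only: R1_def)
  define q where "q = r * R / R1"
  have q: "0 < q" "q < 1" using R1 r R by (auto simp: q_def)
  obtain K0 where K0: "K0 > 0" "\<And>n. norm (a n) \<le> K0 / R1 ^ n"
    using hankel_coeff_upper_bound[OF _ R1(1,2), of c "hankel_alpha k" hankel_beta] R unfolding a_def by auto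
  define Q where "Q = infsum (\<lambda>m::int. q ^ nat \<bar>m\<bar>) UNIV"
  define K where "K = K0 * exp c * Q + 1"
  have "Q \<ge> 0" unfolding Q_def using q by (intro infsum_nonneg) auto
  then have K: "K > 0" using K0 by (simp add: K_def add_nonneg_pos)
  show ?thesis
  proof (intro exI[of _ K] conjI K allI impI)
    fix M and y :: "nat \<Rightarrow> real^2" and \<theta>\<^sub>0 and m :: int and x :: "real^2"
    assume M: "M \<ge> 1" and y: "\<forall>i<M. plane_complex (y i) = of_real R * cis (\<theta>\<^sub>0 + 2 * pi * real i / real M)" and x: "norm x \<le> r"
    define \<phi> where "\<phi> = (\<lambda>i. \<theta>\<^sub>0 + 2 * pi * real i / real M)"
    define E where "E = (\<lambda>n. helmholtz_mode c n (plane_complex x))"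
    have Eb: "norm (E n) \<le> r ^ nat \<bar>n\<bar> * exp c" for n
    proof -
      have "norm (E n) \<le> norm x ^ nat \<bar>n\<bar> * exp (\<bar>c\<bar> * (norm x)\<^sup>2)"
        unfolding E_def using helmholtz_mode_norm_le[of c n "plane_complex x"] by (simp add: plane_complex_norm)
      also have "\<dots> \<le> r ^ nat \<bar>n\<bar> * exp c"
      proof (intro mult_mono power_mono)
        have "(norm x)\<^sup>2 \<le> 1" using x r by (intro power_le_one) auto
        then show "exp (\<bar>c\<bar> * (norm x)\<^sup>2) \<le> exp c" by (simp add: c_def mult_left_le)
      qed (use x r in auto)
      finally show ?thesis .
    qed
    \<comment> \<open>the weight of mode n in the average: 1 for n = m, and 0 for the other modes that are not aliases of m\<close>
    define w where "w = (\<lambda>n::int. (\<Sum>i<M. cis (of_int (m - n) * \<phi> i)) / of_nat M)"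
    have wm: "w m = 1" using M by (simp add: w_def)
    have wb: "norm (w n) \<le> 1" for n
    proof -
      have "norm (\<Sum>i<M. cis (of_int (m - n) * \<phi> i)) \<le> (\<Sum>i<M. norm (cis (of_int (m - n) * \<phi> i)))" by (rule norm_sum)
      then show ?thesis using M by (simp add: w_def norm_divide)
    qed
    have w0: "w n = 0" if "nat \<bar>n\<bar> + nat \<bar>m\<bar> < M" "n \<noteq> m" for n
    proof -
      have "\<not> int M dvd (m - n)"
      proof
        assume "int M dvd (m - n)"
        then have "int M \<le> \<bar>m - n\<bar>" using that(2) by (intro zdvd_imp_le) (auto simp: dvd_abs_iff)
        then show False using that(1) by linarith
      qed
      from sum_cis_equally_spaced[OF M this] show ?thesis by (simp add: w_def \<phi>_def)
    qed
    have "((\<lambda>n. \<Sum>i<M. cis (of_int m * \<phi> i) / of_nat M * (a (nat \<bar>n\<bar>) * cis (- (of_int n * \<phi> i)) * E n))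
        has_sum (\<Sum>i<M. cis (of_int m * \<phi> i) / of_nat M * fundamental_solution k (y i) x)) UNIV"
    proof (intro has_sum_finite_sum has_sum_cmult_right)
      fix i assume "i \<in> {..<M}"
      then have yi: "plane_complex (y i) = of_real R * cis (\<phi> i)" using y by (simp add: \<phi>_def)
      show "((\<lambda>n. a (nat \<bar>n\<bar>) * cis (- (of_int n * \<phi> i)) * E n) has_sum fundamental_solution k (y i) x) UNIV"
        using fundamental_solution_expansion[OF k yi, of x] R r x unfolding a_def E_def c_def by simp
    qed simp
    moreover have "(\<Sum>i<M. cis (of_int m * \<phi> i) / of_nat M * (a (nat \<bar>n\<bar>) * cis (- (of_int n * \<phi> i)) * E n)) = w n * (a (nat \<bar>n\<bar>) * E n)" for n
    proof -
      have "cis (of_int m * \<phi> i) / of_nat M * (a (nat \<bar>n\<bar>) * cis (- (of_int n * \<phi> i)) * E n)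
          = (cis (of_int m * \<phi> i) * cis (- (of_int n * \<phi> i))) / of_nat M * (a (nat \<bar>n\<bar>) * E n)" for i by simp
      also have "(cis (of_int m * \<phi> i) * cis (- (of_int n * \<phi> i))) / of_nat M * (a (nat \<bar>n\<bar>) * E n)
          = cis (of_int (m - n) * \<phi> i) / of_nat M * (a (nat \<bar>n\<bar>) * E n)" for i
        unfolding cis_mult by (simp add: left_diff_distrib)
      finally show ?thesis
        unfolding w_def sum_divide_distrib sum_distrib_right by (intro sum.cong refl)
    qed
    ultimately have 1: "((\<lambda>n. w n * (a (nat \<bar>n\<bar>) * E n)) has_sum (\<Sum>i<M. cis (of_int m * \<phi> i) / of_nat M * fundamental_solution k (y i) x)) UNIV"
      by (simp only: )
    have 2: "((\<lambda>n. if n = m then a (nat \<bar>n\<bar>) * E n else 0) has_sum (a (nat \<bar>m\<bar>) * E m)) UNIV"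
    proof -
      let ?f = "\<lambda>n. if n = m then a (nat \<bar>n\<bar>) * E n else 0"
      have "(?f has_sum (\<Sum>n\<in>{m}. ?f n)) {m}" by (rule has_sum_finite) simp
      moreover have "(?f has_sum (\<Sum>n\<in>{m}. ?f n)) {m} \<longleftrightarrow> (?f has_sum (\<Sum>n\<in>{m}. ?f n)) UNIV"
        by (rule has_sum_cong_neutral) auto
      ultimately show ?thesis by simp
    qed
    have 3: "((\<lambda>n. w n * (a (nat \<bar>n\<bar>) * E n) + - 1 * (if n = m then a (nat \<bar>n\<bar>) * E n else 0))
        has_sum ((\<Sum>i<M. cis (of_int m * \<phi> i) / of_nat M * fundamental_solution k (y i) x) + - 1 * (a (nat \<bar>m\<bar>) * E m))) UNIV"
      by (intro has_sum_add has_sum_cmult_right 1 2)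
    have "norm ((\<Sum>i<M. cis (of_int m * \<phi> i) / of_nat M * fundamental_solution k (y i) x) + - 1 * (a (nat \<bar>m\<bar>) * E m))
        \<le> infsum (\<lambda>n::int. K0 * exp c * (R ^ nat \<bar>m\<bar> / R ^ M) * q ^ nat \<bar>n\<bar>) UNIV"
    proof (rule has_sum_norm_le[OF 3])
      show "(\<lambda>n::int. K0 * exp c * (R ^ nat \<bar>m\<bar> / R ^ M) * q ^ nat \<bar>n\<bar>) summable_on UNIV"
        using q by (intro summable_on_cmult_right geometric_int_summable) auto
      fix n :: int
      have rhs: "0 \<le> K0 * exp c * (R ^ nat \<bar>m\<bar> / R ^ M) * q ^ nat \<bar>n\<bar>" using K0 R q by simp
      show "norm (w n * (a (nat \<bar>n\<bar>) * E n) + - 1 * (if n = m then a (nat \<bar>n\<bar>) * E n else 0)) \<le> K0 * exp c * (R ^ nat \<bar>m\<bar> / R ^ M) * q ^ nat \<bar>n\<bar>"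
      proof (cases "n = m \<or> nat \<bar>n\<bar> + nat \<bar>m\<bar> < M")
        case True
        then show ?thesis using w0[of n] wm rhs by auto
      next
        case False
        define j where "j = nat \<bar>n\<bar>"
        have "R ^ M \<le> R ^ (j + nat \<bar>m\<bar>)" using False R by (intro power_increasing) (auto simp: j_def)
        then have Rj: "1 / R ^ j \<le> R ^ nat \<bar>m\<bar> / R ^ M" using R by (simp add: field_simps power_add)
        have "norm (w n * (a j * E n)) \<le> 1 * ((K0 / R1 ^ j) * (r ^ j * exp c))"
          unfolding norm_mult using wb K0(2)[of j] Eb[of n] R1 K0(1) by (intro mult_mono) (auto simp: j_def)
        also have "\<dots> = K0 * exp c * (1 / R ^ j) * q ^ j"
          using R R1 by (simp add: q_def power_divide power_mult_distrib)
        also have "\<dots> \<le> K0 * exp c * (R ^ nat \<bar>m\<bar> / R ^ M) * q ^ j"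
          using Rj K0 q by (intro mult_right_mono mult_left_mono) auto
        finally show ?thesis using False by (simp add: j_def)
      qed
    qed
    also have "\<dots> = K0 * exp c * (R ^ nat \<bar>m\<bar> / R ^ M) * Q"
      unfolding Q_def by (rule infsum_cmult_right')
    also have "\<dots> \<le> K * R ^ nat \<bar>m\<bar> / R ^ M"
      using R by (simp add: K_def divide_right_mono algebra_simps)
    also have "(\<Sum>i<M. cis (of_int m * \<phi> i) / of_nat M * fundamental_solution k (y i) x) = (\<Sum>i<M. cis (of_int m * \<phi> i) * fundamental_solution k (y i) x) / of_nat M"
      by (simp add: sum_divide_distrib)
    finally show "norm ((\<Sum>i<M. cis (of_int m * (\<theta>\<^sub>0 + 2 * pi * real i / real M)) * fundamental_solution k (y i) x) / of_nat M
       - hankel_coeff (k\<^sup>2 / 4) (hankel_alpha k) hankel_beta R (nat \<bar>m\<bar>) * helmholtz_mode (k\<^sup>2 / 4) m (plane_complex x))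
    \<le> K * R ^ nat \<bar>m\<bar> / R ^ M"
      by (simp add: a_def E_def c_def \<phi>_def)
  qed
qed

text \<open>The factor \<open>r ^ \<bar>m\<bar>\<close> is kept, up to a linear one, so that Lipschitz constants of the modes can be
  summed against bounded coefficients.\<close>

lemma helmholtz_mode_lipschitz:
  assumes c: "c > 0" and r: "0 < r" "r < 1" and z: "norm z \<le> r" and w: "norm w \<le> r"
  shows "norm (helmholtz_mode c m z - helmholtz_mode c m w) \<le> (real (nat \<bar>m\<bar>) / r + 2 * c) * r ^ nat \<bar>m\<bar> * exp c * norm (z - w)"
proof -
  define n where "n = nat \<bar>m\<bar>"
  define p where "p = (\<lambda>z::complex. (if m \<ge> 0 then z else cnj z) ^ n)"
  define \<kappa> where "\<kappa> = (\<lambda>z::complex. complex_of_real (fact n * bessel_clifford c n ((norm z)\<^sup>2)))"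
  have E: "helmholtz_mode c m z = p z * \<kappa> z" for z
    unfolding helmholtz_mode_def p_def \<kappa>_def n_def bessel_clifford_of_real by simp
  have sq: "0 \<le> (norm v)\<^sup>2" "(norm v)\<^sup>2 \<le> 1" if "norm v \<le> r" for v :: complex
    using that r by (auto intro: power_le_one)
  have kb: "norm (\<kappa> v) \<le> exp c" if v: "norm v \<le> r" for v
  proof -
    have "norm (bessel_clifford c n ((norm v)\<^sup>2)) \<le> exp (\<bar>c\<bar> * norm ((norm v)\<^sup>2)) / fact n" by (rule bessel_clifford_norm_le)
    also have "\<dots> \<le> exp c / fact n" using c sq[OF v] by (intro divide_right_mono) (auto simp: mult_left_le)
    finally show ?thesis by (simp add: \<kappa>_def norm_mult field_simps)
  qed
  have kl: "norm (\<kappa> z - \<kappa> w) \<le> c * exp c * (2 * norm (z - w))"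
  proof -
    have "norm (fact n * bessel_clifford c n ((norm z)\<^sup>2) - fact n * bessel_clifford c n ((norm w)\<^sup>2)) \<le> c * exp c * norm ((norm z)\<^sup>2 - (norm w)\<^sup>2)"
    proof (rule field_differentiable_bound[of "{0..1}"])
      fix x :: real assume x: "x \<in> {0..1}"
      show "((\<lambda>s. fact n * bessel_clifford c n s) has_field_derivative fact n * (- c * bessel_clifford c (Suc n) x)) (at x within {0..1})"
        using DERIV_cmult[OF bessel_clifford_deriv[of c n x], of "fact n"] by (simp add: has_field_derivative_at_within)
      have "norm (fact n * (- c * bessel_clifford c (Suc n) x)) = fact n * c * norm (bessel_clifford c (Suc n) x)"
        using c by (simp add: abs_mult)
      also have "\<dots> \<le> fact n * c * (exp (c * x) / fact (Suc n))"
        using bessel_clifford_norm_le[of c "Suc n" x] c x by (intro mult_left_mono) auto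
      also have "\<dots> = c * exp (c * x) / real (Suc n)" by (simp del: of_nat_Suc)
      also have "\<dots> \<le> c * exp (c * x) / 1" using c by (intro divide_left_mono) auto
      also have "\<dots> \<le> c * exp c" using c x by (auto simp: mult_left_le)
      finally show "norm (fact n * (- c * bessel_clifford c (Suc n) x)) \<le> c * exp c" .
    qed (use sq z w in auto)
    also have "norm ((norm z)\<^sup>2 - (norm w)\<^sup>2) \<le> 2 * norm (z - w)"
    proof -
      have "(norm z)\<^sup>2 - (norm w)\<^sup>2 = (norm z + norm w) * (norm z - norm w)" by (simp add: power2_eq_square algebra_simps)
      then have "norm ((norm z)\<^sup>2 - (norm w)\<^sup>2) = (norm z + norm w) * \<bar>norm z - norm w\<bar>" by (simp add: abs_mult)
      also have "\<dots> \<le> 2 * norm (z - w)" using z w r by (intro mult_mono norm_triangle_ineq3) auto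
      finally show ?thesis .
    qed
    finally have "norm (fact n * bessel_clifford c n ((norm z)\<^sup>2) - fact n * bessel_clifford c n ((norm w)\<^sup>2)) \<le> c * exp c * (2 * norm (z - w))"
      using c by (simp add: mult_left_mono)
    then show ?thesis unfolding \<kappa>_def of_real_diff[symmetric] norm_of_real by simp
  qed
  have pl: "norm (p z - p w) \<le> real n / r * r ^ n * norm (z - w)"
  proof -
    have P: "norm (x ^ n - y ^ n) \<le> real n * r ^ (n - 1) * norm (x - y)" if "norm x \<le> r" "norm y \<le> r" for x y :: complex
    proof (rule field_differentiable_bound[of "cball 0 r"])
      fix v :: complex assume v: "v \<in> cball 0 r"
      show "((\<lambda>z. z ^ n) has_field_derivative of_nat n * v ^ (n - 1)) (at v within cball 0 r)"
        by (auto intro!: derivative_eq_intros)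
      show "norm (of_nat n * v ^ (n - 1)) \<le> real n * r ^ (n - 1)"
        using v by (auto simp: norm_mult norm_power intro!: mult_left_mono power_mono)
    qed (use that in auto)
    have "norm (p z - p w) \<le> real n * r ^ (n - 1) * norm (z - w)"
      unfolding p_def using P[of z w] P[of "cnj z" "cnj w"] z w by (simp flip: complex_cnj_diff complex_cnj_power)
    also have "real n * r ^ (n - 1) = real n / r * r ^ n" using r by (cases n) auto
    finally show ?thesis .
  qed
  have pb: "norm (p w) \<le> r ^ n" unfolding p_def norm_power using w by (intro power_mono) auto
  have "helmholtz_mode c m z - helmholtz_mode c m w = (p z - p w) * \<kappa> z + p w * (\<kappa> z - \<kappa> w)"
    unfolding E by (simp add: algebra_simps)
  also have "norm \<dots> \<le> (real n / r * r ^ n * norm (z - w)) * exp c + r ^ n * (c * exp c * (2 * norm (z - w)))"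
  proof (intro norm_triangle_le add_mono)
    show "norm ((p z - p w) * \<kappa> z) \<le> (real n / r * r ^ n * norm (z - w)) * exp c"
      unfolding norm_mult by (rule mult_mono[OF pl kb[OF z]]) (use r in auto)
    show "norm (p w * (\<kappa> z - \<kappa> w)) \<le> r ^ n * (c * exp c * (2 * norm (z - w)))"
      unfolding norm_mult by (rule mult_mono[OF pb kl]) (use r in auto)
  qed
  also have "\<dots> = (real n / r + 2 * c) * r ^ n * exp c * norm (z - w)" by (simp add: algebra_simps)
  finally show ?thesis by (simp add: n_def)
qed

text \<open>Both the solution and the sources have expansions to which this applies, with different
  \<open>q\<close>.\<close>

lemma mode_series_bounds:
  assumes c: "c > 0" and r: "0 < r" "r < 1" "r < q"
  shows "\<exists>K>0. \<forall>B V (v :: real^2 \<Rightarrow> complex). (\<forall>m. norm (V m) \<le> B / q ^ nat \<bar>m\<bar>) \<longrightarrow>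
      (\<forall>x. norm x \<le> r \<longrightarrow> ((\<lambda>m. V m * helmholtz_mode c m (plane_complex x)) has_sum v x) UNIV) \<longrightarrow>
      (\<forall>x x'. norm x \<le> r \<longrightarrow> norm x' \<le> r \<longrightarrow> norm (v x) \<le> K * B \<and> norm (v x - v x') \<le> K * B * norm (x - x'))"
proof -
  define t where "t = r / q"
  have t: "0 < t" "t < 1" using r by (auto simp: t_def)
  have s1: "(\<lambda>m::int. t ^ nat \<bar>m\<bar>) summable_on UNIV" using t by (intro geometric_int_summable) auto
  have s2: "(\<lambda>m::int. (real (nat \<bar>m\<bar>) / r + 2 * c) * t ^ nat \<bar>m\<bar>) summable_on UNIV"
  proof (rule summable_on_int_nat_abs)
    have "summable (\<lambda>n. real n * t ^ n)"
    proof -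
      have "summable (\<lambda>n. of_nat n * t ^ n)"
      proof -
        have "norm t < 1" using t by simp
        from geometric_deriv_sums[OF this] have "summable (\<lambda>n. of_nat (Suc n) * t ^ n)" by (rule sums_summable)
        then have "summable (\<lambda>n. t * (of_nat (Suc n) * t ^ n))" by (rule summable_mult)
        then have "summable (\<lambda>n. of_nat (Suc n) * t ^ Suc n)" by (simp only: power_Suc mult_ac)
        then show ?thesis by (subst (asm) summable_Suc_iff)
      qed
      then show ?thesis by simp
    qed
    then have "summable (\<lambda>n. 1 / r * (real n * t ^ n) + 2 * c * t ^ n)"
      using t by (intro summable_add summable_mult summable_geometric) auto
    then show "summable (\<lambda>n. (real n / r + 2 * c) * t ^ n)" by (simp add: algebra_simps)
  qed (use r c t in auto)
  define K1 K2 where "K1 = exp c * infsum (\<lambda>m::int. t ^ nat \<bar>m\<bar>) UNIV"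
    and "K2 = exp c * infsum (\<lambda>m::int. (real (nat \<bar>m\<bar>) / r + 2 * c) * t ^ nat \<bar>m\<bar>) UNIV"
  have K12: "K1 \<ge> 0" "K2 \<ge> 0" unfolding K1_def K2_def using t r c by (auto intro!: mult_nonneg_nonneg infsum_nonneg)
  define K where "K = K1 + K2 + 1"
  have K: "K > 0" using K12 by (simp add: K_def)
  show ?thesis
  proof (intro exI[of _ K] conjI K allI impI)
    fix B V and v :: "real^2 \<Rightarrow> complex" and x x' :: "real^2"
    assume V: "\<forall>m. norm (V m) \<le> B / q ^ nat \<bar>m\<bar>"
      and v: "\<forall>x. norm x \<le> r \<longrightarrow> ((\<lambda>m. V m * helmholtz_mode c m (plane_complex x)) has_sum v x) UNIV"
      and x: "norm x \<le> r" and x': "norm x' \<le> r"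
    have B: "B \<ge> 0" using order_trans[OF norm_ge_zero V[rule_format, of 0]] by simp
    have px: "norm (plane_complex x) \<le> r" "norm (plane_complex x') \<le> r" using x x' by (simp_all add: plane_complex_norm)
    have "norm (v x) \<le> infsum (\<lambda>m::int. (B * exp c) * t ^ nat \<bar>m\<bar>) UNIV"
    proof (rule has_sum_norm_le[OF v[rule_format, OF x]])
      fix m :: int
      have "norm (helmholtz_mode c m (plane_complex x)) \<le> norm (plane_complex x) ^ nat \<bar>m\<bar> * exp (\<bar>c\<bar> * (norm (plane_complex x))\<^sup>2)"
        by (rule helmholtz_mode_norm_le)
      also have "\<dots> \<le> r ^ nat \<bar>m\<bar> * exp c"
      proof (intro mult_mono power_mono px)
        have "(norm (plane_complex x))\<^sup>2 \<le> 1" using px r by (intro power_le_one) auto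
        then show "exp (\<bar>c\<bar> * (norm (plane_complex x))\<^sup>2) \<le> exp c" using c by (simp add: mult_left_le)
      qed (use r in auto)
      finally have "norm (V m * helmholtz_mode c m (plane_complex x)) \<le> (B / q ^ nat \<bar>m\<bar>) * (r ^ nat \<bar>m\<bar> * exp c)"
        unfolding norm_mult using V B r by (intro mult_mono) auto
      then show "norm (V m * helmholtz_mode c m (plane_complex x)) \<le> (B * exp c) * t ^ nat \<bar>m\<bar>"
        by (simp add: t_def power_divide mult_ac)
    qed (intro summable_on_cmult_right s1)
    also have "\<dots> = B * K1" by (simp only: infsum_cmult_right' K1_def mult.assoc)
    also have "\<dots> \<le> K * B" using B K12 by (simp add: K_def algebra_simps)
    finally show "norm (v x) \<le> K * B" .
    have d: "((\<lambda>m. V m * helmholtz_mode c m (plane_complex x) + - 1 * (V m * helmholtz_mode c m (plane_complex x'))) has_sum (v x + - 1 * v x')) UNIV"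
      by (intro has_sum_add has_sum_cmult_right v[rule_format, OF x] v[rule_format, OF x'])
    have "norm (v x + - 1 * v x') \<le> infsum (\<lambda>m::int. (B * exp c * norm (x - x')) * ((real (nat \<bar>m\<bar>) / r + 2 * c) * t ^ nat \<bar>m\<bar>)) UNIV"
    proof (rule has_sum_norm_le[OF d])
      fix m :: int
      have "norm (V m * helmholtz_mode c m (plane_complex x) + - 1 * (V m * helmholtz_mode c m (plane_complex x')))
          = norm (V m) * norm (helmholtz_mode c m (plane_complex x) - helmholtz_mode c m (plane_complex x'))"
        by (simp add: right_diff_distrib[symmetric] norm_mult)
      also have "\<dots> \<le> (B / q ^ nat \<bar>m\<bar>) * ((real (nat \<bar>m\<bar>) / r + 2 * c) * r ^ nat \<bar>m\<bar> * exp c * norm (plane_complex x - plane_complex x'))"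
        using V B r c helmholtz_mode_lipschitz[OF c r(1,2) px] by (intro mult_mono) auto
      also have "norm (plane_complex x - plane_complex x') = norm (x - x')"
        by (simp only: plane_complex_diff[symmetric] plane_complex_norm)
      finally show "norm (V m * helmholtz_mode c m (plane_complex x) + - 1 * (V m * helmholtz_mode c m (plane_complex x')))
          \<le> (B * exp c * norm (x - x')) * ((real (nat \<bar>m\<bar>) / r + 2 * c) * t ^ nat \<bar>m\<bar>)"
        by (simp add: t_def power_divide mult_ac)
    qed (intro summable_on_cmult_right s2)
    also have "\<dots> = B * norm (x - x') * K2" by (simp only: infsum_cmult_right' K2_def mult_ac)
    also have "\<dots> \<le> B * norm (x - x') * K" using B K12 by (intro mult_left_mono) (auto simp: K_def)
    finally show "norm (v x - v x') \<le> K * B * norm (x - x')" by (simp add: mult_ac)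
  qed
qed

section \<open>Approximation by sources on a circle\<close>

text \<open>The strength of source \<open>i\<close> is the value at its angle of the Fourier series with coefficients
  \<open>C m / a \<bar>m\<bar>\<close>, divided by \<open>M\<close>. The radii are chosen as \<open>R < R' < q / R\<close> with \<open>R\<^sup>2 < q < \<rho>\<close>: the lower
  bound on \<open>a\<close> holds with \<open>R'\<close>, and \<open>R' * R / q < 1\<close> makes the sum of the averaging errors converge.\<close>

theorem helmholtz_source_approximation:
  assumes k: "k > 0" and R: "R > 1" and \<rho>: "R\<^sup>2 < \<rho>" and r: "0 < r" "r < 1"
  shows "\<exists>K>0. \<forall>U u M (y :: nat \<Rightarrow> real^2). helmholtz_solution U k u \<longrightarrow> ball 0 \<rho> \<subseteq> U \<longrightarrow> M \<ge> 1 \<longrightarrow>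
    equally_distributed_on_circle R M y \<longrightarrow>
    (\<exists>d. (\<forall>i. norm (d i) \<le> K * L2norm U u / real M) \<and>
      (\<forall>x. norm x \<le> r \<longrightarrow> norm (u x - (\<Sum>i<M. d i * fundamental_solution k (y i) x)) \<le> K * L2norm U u / R ^ M))"
proof -
  define c where "c = k\<^sup>2 / 4"
  have c: "c > 0" using k by (simp add: c_def)
  define a where "a = hankel_coeff c (hankel_alpha k) hankel_beta R"
  have R2: "R < R\<^sup>2" using R by (simp add: power2_eq_square)
  define q where "q = (R\<^sup>2 + \<rho>) / 2"
  have q: "R\<^sup>2 < q" "q < \<rho>" using \<rho> by (auto simp: q_def)
  have qR: "R < q / R" using q R by (simp add: field_simps power2_eq_square)
  define R' where "R' = (R + q / R) / 2"
  have mid: "a < (a + b) / 2 \<and> (a + b) / 2 < b" if "a < b" for a b :: real using that by simp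
  have R': "R < R'" "R' < q / R" using mid[OF qR] by (simp_all only: R'_def)
  have R'q: "R' * R < q" using R' R by (simp add: field_simps)
  have q0: "q > 0" using q R2 R by linarith
  have "Im (hankel_alpha k) = 1 / 4"
    unfolding hankel_alpha_def minus_complex.simps Im_complex_of_real by simp
  then have al: "Im (hankel_alpha k) \<noteq> 0" "Im hankel_beta = 0" "hankel_beta \<noteq> 0"
    by (simp_all add: hankel_beta_def)
  obtain \<delta> where \<delta>: "\<delta> > 0" "\<And>m. \<delta> / R' ^ m \<le> norm (a m)"
    using hankel_coeff_lower_bound[OF _ c al R'(1)] R unfolding a_def by auto
  have R'0: "R' > 0" using R' R by simp
  have a0: "a m \<noteq> 0" for m
  proof -
    have "0 < \<delta> / R' ^ m" using \<delta>(1) R'0 by simp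
    then show ?thesis using \<delta>(2)[of m] by auto
  qed
  obtain Kc where Kc: "Kc > 0" "\<And>U u. helmholtz_solution U k u \<Longrightarrow> ball 0 \<rho> \<subseteq> U \<Longrightarrow>
    (\<exists>C. (\<forall>m. norm (C m) \<le> Kc * L2norm U u / q ^ nat \<bar>m\<bar>) \<and>
      (\<forall>x. norm x < q \<longrightarrow> ((\<lambda>m. C m * helmholtz_mode c m (plane_complex x)) has_sum u x) UNIV))"
    using helmholtz_expansion[OF k q0 q(2)] unfolding c_def by blast
  obtain K1 where K1: "K1 > 0" "\<And>M (y :: nat \<Rightarrow> real^2) \<theta>\<^sub>0 (m::int) x. M \<ge> 1 \<Longrightarrow>
    (\<forall>i<M. plane_complex (y i) = of_real R * cis (\<theta>\<^sub>0 + 2 * pi * real i / real M)) \<Longrightarrow> norm x \<le> r \<Longrightarrow>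
    norm ((\<Sum>i<M. cis (of_int m * (\<theta>\<^sub>0 + 2 * pi * real i / real M)) * fundamental_solution k (y i) x) / of_nat M
       - a (nat \<bar>m\<bar>) * helmholtz_mode c m (plane_complex x))
    \<le> K1 * R ^ nat \<bar>m\<bar> / R ^ M"
    using source_average_mode_error[OF k R r] unfolding c_def a_def by blast
  define t where "t = R' * R / q"
  have t: "0 < t" "t < 1" using R'q R'0 R q0 by (auto simp: t_def)
  define t' where "t' = R' / q"
  have t': "0 < t'" "t' < 1"
  proof -
    have "R' < R' * R" using R'0 R by simp
    then have "R' < q" using R'q by linarith
    then show "0 < t'" "t' < 1" using R'0 q0 by (auto simp: t'_def)
  qed
  have st: "(\<lambda>m::int. t ^ nat \<bar>m\<bar>) summable_on UNIV" "(\<lambda>m::int. t' ^ nat \<bar>m\<bar>) summable_on UNIV"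
    using t t' by (auto intro!: geometric_int_summable)
  define Q Q' where "Q = infsum (\<lambda>m::int. t ^ nat \<bar>m\<bar>) UNIV" and "Q' = infsum (\<lambda>m::int. t' ^ nat \<bar>m\<bar>) UNIV"
  have Q: "Q \<ge> 0" "Q' \<ge> 0" unfolding Q_def Q'_def using t t' by (auto intro!: infsum_nonneg)
  define K where "K = (Kc / \<delta>) * Q' + (Kc / \<delta>) * K1 * Q + 1"
  have K': "(Kc / \<delta>) * Q' \<ge> 0" "(Kc / \<delta>) * K1 * Q \<ge> 0" using Kc(1) \<delta>(1) K1(1) Q by auto
  then have K: "K > 0" by (simp add: K_def)
  show ?thesis
  proof (intro exI[of _ K] conjI K allI impI)
    fix U u M and y :: "nat \<Rightarrow> real^2"
    assume u: "helmholtz_solution U k u" and U: "ball 0 \<rho> \<subseteq> U" and M: "M \<ge> 1" and y: "equally_distributed_on_circle R M y"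
    obtain \<theta>\<^sub>0 where "\<forall>i<M. y i = vector [R * cos (\<theta>\<^sub>0 + 2 * pi * real i / real M), R * sin (\<theta>\<^sub>0 + 2 * pi * real i / real M)]"
      using y unfolding equally_distributed_on_circle_def by blast
    then have y': "\<forall>i<M. plane_complex (y i) = of_real R * cis (\<theta>\<^sub>0 + 2 * pi * real i / real M)"
      by (simp add: plane_complex_def complex_eq_iff)
    define \<phi> where "\<phi> = (\<lambda>i. \<theta>\<^sub>0 + 2 * pi * real i / real M)"
    obtain C where C: "\<And>m. norm (C m) \<le> Kc * L2norm U u / q ^ nat \<bar>m\<bar>"
      "\<And>x. norm x < q \<Longrightarrow> ((\<lambda>m. C m * helmholtz_mode c m (plane_complex x)) has_sum u x) UNIV"
      using Kc(2)[OF u U] by blast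
    define L where "L = L2norm U u"
    have L: "L \<ge> 0" using order_trans[OF norm_ge_zero C(1)[of 0]] Kc(1) by (simp add: L_def zero_le_mult_iff)
    define g where "g = (\<lambda>m. C m / a (nat \<bar>m\<bar>))"
    have gb: "norm (g m) \<le> (Kc / \<delta>) * L * t' ^ nat \<bar>m\<bar>" for m
    proof -
      define n where "n = nat \<bar>m\<bar>"
      have "norm (g m) \<le> (Kc * L / q ^ n) / (\<delta> / R' ^ n)"
        unfolding g_def norm_divide using C(1)[of m] \<delta>(2)[of n] \<delta>(1) R'0
        by (intro frac_le) (use order_trans[OF norm_ge_zero C(1)[of m]] in \<open>auto simp: n_def L_def\<close>)
      also have "\<dots> = (Kc / \<delta>) * L * t' ^ n" by (simp add: t'_def power_divide)
      finally show ?thesis by (simp add: n_def)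
    qed
    have gs: "(\<lambda>m. g m * cis (of_int m * \<phi> i)) summable_on UNIV" for i
    proof -
      have "(\<lambda>m. norm (g m * cis (of_int m * \<phi> i))) summable_on UNIV"
        by (rule Infinite_Sum.abs_summable_on_comparison_test'[OF summable_on_cmult_right[OF st(2), of "(Kc / \<delta>) * L"]])
          (use gb in \<open>simp add: norm_mult\<close>)
      then show ?thesis by (rule abs_summable_summable)
    qed
    define d where "d = (\<lambda>i. infsum (\<lambda>m. g m * cis (of_int m * \<phi> i)) UNIV / of_nat M)"
    have dhs: "((\<lambda>m. g m * cis (of_int m * \<phi> i) / of_nat M) has_sum d i) UNIV" for i
    proof -
      have "((\<lambda>m. 1 / of_nat M * (g m * cis (of_int m * \<phi> i))) has_sum (1 / of_nat M * infsum (\<lambda>m. g m * cis (of_int m * \<phi> i)) UNIV)) UNIV"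
        by (intro has_sum_cmult_right has_sum_infsum gs)
      then show ?thesis by (simp add: d_def)
    qed
    have db: "norm (d i) \<le> K * L2norm U u / real M" for i
    proof -
      have "norm (infsum (\<lambda>m. g m * cis (of_int m * \<phi> i)) UNIV) \<le> infsum (\<lambda>m. (Kc / \<delta>) * L * t' ^ nat \<bar>m\<bar>) UNIV"
        by (rule has_sum_norm_le[OF has_sum_infsum[OF gs] summable_on_cmult_right[OF st(2)]])
          (use gb in \<open>simp add: norm_mult\<close>)
      also have "\<dots> = (Kc / \<delta>) * L * Q'" unfolding Q'_def by (rule infsum_cmult_right')
      also have "\<dots> = (Kc / \<delta>) * Q' * L" by simp
      also have "\<dots> \<le> K * L" using K' L by (intro mult_right_mono) (auto simp: K_def)
      finally show ?thesis unfolding d_def L_def norm_divide by (simp add: divide_right_mono)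
    qed
    have app: "norm (u x - (\<Sum>i<M. d i * fundamental_solution k (y i) x)) \<le> K * L2norm U u / R ^ M" if x: "norm x \<le> r" for x
    proof -
      have xq: "norm x < q" using x r R2 R q by linarith
      let ?A = "\<lambda>m. (\<Sum>i<M. cis (of_int m * \<phi> i) * fundamental_solution k (y i) x) / of_nat M"
      let ?B = "\<lambda>m. a (nat \<bar>m\<bar>) * helmholtz_mode c m (plane_complex x)"
      have 1: "((\<lambda>m. g m * ?A m) has_sum (\<Sum>i<M. d i * fundamental_solution k (y i) x)) UNIV"
      proof -
        have "((\<lambda>m. \<Sum>i<M. (g m * cis (of_int m * \<phi> i) / of_nat M) * fundamental_solution k (y i) x) has_sum (\<Sum>i<M. d i * fundamental_solution k (y i) x)) UNIV"
          by (intro has_sum_finite_sum has_sum_cmult_left dhs) simp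
        then show ?thesis by (simp add: sum_divide_distrib sum_distrib_left mult_ac)
      qed
      have 2: "((\<lambda>m. g m * ?B m) has_sum u x) UNIV"
        using C(2)[OF xq] a0 by (simp add: g_def)
      have 3: "((\<lambda>m. g m * ?A m + - 1 * (g m * ?B m)) has_sum ((\<Sum>i<M. d i * fundamental_solution k (y i) x) + - 1 * u x)) UNIV"
        by (intro has_sum_add has_sum_cmult_right 1 2)
      have "norm ((\<Sum>i<M. d i * fundamental_solution k (y i) x) + - 1 * u x) \<le> infsum (\<lambda>m::int. ((Kc / \<delta>) * L * K1 / R ^ M) * t ^ nat \<bar>m\<bar>) UNIV"
      proof (rule has_sum_norm_le[OF 3])
        fix m :: int
        have "norm (g m * ?A m + - 1 * (g m * ?B m)) = norm (g m) * norm (?A m - ?B m)"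
        proof -
          have "g m * ?A m + - 1 * (g m * ?B m) = g m * (?A m - ?B m)"
            by (simp only: right_diff_distrib mult_minus1 add_uminus_conv_diff)
          then show ?thesis by (simp only: norm_mult)
        qed
        also have "\<dots> \<le> ((Kc / \<delta>) * L * t' ^ nat \<bar>m\<bar>) * (K1 * R ^ nat \<bar>m\<bar> / R ^ M)"
          using gb[of m] K1(2)[OF M y' x, of m] Kc(1) \<delta>(1) L t' unfolding \<phi>_def by (intro mult_mono) auto
        also have "\<dots> = ((Kc / \<delta>) * L * K1 / R ^ M) * t ^ nat \<bar>m\<bar>"
          by (simp add: t_def t'_def power_divide power_mult_distrib mult_ac)
        finally show "norm (g m * ?A m + - 1 * (g m * ?B m)) \<le> ((Kc / \<delta>) * L * K1 / R ^ M) * t ^ nat \<bar>m\<bar>" .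
      qed (intro summable_on_cmult_right st)
      also have "\<dots> = ((Kc / \<delta>) * L * K1 / R ^ M) * Q" unfolding Q_def by (rule infsum_cmult_right')
      also have "\<dots> = ((Kc / \<delta>) * K1 * Q) * L / R ^ M" by simp
      also have "\<dots> \<le> K * L / R ^ M" using K' L R by (intro divide_right_mono mult_right_mono) (auto simp: K_def)
      finally show ?thesis by (simp add: L_def norm_minus_commute)
    qed
    show "\<exists>d. (\<forall>i. norm (d i) \<le> K * L2norm U u / real M) \<and>
      (\<forall>x. norm x \<le> r \<longrightarrow> norm (u x - (\<Sum>i<M. d i * fundamental_solution k (y i) x)) \<le> K * L2norm U u / R ^ M)"
      using db app by blast
  qed
qed

lemma helmholtz_lipschitz:
  assumes k: "k > 0" and r: "0 < r" "r < 1" and \<rho>: "1 < \<rho>"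
  shows "\<exists>K>0. \<forall>U u x x'. helmholtz_solution U k u \<longrightarrow> ball 0 \<rho> \<subseteq> U \<longrightarrow> norm x \<le> r \<longrightarrow> norm x' \<le> r \<longrightarrow>
    norm (u x) \<le> K * L2norm U u \<and> norm (u x - u x') \<le> K * L2norm U u * norm (x - x')"
proof -
  define c where "c = k\<^sup>2 / 4"
  have c: "c > 0" using k by (simp add: c_def)
  have one: "(0::real) < 1" "r < 1" using r by auto
  obtain Kc where Kc: "Kc > 0" "\<And>U u. helmholtz_solution U k u \<Longrightarrow> ball 0 \<rho> \<subseteq> U \<Longrightarrow>
    (\<exists>C. (\<forall>m. norm (C m) \<le> Kc * L2norm U u / 1 ^ nat \<bar>m\<bar>) \<and>
      (\<forall>x. norm x < 1 \<longrightarrow> ((\<lambda>m. C m * helmholtz_mode c m (plane_complex x)) has_sum u x) UNIV))"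
    using helmholtz_expansion[OF k one(1) \<rho>] unfolding c_def by blast
  obtain K where K: "K > 0" "\<And>B V (v :: real^2 \<Rightarrow> complex) x x'. (\<forall>m. norm (V m) \<le> B / 1 ^ nat \<bar>m\<bar>) \<Longrightarrow>
      (\<forall>x. norm x \<le> r \<longrightarrow> ((\<lambda>m. V m * helmholtz_mode c m (plane_complex x)) has_sum v x) UNIV) \<Longrightarrow>
      norm x \<le> r \<Longrightarrow> norm x' \<le> r \<Longrightarrow> norm (v x) \<le> K * B \<and> norm (v x - v x') \<le> K * B * norm (x - x')"
    using mode_series_bounds[OF c r one(2)] by blast
  show ?thesis
  proof (intro exI[of _ "K * Kc"] conjI allI impI)
    show "K * Kc > 0" using K Kc by simp
    fix U u and x x' :: "real^2"
    assume u: "helmholtz_solution U k u" and U: "ball 0 \<rho> \<subseteq> U" and x: "norm x \<le> r" "norm x' \<le> r"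
    obtain C where C: "\<forall>m. norm (C m) \<le> Kc * L2norm U u / 1 ^ nat \<bar>m\<bar>"
      "\<forall>x. norm x < 1 \<longrightarrow> ((\<lambda>m. C m * helmholtz_mode c m (plane_complex x)) has_sum u x) UNIV"
      using Kc(2)[OF u U] by blast
    have "\<forall>x. norm x \<le> r \<longrightarrow> ((\<lambda>m. C m * helmholtz_mode c m (plane_complex x)) has_sum u x) UNIV"
      using C(2) r by auto
    from K(2)[OF C(1) this x]
    show "norm (u x) \<le> K * Kc * L2norm U u" "norm (u x - u x') \<le> K * Kc * L2norm U u * norm (x - x')"
      by (simp_all add: mult.assoc)
  qed
qed

text \<open>The bound is uniform over the position of the source because the modulus of the coefficients in
  its expansion is independent of the angle.\<close>

lemma fundamental_solution_lipschitz:
  assumes k: "k > 0" and r: "0 < r" "r < 1" and R: "1 < R"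
  shows "\<exists>K>0. \<forall>y x x'. norm y = R \<longrightarrow> norm x \<le> r \<longrightarrow> norm x' \<le> r \<longrightarrow>
    norm (fundamental_solution k y x) \<le> K \<and>
    norm (fundamental_solution k y x - fundamental_solution k y x') \<le> K * norm (x - x')"
proof -
  define c where "c = k\<^sup>2 / 4"
  have c: "c > 0" using k by (simp add: c_def)
  define a where "a = hankel_coeff c (hankel_alpha k) hankel_beta R"
  have one: "(0::real) < 1" "r < 1" "R > 0" using r R by auto
  obtain K0 where K0: "K0 > 0" "\<And>n. norm (a n) \<le> K0 / 1 ^ n"
    using hankel_coeff_upper_bound[OF one(3,1) R, of c "hankel_alpha k" hankel_beta] unfolding a_def by auto
  obtain K where K: "K > 0" "\<And>B V (v :: real^2 \<Rightarrow> complex) x x'. (\<forall>m. norm (V m) \<le> B / 1 ^ nat \<bar>m\<bar>) \<Longrightarrow>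
      (\<forall>x. norm x \<le> r \<longrightarrow> ((\<lambda>m. V m * helmholtz_mode c m (plane_complex x)) has_sum v x) UNIV) \<Longrightarrow>
      norm x \<le> r \<Longrightarrow> norm x' \<le> r \<Longrightarrow> norm (v x) \<le> K * B \<and> norm (v x - v x') \<le> K * B * norm (x - x')"
    using mode_series_bounds[OF c r one(2)] by blast
  show ?thesis
  proof (intro exI[of _ "K * K0"] conjI allI impI)
    show "K * K0 > 0" using K K0 by simp
    fix y x x' :: "real^2"
    assume y: "norm y = R" and x: "norm x \<le> r" "norm x' \<le> r"
    define \<phi> where "\<phi> = Arg2pi (plane_complex y)"
    have py: "plane_complex y = of_real R * cis \<phi>"
      using Arg2pi[of "plane_complex y"] unfolding is_Arg_def plane_complex_norm y \<phi>_def cis_conv_exp by blast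
    define V where "V = (\<lambda>m. a (nat \<bar>m\<bar>) * cis (- (of_int m * \<phi>)))"
    have V1: "\<forall>m. norm (V m) \<le> K0 / 1 ^ nat \<bar>m\<bar>" using K0(2) by (simp add: V_def norm_mult)
    have V2: "\<forall>x. norm x \<le> r \<longrightarrow> ((\<lambda>m. V m * helmholtz_mode c m (plane_complex x)) has_sum fundamental_solution k y x) UNIV"
      using fundamental_solution_expansion[OF k py one(3)] r R unfolding V_def a_def c_def by auto
    from K(2)[OF V1 V2 x]
    show "norm (fundamental_solution k y x) \<le> K * K0"
      "norm (fundamental_solution k y x - fundamental_solution k y x') \<le> K * K0 * norm (x - x')" by simp_all
  qed
qed

section \<open>Arc length and preimages of boundary sets\<close>

text \<open>Cover \<open>T\<close> by nonoverlapping intervals of almost the same total length; the image of an interval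
  lies in an interval that is not longer.\<close>

lemma measure_lipschitz_image_le:
  fixes \<psi> :: "real \<Rightarrow> real"
  assumes lip: "\<And>s t. s \<in> {0..l} \<Longrightarrow> t \<in> {0..l} \<Longrightarrow> \<bar>\<psi> s - \<psi> t\<bar> \<le> \<bar>s - t\<bar>" and T: "compact T" "T \<subseteq> {0..l}"
  shows "measure lebesgue (\<psi> ` T) \<le> measure lebesgue T"
proof (rule field_le_epsilon)
  fix e :: real assume e: "e > 0"
  have cont: "continuous_on {0..l} \<psi>"
  proof (rule continuous_onI)
    fix x \<epsilon> :: real assume x: "x \<in> {0..l}" and "\<epsilon> > 0"
    moreover have "dist (\<psi> x') (\<psi> x) \<le> \<epsilon>" if "x' \<in> {0..l}" "dist x' x < \<epsilon>" for x'
      using lip[OF that(1) x] that(2) by (simp add: dist_real_def)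
    ultimately show "\<exists>d>0. \<forall>x'\<in>{0..l}. dist x' x < d \<longrightarrow> dist (\<psi> x') (\<psi> x) \<le> \<epsilon>" by blast
  qed
  have "T \<in> lmeasurable" using T(1) by (rule lmeasurable_compact)
  moreover have "T \<subseteq> cbox 0 l" using T(2) by simp
  ultimately obtain \<D> where D: "countable \<D>" "\<And>K. K \<in> \<D> \<Longrightarrow> K \<subseteq> cbox 0 l \<and> K \<noteq> {} \<and> (\<exists>c d. K = cbox c d)"
    "pairwise (\<lambda>A B. interior A \<inter> interior B = {}) \<D>" "T \<subseteq> \<Union>\<D>" "\<Union>\<D> \<in> lmeasurable" "measure lebesgue (\<Union>\<D>) \<le> measure lebesgue T + e"
    using measurable_outer_intervals_bounded[of T 0 l e] e by metis
  have im: "\<psi> ` K \<in> lmeasurable \<and> measure lebesgue (\<psi> ` K) \<le> measure lebesgue K" if K: "K \<in> \<D>" for K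
  proof -
    obtain c d where cd: "K = {c..d}" "c \<le> d" "{c..d} \<subseteq> {0..l}" using D(2)[OF K] by auto
    have cK: "compact (\<psi> ` K)" unfolding cd(1)
      by (intro compact_continuous_image continuous_on_subset[OF cont] cd(3)) simp
    obtain s0 where s0: "s0 \<in> K" "\<And>s. s \<in> K \<Longrightarrow> \<psi> s0 \<le> \<psi> s"
      using continuous_attains_inf[of K \<psi>] continuous_on_subset[OF cont cd(3)] cd by auto
    have "\<psi> ` K \<subseteq> {\<psi> s0..\<psi> s0 + (d - c)}"
    proof
      fix v assume "v \<in> \<psi> ` K"
      then obtain s where s: "s \<in> K" "v = \<psi> s" by blast
      have "\<bar>\<psi> s - \<psi> s0\<bar> \<le> \<bar>s - s0\<bar>" using s s0(1) cd by (intro lip) auto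
      moreover have "\<bar>s - s0\<bar> \<le> d - c" using s(1) s0(1) cd by auto
      ultimately show "v \<in> {\<psi> s0..\<psi> s0 + (d - c)}" using s s0(2)[OF s(1)] by auto
    qed
    then have "measure lebesgue (\<psi> ` K) \<le> measure lebesgue {\<psi> s0..\<psi> s0 + (d - c)}"
      by (intro measure_mono_fmeasurable) (auto simp: fmeasurableD lmeasurable_compact cK)
    also have "\<dots> = measure lebesgue K" using cd by simp
    finally show ?thesis using lmeasurable_compact[OF cK] by simp
  qed
  have fin: "measure lebesgue (\<Union>K\<in>F. \<psi> ` K) \<le> measure lebesgue T + e" if F: "finite F" "F \<subseteq> \<D>" for F
  proof -
    have "measure lebesgue (\<Union>K\<in>F. \<psi> ` K) \<le> (\<Sum>K\<in>F. measure lebesgue (\<psi> ` K))"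
      using F im by (intro measure_UNION_le) (auto simp: fmeasurableD)
    also have "\<dots> \<le> (\<Sum>K\<in>F. measure lebesgue K)" using F im by (intro sum_mono) auto
    also have "\<dots> = measure lebesgue (\<Union>F)"
    proof (rule content_division)
      show "F division_of \<Union>F"
        using F D(2,3) by (auto simp: division_of_def pairwise_def subset_eq)
    qed
    also have "\<dots> \<le> measure lebesgue (\<Union>\<D>)"
    proof (rule measure_mono_fmeasurable[OF _ _ D(5)])
      show "\<Union>F \<in> sets lebesgue"
        using F D(2) by (intro sets.finite_Union) (auto simp: subset_eq, metis D(2) lmeasurable_cbox fmeasurableD subsetD)
    qed (use F in auto)
    finally show ?thesis using D(6) by linarith
  qed
  show "measure lebesgue (\<psi> ` T) \<le> measure lebesgue T + e"
  proof (cases "\<D> = {}")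
    case True
    then have "T = {}" using D(4) by auto
    then show ?thesis using e by simp
  next
    case False
    define f where "f = (\<lambda>n. \<psi> ` from_nat_into \<D> n)"
    have fm: "f n \<in> lmeasurable" for n using im[OF from_nat_into[OF False]] by (simp add: f_def)
    have fb: "measure lebesgue (\<Union>i\<le>n. f i) \<le> measure lebesgue T + e" for n
      using fin[of "from_nat_into \<D> ` {..n}"] from_nat_into[OF False] by (auto simp: f_def)
    have U: "(\<Union>n. f n) \<in> lmeasurable" "measure lebesgue (\<Union>n. f n) \<le> measure lebesgue T + e"
      using fmeasurable_countable_Union[OF fm fb] measure_countable_Union_le[OF fm fb] by auto
    have "\<psi> ` T \<subseteq> (\<Union>n. f n)"
    proof
      fix v assume "v \<in> \<psi> ` T"
      then obtain t where t: "t \<in> T" "v = \<psi> t" by auto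
      then obtain K where K: "K \<in> \<D>" "t \<in> K" using D(4) by auto
      have "from_nat_into \<D> (to_nat_on \<D> K) = K" by (rule from_nat_into_to_nat_on[OF D(1) K(1)])
      then have "v \<in> f (to_nat_on \<D> K)" unfolding f_def using K(2) t(2) by simp
      then show "v \<in> (\<Union>n. f n)" by (rule UN_I[OF UNIV_I])
    qed
    moreover have "compact (\<psi> ` T)"
      by (intro compact_continuous_image continuous_on_subset[OF cont] T)
    ultimately have "measure lebesgue (\<psi> ` T) \<le> measure lebesgue (\<Union>n. f n)"
      by (intro measure_mono_fmeasurable U(1)) (auto simp: fmeasurableD lmeasurable_compact)
    then show ?thesis using U(2) by linarith
  qed
qed

lemma arclength_loop_regular:
  assumes "arclength_loop l g"
  obtains S D where "finite S" "\<And>x. x \<in> {0..l} - S \<Longrightarrow> (g has_vector_derivative D x) (at x)"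
    "\<And>x. x \<in> {0..l} - S \<Longrightarrow> norm (D x) = 1" "continuous_on {0..l} g"
proof -
  have g: "g piecewise_C1_differentiable_on {0..l}" and f: "finite {s\<in>{0..l}. norm (vector_derivative g (at s)) \<noteq> 1}"
    using assms by (auto simp: arclength_loop_def)
  obtain S where S: "finite S" "g C1_differentiable_on ({0..l} - S)" and c: "continuous_on {0..l} g"
    using g by (auto simp: piecewise_C1_differentiable_on_def)
  obtain D where D: "\<And>x. x \<in> {0..l} - S \<Longrightarrow> (g has_vector_derivative D x) (at x)"
    using S(2) unfolding C1_differentiable_on_def by blast
  show ?thesis
  proof (rule that[of "S \<union> {s\<in>{0..l}. norm (vector_derivative g (at s)) \<noteq> 1}" D])
    fix x assume x: "x \<in> {0..l} - (S \<union> {s\<in>{0..l}. norm (vector_derivative g (at s)) \<noteq> 1})"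
    then show "(g has_vector_derivative D x) (at x)" by (intro D) auto
    then have "vector_derivative g (at x) = D x" by (rule vector_derivative_at)
    then show "norm (D x) = 1" using x by auto
  qed (use S f c in auto)
qed

lemma arclength_loop_lipschitz:
  assumes g: "arclength_loop l g" and st: "s \<in> {0..l}" "t \<in> {0..l}"
  shows "norm (g s - g t) \<le> \<bar>s - t\<bar>"
proof -
  obtain S D where S: "finite S" and D: "\<And>x. x \<in> {0..l} - S \<Longrightarrow> (g has_vector_derivative D x) (at x)"
    "\<And>x. x \<in> {0..l} - S \<Longrightarrow> norm (D x) = 1" and c: "continuous_on {0..l} g"
    using arclength_loop_regular[OF g] by metis
  have main: "norm (g b - g a) \<le> b - a" if ab: "0 \<le> a" "a \<le> b" "b \<le> l" for a b
  proof -
    have I: "(D has_integral (g b - g a)) {a..b}"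
    proof (rule fundamental_theorem_of_calculus_interior_strong[OF S ab(2)])
      show "continuous_on {a..b} g" using ab by (intro continuous_on_subset[OF c]) auto
    qed (use D ab in auto)
    have "norm (g b - g a) \<le> 1 * measure lborel {a..b}"
      by (rule has_integral_bound_real[OF zero_le_one S I]) (use D ab in auto)
    then show ?thesis using ab by simp
  qed
  show ?thesis using main[of s t] main[of t s] st by (cases "s \<le> t") (auto simp: norm_minus_commute)
qed

text \<open>The length, measured in the given parametrization, of the part of the boundary inside \<open>A\<close>.\<close>

definition preimage_length :: "(real \<times> (real \<Rightarrow> real^2)) list \<Rightarrow> (real^2) set \<Rightarrow> real"
  where "preimage_length bs A = (\<Sum>i<length bs. measure lebesgue {t\<in>{0..fst (bs ! i)}. snd (bs ! i) t \<in> A})"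

lemma compact_loop_preimage:
  assumes "arclength_loop l g" "closed A"
  shows "compact {t\<in>{0..l}. g t \<in> A}"
proof -
  have "continuous_on {0..l} g" using assms(1) by (simp add: arclength_loop_def piecewise_C1_differentiable_on_def)
  then have "closed ({0..l} \<inter> g -` A)" using assms(2) by (intro continuous_closed_preimage) auto
  moreover have "{t\<in>{0..l}. g t \<in> A} = {0..l} \<inter> g -` A" by auto
  ultimately show ?thesis using compact_Int_closed[of "{0..l}" "{0..l} \<inter> g -` A"] by (simp add: Int_absorb2)
qed

lemma boundary_parametrization_loop:
  assumes "boundary_parametrization \<Omega> bs" "i < length bs"
  shows "arclength_loop (fst (bs ! i)) (snd (bs ! i))"
  using assms nth_mem[of i bs] unfolding boundary_parametrization_def by (auto simp: split_def)

lemma boundary_parametrization_cover: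
  assumes "boundary_parametrization \<Omega> bs"
  shows "frontier \<Omega> = (\<Union>i<length bs. snd (bs ! i) ` {0..fst (bs ! i)})"
proof -
  have "frontier \<Omega> = (\<Union>b\<in>set bs. snd b ` {0..fst b})"
    using assms unfolding boundary_parametrization_def split_def by blast
  then show ?thesis by (auto simp: set_conv_nth)
qed

text \<open>Project to the line through \<open>p\<close> and \<open>q\<close>: the image of \<open>A\<close> is connected and contains the segment, and
  it is covered by the images of the preimages of \<open>A\<close> under maps that do not increase lengths.\<close>

lemma chord_le_preimage_length:
  assumes bs: "boundary_parametrization \<Omega> bs" and A: "compact A" "connected A" "A \<subseteq> frontier \<Omega>" and pq: "p \<in> A" "q \<in> A"
  shows "norm (p - q) \<le> preimage_length bs A"
proof (cases "p = q")
  case True then show ?thesis unfolding preimage_length_def by (simp add: sum_nonneg)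
next
  case False
  define e where "e = (p - q) /\<^sub>R norm (p - q)"
  have ne: "norm e = 1" using False by (simp add: e_def)
  define \<pi> where "\<pi> = (\<lambda>y::real^2. y \<bullet> e)"
  have pe: "\<pi> p - \<pi> q = norm (p - q)"
  proof -
    have "\<pi> p - \<pi> q = (p - q) \<bullet> e" by (simp add: \<pi>_def inner_diff_left)
    also have "\<dots> = inverse (norm (p - q)) * ((p - q) \<bullet> (p - q))" by (simp only: e_def inner_scaleR_right)
    also have "(p - q) \<bullet> (p - q) = (norm (p - q))\<^sup>2" by (rule power2_norm_eq_inner[symmetric])
    also have "inverse (norm (p - q)) * (norm (p - q))\<^sup>2 = norm (p - q)" using False by (simp add: power2_eq_square)
    finally show ?thesis .
  qed
  define T where "T = (\<lambda>i. {t\<in>{0..fst (bs ! i)}. snd (bs ! i) t \<in> A})"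
  have cT: "compact (T i)" if "i < length bs" for i
    unfolding T_def using A(1) by (intro compact_loop_preimage[OF boundary_parametrization_loop[OF bs that]]) (simp add: compact_imp_closed)
  have lip: "\<bar>\<pi> (snd (bs ! i) s) - \<pi> (snd (bs ! i) t)\<bar> \<le> \<bar>s - t\<bar>"
    if i: "i < length bs" and st: "s \<in> {0..fst (bs ! i)}" "t \<in> {0..fst (bs ! i)}" for i s t
  proof -
    have "\<bar>\<pi> (snd (bs ! i) s) - \<pi> (snd (bs ! i) t)\<bar> \<le> norm (snd (bs ! i) s - snd (bs ! i) t) * norm e"
      unfolding \<pi>_def inner_diff_left[symmetric] by (rule Cauchy_Schwarz_ineq2)
    also have "\<dots> \<le> \<bar>s - t\<bar>" using arclength_loop_lipschitz[OF boundary_parametrization_loop[OF bs i] st] ne by simp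
    finally show ?thesis .
  qed
  have "connected (\<pi> ` A)" unfolding \<pi>_def by (intro connected_continuous_image A(2) continuous_intros)
  then have "{\<pi> q..\<pi> p} \<subseteq> \<pi> ` A" using pq by (intro connected_contains_Icc) auto
  also have "\<dots> \<subseteq> (\<Union>i<length bs. (\<lambda>t. \<pi> (snd (bs ! i) t)) ` T i)"
  proof
    fix v assume "v \<in> \<pi> ` A"
    then obtain a where a: "a \<in> A" "v = \<pi> a" by blast
    then obtain i t where "i < length bs" "t \<in> {0..fst (bs ! i)}" "a = snd (bs ! i) t"
      using A(3) unfolding boundary_parametrization_cover[OF bs] by blast
    then show "v \<in> (\<Union>i<length bs. (\<lambda>t. \<pi> (snd (bs ! i) t)) ` T i)" using a unfolding T_def by blast
  qed
  finally have sub: "{\<pi> q..\<pi> p} \<subseteq> (\<Union>i<length bs. (\<lambda>t. \<pi> (snd (bs ! i) t)) ` T i)" .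
  have cpi: "compact ((\<lambda>t. \<pi> (snd (bs ! i) t)) ` T i)" if i: "i < length bs" for i
  proof (rule compact_continuous_image[OF _ cT[OF i]])
    have "continuous_on {0..fst (bs ! i)} (snd (bs ! i))"
      using boundary_parametrization_loop[OF bs i] by (simp add: arclength_loop_def piecewise_C1_differentiable_on_def)
    then show "continuous_on (T i) (\<lambda>t. \<pi> (snd (bs ! i) t))"
      unfolding \<pi>_def by (intro continuous_intros) (auto simp: T_def elim: continuous_on_subset)
  qed
  have "norm (p - q) = measure lebesgue {\<pi> q..\<pi> p}" using pe[symmetric] norm_ge_zero[of "p - q"] by simp
  also have "\<dots> \<le> measure lebesgue (\<Union>i<length bs. (\<lambda>t. \<pi> (snd (bs ! i) t)) ` T i)"
    using cpi by (intro measure_mono_fmeasurable[OF sub] lmeasurable_compact compact_UN) auto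
  also have "\<dots> \<le> (\<Sum>i<length bs. measure lebesgue ((\<lambda>t. \<pi> (snd (bs ! i) t)) ` T i))"
    using cpi by (intro measure_UNION_le) (auto simp: fmeasurableD lmeasurable_compact)
  also have "\<dots> \<le> (\<Sum>i<length bs. measure lebesgue (T i))"
  proof (rule sum_mono)
    fix i assume "i \<in> {..<length bs}"
    then have i: "i < length bs" by simp
    show "measure lebesgue ((\<lambda>t. \<pi> (snd (bs ! i) t)) ` T i) \<le> measure lebesgue (T i)"
      by (rule measure_lipschitz_image_le[OF lip[OF i] cT[OF i]]) (auto simp: T_def)
  qed
  finally show ?thesis by (simp add: preimage_length_def T_def)
qed

section \<open>Comparison of two parametrizations\<close>

lemma loop_preimage_finite:
  assumes g: "arclength_loop l g"
  shows "finite {t\<in>{0..l}. g t \<in> {p}}"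
proof -
  have inj: "inj_on g {0..<l}" using g by (simp add: arclength_loop_def)
  have "finite ({0..<l} \<inter> g -` {p})" using finite_vimage_IntI[of "{p}" g "{0..<l}"] inj by (simp add: Int_commute)
  moreover have "{t\<in>{0..l}. g t \<in> {p}} \<subseteq> insert l ({0..<l} \<inter> g -` {p})" by auto
  ultimately show ?thesis by (meson finite.insertI finite_subset)
qed

lemma preimage_length_Un:
  assumes bs: "boundary_parametrization \<Omega> bs" and AB: "closed A" "closed B" "finite (A \<inter> B)"
  shows "preimage_length bs (A \<union> B) = preimage_length bs A + preimage_length bs B"
proof -
  have "measure lebesgue {t\<in>{0..fst (bs ! i)}. snd (bs ! i) t \<in> A \<union> B}
      = measure lebesgue {t\<in>{0..fst (bs ! i)}. snd (bs ! i) t \<in> A} + measure lebesgue {t\<in>{0..fst (bs ! i)}. snd (bs ! i) t \<in> B}"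
    if i: "i < length bs" for i
  proof -
    note g = boundary_parametrization_loop[OF bs i]
    let ?T = "\<lambda>A. {t\<in>{0..fst (bs ! i)}. snd (bs ! i) t \<in> A}"
    have "?T A \<inter> ?T B \<subseteq> (\<Union>p\<in>A \<inter> B. ?T {p})" by auto
    moreover have "finite (\<Union>p\<in>A \<inter> B. ?T {p})" using AB(3) loop_preimage_finite[OF g] by blast
    ultimately have "finite (?T A \<inter> ?T B)" by (rule finite_subset)
    then have n: "negligible (?T A \<inter> ?T B)" by (rule negligible_finite)
    have m: "?T A \<in> lmeasurable" "?T B \<in> lmeasurable"
      by (intro lmeasurable_compact compact_loop_preimage[OF g] AB)+
    have "?T (A \<union> B) = ?T A \<union> ?T B" by auto
    then have "measure lebesgue (?T (A \<union> B)) = measure lebesgue (?T A) + measure lebesgue (?T B) - measure lebesgue (?T A \<inter> ?T B)"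
      using measure_Un3[OF m] by simp
    then show ?thesis using n by (simp add: negligible_imp_measure0)
  qed
  then show ?thesis unfolding preimage_length_def by (simp add: sum.distrib[symmetric])
qed

lemma preimage_length_mono:
  assumes bs: "boundary_parametrization \<Omega> bs" and AB: "closed A" "closed B" "A \<subseteq> B"
  shows "preimage_length bs A \<le> preimage_length bs B"
  unfolding preimage_length_def
proof (rule sum_mono)
  fix i assume "i \<in> {..<length bs}"
  then have g: "arclength_loop (fst (bs ! i)) (snd (bs ! i))" by (intro boundary_parametrization_loop[OF bs]) simp
  show "measure lebesgue {t\<in>{0..fst (bs ! i)}. snd (bs ! i) t \<in> A} \<le> measure lebesgue {t\<in>{0..fst (bs ! i)}. snd (bs ! i) t \<in> B}"
  proof (rule measure_mono_fmeasurable)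
    show "{t\<in>{0..fst (bs ! i)}. snd (bs ! i) t \<in> A} \<subseteq> {t\<in>{0..fst (bs ! i)}. snd (bs ! i) t \<in> B}" using AB(3) by auto
  qed (intro fmeasurableD lmeasurable_compact compact_loop_preimage[OF g] AB)+
qed

text \<open>At a point with unit tangent short chords are almost as long as the arc; the factor two leaves room
  and avoids a limit.\<close>

lemma arclength_loop_chord:
  assumes D: "(g has_vector_derivative D) (at x)" "norm (D :: real^2) = 1"
  shows "\<exists>d>0. \<forall>a b. a \<le> x \<and> x \<le> b \<and> b - a < d \<longrightarrow> (b - a) / 2 \<le> norm (g b - g a)"
proof -
  have "(g has_derivative (\<lambda>h. h *\<^sub>R D)) (at x)" using D(1) by (simp add: has_vector_derivative_def)
  then obtain d where d: "d > 0" "\<And>y. norm (y - x) < d \<Longrightarrow> norm (g y - g x - (y - x) *\<^sub>R D) \<le> 1 / 4 * norm (y - x)"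
    unfolding has_derivative_at_alt by (metis zero_less_divide_1_iff zero_less_numeral)
  show ?thesis
  proof (intro exI[of _ d] conjI allI impI d(1))
    fix a b assume ab: "a \<le> x \<and> x \<le> b \<and> b - a < d"
    have 1: "norm (g b - g x - (b - x) *\<^sub>R D) \<le> 1 / 4 * (b - x)" using d(2)[of b] ab by simp
    have 2: "norm (g a - g x - (a - x) *\<^sub>R D) \<le> 1 / 4 * (x - a)" using d(2)[of a] ab by simp
    have "(b - a) *\<^sub>R D = (g b - g a) - ((g b - g x - (b - x) *\<^sub>R D) - (g a - g x - (a - x) *\<^sub>R D))"
      by (simp add: algebra_simps)
    then have "norm ((b - a) *\<^sub>R D) \<le> norm (g b - g a) + norm ((g b - g x - (b - x) *\<^sub>R D) - (g a - g x - (a - x) *\<^sub>R D))"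
      by (metis norm_triangle_ineq4)
    also have "\<dots> \<le> norm (g b - g a) + (1 / 4 * (b - x) + 1 / 4 * (x - a))"
      using norm_triangle_ineq4[of "g b - g x - (b - x) *\<^sub>R D" "g a - g x - (a - x) *\<^sub>R D"] 1 2 by linarith
    finally have "\<bar>b - a\<bar> \<le> norm (g b - g a) + (1 / 4 * (b - x) + 1 / 4 * (x - a))" by (simp only: norm_scaleR D(2) mult_1_right)
    moreover have "\<bar>b - a\<bar> = b - a" "1 / 4 * (b - x) + 1 / 4 * (x - a) = (b - a) / 4" using ab by (auto simp: field_simps)
    ultimately have "b - a \<le> norm (g b - g a) + (b - a) / 4" by (simp only:)
    then show "(b - a) / 2 \<le> norm (g b - g a)" using ab by argo
  qed
qed

text \<open>Near a regular parameter, half the parameter length of an arc of \<open>g\<close> is at most a chord, hence at most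
  the length of the arc in the other parametrization. Both sides are additive over adjacent
  arcs, so Bolzano's bisection principle extends the inequality to the whole loop; the exceptional
  parameters are handled by approaching them from either side.\<close>

lemma loop_length_le_preimage_length:
  assumes bs: "boundary_parametrization \<Omega> bs" and g: "arclength_loop l g" and sub: "g ` {0..l} \<subseteq> frontier \<Omega>"
  shows "l / 2 \<le> preimage_length bs (g ` {0..l})"
proof -
  obtain S D where S: "finite S" and D: "\<And>x. x \<in> {0..l} - S \<Longrightarrow> (g has_vector_derivative D x) (at x)"
    "\<And>x. x \<in> {0..l} - S \<Longrightarrow> norm (D x) = 1" and c: "continuous_on {0..l} g"
    using arclength_loop_regular[OF g] by metis
  have l: "0 < l" "g l = g 0" "inj_on g {0..<l}" using g by (auto simp: arclength_loop_def)
  define N where "N = (\<lambda>a b. preimage_length bs (g ` {a..b}))"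
  have cg: "compact (g ` {a..b})" if "0 \<le> a" "b \<le> l" for a b
    using that by (intro compact_continuous_image continuous_on_subset[OF c]) auto
  have clg: "closed (g ` {a..b})" if "0 \<le> a" "b \<le> l" for a b using cg[OF that] by (rule compact_imp_closed)
  have mono: "N a b \<le> N a' b'" if "0 \<le> a'" "a' \<le> a" "b \<le> b'" "b' \<le> l" for a b a' b'
    unfolding N_def using that by (intro preimage_length_mono[OF bs] clg image_mono) auto
  have chord: "norm (g b - g a) \<le> N a b" if "0 \<le> a" "a \<le> b" "b \<le> l" for a b
    unfolding N_def
  proof (rule chord_le_preimage_length[OF bs])
    show "connected (g ` {a..b})" using that by (intro connected_continuous_image continuous_on_subset[OF c]) auto
    show "g ` {a..b} \<subseteq> frontier \<Omega>" using sub that by auto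
  qed (use that cg in auto)
  have split: "N a c = N a b + N b c" if abc: "0 \<le> a" "a \<le> b" "b \<le> c" "c \<le> l" for a b c
  proof -
    have "g ` {a..b} \<inter> g ` {b..c} \<subseteq> {g b, g l}"
    proof
      fix v assume "v \<in> g ` {a..b} \<inter> g ` {b..c}"
      then obtain s t where st: "s \<in> {a..b}" "t \<in> {b..c}" "v = g s" "v = g t" by blast
      show "v \<in> {g b, g l}"
      proof (cases "t < l")
        case True
        then have "s = t" using st abc by (intro inj_onD[OF l(3)]) auto
        then show ?thesis using st by auto
      next
        case False
        then have "t = l" using st abc by auto
        then show ?thesis using st by auto
      qed
    qed
    then have fin: "finite (g ` {a..b} \<inter> g ` {b..c})" by (rule finite_subset) simp
    have "g ` {a..c} = g ` {a..b} \<union> g ` {b..c}"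
      using abc by (metis image_Un ivl_disj_un_two_touch(4))
    then show ?thesis unfolding N_def using preimage_length_Un[OF bs clg clg fin] abc by simp
  qed
  \<comment> \<open>the two premises make P trivial outside the parameter interval, as bisection quantifies over all reals\<close>
  define P where "P = (\<lambda>a b. 0 \<le> a \<longrightarrow> b \<le> l \<longrightarrow> (b - a) / 2 \<le> N a b)"
  have trans: "P a c" if "P a b" "P b c" "a \<le> b" "b \<le> c" for a b c
    using that split[of a b c] unfolding P_def by (auto simp: field_simps)
  have loc: "\<exists>d>0. \<forall>a b. a \<le> x \<and> x \<le> b \<and> b - a < d \<longrightarrow> P a b" if x: "x \<in> {0..l} - S" for x
  proof -
    obtain d where d: "d > 0" "\<forall>a b. a \<le> x \<and> x \<le> b \<and> b - a < d \<longrightarrow> (b - a) / 2 \<le> norm (g b - g a)"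
      using arclength_loop_chord[OF D(1)[OF x] D(2)[OF x]] by blast
    have "P a b" if "a \<le> x \<and> x \<le> b \<and> b - a < d" for a b
      unfolding P_def using d(2) that chord[of a b] by (meson order_trans)
    then show ?thesis using d(1) by blast
  qed
  have regular: "P a b" if ab: "0 \<le> a" "a \<le> b" "b \<le> l" and none: "{a..b} \<inter> S = {}" for a b
  proof (rule Bolzano[OF ab(2)])
    show "\<exists>d>0. \<forall>a b. a \<le> x \<and> x \<le> b \<and> b - a < d \<longrightarrow> P a b" if "a \<le> x" "x \<le> b" for x
      using none that ab by (intro loc) auto
  qed (rule trans)
  have open_regular: "P a b" if ab: "0 \<le> a" "a \<le> b" "b \<le> l" and none: "{a<..<b} \<inter> S = {}" for a b
    unfolding P_def
  proof (intro impI)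
    have N0: "0 \<le> N a b" unfolding N_def preimage_length_def by (intro sum_nonneg) auto
    show "(b - a) / 2 \<le> N a b"
    proof (rule field_le_epsilon)
      fix e :: real assume e: "e > 0"
      show "(b - a) / 2 \<le> N a b + e"
      proof (cases "b - a \<le> 2 * e")
        case True
        then have "(b - a) / 2 \<le> e" by simp
        then show ?thesis using N0 by (rule add_increasing[rotated])
      next
        case False
        \<comment> \<open>cut off both ends, which may be exceptional parameters\<close>
        define h where "h = min e ((b - a) / 2)"
        have h: "h > 0" "h \<le> e" "h \<le> (b - a) / 2" using e False by (auto simp: h_def)
        have "{a + h..b - h} \<subseteq> {a<..<b}" using h(1) by auto
        then have "{a + h..b - h} \<inter> S = {}" using none by blast
        then have "P (a + h) (b - h)" using ab h by (intro regular) (auto simp: field_simps)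
        then have "(b - h - (a + h)) / 2 \<le> N (a + h) (b - h)" using ab h unfolding P_def by simp
        also have "\<dots> \<le> N a b" using ab h by (intro mono) auto
        finally show ?thesis using h by (simp add: field_simps)
      qed
    qed
  qed
  have "P 0 l"
  proof (rule Bolzano)
    show "0 \<le> l" using l by simp
    show "\<exists>d>0. \<forall>a b. a \<le> x \<and> x \<le> b \<and> b - a < d \<longrightarrow> P a b" if x: "0 \<le> x" "x \<le> l" for x
    proof -
      obtain d where d: "d > 0" "\<forall>y\<in>S. y \<noteq> x \<longrightarrow> d \<le> dist x y"
        using finite_set_avoid[OF S, of x] by blast
      have "P a b" if ab: "a \<le> x \<and> x \<le> b \<and> b - a < d" for a b
      proof (cases "0 \<le> a \<and> b \<le> l")
        case True
        have e1: "{a<..<x} \<inter> S = {}" using d(2) ab by (force simp: dist_real_def)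
        have e2: "{x<..<b} \<inter> S = {}" using d(2) ab by (force simp: dist_real_def)
        have "P a x" "P x b" using open_regular[OF _ _ _ e1] open_regular[OF _ _ _ e2] True ab x by auto
        then show ?thesis using trans ab by blast
      qed (auto simp: P_def)
      then show ?thesis using d(1) by blast
    qed
  qed (rule trans)
  then show ?thesis using l by (simp add: P_def N_def)
qed

lemma boundary_length_nth: "boundary_length bs = (\<Sum>i<length bs. fst (bs ! i))"
  by (simp add: boundary_length_def sum_list_sum_nth atLeast0LessThan)

text \<open>The loops of \<open>bs\<close> have disjoint images, so their preimages under \<open>bs0\<close> share the length of \<open>bs0\<close>.\<close>

lemma boundary_length_comparison:
  assumes bs: "boundary_parametrization \<Omega> bs" and bs0: "boundary_parametrization \<Omega> bs0"
  shows "boundary_length bs \<le> 2 * boundary_length bs0"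
proof -
  let ?I = "\<lambda>j. snd (bs ! j) ` {0..fst (bs ! j)}"
  let ?T = "\<lambda>i j. {t\<in>{0..fst (bs0 ! i)}. snd (bs0 ! i) t \<in> ?I j}"
  have cl: "closed (?I j)" if j: "j < length bs" for j
  proof -
    have "continuous_on {0..fst (bs ! j)} (snd (bs ! j))"
      using boundary_parametrization_loop[OF bs j] by (simp add: arclength_loop_def piecewise_C1_differentiable_on_def)
    then show ?thesis by (intro compact_imp_closed compact_continuous_image) auto
  qed
  have disj: "?I i \<inter> ?I j = {}" if "i < length bs" "j < length bs" "i \<noteq> j" for i j
    using bs that unfolding boundary_parametrization_def by blast
  have "boundary_length bs / 2 = (\<Sum>j<length bs. fst (bs ! j) / 2)" by (simp add: boundary_length_nth sum_divide_distrib)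
  also have "\<dots> \<le> (\<Sum>j<length bs. preimage_length bs0 (?I j))"
  proof (rule sum_mono)
    fix j assume "j \<in> {..<length bs}"
    then have j: "j < length bs" by simp
    show "fst (bs ! j) / 2 \<le> preimage_length bs0 (?I j)"
      by (rule loop_length_le_preimage_length[OF bs0 boundary_parametrization_loop[OF bs j]])
        (use j in \<open>auto simp: boundary_parametrization_cover[OF bs]\<close>)
  qed
  also have "\<dots> = (\<Sum>i<length bs0. \<Sum>j<length bs. measure lebesgue (?T i j))"
    unfolding preimage_length_def by (rule sum.swap)
  also have "\<dots> \<le> (\<Sum>i<length bs0. fst (bs0 ! i))"
  proof (rule sum_mono)
    fix i assume "i \<in> {..<length bs0}"
    then have g: "arclength_loop (fst (bs0 ! i)) (snd (bs0 ! i))" by (intro boundary_parametrization_loop[OF bs0]) simp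
    have m: "?T i j \<in> lmeasurable" if "j < length bs" for j
      by (rule lmeasurable_compact[OF compact_loop_preimage[OF g cl[OF that]]])
    have "(\<Sum>j<length bs. measure lebesgue (?T i j)) = measure lebesgue (\<Union>j<length bs. ?T i j)"
    proof (rule measure_finite_Union[symmetric])
      show "disjoint_family_on (\<lambda>j. ?T i j) {..<length bs}"
        unfolding disjoint_family_on_def using disj by blast
      show "emeasure lebesgue (?T i j) \<noteq> \<infinity>" if "j \<in> {..<length bs}" for j
        using m[of j] that by (auto simp: fmeasurable_def)
    qed (use m in \<open>auto simp: fmeasurableD\<close>)
    also have "\<dots> \<le> measure lebesgue {0..fst (bs0 ! i)}"
      using m by (intro measure_mono_fmeasurable) (auto simp: fmeasurableD)
    also have "\<dots> = fst (bs0 ! i)" using g by (simp add: arclength_loop_def)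
    finally show "(\<Sum>j<length bs. measure lebesgue (?T i j)) \<le> fst (bs0 ! i)" .
  qed
  finally show ?thesis by (simp add: boundary_length_nth)
qed

section \<open>Loops, collocation points and quadrature on the boundary\<close>

lemma compact_connected_loop_image:
  assumes g: "arclength_loop l g"
  shows "compact (g ` {0..l})" "connected (g ` {0..l})" "g ` {0..l} \<noteq> {}"
proof -
  have "continuous_on {0..l} g" using g by (simp add: arclength_loop_def piecewise_C1_differentiable_on_def)
  then show "compact (g ` {0..l})" "connected (g ` {0..l})"
    by (intro compact_continuous_image connected_continuous_image; simp)+
  show "g ` {0..l} \<noteq> {}" using g by (simp add: arclength_loop_def)
qed

text \<open>The other loops form a closed set, so a connected set that meets one loop cannot leave it.\<close>

lemma loop_image_component:
  assumes bs: "boundary_parametrization \<Omega> bs" and i: "i < length bs"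
  shows "snd (bs ! i) ` {0..fst (bs ! i)} \<in> components (frontier \<Omega>)"
proof -
  let ?I = "\<lambda>j. snd (bs ! j) ` {0..fst (bs ! j)}"
  note im = compact_connected_loop_image[OF boundary_parametrization_loop[OF bs]]
  have F: "frontier \<Omega> = (\<Union>j<length bs. ?I j)" by (rule boundary_parametrization_cover[OF bs])
  have sub: "?I i \<subseteq> frontier \<Omega>" using i unfolding F by blast
  obtain c where c: "c \<in> components (frontier \<Omega>)" "?I i \<subseteq> c"
    using exists_component_superset[OF sub _ im(2)[OF i]] sub im(3)[OF i] by blast
  define X where "X = (\<Union>j\<in>{..<length bs} - {i}. ?I j)"
  have X: "closed X" unfolding X_def using im(1) by (intro closed_UN) (auto simp: compact_imp_closed)
  have disj: "?I i \<inter> X = {}"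
    using bs i unfolding boundary_parametrization_def X_def by blast
  have cov: "c \<subseteq> ?I i \<union> X" using in_components_subset[OF c(1)] unfolding F X_def by blast
  have "c \<inter> X = {}"
  proof (rule ccontr)
    assume "c \<inter> X \<noteq> {}"
    moreover have "?I i \<inter> c \<noteq> {}" using c(2) im(3)[OF i] by blast
    ultimately show False
      using in_components_connected[OF c(1)] cov disj X compact_imp_closed[OF im(1)[OF i]]
      unfolding connected_closed by blast
  qed
  then have "c = ?I i" using cov c(2) by blast
  then show ?thesis using c(1) by simp
qed

lemma finite_boundary_components:
  assumes bs: "boundary_parametrization \<Omega> bs" and C: "C \<in> components (frontier \<Omega>)"
  shows "C \<in> (\<lambda>i. snd (bs ! i) ` {0..fst (bs ! i)}) ` {..<length bs}"
proof -
  obtain p where p: "p \<in> C" using in_components_nonempty[OF C] by blast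
  then have "p \<in> frontier \<Omega>" using in_components_subset[OF C] by blast
  then obtain i where i: "i < length bs" "p \<in> snd (bs ! i) ` {0..fst (bs ! i)}"
    unfolding boundary_parametrization_cover[OF bs] by blast
  have "C = snd (bs ! i) ` {0..fst (bs ! i)}"
    using components_eq[OF C loop_image_component[OF bs i(1)]] p i(2) by blast
  then show ?thesis using i(1) by blast
qed

lemma loop_image_diameter:
  assumes g: "arclength_loop l g"
  shows "0 < diameter (g ` {0..l})" "diameter (g ` {0..l}) \<le> l"
proof -
  have l: "0 < l" "inj_on g {0..<l}" using g by (auto simp: arclength_loop_def)
  have "g 0 \<noteq> g (l / 2)" using inj_onD[OF l(2), of 0 "l / 2"] l(1) by auto
  then have "0 < dist (g 0) (g (l / 2))" by simp
  also have "\<dots> \<le> diameter (g ` {0..l})"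
    using l(1) by (intro diameter_bounded_bound compact_imp_bounded compact_connected_loop_image(1)[OF g]) auto
  finally show "0 < diameter (g ` {0..l})" .
  show "diameter (g ` {0..l}) \<le> l"
  proof (rule diameter_le)
    fix p q assume "p \<in> g ` {0..l}" "q \<in> g ` {0..l}"
    then obtain s t where st: "s \<in> {0..l}" "t \<in> {0..l}" "p = g s" "q = g t" by blast
    have "norm (g s - g t) \<le> \<bar>s - t\<bar>" by (rule arclength_loop_lipschitz[OF g st(1,2)])
    then show "norm (p - q) \<le> l" using st by auto
  qed (use l in auto)
qed

text \<open>The components of the boundary do not depend on the parametrization; each has a positive
  diameter, and there are finitely many. The number \<open>1\<close> in the minimum only caters for an empty set.\<close>

lemma loop_length_lower_bound:
  assumes bs0: "boundary_parametrization \<Omega> bs0"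
  shows "\<exists>\<delta>>0. \<forall>bs. boundary_parametrization \<Omega> bs \<longrightarrow> (\<forall>i<length bs. \<delta> \<le> fst (bs ! i))"
proof -
  \<comment> \<open>depends on the frontier only, not on a parametrization of it\<close>
  let ?D = "insert 1 (diameter ` components (frontier \<Omega>))"
  have fin: "finite ?D"
    using finite_subset[OF subsetI[OF finite_boundary_components[OF bs0]]] by simp
  have "0 < d" if d: "d \<in> ?D" for d
  proof (cases "d = 1")
    case False
    then obtain C where C: "C \<in> components (frontier \<Omega>)" "d = diameter C" using d by blast
    from finite_boundary_components[OF bs0 C(1)] obtain i where
      i: "i < length bs0" "C = snd (bs0 ! i) ` {0..fst (bs0 ! i)}" by blast
    show ?thesis using loop_image_diameter(1)[OF boundary_parametrization_loop[OF bs0 i(1)]] C(2) i(2) by simp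
  qed simp
  then have "0 < Min ?D" using fin by (subst Min_gr_iff) auto
  moreover have "Min ?D \<le> fst (bs ! i)" if bs: "boundary_parametrization \<Omega> bs" and i: "i < length bs" for bs i
  proof -
    have "Min ?D \<le> diameter (snd (bs ! i) ` {0..fst (bs ! i)})"
      using loop_image_component[OF bs i] by (intro Min_le fin) blast
    also have "\<dots> \<le> fst (bs ! i)" by (rule loop_image_diameter(2)[OF boundary_parametrization_loop[OF bs i]])
    finally show ?thesis .
  qed
  ultimately show ?thesis by blast
qed

text \<open>The parameter interval of the loop that contains \<open>s\<close> starts at \<open>a\<close>, the total length of the earlier
  loops.\<close>

lemma boundary_point_on_loop:
  assumes "\<forall>b\<in>set bs. 0 < fst b" "0 \<le> s" "s < boundary_length bs"
  shows "\<exists>b\<in>set bs. \<exists>a\<ge>0. a \<le> s \<and> s < a + fst b \<and> a + fst b \<le> boundary_length bs \<and>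
    (\<forall>t. a \<le> t \<longrightarrow> t < a + fst b \<longrightarrow> boundary_point bs t = snd b (t - a))"
  using assms
proof (induction bs arbitrary: s)
  case Nil then show ?case by (simp add: boundary_length_def)
next
  case (Cons b bs)
  obtain l g where b: "b = (l, g)" by (cases b)
  have len: "boundary_length (b # bs) = l + boundary_length bs" by (simp add: boundary_length_def b)
  have nn: "0 \<le> boundary_length bs" unfolding boundary_length_def using Cons.prems(1) by (intro sum_list_nonneg) auto
  show ?case
  proof (cases "s < l")
    case True
    show ?thesis
      by (rule bexI[of _ b], rule exI[of _ 0]) (use True Cons.prems(2) nn in \<open>auto simp: b boundary_length_def\<close>)
  next
    case False
    have "0 \<le> s - l" "s - l < boundary_length bs" using False Cons.prems(3) len by auto
    then obtain b' a where a: "b' \<in> set bs" "a \<ge> 0" "a \<le> s - l" "s - l < a + fst b'" "a + fst b' \<le> boundary_length bs"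
      "\<And>t. a \<le> t \<Longrightarrow> t < a + fst b' \<Longrightarrow> boundary_point bs t = snd b' (t - a)"
      using Cons.IH[of "s - l"] Cons.prems(1) by auto
    have l: "0 < l" using Cons.prems(1) b by simp
    have pt: "boundary_point (b # bs) t = snd b' (t - (a + l))" if "a + l \<le> t" "t < a + l + fst b'" for t
    proof -
      have "boundary_point (b # bs) t = boundary_point bs (t - l)" using that a(2) by (simp add: b)
      also have "\<dots> = snd b' (t - l - a)" using that by (intro a(6)) auto
      finally show ?thesis by (simp add: algebra_simps)
    qed
    show ?thesis
      by (rule bexI[of _ b'], rule exI[of _ "a + l"]) (use a l len pt in auto)
  qed
qed

lemma boundary_point_frontier:
  assumes bs: "boundary_parametrization \<Omega> bs" and s: "0 \<le> s" "s < boundary_length bs"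
  shows "boundary_point bs s \<in> frontier \<Omega>"
proof -
  have "\<forall>b\<in>set bs. 0 < fst b" using bs unfolding boundary_parametrization_def arclength_loop_def by auto
  from boundary_point_on_loop[OF this s] obtain b a where b: "b \<in> set bs" "a \<le> s" "s < a + fst b"
    "boundary_point bs s = snd b (s - a)" by blast
  have "frontier \<Omega> = (\<Union>b\<in>set bs. snd b ` {0..fst b})"
    using bs unfolding boundary_parametrization_def split_def by blast
  moreover have "s - a \<in> {0..fst b}" using b by auto
  ultimately show ?thesis using b by blast
qed

text \<open>Neighbouring parameters may lie on different loops. If all loops are at least as long as the
  spacing, one of the two collocation parameters next to \<open>s\<close> lies on the same loop.\<close>

lemma nearest_collocation_point:
  assumes bs: "boundary_parametrization \<Omega> bs" and N: "N \<ge> 1"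
    and long: "\<And>i. i < length bs \<Longrightarrow> boundary_length bs / real N \<le> fst (bs ! i)"
    and s0: "0 \<le> s0" "s0 < boundary_length bs / real N"
    and s: "0 \<le> s" "s < boundary_length bs"
  shows "\<exists>j<N. \<bar>s - (s0 + real j * (boundary_length bs / real N))\<bar> \<le> boundary_length bs / real N \<and>
    norm (boundary_point bs s - boundary_point bs (s0 + real j * (boundary_length bs / real N))) \<le> boundary_length bs / real N"
proof -
  define h where "h = boundary_length bs / real N"
  have Nh: "real N * h = boundary_length bs" using N by (simp add: h_def)
  have h: "h > 0" using s0 by (simp add: h_def)
  have "\<forall>b\<in>set bs. 0 < fst b" using bs unfolding boundary_parametrization_def arclength_loop_def by auto
  from boundary_point_on_loop[OF this s] obtain b a where b: "b \<in> set bs" "a \<ge> 0" "a \<le> s" "s < a + fst b"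
    "a + fst b \<le> boundary_length bs" and pt: "\<And>t. a \<le> t \<Longrightarrow> t < a + fst b \<Longrightarrow> boundary_point bs t = snd b (t - a)" by blast
  obtain i where i: "i < length bs" "b = bs ! i" using b(1) by (auto simp: in_set_conv_nth)
  have lh: "h \<le> fst b" using long[OF i(1)] i(2) by (simp add: h_def)
  have close: "norm (boundary_point bs s - boundary_point bs t) \<le> h" if t: "a \<le> t" "t < a + fst b" "\<bar>s - t\<bar> \<le> h" for t
  proof -
    have "norm (snd b (s - a) - snd b (t - a)) \<le> \<bar>(s - a) - (t - a)\<bar>"
      unfolding i(2) using b t i by (intro arclength_loop_lipschitz[OF boundary_parametrization_loop[OF bs i(1)]]) auto
    then show ?thesis using pt[of s] pt[of t] b t by simp
  qed
  have "\<exists>j<N. a \<le> s0 + real j * h \<and> s0 + real j * h < a + fst b \<and> \<bar>s - (s0 + real j * h)\<bar> \<le> h"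
  proof (cases "s < s0")
    case True
    have "s0 < h" using s0 by (simp add: h_def)
    then show ?thesis using True b lh s N by (intro exI[of _ 0]) auto
  next
    case False
    define j where "j = nat \<lfloor>(s - s0) / h\<rfloor>"
    have "0 \<le> (s - s0) / h" using False h by simp
    then have "real j \<le> (s - s0) / h" "(s - s0) / h < real j + 1" unfolding j_def by linarith+
    then have j: "real j * h \<le> s - s0" "s - s0 < real j * h + h" using h by (auto simp: field_simps)
    have jN: "real j' * h < real N * h \<Longrightarrow> j' < N" for j' using h by simp
    show ?thesis
    proof (cases "a \<le> s0 + real j * h")
      case True
      have "j < N" using j s s0 Nh by (intro jN) auto
      then show ?thesis using True j b by (intro exI[of _ j]) auto
    next
      case False
      have e: "real (Suc j) * h = real j * h + h" by (simp add: algebra_simps)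
      have "Suc j < N" using False b lh s0 Nh e by (intro jN) linarith
      then show ?thesis using False j b lh e by (intro exI[of _ "Suc j"]) auto
    qed
  qed
  then show ?thesis using close unfolding h_def[symmetric] by blast
qed

lemma integrable_interval_indicator:
  fixes a b :: real
  shows "integrable lebesgue (indicat_real {a..<b})" "integrable lebesgue (indicat_real {a..b})"
proof -
  have "bounded {a..<b}" by (rule bounded_subset[OF bounded_closed_interval[of a b]]) auto
  then have "{a..<b} \<in> lmeasurable" by (rule bounded_set_imp_lmeasurable) simp
  then show "integrable lebesgue (indicat_real {a..<b})" by (simp only: lmeasurable_iff_integrable)
  have "{a..b} \<in> lmeasurable" by (rule lmeasurable_compact) simp
  then show "integrable lebesgue (indicat_real {a..b})" by (simp only: lmeasurable_iff_integrable)
qed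

lemma boundary_L2norm_square:
  "(boundary_L2norm bs w)\<^sup>2 = (LINT s:{0..<boundary_length bs}|lebesgue. (norm (w (boundary_point bs s)))\<^sup>2)"
proof -
  have "0 \<le> (LINT s:{0..<boundary_length bs}|lebesgue. (norm (w (boundary_point bs s)))\<^sup>2)"
    unfolding set_lebesgue_integral_def by (rule Bochner_Integration.integral_nonneg) (auto simp: indicator_def)
  then show ?thesis by (simp add: boundary_L2norm_def)
qed

lemma boundary_L2norm_le_sup:
  assumes bs: "boundary_parametrization \<Omega> bs" and w: "\<And>p. p \<in> frontier \<Omega> \<Longrightarrow> norm (w p) \<le> B"
    and L: "0 \<le> boundary_length bs"
  shows "(boundary_L2norm bs w)\<^sup>2 \<le> B\<^sup>2 * boundary_length bs"
proof -
  let ?L = "boundary_length bs"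
  have "integrable lebesgue (\<lambda>s. B\<^sup>2 * indicator {0..<?L} s)"
    by (intro Bochner_Integration.integrable_mult_right integrable_interval_indicator)
  then have "(boundary_L2norm bs w)\<^sup>2 \<le> (\<integral>s. B\<^sup>2 * indicator {0..<?L} s \<partial>lebesgue)"
    unfolding boundary_L2norm_square set_lebesgue_integral_def
  proof (rule integral_mono')
    fix s show "indicator {0..<?L} s *\<^sub>R (norm (w (boundary_point bs s)))\<^sup>2 \<le> B\<^sup>2 * indicator {0..<?L} s"
      using w[OF boundary_point_frontier[OF bs, of s]] by (auto simp: indicator_def intro!: power_mono)
  qed simp
  also have "\<dots> = B\<^sup>2 * ?L" using L by simp
  finally show ?thesis .
qed

text \<open>Each point of the boundary is compared with a collocation point within the spacing \<open>h\<close>, and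
  each collocation point is used on a parameter interval of length at most \<open>2 * h\<close>. The integrand
  is therefore dominated by a step function.\<close>

lemma boundary_L2norm_quadrature:
  assumes bs: "boundary_parametrization \<Omega> bs" and N: "N \<ge> 1" and x: "equally_placed bs N x"
    and long: "\<And>i. i < length bs \<Longrightarrow> boundary_length bs / real N \<le> fst (bs ! i)"
    and lip: "\<And>p q. p \<in> frontier \<Omega> \<Longrightarrow> q \<in> frontier \<Omega> \<Longrightarrow> norm (w p - w q) \<le> \<Lambda> * norm (p - q)" and \<Lambda>: "\<Lambda> \<ge> 0"
  shows "(boundary_L2norm bs w)\<^sup>2 \<le> 4 * (boundary_length bs / real N) * (\<Sum>j<N. (norm (w (x j)))\<^sup>2)
    + 2 * \<Lambda>\<^sup>2 * (boundary_length bs / real N)\<^sup>2 * boundary_length bs"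
proof -
  define L where "L = boundary_length bs"
  define h where "h = L / real N"
  obtain s0 where s0: "0 \<le> s0" "s0 < h" and xj: "\<And>j. j < N \<Longrightarrow> x j = boundary_point bs (s0 + real j * h)"
    using x unfolding equally_placed_def h_def L_def by auto
  have h: "h > 0" using s0 by simp
  have Nh: "real N * h = L" using N by (simp add: h_def)
  have L: "L > 0" using h N Nh[symmetric] by simp
  define G where "G = (\<lambda>s. (\<Sum>j<N. 2 * (norm (w (x j)))\<^sup>2 * indicator {s0 + real j * h - h..s0 + real j * h + h} s)
    + 2 * \<Lambda>\<^sup>2 * h\<^sup>2 * indicator {0..<L} s)"
  have G0: "0 \<le> G s" for s unfolding G_def by (intro add_nonneg_nonneg sum_nonneg) (auto simp: indicator_def)
  have Gi: "integrable lebesgue G" unfolding G_def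
    by (intro Bochner_Integration.integrable_add Bochner_Integration.integrable_sum Bochner_Integration.integrable_mult_right integrable_interval_indicator)
  have pw: "(norm (w (boundary_point bs s)))\<^sup>2 \<le> G s" if s: "0 \<le> s" "s < L" for s
  proof -
    obtain j where j: "j < N" "\<bar>s - (s0 + real j * h)\<bar> \<le> h" "norm (boundary_point bs s - boundary_point bs (s0 + real j * h)) \<le> h"
      using nearest_collocation_point[OF bs N long, of s0 s] s0 s unfolding h_def L_def by blast
    have "s0 + real j * h < L"
    proof -
      have "real j + 1 \<le> real N" using j(1) by simp
      then have "(real j + 1) * h \<le> real N * h" using h by (intro mult_right_mono) auto
      then show ?thesis using s0 Nh by (simp add: algebra_simps)
    qed
    moreover have "0 \<le> s0 + real j * h" using s0 h by simp
    ultimately have fr: "x j \<in> frontier \<Omega>" using xj[OF j(1)] boundary_point_frontier[OF bs] by (simp add: L_def)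
    have "norm (w (boundary_point bs s) - w (x j)) \<le> \<Lambda> * norm (boundary_point bs s - x j)"
      using s by (intro lip fr boundary_point_frontier[OF bs]) (auto simp: L_def)
    also have "\<dots> \<le> \<Lambda> * h" using j(3) xj[OF j(1)] \<Lambda> by (intro mult_left_mono) auto
    finally have d: "norm (w (boundary_point bs s) - w (x j)) \<le> \<Lambda> * h" .
    have "norm (w (boundary_point bs s)) \<le> norm (w (x j)) + \<Lambda> * h" using norm_triangle_sub[of "w (boundary_point bs s)" "w (x j)"] d by linarith
    then have "(norm (w (boundary_point bs s)))\<^sup>2 \<le> (norm (w (x j)) + \<Lambda> * h)\<^sup>2" by (intro power_mono) auto
    also have "\<dots> \<le> 2 * (norm (w (x j)))\<^sup>2 + 2 * \<Lambda>\<^sup>2 * h\<^sup>2"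
      using zero_le_power2[of "norm (w (x j)) - \<Lambda> * h"] by (simp add: power2_eq_square algebra_simps)
    also have "2 * (norm (w (x j)))\<^sup>2 \<le> (\<Sum>j<N. 2 * (norm (w (x j)))\<^sup>2 * indicator {s0 + real j * h - h..s0 + real j * h + h} s)"
    proof -
      have "s \<in> {s0 + real j * h - h..s0 + real j * h + h}" using j(2) by auto
      then have "2 * (norm (w (x j)))\<^sup>2 = 2 * (norm (w (x j)))\<^sup>2 * indicator {s0 + real j * h - h..s0 + real j * h + h} s" by simp
      also have "\<dots> \<le> (\<Sum>j<N. 2 * (norm (w (x j)))\<^sup>2 * indicator {s0 + real j * h - h..s0 + real j * h + h} s)"
        using j(1) by (intro member_le_sum) (auto simp: indicator_def)
      finally show ?thesis .
    qed
    finally show ?thesis using s unfolding G_def by (simp add: indicator_def)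
  qed
  have "(boundary_L2norm bs w)\<^sup>2 \<le> (\<integral>s. G s \<partial>lebesgue)"
    unfolding boundary_L2norm_square set_lebesgue_integral_def L_def[symmetric]
  proof (rule integral_mono'[OF Gi])
    fix s show "indicator {0..<L} s *\<^sub>R (norm (w (boundary_point bs s)))\<^sup>2 \<le> G s"
      using pw[of s] G0[of s] by (auto simp: indicator_def)
  qed (rule G0)
  also have "\<dots> = (\<Sum>j<N. 2 * (norm (w (x j)))\<^sup>2 * (2 * h)) + 2 * \<Lambda>\<^sup>2 * h\<^sup>2 * L"
  proof -
    have I: "integrable lebesgue (\<lambda>s. 2 * (norm (w (x j)))\<^sup>2 * indicator {s0 + real j * h - h..s0 + real j * h + h} s)" for j
      by (intro Bochner_Integration.integrable_mult_right integrable_interval_indicator)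
    have "integrable lebesgue (\<lambda>s. 2 * \<Lambda>\<^sup>2 * h\<^sup>2 * indicator {0..<L} s)"
      by (intro Bochner_Integration.integrable_mult_right integrable_interval_indicator)
    then have "(\<integral>s. G s \<partial>lebesgue) = (\<Sum>j<N. \<integral>s. 2 * (norm (w (x j)))\<^sup>2 * indicator {s0 + real j * h - h..s0 + real j * h + h} s \<partial>lebesgue)
      + (\<integral>s. 2 * \<Lambda>\<^sup>2 * h\<^sup>2 * indicator {0..<L} s \<partial>lebesgue)"
      unfolding G_def using I by (simp only: Bochner_Integration.integral_add Bochner_Integration.integral_sum Bochner_Integration.integrable_sum)
    then show ?thesis using h L by simp
  qed
  also have "(\<Sum>j<N. 2 * (norm (w (x j)))\<^sup>2 * (2 * h)) = 4 * h * (\<Sum>j<N. (norm (w (x j)))\<^sup>2)"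
    by (simp add: sum_distrib_left sum_distrib_right mult_ac)
  finally show ?thesis by (simp add: h_def L_def)
qed

section \<open>The error estimate\<close>

text \<open>The competitor \<open>d\<close> makes the functional at most \<open>(1 + c2) * B\<^sup>2 * N / R ^ (2 * M)\<close>. The lower bound on
  \<open>\<alpha>\<close> then limits the squared norm of the minimizer to order \<open>1 / M\<close>, and Cauchy-Schwarz its sum to order
  one.\<close>

lemma tikhonov_estimates:
  fixes f :: "real^2 \<Rightarrow> complex"
  assumes R: "R > 1" and c: "c1 > 0" "c2 > 0" and M: "M \<ge> 1" and N: "N \<ge> 1"
    and \<alpha>: "c1 * real M * real N / R ^ (2 * M) \<le> \<alpha>" "\<alpha> \<le> c2 * real M * real N / R ^ (2 * M)"
    and B: "B \<ge> 0" and d: "\<And>i. norm (d i) \<le> B / real M"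
    and approx: "\<And>j. j < N \<Longrightarrow> norm (f (x j) - (\<Sum>i<M. d i * fundamental_solution k (y i) (x j))) \<le> B / R ^ M"
  obtains e where "\<And>p. numerical_solution k M N y x \<alpha> f p = (\<Sum>i<M. e i * fundamental_solution k (y i) p)"
    "(\<Sum>j<N. (norm (numerical_solution k M N y x \<alpha> f (x j) - f (x j)))\<^sup>2) \<le> (1 + c2) * B\<^sup>2 * real N / R ^ (2 * M)"
    "(\<Sum>i<M. norm (e i)) \<le> sqrt ((1 + c2) / c1) * B"
proof -
  have P: "R ^ (2 * M) > 0" "real M > 0" "real N > 0" using R M N by auto
  have "0 < c1 * real M * real N / R ^ (2 * M)" using P c by simp
  then have \<alpha>0: "\<alpha> > 0" using \<alpha>(1) by linarith
  obtain e where e: "\<And>p. numerical_solution k M N y x \<alpha> f p = (\<Sum>i<M. e i * fundamental_solution k (y i) p)"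
    and opt: "(\<Sum>j<N. (norm ((\<Sum>i<M. e i * fundamental_solution k (y i) (x j)) - f (x j)))\<^sup>2) + \<alpha> * (\<Sum>i<M. (norm (e i))\<^sup>2)
      \<le> (\<Sum>j<N. (norm ((\<Sum>i<M. d i * fundamental_solution k (y i) (x j)) - f (x j)))\<^sup>2) + \<alpha> * (\<Sum>i<M. (norm (d i))\<^sup>2)"
    using numerical_solution_dual[OF \<alpha>0, of k M N y x f] by blast
  have "(\<Sum>j<N. (norm ((\<Sum>i<M. d i * fundamental_solution k (y i) (x j)) - f (x j)))\<^sup>2) \<le> (\<Sum>j<N. (B / R ^ M)\<^sup>2)"
    using approx by (intro sum_mono power_mono) (auto simp: norm_minus_commute)
  also have "\<dots> = B\<^sup>2 * real N / R ^ (2 * M)"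
    by (simp add: power_divide power_mult[symmetric] mult.commute)
  finally have res: "(\<Sum>j<N. (norm ((\<Sum>i<M. d i * fundamental_solution k (y i) (x j)) - f (x j)))\<^sup>2) \<le> B\<^sup>2 * real N / R ^ (2 * M)" .
  have "(\<Sum>i<M. (norm (d i))\<^sup>2) \<le> (\<Sum>i<M. (B / real M)\<^sup>2)" using d by (intro sum_mono power_mono) auto
  also have "\<dots> = B\<^sup>2 / real M" using P by (simp add: power2_eq_square)
  finally have "\<alpha> * (\<Sum>i<M. (norm (d i))\<^sup>2) \<le> (c2 * real M * real N / R ^ (2 * M)) * (B\<^sup>2 / real M)"
    using \<alpha>(2) \<alpha>0 by (intro mult_mono) (auto intro: sum_nonneg)
  also have "\<dots> = c2 * (B\<^sup>2 * real N / R ^ (2 * M))" using P by simp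
  finally have tot: "(\<Sum>j<N. (norm ((\<Sum>i<M. e i * fundamental_solution k (y i) (x j)) - f (x j)))\<^sup>2) + \<alpha> * (\<Sum>i<M. (norm (e i))\<^sup>2)
      \<le> (1 + c2) * (B\<^sup>2 * real N / R ^ (2 * M))" using opt res unfolding distrib_right mult_1_left by argo
  have "0 \<le> \<alpha> * (\<Sum>i<M. (norm (e i))\<^sup>2)" using \<alpha>0 by (simp add: sum_nonneg)
  then have fit: "(\<Sum>j<N. (norm (numerical_solution k M N y x \<alpha> f (x j) - f (x j)))\<^sup>2) \<le> (1 + c2) * B\<^sup>2 * real N / R ^ (2 * M)"
    using tot by (simp add: e)
  have "0 \<le> (\<Sum>j<N. (norm ((\<Sum>i<M. e i * fundamental_solution k (y i) (x j)) - f (x j)))\<^sup>2)" by (intro sum_nonneg) auto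
  then have "\<alpha> * (\<Sum>i<M. (norm (e i))\<^sup>2) \<le> (1 + c2) * (B\<^sup>2 * real N / R ^ (2 * M))" using tot by linarith
  moreover have "(c1 * real M * real N / R ^ (2 * M)) * (\<Sum>i<M. (norm (e i))\<^sup>2) \<le> \<alpha> * (\<Sum>i<M. (norm (e i))\<^sup>2)"
    using \<alpha>(1) by (intro mult_right_mono sum_nonneg) auto
  ultimately have "(c1 * real M * (\<Sum>i<M. (norm (e i))\<^sup>2)) * (real N / R ^ (2 * M)) \<le> ((1 + c2) * B\<^sup>2) * (real N / R ^ (2 * M))"
    by (simp add: mult_ac)
  then have "c1 * real M * (\<Sum>i<M. (norm (e i))\<^sup>2) \<le> (1 + c2) * B\<^sup>2"
    by (rule mult_right_le_imp_le) (use P in simp)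
  then have "(\<Sum>i<M. (norm (e i))\<^sup>2) * real M \<le> (1 + c2) / c1 * B\<^sup>2" using c by (simp add: field_simps)
  moreover have "(\<Sum>i<M. norm (e i))\<^sup>2 \<le> (\<Sum>i<M. (norm (e i))\<^sup>2) * real M"
    using sum_squared_le_sum_of_squares[of "\<lambda>i. norm (e i)" "{..<M}"] by simp
  ultimately have "(\<Sum>i<M. norm (e i))\<^sup>2 \<le> (1 + c2) / c1 * B\<^sup>2" by linarith
  then have "(\<Sum>i<M. norm (e i)) \<le> sqrt ((1 + c2) / c1 * B\<^sup>2)" by (rule real_le_rsqrt)
  also have "\<dots> = sqrt ((1 + c2) / c1) * B" using B by (simp only: real_sqrt_mult real_sqrt_abs abs_of_nonneg)
  finally show ?thesis by (rule that[OF e fit])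
qed

lemma compactly_inside_disk_radius:
  assumes "\<Omega> \<subset>\<subset> cball 0 1"
  obtains r where "0 < r" "r < 1" "\<And>p. p \<in> frontier \<Omega> \<Longrightarrow> norm p \<le> r"
proof (cases "closure \<Omega> = {}")
  case True
  then show ?thesis using that[of "1 / 2"] by (auto simp: frontier_def)
next
  case False
  have "compact (closure \<Omega>)" and sub: "closure \<Omega> \<subseteq> ball 0 1" using assms by (auto simp: compactly_inside_def)
  then obtain q where q: "q \<in> closure \<Omega>" "\<And>p. p \<in> closure \<Omega> \<Longrightarrow> norm p \<le> norm q"
    using continuous_attains_sup[of "closure \<Omega>" norm] False continuous_on_norm_id by blast
  have q1: "norm q < 1" using q(1) sub by auto
  show ?thesis
  proof (rule that[of "(1 + norm q) / 2"])
    show "0 < (1 + norm q) / 2" by (simp add: add_pos_nonneg)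
    show "(1 + norm q) / 2 < 1" using q1 by simp
    fix p assume "p \<in> frontier \<Omega>"
    then have "norm p \<le> norm q" using q(2) by (simp add: frontier_def)
    then show "norm p \<le> (1 + norm q) / 2" using q1 by simp
  qed
qed

lemma equally_distributed_norm:
  assumes "equally_distributed_on_circle R M y" "i < M" "R > 0"
  shows "norm (y i) = R"
proof -
  obtain t where "y i = vector [R * cos t, R * sin t]" using assms unfolding equally_distributed_on_circle_def by blast
  then have "norm (y i) = sqrt ((R * cos t)\<^sup>2 + (R * sin t)\<^sup>2)" by (simp add: norm_vec_def L2_set_def sum_2)
  also have "(R * cos t)\<^sup>2 + (R * sin t)\<^sup>2 = R\<^sup>2 * ((sin t)\<^sup>2 + (cos t)\<^sup>2)" by (simp only: power_mult_distrib distrib_left add.commute)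
  finally show ?thesis using assms(3) by simp
qed

lemma L2norm_nonneg: "0 \<le> L2norm U u"
  unfolding L2norm_def set_lebesgue_integral_def
  by (intro real_sqrt_ge_zero Bochner_Integration.integral_nonneg) (auto simp: indicator_def)

text \<open>If some loop is shorter than the spacing, quadrature fails; but then the spacing is at least \<open>\<delta>\<close>, so
  that \<open>1 / N\<close> is bounded below and the bound on the supremum of \<open>w\<close> is good enough.\<close>

lemma boundary_error_estimate:
  assumes bs: "boundary_parametrization \<Omega> bs" and M: "M \<ge> 1" and N: "N \<ge> 1" and R: "R > 1"
    and x: "equally_placed bs N x"
    and L: "boundary_length bs \<le> Lm" and \<delta>: "\<delta> > 0" "\<And>i. i < length bs \<Longrightarrow> \<delta> \<le> fst (bs ! i)"
    and b0: "b0 \<ge> 0" and B: "B \<ge> 0"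
    and disc: "(\<Sum>j<N. (norm (w (x j)))\<^sup>2) \<le> b0 * B\<^sup>2 * real N / R ^ (2 * M)"
    and sup: "\<And>p. p \<in> frontier \<Omega> \<Longrightarrow> norm (w p) \<le> \<Lambda> * B" and \<Lambda>: "\<Lambda> \<ge> 0"
    and lip: "\<And>p q. p \<in> frontier \<Omega> \<Longrightarrow> q \<in> frontier \<Omega> \<Longrightarrow> norm (w p - w q) \<le> \<Lambda> * B * norm (p - q)"
  shows "boundary_L2norm bs w \<le> sqrt (4 * Lm * b0 + 2 * \<Lambda>\<^sup>2 * Lm ^ 3 + \<Lambda>\<^sup>2 * Lm ^ 3 / \<delta>\<^sup>2) * B * (1 / R ^ M + 1 / real N)"
proof -
  define S where "S = 4 * Lm * b0 + 2 * \<Lambda>\<^sup>2 * Lm ^ 3 + \<Lambda>\<^sup>2 * Lm ^ 3 / \<delta>\<^sup>2"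
  define E where "E = 1 / R ^ M + 1 / real N"
  define l where "l = boundary_length bs"
  obtain s0 where "0 \<le> s0" "s0 < l / real N" using x unfolding equally_placed_def l_def by blast
  then have "0 < l / real N" by linarith
  then have l0: "0 < l" using N by (simp add: zero_less_divide_iff)
  have lm: "l \<le> Lm" using L by (simp add: l_def)
  have Lm: "0 < Lm" using l0 lm by linarith
  have S1: "0 \<le> 4 * Lm * b0" "0 \<le> 2 * \<Lambda>\<^sup>2 * Lm ^ 3" "0 \<le> \<Lambda>\<^sup>2 * Lm ^ 3 / \<delta>\<^sup>2" using Lm b0 by auto
  have E: "(1 / R ^ M)\<^sup>2 \<le> E\<^sup>2" "(1 / real N)\<^sup>2 \<le> E\<^sup>2" "0 \<le> E" using R by (auto simp: E_def intro!: power_mono)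
  have l3: "l ^ 3 \<le> Lm ^ 3" using l0 lm by (intro power_mono) auto
  have "(boundary_L2norm bs w)\<^sup>2 \<le> S * (B * E)\<^sup>2"
  proof (cases "\<forall>i<length bs. l / real N \<le> fst (bs ! i)")
    case True
    have "(boundary_L2norm bs w)\<^sup>2 \<le> 4 * (l / real N) * (\<Sum>j<N. (norm (w (x j)))\<^sup>2) + 2 * (\<Lambda> * B)\<^sup>2 * (l / real N)\<^sup>2 * l"
      unfolding l_def using True B \<Lambda> by (intro boundary_L2norm_quadrature[OF bs N x _ lip]) (auto simp: l_def)
    also have "4 * (l / real N) * (\<Sum>j<N. (norm (w (x j)))\<^sup>2) \<le> 4 * (l / real N) * (b0 * B\<^sup>2 * real N / R ^ (2 * M))"
      using disc l0 by (intro mult_left_mono) auto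
    also have "\<dots> = l * (4 * b0 * B\<^sup>2 * (1 / R ^ M)\<^sup>2)"
      using N by (simp add: power_divide power_mult[symmetric] mult.commute[of M])
    also have "\<dots> \<le> Lm * (4 * b0 * B\<^sup>2 * E\<^sup>2)" using lm E b0 Lm by (intro mult_mono) auto
    also have "2 * (\<Lambda> * B)\<^sup>2 * (l / real N)\<^sup>2 * l = (2 * \<Lambda>\<^sup>2 * B\<^sup>2) * (l ^ 3 * (1 / real N)\<^sup>2)"
      by (simp add: power_divide power_mult_distrib power2_eq_square power3_eq_cube)
    also have "\<dots> \<le> (2 * \<Lambda>\<^sup>2 * B\<^sup>2) * (Lm ^ 3 * E\<^sup>2)" using l3 E Lm by (intro mult_left_mono mult_mono) auto
    finally have "(boundary_L2norm bs w)\<^sup>2 \<le> (4 * Lm * b0 + 2 * \<Lambda>\<^sup>2 * Lm ^ 3) * (B * E)\<^sup>2"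
      by (simp add: power_mult_distrib algebra_simps)
    also have "\<dots> \<le> S * (B * E)\<^sup>2" unfolding S_def using S1 by (intro mult_right_mono) auto
    finally show ?thesis .
  next
    case False
    then obtain i where i: "i < length bs" "fst (bs ! i) < l / real N" by auto
    then have "\<delta> \<le> l / real N" using \<delta>(2)[OF i(1)] by linarith
    then have "\<delta>\<^sup>2 \<le> (l / real N)\<^sup>2" using \<delta>(1) by (intro power_mono) auto
    then have "1 \<le> (l / real N)\<^sup>2 / \<delta>\<^sup>2" using \<delta>(1) by simp
    then have "(\<Lambda> * B)\<^sup>2 * l * 1 \<le> (\<Lambda> * B)\<^sup>2 * l * ((l / real N)\<^sup>2 / \<delta>\<^sup>2)" using l0 by (intro mult_left_mono) auto
    moreover have "(boundary_L2norm bs w)\<^sup>2 \<le> (\<Lambda> * B)\<^sup>2 * l"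
      unfolding l_def using l0 by (intro boundary_L2norm_le_sup[OF bs sup]) (auto simp: l_def)
    ultimately have "(boundary_L2norm bs w)\<^sup>2 \<le> (\<Lambda> * B)\<^sup>2 * l * ((l / real N)\<^sup>2 / \<delta>\<^sup>2)" by simp
    also have "\<dots> = (\<Lambda>\<^sup>2 * B\<^sup>2 / \<delta>\<^sup>2) * (l ^ 3 * (1 / real N)\<^sup>2)"
      by (simp add: power_divide power_mult_distrib power2_eq_square power3_eq_cube mult_ac)
    also have "\<dots> \<le> (\<Lambda>\<^sup>2 * B\<^sup>2 / \<delta>\<^sup>2) * (Lm ^ 3 * E\<^sup>2)" using l3 E Lm by (intro mult_left_mono mult_mono) auto
    also have "\<dots> = (\<Lambda>\<^sup>2 * Lm ^ 3 / \<delta>\<^sup>2) * (B * E)\<^sup>2" by (simp add: power_mult_distrib)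
    also have "\<dots> \<le> S * (B * E)\<^sup>2" unfolding S_def using S1 by (intro mult_right_mono) auto
    finally show ?thesis .
  qed
  then have "boundary_L2norm bs w \<le> sqrt (S * (B * E)\<^sup>2)" by (rule real_le_rsqrt)
  also have "\<dots> = sqrt S * B * E" using B E(3) by (simp add: real_sqrt_mult)
  finally show ?thesis by (simp add: S_def E_def)
qed

theorem theorem4p1:
  fixes \<Omega> \<Omega>\<^sub>\<rho> :: "(real^2) set" and R \<rho> k c1 c2 :: real
  assumes "bounded_piecewise_smooth_domain \<Omega>"
    and "R > 1"
    and "k > 0" and "\<not> dirichlet_eigenvalue \<Omega> (k\<^sup>2)"
    and "open \<Omega>\<^sub>\<rho>" and "connected \<Omega>\<^sub>\<rho>"
    and "\<rho> > R\<^sup>2" and "ball 0 \<rho> \<subset>\<subset> \<Omega>\<^sub>\<rho>"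
    and "\<Omega> \<subset>\<subset> cball 0 1" and "cball 0 1 \<subset>\<subset> ball 0 R" and "ball 0 R \<subset>\<subset> \<Omega>\<^sub>\<rho>"
    and "c1 > 0" and "c2 > 0"
  shows "\<exists>C>0. \<forall>(bs :: (real \<times> (real \<Rightarrow> real^2)) list) (M :: nat) (N :: nat) (\<alpha> :: real)
           (xhat :: nat \<Rightarrow> real^2) (x :: nat \<Rightarrow> real^2)
           (u :: real^2 \<Rightarrow> complex) (f :: real^2 \<Rightarrow> complex) (C\<^sub>\<rho> :: real).
           boundary_parametrization \<Omega> bs \<longrightarrow>
           M \<ge> 1 \<longrightarrow> N \<ge> 1 \<longrightarrow>
           c1 * real M * real N / R ^ (2 * M) \<le> \<alpha> \<longrightarrow>
           \<alpha> \<le> c2 * real M * real N / R ^ (2 * M) \<longrightarrow>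
           equally_distributed_on_circle R M xhat \<longrightarrow>
           equally_placed bs N x \<longrightarrow>
           helmholtz_solution \<Omega>\<^sub>\<rho> k u \<longrightarrow> H1_norm \<Omega>\<^sub>\<rho> u \<le> C\<^sub>\<rho> \<longrightarrow>
           (\<forall>p\<in>frontier \<Omega>. f p = u p) \<longrightarrow>
           boundary_L2norm bs (\<lambda>p. u p - numerical_solution k M N xhat x \<alpha> f p)
             \<le> C * L2norm \<Omega>\<^sub>\<rho> u * (1 / R ^ M + 1 / real N)"
proof -
  obtain bs0 where bs0: "boundary_parametrization \<Omega> bs0" using assms(1) by (auto simp: bounded_piecewise_smooth_domain_def)
  \<comment> \<open>a bound for the length of every parametrization of the boundary\<close>
  define Lm where "Lm = 2 * \<bar>boundary_length bs0\<bar>"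
  obtain \<delta> where \<delta>: "\<delta> > 0" "\<And>bs i. boundary_parametrization \<Omega> bs \<Longrightarrow> i < length bs \<Longrightarrow> \<delta> \<le> fst (bs ! i)"
    using loop_length_lower_bound[OF bs0] by blast
  obtain r where r: "0 < r" "r < 1" "\<And>p. p \<in> frontier \<Omega> \<Longrightarrow> norm p \<le> r"
    using compactly_inside_disk_radius[OF assms(9)] by blast
  have sub: "ball 0 \<rho> \<subseteq> \<Omega>\<^sub>\<rho>"
    using assms(8) closure_subset interior_subset unfolding compactly_inside_def by blast
  have "1 < R\<^sup>2" using assms(2) by simp
  then have \<rho>: "1 < \<rho>" using assms(7) by linarith
  obtain K1 where K1: "K1 > 0" "\<And>u M y. helmholtz_solution \<Omega>\<^sub>\<rho> k u \<Longrightarrow> M \<ge> 1 \<Longrightarrow> equally_distributed_on_circle R M y \<Longrightarrow>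
      \<exists>d. (\<forall>i. norm (d i) \<le> K1 * L2norm \<Omega>\<^sub>\<rho> u / real M) \<and>
        (\<forall>x. norm x \<le> r \<longrightarrow> norm (u x - (\<Sum>i<M. d i * fundamental_solution k (y i) x)) \<le> K1 * L2norm \<Omega>\<^sub>\<rho> u / R ^ M)"
    using helmholtz_source_approximation[OF assms(3,2,7) r(1,2)] sub by meson
  obtain K2 where K2: "K2 > 0" "\<And>u x x'. helmholtz_solution \<Omega>\<^sub>\<rho> k u \<Longrightarrow> norm x \<le> r \<Longrightarrow> norm x' \<le> r \<Longrightarrow>
      norm (u x) \<le> K2 * L2norm \<Omega>\<^sub>\<rho> u \<and> norm (u x - u x') \<le> K2 * L2norm \<Omega>\<^sub>\<rho> u * norm (x - x')"
    using helmholtz_lipschitz[OF assms(3) r(1,2) \<rho>] sub by meson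
  obtain K3 where K3: "K3 > 0" "\<And>y x x'. norm y = R \<Longrightarrow> norm x \<le> r \<Longrightarrow> norm x' \<le> r \<Longrightarrow>
      norm (fundamental_solution k y x) \<le> K3 \<and> norm (fundamental_solution k y x - fundamental_solution k y x') \<le> K3 * norm (x - x')"
    using fundamental_solution_lipschitz[OF assms(3) r(1,2) assms(2)] by meson
  \<comment> \<open>the size of the sum of the source strengths, relative to the norm of u\<close>
  define q where "q = sqrt ((1 + c2) / c1) * K1"
  have q0: "0 \<le> q" using K1(1) assms(12,13) by (simp add: q_def)
  define \<Lambda> where "\<Lambda> = K2 + K3 * q"
  have \<Lambda>: "0 \<le> \<Lambda>" using K2(1) K3(1) q0 by (simp add: \<Lambda>_def)
  define b0 where "b0 = (1 + c2) * K1\<^sup>2"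
  have b0: "0 \<le> b0" using assms(13) by (simp add: b0_def)
  define S where "S = 4 * Lm * b0 + 2 * \<Lambda>\<^sup>2 * Lm ^ 3 + \<Lambda>\<^sup>2 * Lm ^ 3 / \<delta>\<^sup>2"
  have "0 \<le> Lm" by (simp add: Lm_def)
  then have S0: "0 \<le> S" using b0 by (simp add: S_def)
  show ?thesis
  proof (intro exI[of _ "sqrt S + 1"] conjI allI impI)
    show "0 < sqrt S + 1" using S0 by (simp add: add_nonneg_pos)
    fix bs :: "(real \<times> (real \<Rightarrow> real^2)) list" and M N :: nat and \<alpha> :: real and xhat x :: "nat \<Rightarrow> real^2"
      and u f :: "real^2 \<Rightarrow> complex" and C\<^sub>\<rho> :: real
    assume bs: "boundary_parametrization \<Omega> bs" and M: "M \<ge> 1" and N: "N \<ge> 1"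
      and \<alpha>: "c1 * real M * real N / R ^ (2 * M) \<le> \<alpha>" "\<alpha> \<le> c2 * real M * real N / R ^ (2 * M)"
      and y: "equally_distributed_on_circle R M xhat" and x: "equally_placed bs N x"
      and u: "helmholtz_solution \<Omega>\<^sub>\<rho> k u" and f: "\<forall>p\<in>frontier \<Omega>. f p = u p"
    define A where "A = L2norm \<Omega>\<^sub>\<rho> u"
    have A: "0 \<le> A" unfolding A_def by (rule L2norm_nonneg)
    have xf: "x j \<in> frontier \<Omega>" if j: "j < N" for j
    proof -
      obtain s0 where s0: "0 \<le> s0" "s0 < boundary_length bs / real N"
        "x j = boundary_point bs (s0 + real j * boundary_length bs / real N)"
        using x j unfolding equally_placed_def by blast
      let ?h = "boundary_length bs / real N"
      have "real j + 1 \<le> real N" using j by simp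
      then have "(real j + 1) * ?h \<le> real N * ?h" using s0 by (intro mult_right_mono) auto
      also have "\<dots> = boundary_length bs" using N by simp
      finally have "real j * ?h + ?h \<le> boundary_length bs" by (simp only: distrib_right mult_1_left)
      then have "s0 + real j * ?h < boundary_length bs" using s0(2) by linarith
      moreover have "0 \<le> s0 + real j * ?h"
        by (intro add_nonneg_nonneg mult_nonneg_nonneg) (use s0(1,2) in linarith)+
      ultimately show ?thesis using s0(3) boundary_point_frontier[OF bs] by simp
    qed
    obtain d where d: "\<And>i. norm (d i) \<le> K1 * A / real M"
      "\<And>p. norm p \<le> r \<Longrightarrow> norm (u p - (\<Sum>i<M. d i * fundamental_solution k (xhat i) p)) \<le> K1 * A / R ^ M"
      using K1(2)[OF u M y] unfolding A_def by blast
    have fd: "norm (f (x j) - (\<Sum>i<M. d i * fundamental_solution k (xhat i) (x j))) \<le> K1 * A / R ^ M" if "j < N" for j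
      using d(2)[OF r(3)[OF xf[OF that]]] f xf[OF that] by simp
    obtain e where e: "\<And>p. numerical_solution k M N xhat x \<alpha> f p = (\<Sum>i<M. e i * fundamental_solution k (xhat i) p)"
      and fit: "(\<Sum>j<N. (norm (numerical_solution k M N xhat x \<alpha> f (x j) - f (x j)))\<^sup>2) \<le> (1 + c2) * (K1 * A)\<^sup>2 * real N / R ^ (2 * M)"
      and e1: "(\<Sum>i<M. norm (e i)) \<le> sqrt ((1 + c2) / c1) * (K1 * A)"
      by (rule tikhonov_estimates[where f = f and x = x and k = k and y = xhat and d = d,
            OF assms(2,12,13) M N \<alpha> mult_nonneg_nonneg[OF less_imp_le[OF K1(1)] A] d(1) fd]) (assumption | (rule that; assumption))+
    have e2: "(\<Sum>i<M. norm (e i)) \<le> q * A" using e1 by (simp add: q_def)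
    have yR: "norm (xhat i) = R" if "i < M" for i using equally_distributed_norm[OF y that] assms(2) by simp
    define w where "w = (\<lambda>p. u p - numerical_solution k M N xhat x \<alpha> f p)"
    have sum_bound: "norm (\<Sum>i<M. e i * g i) \<le> q * A * K" if g: "\<And>i. i < M \<Longrightarrow> norm (g i) \<le> K" and K: "0 \<le> K" for g :: "nat \<Rightarrow> complex" and K
    proof -
      have "norm (\<Sum>i<M. e i * g i) \<le> (\<Sum>i<M. norm (e i) * K)"
        using g by (intro sum_norm_le) (auto simp: norm_mult intro: mult_left_mono)
      also have "\<dots> = (\<Sum>i<M. norm (e i)) * K" by (simp add: sum_distrib_right)
      also have "\<dots> \<le> q * A * K" by (rule mult_right_mono[OF e2 K])
      finally show ?thesis .
    qed
    have "boundary_L2norm bs w \<le> sqrt S * A * (1 / R ^ M + 1 / real N)"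
      unfolding S_def
    proof (rule boundary_error_estimate[OF bs M N assms(2) x _ \<delta>(1) \<delta>(2)[OF bs] b0 A _ _ \<Lambda>])
      show "boundary_length bs \<le> Lm" using boundary_length_comparison[OF bs bs0] unfolding Lm_def by linarith
      have "(\<Sum>j<N. (norm (w (x j)))\<^sup>2) = (\<Sum>j<N. (norm (numerical_solution k M N xhat x \<alpha> f (x j) - f (x j)))\<^sup>2)"
        using f xf by (intro sum.cong) (auto simp: w_def norm_minus_commute)
      then show "(\<Sum>j<N. (norm (w (x j)))\<^sup>2) \<le> b0 * A\<^sup>2 * real N / R ^ (2 * M)"
        using fit by (simp add: b0_def power_mult_distrib mult_ac)
      show "norm (w p) \<le> \<Lambda> * A" if p: "p \<in> frontier \<Omega>" for p
      proof -
        have "norm (\<Sum>i<M. e i * fundamental_solution k (xhat i) p) \<le> q * A * K3"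
          using K3 yR r(3)[OF p] by (intro sum_bound) auto
        moreover have "norm (u p) \<le> K2 * A" using K2(2)[OF u r(3)[OF p] r(3)[OF p]] by (simp add: A_def)
        moreover have "norm (w p) \<le> norm (u p) + norm (\<Sum>i<M. e i * fundamental_solution k (xhat i) p)"
          unfolding w_def e by (rule norm_triangle_ineq4)
        ultimately have "norm (w p) \<le> K2 * A + q * A * K3" by linarith
        then show ?thesis by (simp add: \<Lambda>_def algebra_simps)
      qed
      show "norm (w p - w p') \<le> \<Lambda> * A * norm (p - p')" if p: "p \<in> frontier \<Omega>" "p' \<in> frontier \<Omega>" for p p'
      proof -
        have "norm (\<Sum>i<M. e i * (fundamental_solution k (xhat i) p - fundamental_solution k (xhat i) p')) \<le> q * A * (K3 * norm (p - p'))"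
          using K3 yR r(3)[OF p(1)] r(3)[OF p(2)] by (intro sum_bound) auto
        moreover have "norm (u p - u p') \<le> K2 * A * norm (p - p')" using K2(2)[OF u r(3)[OF p(1)] r(3)[OF p(2)]] by (simp add: A_def)
        moreover have "w p - w p' = (u p - u p') - (\<Sum>i<M. e i * (fundamental_solution k (xhat i) p - fundamental_solution k (xhat i) p'))"
          by (simp add: w_def e right_diff_distrib sum_subtractf)
        then have "norm (w p - w p') \<le> norm (u p - u p') + norm (\<Sum>i<M. e i * (fundamental_solution k (xhat i) p - fundamental_solution k (xhat i) p'))"
          by (simp only: norm_triangle_ineq4)
        ultimately have "norm (w p - w p') \<le> K2 * A * norm (p - p') + q * A * (K3 * norm (p - p'))" by linarith
        then show ?thesis by (simp add: \<Lambda>_def algebra_simps)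
      qed
    qed
    also have "\<dots> \<le> (sqrt S + 1) * A * (1 / R ^ M + 1 / real N)"
      using A assms(2) by (intro mult_right_mono) auto
    finally show "boundary_L2norm bs (\<lambda>p. u p - numerical_solution k M N xhat x \<alpha> f p) \<le> (sqrt S + 1) * L2norm \<Omega>\<^sub>\<rho> u * (1 / R ^ M + 1 / real N)"
      by (simp add: w_def A_def)
  qed
qed

end
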